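(* Let $\nu\ge1$ be an integer, $K\ge0$, $\alpha<1/2$, and $u_j:=\max(1,|j|^{1-\alpha})$ for $j\in\mathbb Z$. Let $(\varepsilon_k)_{k\in\mathbb Z}$ be independent standard Gaussian random variables and let $$X_{t,n}:=\sum_{j\in\mathbb Z}a_{t,n}(j)\,\varepsilon_{t-j},\qquad 1\le t\le n+\nu,\ n\ge1,$$ where the real sequences $(a_{t,n}(j))_{j\in\mathbb Z}$ satisfy $$\max_{1\le t\le n+\nu}|a_{t,n}(j)|\le\frac{K}{u_j}\qquad\text{for all } n\ge1,\ j\in\mathbb Z,$$ and such that there exist functions $\tau\in(0,1]\mapsto a(\tau,j)\in\mathbb R$, $j\in\mathbb Z$, with $$\sup_{\tau\in(0,1]}|a(\tau,j)|\le\frac K{u_j}\quad\forall j\in\mathbb Z,\qquad\text{and}\qquad \sup_{\tau\in(0,1]}\ \max_{1\le k\le n+\nu,\ |[n\tau]-k|\le L}|a_{k,n}(j)-a(\tau,j)|\xrightarrow[n\to\infty]{}0\quad\forall j\in\mathbb Z,\ \forall L>0.$$ For $\tau\in(0,1]$ let $W_\tau(t):=\sum_{j\in\mathbb Z}a(\tau,j)\varepsilon_{t-j}$, $t\in\mathbb Z$, and set $$\mathbf Y_n(k):=(X_{k+1,n},\dots,X_{k+\nu,n})^\top,\quad \mathbf W_\tau(j):=(W_\tau(j+1),\dots,W_\tau(j+\nu))^\top,$$ $$\Sigma_{k,n}:=\mathrm E[\mathbf Y_n(k)\mathbf Y_n(k)^\top],\qquad \Sigma_\tau:=\mathrm E[\mathbf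 W_\tau(0)\mathbf W_\tau(0)^\top].$$ Assume $$\sup_{\tau\in(0,1]}\|\Sigma_\tau^{-1}\|<\infty .$$ Let $m$ be an integer with $m>1/(1-2\alpha)$, and let $f_{k,n}\in\mathbb L_0^2(\mathbf Y_n(k))$, $1\le k\le n$, $n\ge1$, be a triangular array of functions all having generalized Hermite rank at least $m$. With $\tilde f_{k,n}(\mathbf x):=f_{k,n}(\Sigma_{k,n}^{1/2}\mathbf x)$, assume there is an $\mathbb L_0^2(\mathbf X)$-valued continuous function $\tilde\phi_\tau$, $\tau\in(0,1]$, such that $$\sup_{\tau\in(0,1]}\mathrm E\big(\tilde f_{[\tau n],n}(\mathbf X)-\tilde\phi_\tau(\mathbf X)\big)^2\xrightarrow[n\to\infty]{}0 .$$ Then $$n^{-1/2}\sum_{k=1}^nf_{k,n}(\mathbf Y_n(k))\ \xrightarrow{\mathcal D}\ \mathcal N(0,\sigma^2),\qquad \sigma^2:=\int_0^1\sum_{j\in\mathbb Z}\mathrm E\big[\phi_\tau(\mathbf W_\tau(0))\,\phi_\tau(\mathbf W_\tau(j))\big]\,d\tau,$$ where $\phi_\tau(\mathbf x):=\tilde\phi_\tau(\Sigma_\tau^{-1/2}\mathbf x)$.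
   Context: $\mathbf X$ is a standardized Gaussian vector in $\mathbb R^\nu$ (zero mean, identity covariance). For a zero-mean Gaussian vector $\mathbf Y\in\mathbb R^\nu$, $\mathbb L^2(\mathbf Y)$ is the class of measurable $f:\mathbb R^\nu\to\mathbb R$ with $\mathrm E f^2(\mathbf Y)<\infty$, and $\mathbb L_0^2(\mathbf Y)$ the subclass with $\mathrm E f(\mathbf Y)=0$; continuity of $\tilde\phi_\tau$ in $\tau$ is with respect to the norm $\|f\|=(\mathrm E f^2(\mathbf X))^{1/2}$. $f\in\mathbb L^2(\mathbf Y)$ has generalized Hermite rank at least $m\ge1$ if $\mathrm E[P(\mathbf Y)f(\mathbf Y)]=0$ for all real polynomials $P$ in $\nu$ variables of degree at most $m-1$. $\|\cdot\|$ on matrices is the spectral norm; $A^{1/2}$ is the symmetric nonnegative square root. $[x]$ is the integer part of $x$; when $[\tau n]=0$, $\tilde f_{0,n}$ is understood as $\tilde f_{1,n}$. $\xrightarrow{\mathcal D}$ is convergence in distribution as $n\to\infty$; $\mathcal N(0,0)$ is the point mass at $0$. *)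

theory Defs
  imports "HOL-Probability.Probability"
begin

text \<open>The law of a standardized Gaussian vector.\<close>

definition std_gaussian :: "(real ^ 'n::finite) measure" where
  "std_gaussian = density lborel (\<lambda>x. ennreal (\<Prod>i\<in>UNIV. std_normal_density (x $ i)))"

text \<open>The one-dimensional centred Gaussian law, parametrized by its variance.\<close>

definition centred_normal :: "real \<Rightarrow> real measure" where
  "centred_normal v =
     (if v = 0 then return borel 0 else density lborel (normal_density 0 (sqrt v)))"

text \<open>
  \<open>Z\<close> is the sum of the series of random variables \<open>g j\<close> in the sense of (unconditional)
  mean-square convergence. Pointwise summation is not an option: the coefficients of the linear
  processes are only square summable, so that the series need not converge absolutely.
\<close>

definition mean_square_sum :: "'a measure \<Rightarrow> ('j \<Rightarrow> 'a \<Rightarrow> real) \<Rightarrow> ('a \<Rightarrow> real) \<Rightarrow> bool" where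
  "mean_square_sum M g Z \<longleftrightarrow>
     Z \<in> borel_measurable M \<and>
     ((\<lambda>F. \<integral>\<^sup>+\<omega>. ennreal ((Z \<omega> - (\<Sum>j\<in>F. g j \<omega>))\<^sup>2) \<partial>M) \<longlongrightarrow> 0)
       (finite_subsets_at_top UNIV)"

text \<open>
  The vector \<open>(Z (k + 1), \<dots>, Z (k + \<nu>))\<close>, where \<open>\<nu> = CARD('n)\<close> and the bijection
  \<open>idx\<close> from \<open>'n\<close> onto \<open>{1..\<nu>}\<close> numbers the coordinates.
\<close>

definition window ::
    "('n::finite \<Rightarrow> nat) \<Rightarrow> ('t::semiring_1 \<Rightarrow> 'a \<Rightarrow> real) \<Rightarrow> 't \<Rightarrow> 'a \<Rightarrow> real ^ 'n" where
  "window idx Z k \<omega> = (\<chi> i. Z (k + of_nat (idx i)) \<omega>)"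

definition second_moment_matrix :: "'a measure \<Rightarrow> ('a \<Rightarrow> real ^ 'n) \<Rightarrow> real ^ 'n ^ 'n" where
  "second_moment_matrix M Y = (\<chi> i j. \<integral>\<omega>. Y \<omega> $ i * Y \<omega> $ j \<partial>M)"

definition matrix_sqrt :: "real ^ 'n ^ 'n \<Rightarrow> real ^ 'n ^ 'n" where
  "matrix_sqrt A = (THE B. transpose B = B \<and> (\<forall>x. 0 \<le> x \<bullet> (B *v x)) \<and> B ** B = A)"

definition spectral_norm :: "real ^ 'n ^ 'n \<Rightarrow> real" where
  "spectral_norm A = onorm ((*v) A)"

text \<open>
  The square-integrable functions with respect to the law \<open>\<mu>\<close> of a random vector, and those
  among them with mean zero. These are functions, not equivalence classes.
\<close>

definition L2_fun :: "(real ^ 'n) measure \<Rightarrow> (real ^ 'n \<Rightarrow> real) set" where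
  "L2_fun \<mu> = {f. f \<in> borel_measurable borel \<and> integrable \<mu> (\<lambda>x. (f x)\<^sup>2)}"

definition L2_fun0 :: "(real ^ 'n) measure \<Rightarrow> (real ^ 'n \<Rightarrow> real) set" where
  "L2_fun0 \<mu> = {f \<in> L2_fun \<mu>. (\<integral>x. f x \<partial>\<mu>) = 0}"

definition L2_norm :: "(real ^ 'n) measure \<Rightarrow> (real ^ 'n \<Rightarrow> real) \<Rightarrow> real" where
  "L2_norm \<mu> f = sqrt (\<integral>x. (f x)\<^sup>2 \<partial>\<mu>)"

text \<open>
  Real polynomial functions of total degree at most \<open>d\<close>; \<open>e\<close> ranges over the exponent
  vectors of the monomials. The index set of the sum is finite, see below.
\<close>

definition poly_funs :: "nat \<Rightarrow> (real ^ 'n::finite \<Rightarrow> real) set" where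
  "poly_funs d =
     {P. \<exists>c. P = (\<lambda>x. \<Sum>e | (\<Sum>i\<in>UNIV. e i) \<le> d. c e * (\<Prod>i\<in>UNIV. x $ i ^ e i))}"

lemma finite_exponents: "finite {e :: 'n::finite \<Rightarrow> nat. (\<Sum>i\<in>UNIV. e i) \<le> d}"
proof -
  have "e i \<le> d" if "(\<Sum>i\<in>UNIV. e i) \<le> d" for e :: "'n \<Rightarrow> nat" and i
    using that member_le_sum[of i UNIV e] by simp
  then have "{e :: 'n \<Rightarrow> nat. (\<Sum>i\<in>UNIV. e i) \<le> d} \<subseteq> PiE UNIV (\<lambda>_. {..d})"
    by blast
  moreover have "finite (PiE (UNIV :: 'n set) (\<lambda>_. {..d}))"
    by (rule finite_PiE) simp_all
  ultimately show ?thesis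
    by (rule finite_subset)
qed

text \<open>
  Generalized Hermite rank at least \<open>m \<ge> 1\<close> with respect to a vector with law \<open>\<mu>\<close>.
\<close>

definition hermite_rank_ge :: "(real ^ 'n::finite) measure \<Rightarrow> nat \<Rightarrow> (real ^ 'n \<Rightarrow> real) \<Rightarrow> bool" where
  "hermite_rank_ge \<mu> m f \<longleftrightarrow>
     f \<in> L2_fun \<mu> \<and> (\<forall>P\<in>poly_funs (m - 1). (\<integral>x. P x * f x \<partial>\<mu>) = 0)"

end

theory Submission
  imports Defs "HOL-Computational_Algebra.Polynomial"
begin

text \<open>
  The vectors \<open>Y n k\<close> enter only through their standardizations \<open>Z n k = \<Sigma>^(-1/2) Y n k\<close>: the
  summands are \<open>ft n k (Z n k)\<close>, where every \<open>Z n k\<close> is standard Gaussian, any two of them are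
  jointly Gaussian, and \<open>ft n k\<close> is orthogonal to all polynomials of degree less than \<open>m\<close>. The
  proof rests on four facts.

  (1) Covariances (\<open>gaussian_covariance_bound\<close>). If \<open>Z, Z'\<close> are standard Gaussian vectors in
  dimension \<open>\<nu>\<close> whose cross covariances are at most \<open>r\<close>, then
  \<open>\<bar>E f(Z) g(Z')\<bar> \<le> (\<nu> r)^m * \<parallel>f\<parallel> * \<parallel>g\<parallel>\<close> whenever \<open>f\<close> has rank at least \<open>m\<close>: in
  the Hermite expansion of the covariance the \<open>q\<close>-th term carries the factor \<open>(\<nu> r)^q\<close> and the
  terms with \<open>q < m\<close> vanish. The expansion is computed for functions \<open>cos (u \<bullet> x + \<theta>)\<close>, where it
  is a Taylor series of the exponential function, and carried over by density.

  (2) Summability (\<open>young_convolution\<close>, \<open>rho_integrable\<close>). At lag \<open>h\<close> the cross covariances are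
  dominated by the self-convolution of \<open>b j = K / u j\<close>, whose \<open>m\<close>-th power is summable by Young's
  inequality because \<open>b\<close> lies in \<open>\<ell>^p\<close> with \<open>p = 2m/(m + 1)\<close>, which is what
  \<open>m * (1 - 2 * \<alpha>) > 1\<close> says. So all covariances at lag \<open>h\<close> are at most \<open>rho c h * Cf\<^sup>2\<close> with
  \<open>rho c\<close> summable and independent of \<open>n\<close>.

  (3) The variance (\<open>variance_limit\<close>). The variance of the normalized sum is an integral over
  \<open>\<tau>\<close> of sums over lags. For fixed \<open>\<tau> < 1\<close> and fixed lag the covariance converges to that of
  the stationary process frozen at \<open>\<tau>\<close>, since covariances depend continuously on the cross
  covariance matrix (\<open>std_pair_continuous\<close>). Dominated convergence, with the bound from (2), gives
  the limit \<open>\<sigma>2\<close>.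

  (4) Normality (\<open>local_char_bound\<close>, \<open>local_approximation\<close>). Replace the moving averages by finite
  ones, of window \<open>J\<close>, and the functions \<open>ft n k\<close> by trigonometric polynomials taken from a finite
  list. The first step changes each summand by little in mean square, and the resulting errors
  have covariances that are both uniformly small and dominated by the summable bound from (2);
  hence the normalized sum changes by little. The second step leaves errors that are functions
  of finitely many neighbouring \<open>\<epsilon> i\<close>, so that their sum is controlled by their variances. What
  remains is a sum of bounded variables each of which depends on finitely many neighbouring
  \<open>\<epsilon> i\<close>. For such a sum the characteristic function nearly solves \<open>\<phi>' = - \<sigma>\<^sup>2 t \<phi>\<close>, and so it is
  nearly Gaussian.

  Everything is uniform in \<open>k\<close> because, up to a small error in \<open>L\<^sup>2\<close>, the functions
  \<open>ft n k\<close> run through a finite set (\<open>finite_net\<close>): \<open>ft n k\<close> is close to \<open>\<phi>t (k / n)\<close>, and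
  this in turn to some \<open>ft N k'\<close> with one fixed \<open>N\<close>.
\<close>

section \<open>Square integrable functions\<close>

text \<open>
  Square integrability and the seminorm of \<open>L\<^sup>2\<close> are used for functions, not
  for equivalence classes, since the functions at hand are composed with random vectors of
  different joint laws.
\<close>

definition sqi :: "'a measure \<Rightarrow> ('a \<Rightarrow> real) \<Rightarrow> bool" where
  "sqi M f \<longleftrightarrow> f \<in> borel_measurable M \<and> integrable M (\<lambda>x. (f x)\<^sup>2)"

definition nrm :: "'a measure \<Rightarrow> ('a \<Rightarrow> real) \<Rightarrow> real" where
  "nrm M f = sqrt (\<integral>x. (f x)\<^sup>2 \<partial>M)"

lemma sqiD: "sqi M f \<Longrightarrow> f \<in> borel_measurable M" "sqi M f \<Longrightarrow> integrable M (\<lambda>x. (f x)\<^sup>2)"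
  by (auto simp: sqi_def)

lemma nrm_nonneg [simp]: "0 \<le> nrm M f"
  by (simp add: nrm_def)

lemma nrm_sq: "(nrm M f)\<^sup>2 = (\<integral>x. (f x)\<^sup>2 \<partial>M)"
  by (simp add: nrm_def)

lemma sqi_mult:
  assumes "sqi M f" "sqi M g"
  shows "integrable M (\<lambda>x. f x * g x)"
proof (rule Bochner_Integration.integrable_bound)
  show "integrable M (\<lambda>x. (f x)\<^sup>2 + (g x)\<^sup>2)"
    using assms by (auto simp: sqi_def)
  show "(\<lambda>x. f x * g x) \<in> borel_measurable M"
    using assms by (auto simp: sqi_def)
  have "\<bar>a * b\<bar> \<le> a\<^sup>2 + b\<^sup>2" for a b :: real
  proof -
    have "2 * (\<bar>a\<bar> * \<bar>b\<bar>) \<le> a\<^sup>2 + b\<^sup>2"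
      using sum_squares_bound[of "\<bar>a\<bar>" "\<bar>b\<bar>"] by (simp add: mult.assoc)
    moreover have "0 \<le> \<bar>a\<bar> * \<bar>b\<bar>" by simp
    ultimately show ?thesis unfolding abs_mult by linarith
  qed
  then show "AE x in M. norm (f x * g x) \<le> norm ((f x)\<^sup>2 + (g x)\<^sup>2)"
    by (auto intro!: AE_I2 order_trans[OF _ abs_ge_self])
qed

lemma sqi_cmult: "sqi M f \<Longrightarrow> sqi M (\<lambda>x. c * f x)"
  by (auto simp: sqi_def power_mult_distrib)

lemma sqi_add:
  assumes "sqi M f" "sqi M g"
  shows "sqi M (\<lambda>x. f x + g x)"
proof -
  have "integrable M (\<lambda>x. (f x)\<^sup>2 + (g x)\<^sup>2 + 2 * (f x * g x))"
    using assms sqi_mult[OF assms] by (auto simp: sqi_def)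
  then show ?thesis
    using assms by (auto simp: sqi_def power2_sum algebra_simps)
qed

lemma sqi_diff:
  assumes "sqi M f" "sqi M g"
  shows "sqi M (\<lambda>x. f x - g x)"
  using sqi_add[OF assms(1) sqi_cmult[OF assms(2), of "-1"]] by simp

lemma sqi_zero [simp]: "sqi M (\<lambda>x. 0)"
  by (auto simp: sqi_def)

lemma sqi_sum:
  assumes "\<And>i. i \<in> A \<Longrightarrow> sqi M (f i)"
  shows "sqi M (\<lambda>x. \<Sum>i\<in>A. f i x)"
  using assms by (induction A rule: infinite_finite_induct) (auto intro!: sqi_add)

lemma sqi_bound:
  assumes "sqi M g" "f \<in> borel_measurable M" "\<And>x. x \<in> space M \<Longrightarrow> \<bar>f x\<bar> \<le> \<bar>g x\<bar>"
  shows "sqi M f"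
  unfolding sqi_def
proof
  show "integrable M (\<lambda>x. (f x)\<^sup>2)"
    using assms by (intro Bochner_Integration.integrable_bound[OF sqiD(2)[OF assms(1)]])
      (auto intro!: AE_I2 simp: abs_le_square_iff)
qed fact

lemma (in finite_measure) sqi_bounded:
  assumes "f \<in> borel_measurable M" "\<And>x. x \<in> space M \<Longrightarrow> \<bar>f x\<bar> \<le> B"
  shows "sqi M f"
proof (rule sqi_bound[of M "\<lambda>_. B"])
  show "\<bar>f x\<bar> \<le> \<bar>B\<bar>" if "x \<in> space M" for x using assms(2)[OF that] by linarith
qed (use assms in \<open>auto simp: sqi_def\<close>)

lemma (in finite_measure) sqi_integrable:
  assumes "sqi M f" shows "integrable M f"
  using sqi_mult[OF assms sqi_bounded[of "\<lambda>_. 1" 1]] by simp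

lemma nrm_cmult: "nrm M (\<lambda>x. c * f x) = \<bar>c\<bar> * nrm M f"
  by (simp add: nrm_def power_mult_distrib real_sqrt_mult)

lemma nrm_minus_commute: "nrm M (\<lambda>x. f x - g x) = nrm M (\<lambda>x. g x - f x)"
  by (simp add: nrm_def power2_commute)

lemma L2_Cauchy_Schwarz:
  assumes "sqi M f" "sqi M g"
  shows "\<bar>\<integral>x. f x * g x \<partial>M\<bar> \<le> nrm M f * nrm M g"
proof -
  define a b c where "a = (\<integral>x. (f x)\<^sup>2 \<partial>M)" and "b = (\<integral>x. (g x)\<^sup>2 \<partial>M)" and "c = (\<integral>x. f x * g x \<partial>M)"
  have q: "0 \<le> a - 2 * t * c + t\<^sup>2 * b" for t
  proof -
    have "0 \<le> (\<integral>x. (f x - t * g x)\<^sup>2 \<partial>M)" by simp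
    also have "\<dots> = (\<integral>x. (f x)\<^sup>2 - 2 * t * (f x * g x) + t\<^sup>2 * (g x)\<^sup>2 \<partial>M)"
      by (simp add: power2_diff power_mult_distrib algebra_simps)
    also have "\<dots> = a - 2 * t * c + t\<^sup>2 * b"
      using sqi_mult[OF assms] sqiD[OF assms(1)] sqiD[OF assms(2)]
      by (simp add: a_def b_def c_def)
    finally show ?thesis .
  qed
  have "0 \<le> a" "0 \<le> b" by (auto simp: a_def b_def)
  have "c\<^sup>2 \<le> a * b"
  proof (cases "b = 0")
    case True
    have "c = 0"
    proof (rule ccontr)
      assume "c \<noteq> 0"
      then show False using q[of "(a + 1) / (2 * c)"] True by simp
    qed
    then show ?thesis using True by simp
  next
    case False
    then have "b > 0" using \<open>0 \<le> b\<close> by simp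
    then show ?thesis using q[of "c / b"] by (simp add: field_simps power2_eq_square)
  qed
  then have "\<bar>c\<bar> \<le> sqrt (a * b)" by (simp add: real_le_rsqrt)
  then show ?thesis by (simp add: nrm_def a_def b_def c_def real_sqrt_mult)
qed

lemma nrm_triangle:
  assumes "sqi M f" "sqi M g"
  shows "nrm M (\<lambda>x. f x + g x) \<le> nrm M f + nrm M g"
proof (rule power2_le_imp_le)
  have "(nrm M (\<lambda>x. f x + g x))\<^sup>2 = (\<integral>x. (f x)\<^sup>2 + (g x)\<^sup>2 + 2 * (f x * g x) \<partial>M)"
    by (simp add: nrm_sq power2_sum algebra_simps)
  also have "\<dots> = (nrm M f)\<^sup>2 + (nrm M g)\<^sup>2 + 2 * (\<integral>x. f x * g x \<partial>M)"
    using sqi_mult[OF assms] sqiD[OF assms(1)] sqiD[OF assms(2)] by (simp add: nrm_sq)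
  also have "\<dots> \<le> (nrm M f + nrm M g)\<^sup>2"
    using L2_Cauchy_Schwarz[OF assms] by (simp add: power2_sum)
  finally show "(nrm M (\<lambda>x. f x + g x))\<^sup>2 \<le> (nrm M f + nrm M g)\<^sup>2" .
qed simp

lemma nrm_triangle_sub:
  assumes "sqi M f" "sqi M g"
  shows "nrm M f \<le> nrm M g + nrm M (\<lambda>x. f x - g x)"
  using nrm_triangle[OF assms(2) sqi_diff[OF assms]] by simp

lemma nrm_triangle3:
  assumes "sqi M f" "sqi M g" "sqi M h"
  shows "nrm M (\<lambda>x. f x - h x) \<le> nrm M (\<lambda>x. f x - g x) + nrm M (\<lambda>x. g x - h x)"
  using nrm_triangle[OF sqi_diff[OF assms(1,2)] sqi_diff[OF assms(2,3)]] by simp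

lemma nrm_sum_le:
  assumes "\<And>i. i \<in> A \<Longrightarrow> sqi M (f i)"
  shows "nrm M (\<lambda>x. \<Sum>i\<in>A. f i x) \<le> (\<Sum>i\<in>A. nrm M (f i))"
  using assms
proof (induction A rule: infinite_finite_induct)
  case (insert a A)
  then show ?case
    using nrm_triangle[of M "f a" "\<lambda>x. \<Sum>i\<in>A. f i x"] sqi_sum[of A M f] by fastforce
qed (auto simp: nrm_def)

lemma L2_inner_diff:
  assumes "sqi M f" "sqi M g" "sqi M f'" "sqi M g'"
  shows "\<bar>(\<integral>x. f x * g x \<partial>M) - (\<integral>x. f' x * g' x \<partial>M)\<bar>
    \<le> nrm M (\<lambda>x. f x - f' x) * nrm M g + nrm M f' * nrm M (\<lambda>x. g x - g' x)"
proof -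
  have "(\<integral>x. f x * g x \<partial>M) - (\<integral>x. f' x * g' x \<partial>M)
      = (\<integral>x. (f x - f' x) * g x \<partial>M) + (\<integral>x. f' x * (g x - g' x) \<partial>M)"
    using sqi_mult[OF assms(1,2)] sqi_mult[OF assms(3,4)] sqi_mult[OF assms(3,2)]
    by (simp add: algebra_simps)
  then show ?thesis
    using L2_Cauchy_Schwarz[OF sqi_diff[OF assms(1,3)] assms(2)]
      L2_Cauchy_Schwarz[OF assms(3) sqi_diff[OF assms(2,4)]] by linarith
qed

lemma (in prob_space) L1_le_nrm:
  assumes "sqi M f" shows "(\<integral>x. \<bar>f x\<bar> \<partial>M) \<le> nrm M f"
proof -
  have "sqi M (\<lambda>x. \<bar>f x\<bar>)" using assms by (auto simp: sqi_def)
  from L2_Cauchy_Schwarz[OF this sqi_bounded[of "\<lambda>_. 1" 1]]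
  show ?thesis by (simp add: nrm_def prob_space)
qed

lemma nrm_dominated:
  assumes [measurable]: "\<And>n. F n \<in> borel_measurable M" "f \<in> borel_measurable M"
    and g: "sqi M g" and le: "\<And>n x. x \<in> space M \<Longrightarrow> \<bar>F n x - f x\<bar> \<le> g x"
    and lim: "\<And>x. x \<in> space M \<Longrightarrow> (\<lambda>n. F n x) \<longlonglongrightarrow> f x"
  shows "(\<lambda>n. nrm M (\<lambda>x. F n x - f x)) \<longlonglongrightarrow> 0"
proof -
  have "(\<lambda>n. \<integral>x. (F n x - f x)\<^sup>2 \<partial>M) \<longlonglongrightarrow> (\<integral>x. 0 \<partial>M)"
  proof (rule integral_dominated_convergence)
    show "integrable M (\<lambda>x. (g x)\<^sup>2)" using g by (rule sqiD)
    show "AE x in M. (\<lambda>n. (F n x - f x)\<^sup>2) \<longlonglongrightarrow> 0"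
    proof (rule AE_I2)
      fix x assume "x \<in> space M"
      from tendsto_power[OF tendsto_diff[OF lim[OF this] tendsto_const[of "f x"]], of 2]
      show "(\<lambda>n. (F n x - f x)\<^sup>2) \<longlonglongrightarrow> 0" by simp
    qed
    show "AE x in M. norm ((F n x - f x)\<^sup>2) \<le> (g x)\<^sup>2" for n
    proof (rule AE_I2)
      fix x assume "x \<in> space M"
      then have "\<bar>F n x - f x\<bar> \<le> \<bar>g x\<bar>" using le[of x n] by linarith
      then show "norm ((F n x - f x)\<^sup>2) \<le> (g x)\<^sup>2" by (simp add: abs_le_square_iff)
    qed
  qed simp_all
  from tendsto_real_sqrt[OF this] show ?thesis by (simp add: nrm_def)
qed

section \<open>Trigonometric polynomials\<close>

definition trig :: "(real \<times> 'v::euclidean_space \<times> real) list \<Rightarrow> 'v \<Rightarrow> real" where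
  "trig xs x = (\<Sum>(c, u, \<theta>)\<leftarrow>xs. c * cos (u \<bullet> x + \<theta>))"

lemma trig_Nil [simp]: "trig [] x = 0"
  and trig_Cons [simp]: "trig ((c, u, \<theta>) # xs) x = c * cos (u \<bullet> x + \<theta>) + trig xs x"
  and trig_append: "trig (xs @ ys) x = trig xs x + trig ys x"
  by (simp_all add: trig_def)

lemma trig_const: "trig [(c, 0, 0)] x = c"
  by (simp add: trig_def)

text \<open>
  Products of cosines are sums of cosines, so these functions form an algebra; the phases
  \<open>\<theta>\<close> provide the sines and the constants.
\<close>

lemma trig_mult_ex: "\<exists>zs. \<forall>x. trig zs x = trig xs x * trig ys x"
proof (induction xs)
  case Nil
  then show ?case by (intro exI[of _ "[]"]) simp
next
  case (Cons a xs)
  obtain c u \<theta> where a: "a = (c, u, \<theta>)" by (cases a)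
  have "\<exists>zs. \<forall>x. trig zs x = c * cos (u \<bullet> x + \<theta>) * trig ys x"
  proof (induction ys)
    case Nil
    then show ?case by (intro exI[of _ "[]"]) simp
  next
    case (Cons b ys)
    obtain d v \<eta> where b: "b = (d, v, \<eta>)" by (cases b)
    from Cons obtain zs where 1: "\<forall>x. trig zs x = c * cos (u \<bullet> x + \<theta>) * trig ys x" by blast
    have 2: "c * cos A * (d * cos B) = c * d / 2 * cos (A - B) + c * d / 2 * cos (A + B)" for A B :: real
      by (simp add: cos_diff cos_add algebra_simps)
    have 3: "(u - v) \<bullet> x + (\<theta> - \<eta>) = (u \<bullet> x + \<theta>) - (v \<bullet> x + \<eta>)"
      "(u + v) \<bullet> x + (\<theta> + \<eta>) = (u \<bullet> x + \<theta>) + (v \<bullet> x + \<eta>)" for x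
      by (simp_all add: inner_diff_left inner_add_left)
    have "trig ((c * d / 2, u - v, \<theta> - \<eta>) # (c * d / 2, u + v, \<theta> + \<eta>) # zs) x
        = c * cos (u \<bullet> x + \<theta>) * trig (b # ys) x" for x
      unfolding b trig_Cons 3 distrib_left 2 using 1 by simp
    then show ?case by blast
  qed
  then obtain zs where "\<forall>x. trig zs x = c * cos (u \<bullet> x + \<theta>) * trig ys x" by blast
  moreover obtain zs' where "\<forall>x. trig zs' x = trig xs x * trig ys x" using Cons by blast
  ultimately show ?case unfolding a
    by (intro exI[of _ "zs @ zs'"]) (simp add: trig_append algebra_simps)
qed

lemma trig_bounded: "\<exists>B>0. \<forall>x. \<bar>trig xs x\<bar> \<le> B"
proof (induction xs)
  case Nil
  then show ?case by (intro exI[of _ 1]) simp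
next
  case (Cons a xs)
  obtain c u \<theta> where a: "a = (c, u, \<theta>)" by (cases a)
  obtain B where B: "B > 0" "\<forall>x. \<bar>trig xs x\<bar> \<le> B" using Cons by blast
  have "\<bar>c * cos (u \<bullet> x + \<theta>)\<bar> \<le> \<bar>c\<bar>" for x
    using mult_left_mono[OF abs_cos_le_one, of "\<bar>c\<bar>"] by (simp add: abs_mult)
  then have "\<bar>trig (a # xs) x\<bar> \<le> \<bar>c\<bar> + B" for x
    using B(2) unfolding a by (simp, smt (verit))
  then show ?case using B by (intro exI[of _ "\<bar>c\<bar> + B"]) auto
qed

lemma continuous_on_trig [continuous_intros]: "continuous_on A (trig xs)"
proof (induction xs)
  case Nil
  then show ?case by (simp add: trig_def[abs_def])
next
  case (Cons a xs)
  then show ?case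
    by (cases a) (auto simp: trig_def[abs_def] intro!: continuous_intros)
qed

lemma borel_measurable_trig [measurable]: "trig xs \<in> borel_measurable borel"
  by (rule borel_measurable_continuous_onI[OF continuous_on_trig])

section \<open>Density of the trigonometric polynomials\<close>

text \<open>
  Approximability by trigonometric polynomials is a monotone class argument: the functions with
  property \<open>appr\<close> below form a closed subspace, stable under products with bounded
  members, that contains the indicators of half spaces.
\<close>

locale borel_finite = finite_measure \<mu> for \<mu> :: "'v::euclidean_space measure" +
  assumes sets_eq [measurable_cong]: "sets \<mu> = sets borel"
begin

definition appr :: "('v \<Rightarrow> real) \<Rightarrow> bool" where
  "appr f \<longleftrightarrow> sqi \<mu> f \<and> (\<forall>e>0. \<exists>xs. nrm \<mu> (\<lambda>x. f x - trig xs x) < e)"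

lemma sqi_trig: "sqi \<mu> (trig xs)"
  using trig_bounded[of xs] by (auto intro!: sqi_bounded)

lemma apprE:
  assumes "appr f" "e > 0"
  obtains xs where "nrm \<mu> (\<lambda>x. f x - trig xs x) < e"
  using assms by (auto simp: appr_def)

lemma appr_trig: "appr (trig xs)"
  by (auto simp: appr_def sqi_trig nrm_def intro!: exI[of _ xs])

lemma appr_lim:
  assumes F: "\<And>n. appr (F n)" and f: "sqi \<mu> f"
    and lim: "(\<lambda>n. nrm \<mu> (\<lambda>x. F n x - f x)) \<longlonglongrightarrow> 0"
  shows "appr f"
  unfolding appr_def
proof (intro conjI allI impI f)
  fix e :: real assume "e > 0"
  from order_tendstoD(2)[OF lim, of "e/2"] \<open>e > 0\<close>
  obtain n where n: "nrm \<mu> (\<lambda>x. F n x - f x) < e / 2" 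
    by (auto simp: eventually_sequentially)
  obtain xs where "nrm \<mu> (\<lambda>x. F n x - trig xs x) < e / 2"
    using apprE[OF F, of "e/2" n] \<open>e > 0\<close> by auto
  with n nrm_triangle3[OF f _ sqi_trig, of "F n" xs] F[of n]
  show "\<exists>xs. nrm \<mu> (\<lambda>x. f x - trig xs x) < e"
    by (intro exI[of _ xs]) (auto simp: appr_def nrm_minus_commute[of \<mu> f])
qed

lemma appr_add:
  assumes "appr f" "appr g" shows "appr (\<lambda>x. f x + g x)"
  unfolding appr_def
proof (intro conjI allI impI)
  have s: "sqi \<mu> f" "sqi \<mu> g" using assms by (auto simp: appr_def)
  then show "sqi \<mu> (\<lambda>x. f x + g x)" by (rule sqi_add)
  fix e :: real assume "e > 0"
  then obtain xs ys where xs: "nrm \<mu> (\<lambda>x. f x - trig xs x) < e / 2" and ys: "nrm \<mu> (\<lambda>x. g x - trig ys x) < e / 2"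
    using apprE[OF assms(1), of "e/2"] apprE[OF assms(2), of "e/2"] by (metis half_gt_zero)
  have "(\<lambda>x. f x + g x - trig (xs @ ys) x) = (\<lambda>x. (f x - trig xs x) + (g x - trig ys x))"
    by (auto simp: trig_append)
  then show "\<exists>xs. nrm \<mu> (\<lambda>x. f x + g x - trig xs x) < e"
    using xs ys nrm_triangle[OF sqi_diff[OF s(1) sqi_trig] sqi_diff[OF s(2) sqi_trig], of xs ys]
    by (intro exI[of _ "xs @ ys"]) simp
qed

lemma appr_trig_mult:
  assumes "appr f" shows "appr (\<lambda>x. trig ys x * f x)"
  unfolding appr_def
proof (intro conjI allI impI)
  obtain B where B: "B > 0" "\<And>x. \<bar>trig ys x\<bar> \<le> B" using trig_bounded[of ys] by auto
  have s: "sqi \<mu> f" using assms by (auto simp: appr_def)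
  have bd: "sqi \<mu> (\<lambda>x. trig ys x * h x) \<and> nrm \<mu> (\<lambda>x. trig ys x * h x) \<le> B * nrm \<mu> h" if h: "sqi \<mu> h" for h
  proof
    have le: "\<bar>trig ys x * h x\<bar> \<le> \<bar>B * h x\<bar>" for x
      using B by (auto simp: abs_mult intro!: mult_mono)
    have [measurable]: "h \<in> borel_measurable \<mu>" using h by (rule sqiD)
    show 1: "sqi \<mu> (\<lambda>x. trig ys x * h x)"
      using le by (intro sqi_bound[OF sqi_cmult[OF h, of B]]) auto
    have "(\<integral>x. (trig ys x * h x)\<^sup>2 \<partial>\<mu>) \<le> (\<integral>x. (B * h x)\<^sup>2 \<partial>\<mu>)"
      using 1 sqi_cmult[OF h, of B] le by (intro integral_mono) (auto simp: sqi_def abs_le_square_iff)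
    then have "nrm \<mu> (\<lambda>x. trig ys x * h x) \<le> nrm \<mu> (\<lambda>x. B * h x)" by (simp add: nrm_def)
    then show "nrm \<mu> (\<lambda>x. trig ys x * h x) \<le> B * nrm \<mu> h" using B by (simp add: nrm_cmult)
  qed
  show "sqi \<mu> (\<lambda>x. trig ys x * f x)" using bd[OF s] by simp
  fix e :: real assume "e > 0"
  then obtain xs where xs: "nrm \<mu> (\<lambda>x. f x - trig xs x) < e / B"
    using apprE[OF assms, of "e / B"] B by (metis divide_pos_pos)
  obtain zs where zs: "\<forall>x. trig zs x = trig ys x * trig xs x" using trig_mult_ex by blast
  have "nrm \<mu> (\<lambda>x. trig ys x * f x - trig zs x) = nrm \<mu> (\<lambda>x. trig ys x * (f x - trig xs x))"
    by (simp add: zs algebra_simps)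
  also have "\<dots> \<le> B * nrm \<mu> (\<lambda>x. f x - trig xs x)"
    using bd[OF sqi_diff[OF s sqi_trig]] by blast
  also have "\<dots> < e" using xs B by (simp add: field_simps)
  finally show "\<exists>xs. nrm \<mu> (\<lambda>x. trig ys x * f x - trig xs x) < e" by blast
qed

lemma appr_cmult: "appr f \<Longrightarrow> appr (\<lambda>x. c * f x)"
  using appr_trig_mult[of f "[(c, 0, 0)]"] by (simp add: trig_const)

lemma appr_const: "appr (\<lambda>x. c)"
  using appr_trig[of "[(c, 0, 0)]"] by (simp add: trig_def[abs_def])

lemma appr_sum:
  "(\<And>i. i \<in> A \<Longrightarrow> appr (f i)) \<Longrightarrow> appr (\<lambda>x. \<Sum>i\<in>A. f i x)"
proof (induction A rule: infinite_finite_induct)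
  case (insert x A)
  then show ?case by (auto intro!: appr_add)
qed (auto simp: appr_const)

text \<open>
  Approximate \<open>f\<close> by \<open>trig (X n)\<close>. The error in the product is
  controlled because \<open>g\<close> is bounded, and \<open>trig (X n) * g\<close> is
  approximable because multiplication by a trigonometric polynomial is bounded and preserves
  trigonometric polynomials.
\<close>

lemma appr_mult_bounded:
  assumes f: "appr f" and g: "appr g" and B: "\<And>x. \<bar>g x\<bar> \<le> B"
  shows "appr (\<lambda>x. f x * g x)"
proof -
  have "\<exists>xs. nrm \<mu> (\<lambda>x. f x - trig xs x) < 1 / real (Suc n)" for n
    using f by (auto simp: appr_def)
  then obtain X where X: "\<And>n. nrm \<mu> (\<lambda>x. f x - trig (X n) x) < 1 / real (Suc n)" by metis
  have s: "sqi \<mu> f" "sqi \<mu> g" using assms by (auto simp: appr_def)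
  have [measurable]: "f \<in> borel_measurable \<mu>" "g \<in> borel_measurable \<mu>" using s by (auto simp: sqi_def)
  have le: "\<bar>h x * g x\<bar> \<le> \<bar>B * h x\<bar>" for x and h :: "'v \<Rightarrow> real"
    using mult_mono[OF B[of x] order_refl[of "\<bar>h x\<bar>"]] abs_ge_self[of B] B[of x]
    by (auto simp: abs_mult mult.commute intro!: mult_left_mono)
  have sg: "sqi \<mu> (\<lambda>x. h x * g x)" if h: "sqi \<mu> h" for h
  proof -
    have [measurable]: "h \<in> borel_measurable \<mu>" using h by (rule sqiD)
    show ?thesis by (rule sqi_bound[OF sqi_cmult[OF h, of B]]) (use le in auto)
  qed
  have nb: "nrm \<mu> (\<lambda>x. h x * g x) \<le> \<bar>B\<bar> * nrm \<mu> h" if h: "sqi \<mu> h" for h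
  proof -
    have "(\<integral>x. (h x * g x)\<^sup>2 \<partial>\<mu>) \<le> (\<integral>x. (B * h x)\<^sup>2 \<partial>\<mu>)"
      using sg[OF h] sqi_cmult[OF h, of B] le by (intro integral_mono) (auto simp: sqi_def abs_le_square_iff)
    then have "nrm \<mu> (\<lambda>x. h x * g x) \<le> nrm \<mu> (\<lambda>x. B * h x)" by (simp add: nrm_def)
    then show ?thesis by (simp add: nrm_cmult)
  qed
  show ?thesis
  proof (rule appr_lim)
    show "appr (\<lambda>x. trig (X n) x * g x)" for n by (rule appr_trig_mult[OF g])
    show "sqi \<mu> (\<lambda>x. f x * g x)" by (rule sg[OF s(1)])
    show "(\<lambda>n. nrm \<mu> (\<lambda>x. trig (X n) x * g x - f x * g x)) \<longlonglongrightarrow> 0"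
    proof (rule Lim_null_comparison)
      have "nrm \<mu> (\<lambda>x. trig (X n) x * g x - f x * g x) \<le> \<bar>B\<bar> * (1 / real (Suc n))" for n
      proof -
        have "nrm \<mu> (\<lambda>x. trig (X n) x * g x - f x * g x) = nrm \<mu> (\<lambda>x. (trig (X n) x - f x) * g x)"
          by (simp add: algebra_simps)
        also have "\<dots> \<le> \<bar>B\<bar> * nrm \<mu> (\<lambda>x. trig (X n) x - f x)"
          by (rule nb[OF sqi_diff[OF sqi_trig s(1)]])
        also have "\<dots> \<le> \<bar>B\<bar> * (1 / real (Suc n))"
          using X[of n] by (intro mult_left_mono) (auto simp: nrm_minus_commute[of _ "trig _"])
        finally show ?thesis .
      qed
      then show "\<forall>\<^sub>F n in sequentially. norm (nrm \<mu> (\<lambda>x. trig (X n) x * g x - f x * g x)) \<le> \<bar>B\<bar> * (1 / real (Suc n))"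
        by (auto intro!: always_eventually)
      show "(\<lambda>n. \<bar>B\<bar> * (1 / real (Suc n))) \<longlonglongrightarrow> 0"
        by (rule tendsto_mult_right_zero[OF LIMSEQ_Suc[OF lim_1_over_n]])
    qed
  qed
qed

lemma appr_bounded_lim:
  assumes F: "\<And>n. appr (F n)" and B: "\<And>n x. \<bar>F n x\<bar> \<le> B" and lim: "\<And>x. (\<lambda>n. F n x) \<longlonglongrightarrow> f x"
  shows "appr f"
proof (rule appr_lim)
  have [measurable]: "F n \<in> borel_measurable \<mu>" for n using F by (auto simp: appr_def sqi_def)
  have [measurable]: "f \<in> borel_measurable \<mu>" using lim by (rule borel_measurable_LIMSEQ_real) auto
  have fB: "\<bar>f x\<bar> \<le> B" for x
    by (rule tendsto_upperbound[OF tendsto_rabs[OF lim]]) (auto simp: B)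
  show "sqi \<mu> f" using fB by (intro sqi_bounded) auto
  show "(\<lambda>n. nrm \<mu> (\<lambda>x. F n x - f x)) \<longlonglongrightarrow> 0"
  proof (rule nrm_dominated[where g="\<lambda>_. 2 * B"])
    show "sqi \<mu> (\<lambda>_. 2 * B)" by (rule sqi_bounded) auto
    fix n x show "\<bar>F n x - f x\<bar> \<le> 2 * B" using B[of n x] fB[of x] by simp
  qed (use lim in auto)
qed (rule F)

lemma appr_power:
  assumes f: "appr f" and B: "\<And>x. \<bar>f x\<bar> \<le> B"
  shows "appr (\<lambda>x. f x ^ k)"
proof (induction k)
  case 0
  then show ?case by (simp add: appr_const)
next
  case (Suc k)
  from appr_mult_bounded[OF this f B] show ?case by (simp add: mult.commute)
qed

text \<open>
  Bernstein polynomials of \<open>f\<close> are approximable, bounded, and converge to \<open>h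
  \<circ> f\<close>.
\<close>

lemma appr_continuous:
  assumes f: "appr f" and B: "\<And>x. 0 \<le> f x \<and> f x \<le> 1" and h: "continuous_on {0..1} h"
  shows "appr (\<lambda>x. h (f x))"
proof -
  define P where "P n y = (\<Sum>k\<le>n. h (real k / real n) * Bernstein n k y)" for n and y :: real
  have P: "appr (\<lambda>x. P n (f x))" for n
  proof -
    have b: "appr (\<lambda>x. f x ^ j)" "appr (\<lambda>x. (1 - f x) ^ j)" for j
    proof -
      show "appr (\<lambda>x. f x ^ j)" by (rule appr_power[OF f, of 1]) (use B in \<open>auto simp: abs_le_iff intro: order_trans\<close>)
      have "appr (\<lambda>x. 1 + (-1) * f x)" by (intro appr_add appr_const appr_cmult f)
      then have "appr (\<lambda>x. 1 - f x)" by simp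
      then show "appr (\<lambda>x. (1 - f x) ^ j)" by (rule appr_power[of _ 1]) (use B in \<open>auto simp: abs_le_iff\<close>)
    qed
    have "appr (\<lambda>x. f x ^ i * (1 - f x) ^ j)" for i j
      by (rule appr_mult_bounded[OF b, of _ 1]) (use B in \<open>auto simp: abs_le_iff power_le_one intro: order_trans[OF _ zero_le_power]\<close>)
    then have "appr (\<lambda>x. (h (real k / real n) * real (n choose k)) * (f x ^ k * (1 - f x) ^ (n - k)))" for k
      by (rule appr_cmult)
    then show ?thesis
      unfolding P_def Bernstein_def by (intro appr_sum) (simp add: mult.assoc)
  qed
  obtain C where C: "\<And>y. y \<in> {0..1} \<Longrightarrow> \<bar>h y\<bar> \<le> C"
    using compact_imp_bounded[OF compact_continuous_image[OF h compact_Icc]] unfolding bounded_iff by fastforce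
  have C0: "C \<ge> 0" using C[of 0] by auto
  have W: "\<exists>N. \<forall>n y. N \<le> n \<and> y \<in> {0..1} \<longrightarrow> \<bar>h y - P n y\<bar> < e" if "e > 0" for e
    using Bernstein_Weierstrass[OF h that] unfolding P_def by auto
  obtain N0 where N0: "\<And>n y. N0 \<le> n \<Longrightarrow> y \<in> {0..1} \<Longrightarrow> \<bar>h y - P n y\<bar> < 1" using W[of 1] by auto
  show ?thesis
  proof (rule appr_bounded_lim[where F="\<lambda>n x. P (n + N0) (f x)" and B="C + 1"])
    show "appr (\<lambda>x. P (n + N0) (f x))" for n by (rule P)
    show "\<bar>P (n + N0) (f x)\<bar> \<le> C + 1" for n x
      using N0[of "n + N0" "f x"] C[of "f x"] B[of x] by auto
    show "(\<lambda>n. P (n + N0) (f x)) \<longlonglongrightarrow> h (f x)" for x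
    proof (rule LIMSEQ_I)
      fix r :: real assume "r > 0"
      then obtain N where "\<forall>n y. N \<le> n \<and> y \<in> {0..1} \<longrightarrow> \<bar>h y - P n y\<bar> < r" using W by blast
      then show "\<exists>no. \<forall>n\<ge>no. norm (P (n + N0) (f x) - h (f x)) < r"
        using B[of x] by (intro exI[of _ N]) (auto simp: abs_minus_commute)
    qed
  qed
qed

text \<open>
  On the strip \<open>\<bar>x \<bullet> i - a\<bar> < \<pi> N\<close> the half space is the set
  where the function \<open>sin ((x \<bullet> i - a) / N)\<close> is positive, and the indicator
  of this set is a limit of continuous functions of that sine.
\<close>

lemma appr_halfspace: "appr (indicator {x. a < x \<bullet> i})"
proof -
  define s where "s N x = sin ((x \<bullet> i - a) / real (Suc N))" for N and x :: 'v
  \<comment> \<open>rescaled to the unit interval, where the Bernstein polynomials live\<close>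
  define g where "g N x = (1 + s N x) / 2" for N x
  have cs: "cos (t - pi / 2) = sin t" for t :: real by (simp add: cos_diff)
  have g: "appr (g N)" for N
  proof -
    have "trig [(1/2, 0, 0), (1/2, (1 / real (Suc N)) *\<^sub>R i, - a / real (Suc N) - pi / 2)] x = g N x" for x
    proof -
      have "((1 / real (Suc N)) *\<^sub>R i) \<bullet> x + (- a / real (Suc N) - pi / 2) = (x \<bullet> i - a) / real (Suc N) - pi / 2"
        by (simp add: inner_commute diff_divide_distrib)
      then show ?thesis
        unfolding trig_Cons trig_Nil by (simp only: cs) (simp add: g_def s_def add_divide_distrib)
    qed
    then show ?thesis using appr_trig by (metis (no_types, lifting) ext)
  qed
  have g01: "0 \<le> g N x \<and> g N x \<le> 1" for N x
  proof -
    have "- 1 \<le> s N x" "s N x \<le> 1" unfolding s_def by simp_all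
    then show ?thesis by (simp add: g_def)
  qed
  define h where "h k y = min 1 (max 0 (real k * (2 * y - 1)))" for k :: nat and y :: real
  have 1: "appr (indicator {x. 0 < s N x})" for N
  proof (rule appr_bounded_lim[where F="\<lambda>k x. h k (g N x)" and B=1])
    show "appr (\<lambda>x. h k (g N x))" for k
      unfolding h_def by (rule appr_continuous[OF g g01]) (intro continuous_intros)
    show "\<bar>h k (g N x)\<bar> \<le> 1" for k x by (simp add: h_def)
    show "(\<lambda>k. h k (g N x)) \<longlonglongrightarrow> indicator {x. 0 < s N x} x" for x
    proof (cases "0 < s N x")
      case True
      have "\<forall>\<^sub>F k in sequentially. 1 / s N x \<le> real k"
      proof -
        obtain K where "1 / s N x \<le> real K" using real_arch_simple by blast
        then show ?thesis unfolding eventually_sequentially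
          by (metis of_nat_mono order_trans)
      qed
      then have "\<forall>\<^sub>F k in sequentially. h k (g N x) = 1"
        by eventually_elim (use True in \<open>simp add: h_def g_def field_simps\<close>)
      then show ?thesis using True by (auto intro: tendsto_eventually)
    next
      case False
      then have "real k * s N x \<le> 0" for k by (simp add: mult_nonneg_nonpos)
      then have "h k (g N x) = 0" for k by (simp add: h_def g_def add_divide_distrib)
      then show ?thesis using False by simp
    qed
  qed
  show ?thesis
  proof (rule appr_bounded_lim[where F="\<lambda>N. indicator {x. 0 < s N x}" and B=1, OF 1])
    show "\<bar>indicator {x. 0 < s N x} x\<bar> \<le> (1::real)" for N x by (auto simp: indicator_def)
    show "(\<lambda>N. indicator {x. 0 < s N x} x) \<longlonglongrightarrow> (indicator {x. a < x \<bullet> i} x :: real)" for x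
    proof -
      obtain K where K: "real K > \<bar>x \<bullet> i - a\<bar>" using reals_Archimedean2 by blast
      have "\<forall>\<^sub>F N in sequentially. (0 < s N x) = (a < x \<bullet> i)"
        unfolding eventually_sequentially
      proof (intro exI[of _ K] allI impI)
        fix N assume "K \<le> N"
        define t where "t = (x \<bullet> i - a) / real (Suc N)"
        have "\<bar>t\<bar> < 1" using K \<open>K \<le> N\<close> by (simp add: t_def)
        then have t: "\<bar>t\<bar> < pi" using pi_gt3 by linarith
        have "0 < sin t \<longleftrightarrow> 0 < t"
        proof
          assume "0 < sin t"
          show "0 < t"
          proof (rule ccontr)
            assume "\<not> 0 < t"
            then have "0 \<le> sin (- t)" using t by (intro sin_ge_zero) auto
            then show False using \<open>0 < sin t\<close> by simp
          qed
        qed (use t in \<open>auto intro: sin_gt_zero\<close>)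
        then show "(0 < s N x) = (a < x \<bullet> i)"
          by (simp add: s_def t_def zero_less_divide_iff)
      qed
      then show ?thesis
        by (intro tendsto_eventually) (auto elim!: eventually_mono simp: indicator_def)
    qed
  qed
qed

lemma appr_indicator:
  assumes "A \<in> sets borel"
  shows "appr (indicator A)"
proof -
  have "A \<in> sigma_sets UNIV ((\<lambda>(a, i). {x::'v. a < x \<bullet> i}) ` (UNIV \<times> Basis))"
    using assms by (subst (asm) borel_eq_halfspace_greater) simp
  then show ?thesis
  proof induction
    case (Basic a)
    then show ?case by (auto simp: appr_halfspace)
  next
    case Empty
    then show ?case using appr_const[of 0] by (simp add: indicator_def[abs_def])
  next
    case (Compl a)
    from appr_add[OF appr_const[of 1] appr_cmult[OF Compl.IH, of "-1"]]
    show ?case by (rule back_subst[of appr]) (auto simp: indicator_def)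
  next
    case (Union a)
    have 1: "appr (indicator (\<Inter>j\<le>n. - a j))" for n
    proof (induction n)
      case 0
      from appr_add[OF appr_const[of 1] appr_cmult[OF Union.IH[of 0], of "-1"]]
      show ?case by (rule back_subst[of appr]) (auto simp: indicator_def)
    next
      case (Suc n)
      from appr_add[OF appr_const[of 1] appr_cmult[OF Union.IH[of "Suc n"], of "-1"]]
      have "appr (indicator (- a (Suc n)))" by (rule back_subst[of appr]) (auto simp: indicator_def)
      from appr_mult_bounded[OF Suc this, of 1]
      show ?case by (rule back_subst[of appr]) (auto simp: indicator_def fun_eq_iff le_Suc_eq)
    qed
    show ?case
    proof (rule appr_bounded_lim[where F="\<lambda>n x. 1 + (-1) * indicator (\<Inter>j\<le>n. - a j) x" and B=1])
      show "appr (\<lambda>x. 1 + (-1) * indicator (\<Inter>j\<le>n. - a j) x)" for n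
        by (intro appr_add appr_const appr_cmult 1)
      show "\<bar>1 + (-1) * indicator (\<Inter>j\<le>n. - a j) x\<bar> \<le> (1::real)" for n x by (auto simp: indicator_def)
      show "(\<lambda>n. 1 + (-1) * indicator (\<Inter>j\<le>n. - a j) x) \<longlonglongrightarrow> (indicator (\<Union> (range a)) x :: real)" for x
      proof (cases "x \<in> \<Union> (range a)")
        case True
        then obtain j where "x \<in> a j" by auto
        then have "\<forall>\<^sub>F n in sequentially. 1 + (-1) * indicator (\<Inter>j\<le>n. - a j) x = (1::real)"
          by (auto simp: eventually_sequentially indicator_def intro!: exI[of _ j])
        then show ?thesis using True by (auto intro!: tendsto_eventually)
      next
        case False
        then show ?thesis by (auto simp: indicator_def)
      qed
    qed
  qed
qed

text \<open>
  From indicators of Borel sets the closure passes to simple functions and then to their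
  dominated limits.
\<close>

lemma trig_dense:
  assumes "sqi \<mu> f" shows "appr f"
proof -
  have [measurable]: "f \<in> borel_measurable \<mu>" using assms by (rule sqiD)
  obtain F where F: "\<And>n. simple_function \<mu> (F n)" "\<And>x. (\<lambda>n. F n x) \<longlonglongrightarrow> f x"
    "\<And>n x. dist (F n x) 0 \<le> 2 * dist (f x) 0"
    using borel_measurable_implies_sequence_metric[of f \<mu> 0] sets_eq_imp_space_eq[OF sets_eq] by auto
  have Fb: "appr (F n)" for n
  proof -
    have fin: "finite (range (F n))" using F(1)[of n] sets_eq_imp_space_eq[OF sets_eq]
      by (auto simp: simple_function_def)
    have m: "F n -` {y} \<in> sets borel" for y
      using measurable_sets[OF borel_measurable_simple_function[OF F(1)[of n]], of "{y}"] 
        sets_eq sets_eq_imp_space_eq[OF sets_eq] by simp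
    have "appr (\<lambda>x. \<Sum>y\<in>range (F n). y * indicator (F n -` {y}) x)"
      by (intro appr_sum appr_cmult appr_indicator m)
    also have "(\<lambda>x. \<Sum>y\<in>range (F n). y * indicator (F n -` {y}) x) = F n"
    proof
      fix x
      have "(\<Sum>y\<in>range (F n). y * indicator (F n -` {y}) x) = (\<Sum>y\<in>range (F n). if y = F n x then y else 0)"
        by (intro sum.cong) (auto simp: indicator_def)
      also have "\<dots> = F n x" using fin by (simp add: sum.delta)
      finally show "(\<Sum>y\<in>range (F n). y * indicator (F n -` {y}) x) = F n x" .
    qed
    finally show ?thesis .
  qed
  show ?thesis
  proof (rule appr_lim[OF Fb assms])
    have [measurable]: "F n \<in> borel_measurable \<mu>" for n using F(1) by (rule borel_measurable_simple_function)
    show "(\<lambda>n. nrm \<mu> (\<lambda>x. F n x - f x)) \<longlonglongrightarrow> 0"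
    proof (rule nrm_dominated[where g="\<lambda>x. 3 * \<bar>f x\<bar>"])
      show "sqi \<mu> (\<lambda>x. 3 * \<bar>f x\<bar>)" by (rule sqi_cmult) (use assms in \<open>auto simp: sqi_def\<close>)
      show "\<bar>F n x - f x\<bar> \<le> 3 * \<bar>f x\<bar>" for n x using F(3)[of n x] by (simp add: dist_real_def)
    qed (use F(2) in auto)
  qed
qed

lemma trig_dense_seq:
  assumes "sqi \<mu> f"
  obtains X where "(\<lambda>n. nrm \<mu> (\<lambda>x. f x - trig (X n) x)) \<longlonglongrightarrow> 0"
proof -
  have "\<exists>xs. nrm \<mu> (\<lambda>x. f x - trig xs x) < 1 / real (Suc n)" for n
    using trig_dense[OF assms] by (auto simp: appr_def)
  then obtain X where X: "\<And>n. nrm \<mu> (\<lambda>x. f x - trig (X n) x) < 1 / real (Suc n)" by metis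
  have "(\<lambda>n. nrm \<mu> (\<lambda>x. f x - trig (X n) x)) \<longlonglongrightarrow> 0"
    by (rule Lim_null_comparison[OF _ LIMSEQ_Suc[OF lim_1_over_n]])
      (use X in \<open>auto intro!: always_eventually less_imp_le\<close>)
  then show ?thesis by (rule that)
qed

end

section \<open>Measures determined by their cosine transforms\<close>

text \<open>
  Trigonometric polynomials have equal integrals, and an indicator can be approximated by one
  and the same trigonometric polynomial in \<open>L\<^sup>2\<close> of both measures: apply
  density to their average.
\<close>

lemma prob_measure_eqI_cos:
  fixes \<mu>1 \<mu>2 :: "'v::euclidean_space measure"
  assumes "prob_space \<mu>1" "prob_space \<mu>2"
    and sets: "sets \<mu>1 = sets borel" "sets \<mu>2 = sets borel"
    and eq: "\<And>u \<theta>. (\<integral>x. cos (u \<bullet> x + \<theta>) \<partial>\<mu>1) = (\<integral>x. cos (u \<bullet> x + \<theta>) \<partial>\<mu>2)"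
  shows "\<mu>1 = \<mu>2"
proof (rule measure_eqI)
  interpret m1: borel_finite \<mu>1
    using assms(1) sets by (auto simp: borel_finite_def borel_finite_axioms_def prob_space_def)
  interpret m2: borel_finite \<mu>2
    using assms(2) sets by (auto simp: borel_finite_def borel_finite_axioms_def prob_space_def)
  \<comment> \<open>\<open>\<mu>\<close> is the average of the two measures, written as a mixture by a fair coin\<close>
  define k where "k b = (if b then \<mu>1 else \<mu>2)" for b
  define \<mu> where "\<mu> = measure_pmf (bernoulli_pmf (1/2)) \<bind> k"
  have k: "k \<in> measurable (measure_pmf (bernoulli_pmf (1/2))) (subprob_algebra borel)"
    using assms prob_space_imp_subprob_space[OF assms(1)] prob_space_imp_subprob_space[OF assms(2)]
    by (auto simp: k_def space_subprob_algebra)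
  have ms: "sets \<mu> = sets borel"
    unfolding \<mu>_def by (rule sets_bind[of _ _ borel]) (use sets in \<open>auto simp: k_def\<close>)
  have nn: "(\<integral>\<^sup>+x. f x \<partial>\<mu>) = (\<integral>\<^sup>+x. f x \<partial>\<mu>1) * ennreal (1/2) + (\<integral>\<^sup>+x. f x \<partial>\<mu>2) * ennreal (1/2)"
    if "f \<in> borel_measurable borel" for f
    unfolding \<mu>_def by (subst nn_integral_bind[OF that k])
      (simp add: k_def nn_integral_measure_pmf_finite UNIV_bool)
  have "finite_measure \<mu>"
  proof (rule finite_measureI)
    show "emeasure \<mu> (space \<mu>) \<noteq> \<infinity>"
      using nn[of "\<lambda>_. 1"] sets_eq_imp_space_eq[OF ms] sets_eq_imp_space_eq[OF sets(1)] sets_eq_imp_space_eq[OF sets(2)]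
        m1.emeasure_finite[of UNIV] m2.emeasure_finite[of UNIV]
      by (auto simp: ennreal_mult_eq_top_iff)
  qed
  then interpret borel_finite \<mu>
    using ms by (auto simp: borel_finite_def borel_finite_axioms_def)
  have trig_eq: "(\<integral>x. trig xs x \<partial>\<mu>1) = (\<integral>x. trig xs x \<partial>\<mu>2)" for xs
  proof (induction xs)
    case (Cons a xs)
    obtain c u \<theta> where a: "a = (c, u, \<theta>)" by (cases a)
    have i: "integrable \<mu>1 (\<lambda>x. cos (u \<bullet> x + \<theta>))" "integrable \<mu>2 (\<lambda>x. cos (u \<bullet> x + \<theta>))"
      by (rule m1.integrable_const_bound[of _ 1] m2.integrable_const_bound[of _ 1]; simp)+
    have "integrable \<mu>1 (trig xs)" "integrable \<mu>2 (trig xs)"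
      using m1.sqi_integrable[OF m1.sqi_trig] m2.sqi_integrable[OF m2.sqi_trig] by auto
    with i Cons show ?case by (simp add: a eq)
  qed simp
  show "sets \<mu>1 = sets \<mu>2" using sets by simp
  fix A assume "A \<in> sets \<mu>1"
  then have A [measurable]: "A \<in> sets borel" using sets by simp
  have main: "\<bar>measure \<mu>1 A - measure \<mu>2 A\<bar> \<le> 2 * (sqrt 2 * e)" if "e > 0" for e
  proof -
    have "sqi \<mu> (indicator A)" by (rule sqi_bounded[of _ 1]) (auto simp: ms indicator_def)
    from apprE[OF trig_dense[OF this] that] obtain xs
      where xs: "nrm \<mu> (\<lambda>x. indicator A x - trig xs x) < e" by blast
    define d where "d x = indicator A x - trig xs x" for x
    have [measurable]: "d \<in> borel_measurable borel" unfolding d_def by measurable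
    obtain B where B: "B > 0" "\<And>x. \<bar>trig xs x\<bar> \<le> B" using trig_bounded[of xs] by auto
    have dB: "\<bar>d x\<bar> \<le> 1 + B" for x
      using B(2)[of x] by (auto simp: d_def indicator_def)
    have sq: "sqi \<mu> d" "sqi \<mu>1 d" "sqi \<mu>2 d"
      by (rule sqi_bounded[of _ "1 + B"] m1.sqi_bounded[of _ "1 + B"] m2.sqi_bounded[of _ "1 + B"];
          use dB in \<open>simp add: sets ms\<close>)+
    have "ennreal (\<integral>x. (d x)\<^sup>2 \<partial>\<mu>) = ennreal (\<integral>x. (d x)\<^sup>2 \<partial>\<mu>1) * ennreal (1/2) + ennreal (\<integral>x. (d x)\<^sup>2 \<partial>\<mu>2) * ennreal (1/2)"
      using nn[of "\<lambda>x. ennreal ((d x)\<^sup>2)"] sq by (simp add: nn_integral_eq_integral sqi_def)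
    also have "\<dots> = ennreal ((\<integral>x. (d x)\<^sup>2 \<partial>\<mu>1) * (1/2) + (\<integral>x. (d x)\<^sup>2 \<partial>\<mu>2) * (1/2))"
    proof -
      have e: "ennreal (a * (1/2) + b * (1/2)) = ennreal a * ennreal (1/2) + ennreal b * ennreal (1/2)"
        if "0 \<le> a" "0 \<le> b" for a b :: real
      proof -
        have p: "0 \<le> a * (1/2)" "0 \<le> b * (1/2)" and h: "(0::real) \<le> 1/2" using that by auto
        show ?thesis unfolding ennreal_plus[OF p] ennreal_mult[OF that(1) h] ennreal_mult[OF that(2) h] ..
      qed
      show ?thesis by (subst e) auto
    qed
    finally have eq2: "(\<integral>x. (d x)\<^sup>2 \<partial>\<mu>) = (\<integral>x. (d x)\<^sup>2 \<partial>\<mu>1) / 2 + (\<integral>x. (d x)\<^sup>2 \<partial>\<mu>2) / 2"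
      by (subst (asm) ennreal_inj) auto
    have nn0: "0 \<le> (\<integral>x. (d x)\<^sup>2 \<partial>\<mu>1)" "0 \<le> (\<integral>x. (d x)\<^sup>2 \<partial>\<mu>2)" by auto
    have "nrm \<mu>1 d \<le> sqrt 2 * nrm \<mu> d" "nrm \<mu>2 d \<le> sqrt 2 * nrm \<mu> d"
      unfolding nrm_def real_sqrt_mult[symmetric] using eq2 nn0 by (auto intro!: real_sqrt_le_mono)
    moreover have "sqrt 2 * nrm \<mu> d \<le> sqrt 2 * e" using xs by (simp add: d_def[abs_def])
    ultimately have le: "nrm \<mu>1 d \<le> sqrt 2 * e" "nrm \<mu>2 d \<le> sqrt 2 * e" by linarith+
    have "\<bar>measure \<mu>1 A - (\<integral>x. trig xs x \<partial>\<mu>1)\<bar> \<le> sqrt 2 * e"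
    proof -
      have "measure \<mu>1 A - (\<integral>x. trig xs x \<partial>\<mu>1) = (\<integral>x. d x \<partial>\<mu>1)"
        unfolding d_def using m1.sqi_integrable[OF m1.sqi_trig[of xs]] sets_eq_imp_space_eq[OF sets(1)]
        by (subst Bochner_Integration.integral_diff) (auto simp: sets m1.emeasure_eq_measure)
      also have "\<bar>\<dots>\<bar> \<le> (\<integral>x. \<bar>d x\<bar> \<partial>\<mu>1)" by (rule integral_abs_bound)
      also have "\<dots> \<le> nrm \<mu>1 d" by (rule prob_space.L1_le_nrm[OF assms(1) sq(2)])
      finally show ?thesis using le by simp
    qed
    moreover have "\<bar>measure \<mu>2 A - (\<integral>x. trig xs x \<partial>\<mu>2)\<bar> \<le> sqrt 2 * e"
    proof -
      have "measure \<mu>2 A - (\<integral>x. trig xs x \<partial>\<mu>2) = (\<integral>x. d x \<partial>\<mu>2)"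
        unfolding d_def using m2.sqi_integrable[OF m2.sqi_trig[of xs]] sets_eq_imp_space_eq[OF sets(2)]
        by (subst Bochner_Integration.integral_diff) (auto simp: sets m2.emeasure_eq_measure)
      also have "\<bar>\<dots>\<bar> \<le> (\<integral>x. \<bar>d x\<bar> \<partial>\<mu>2)" by (rule integral_abs_bound)
      also have "\<dots> \<le> nrm \<mu>2 d" by (rule prob_space.L1_le_nrm[OF assms(2) sq(3)])
      finally show ?thesis using le by simp
    qed
    ultimately show ?thesis using trig_eq[of xs] by linarith
  qed
  have "measure \<mu>1 A = measure \<mu>2 A"
  proof (rule ccontr)
    assume "measure \<mu>1 A \<noteq> measure \<mu>2 A"
    then show False
      using main[of "\<bar>measure \<mu>1 A - measure \<mu>2 A\<bar> / (4 * sqrt 2)"] by (simp add: field_simps)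
  qed
  then show "emeasure \<mu>1 A = emeasure \<mu>2 A"
    by (simp add: m1.emeasure_eq_measure m2.emeasure_eq_measure)
qed

section \<open>Polynomial functions\<close>

lemma poly_funs_monomial:
  assumes "(\<Sum>i\<in>UNIV. e i) \<le> d"
  shows "(\<lambda>x::real^'n::finite. \<Prod>i\<in>UNIV. x $ i ^ e i) \<in> poly_funs d"
  unfolding poly_funs_def mem_Collect_eq
proof (intro exI ext)
  fix x :: "real^'n"
  have "(\<Sum>e' | (\<Sum>i\<in>UNIV. e' i) \<le> d. (if e' = e then 1 else 0) * (\<Prod>i\<in>UNIV. x $ i ^ e' i))
    = (\<Sum>e' | (\<Sum>i\<in>UNIV. e' i) \<le> d. if e' = e then (\<Prod>i\<in>UNIV. x $ i ^ e i) else 0)"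
    by (intro sum.cong) auto
  also have "\<dots> = (\<Prod>i\<in>UNIV. x $ i ^ e i)"
    using finite_exponents[where 'n='n and d=d] assms by (simp add: sum.delta)
  finally show "(\<Prod>i\<in>UNIV. x $ i ^ e i) = (\<Sum>e' | (\<Sum>i\<in>UNIV. e' i) \<le> d. (if e' = e then 1 else 0) * (\<Prod>i\<in>UNIV. x $ i ^ e' i))" ..
qed

lemma poly_funs_add:
  assumes "P \<in> poly_funs d" "Q \<in> poly_funs d" shows "(\<lambda>x. P x + Q x) \<in> poly_funs d"
proof -
  obtain c c' where "P = (\<lambda>x. \<Sum>e | (\<Sum>i\<in>UNIV. e i) \<le> d. c e * (\<Prod>i\<in>UNIV. x $ i ^ e i))"
    "Q = (\<lambda>x. \<Sum>e | (\<Sum>i\<in>UNIV. e i) \<le> d. c' e * (\<Prod>i\<in>UNIV. x $ i ^ e i))"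
    using assms unfolding poly_funs_def by blast
  then show ?thesis unfolding poly_funs_def
    by (auto intro!: exI[of _ "\<lambda>e. c e + c' e"] simp: sum.distrib distrib_right)
qed

lemma poly_funs_cmult:
  assumes "P \<in> poly_funs d" shows "(\<lambda>x. k * P x) \<in> poly_funs d"
proof -
  obtain c where "P = (\<lambda>x. \<Sum>e | (\<Sum>i\<in>UNIV. e i) \<le> d. c e * (\<Prod>i\<in>UNIV. x $ i ^ e i))"
    using assms unfolding poly_funs_def by blast
  then show ?thesis unfolding poly_funs_def
    by (auto intro!: exI[of _ "\<lambda>e. k * c e"] simp: sum_distrib_left mult.assoc)
qed

lemma poly_funs_const: "(\<lambda>x. k) \<in> poly_funs d"
  using poly_funs_cmult[OF poly_funs_monomial[of "\<lambda>_. 0" d], of k] by simp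

lemma poly_funs_sum:
  "(\<And>i. i \<in> A \<Longrightarrow> P i \<in> poly_funs d) \<Longrightarrow> (\<lambda>x. \<Sum>i\<in>A. P i x) \<in> poly_funs d"
  by (induction A rule: infinite_finite_induct) (auto intro: poly_funs_add poly_funs_const)

lemma poly_funs_cases:
  assumes "P \<in> poly_funs d"
  obtains c where "P = (\<lambda>x. \<Sum>e | (\<Sum>i\<in>UNIV. e i) \<le> d. c e * (\<Prod>i\<in>UNIV. x $ i ^ e i))"
  using assms unfolding poly_funs_def by blast

lemma poly_funs_mult:
  assumes "P \<in> poly_funs d" "Q \<in> poly_funs d'" shows "(\<lambda>x. P x * Q x) \<in> poly_funs (d + d')"
proof -
  from poly_funs_cases[OF assms(1)] obtain c
    where c: "P = (\<lambda>x. \<Sum>e | (\<Sum>i\<in>UNIV. e i) \<le> d. c e * (\<Prod>i\<in>UNIV. x $ i ^ e i))" .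
  from poly_funs_cases[OF assms(2)] obtain c'
    where c': "Q = (\<lambda>x. \<Sum>e | (\<Sum>i\<in>UNIV. e i) \<le> d'. c' e * (\<Prod>i\<in>UNIV. x $ i ^ e i))" .
  have "(\<lambda>x. P x * Q x) = (\<lambda>x. \<Sum>e | (\<Sum>i\<in>UNIV. e i) \<le> d. \<Sum>e' | (\<Sum>i\<in>UNIV. e' i) \<le> d'.
      (c e * c' e') * (\<Prod>i\<in>UNIV. x $ i ^ (e i + e' i)))"
    unfolding c c' sum_product by (simp add: power_add prod.distrib algebra_simps)
  also have "\<dots> \<in> poly_funs (d + d')"
    by (intro poly_funs_sum poly_funs_cmult poly_funs_monomial)
      (auto simp: sum.distrib intro: add_mono)
  finally show ?thesis .
qed

lemma poly_funs_mono:
  assumes "P \<in> poly_funs d" "d \<le> d'" shows "P \<in> poly_funs d'"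
  using poly_funs_mult[OF assms(1) poly_funs_const[of 1 "d' - d"]] assms(2) by simp

lemma poly_funs_power: "P \<in> poly_funs d \<Longrightarrow> (\<lambda>x. P x ^ k) \<in> poly_funs (k * d)"
proof (induction k)
  case (Suc k)
  from poly_funs_mult[OF Suc.prems Suc.IH[OF Suc.prems]] show ?case by (simp add: add.commute)
qed (simp add: poly_funs_const)

lemma poly_funs_prod:
  "(\<And>i. i \<in> A \<Longrightarrow> P i \<in> poly_funs (d i)) \<Longrightarrow> finite A \<Longrightarrow> (\<lambda>x. \<Prod>i\<in>A. P i x) \<in> poly_funs (\<Sum>i\<in>A. d i)"
proof (induction A rule: infinite_finite_induct)
  case (insert x A)
  then show ?case using poly_funs_mult[of "P x" "d x"] by simp
qed (auto simp: poly_funs_const)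

lemma poly_funs_coord: "(\<lambda>x::real^'n::finite. x $ k) \<in> poly_funs 1"
proof -
  have "(\<Prod>i\<in>UNIV. x $ i ^ (if i = k then 1 else 0)) = x $ k" for x :: "real^'n"
  proof -
    have "(\<Prod>i\<in>UNIV. x $ i ^ (if i = k then 1 else 0)) = (\<Prod>i\<in>UNIV. if i = k then x $ i else 1)"
      by (intro prod.cong) auto
    then show ?thesis by simp
  qed
  with poly_funs_monomial[of "\<lambda>i. if i = k then 1 else 0" 1] show ?thesis by simp
qed

text \<open>
  Rank conditions refer to the law of \<open>Y n k\<close>, the covariance bound to a standard
  Gaussian vector; the two are exchanged by a linear change of variables, which preserves the
  degree.
\<close>

lemma poly_funs_linear_subst:
  fixes A :: "real^'n^'n::finite"
  assumes "P \<in> poly_funs d"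
  shows "(\<lambda>x. P (A *v x)) \<in> poly_funs d"
proof -
  from poly_funs_cases[OF assms] obtain c
    where c: "P = (\<lambda>x. \<Sum>e | (\<Sum>i\<in>UNIV. e i) \<le> d. c e * (\<Prod>i\<in>UNIV. x $ i ^ e i))" .
  have co: "(\<lambda>x. (A *v x) $ i) \<in> poly_funs 1" for i
    unfolding matrix_vector_mult_def by (simp del: One_nat_def) (intro poly_funs_sum poly_funs_cmult poly_funs_coord)
  show ?thesis unfolding c
  proof (intro poly_funs_sum poly_funs_cmult)
    fix e :: "'n \<Rightarrow> nat" assume "e \<in> {e. (\<Sum>i\<in>UNIV. e i) \<le> d}"
    moreover have "(\<lambda>x. \<Prod>i\<in>UNIV. (A *v x) $ i ^ e i) \<in> poly_funs (\<Sum>i\<in>UNIV. e i * 1)"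
      by (intro poly_funs_prod poly_funs_power co) auto
    ultimately show "(\<lambda>x. \<Prod>i\<in>UNIV. (A *v x) $ i ^ e i) \<in> poly_funs d"
      by (auto intro: poly_funs_mono)
  qed
qed

lemma poly_funs_poly: "(\<lambda>x::real^'n::finite. poly p (x $ k)) \<in> poly_funs (degree p)"
  unfolding poly_altdef
proof (intro poly_funs_sum poly_funs_cmult)
  fix i assume "i \<in> {..degree p}"
  then show "(\<lambda>x::real^'n. (x $ k) ^ i) \<in> poly_funs (degree p)"
    using poly_funs_mono[OF poly_funs_power[OF poly_funs_coord[of k], of i]] by auto
qed

section \<open>The standard Gaussian measure\<close>

lemma sets_std_gaussian [measurable_cong, simp]: "sets std_gaussian = sets borel"
  by (simp add: std_gaussian_def)

lemma space_std_gaussian [simp]: "space std_gaussian = UNIV"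
  by (simp add: std_gaussian_def)

text \<open>
  Fubini for product functions. Lebesgue measure on a Euclidean space is a product measure over
  the basis vectors; \<open>k\<close> in the proof translates basis vectors into coordinates.
\<close>

lemma lborel_vec_prod:
  fixes g :: "'n::finite \<Rightarrow> real \<Rightarrow> 'b::{real_normed_field, banach, second_countable_topology}"
  assumes int: "\<And>i. integrable lborel (g i)"
  shows "integrable lborel (\<lambda>x::real^'n. \<Prod>i\<in>UNIV. g i (x $ i))" (is ?I)
    and "(\<integral>x. (\<Prod>i\<in>UNIV. g i ((x::real^'n) $ i)) \<partial>lborel) = (\<Prod>i\<in>UNIV. (\<integral>x. g i x \<partial>lborel))" (is ?E)
proof -
  interpret product_sigma_finite "\<lambda>b::real^'n. lborel :: real measure"
    by (simp add: product_sigma_finite_def sigma_finite_lborel)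
  have [measurable]: "g i \<in> borel_measurable borel" for i
    using int[of i] by (auto dest: borel_measurable_integrable)
  define k where "k b = (THE i::'n. b = axis i (1::real))" for b
  have B: "Basis = range (\<lambda>i::'n. axis i (1::real))" by (auto simp: Basis_vec_def)
  have inj: "inj (\<lambda>i::'n. axis i (1::real))" by (auto simp: inj_def axis_eq_axis)
  have k: "k (axis i 1) = i" for i by (auto simp: k_def axis_eq_axis)
  have eq: "(\<Prod>i\<in>UNIV. g i ((\<Sum>b\<in>Basis. f b *\<^sub>R b) $ i)) = (\<Prod>b\<in>Basis. g (k b) (f b))" for f :: "real^'n \<Rightarrow> real"
  proof -
    have "(\<Sum>b\<in>Basis. f b *\<^sub>R b) $ i = f (axis i 1)" for i
    proof -
      have "(\<Sum>b\<in>Basis. f b *\<^sub>R b) $ i = (\<Sum>b\<in>Basis. f b *\<^sub>R b) \<bullet> axis i 1" by (simp add: inner_axis)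
      also have "\<dots> = f (axis i 1)"
        by (rule inner_sum_left_Basis) (auto simp: B)
      finally show ?thesis .
    qed
    then show ?thesis unfolding B by (subst prod.reindex[OF inj]) (simp add: k)
  qed
  have int': "integrable (\<Pi>\<^sub>M b\<in>Basis. lborel) (\<lambda>f. \<Prod>b\<in>Basis. g (k b) (f b))"
    by (rule product_integrable_prod) (auto intro: int)
  show ?I
  proof (subst lborel_eq, subst integrable_distr_eq)
    show "integrable (\<Pi>\<^sub>M b\<in>Basis. lborel) (\<lambda>f. \<Prod>i\<in>UNIV. g i ((\<Sum>b\<in>Basis. f b *\<^sub>R b) $ i))"
      unfolding eq by (rule int')
  qed simp_all
  show ?E
  proof (subst lborel_eq, subst integral_distr)
    show "(\<integral>f. (\<Prod>i\<in>UNIV. g i ((\<Sum>b\<in>Basis. f b *\<^sub>R b) $ i)) \<partial>(\<Pi>\<^sub>M b\<in>Basis. lborel)) = (\<Prod>i\<in>UNIV. (\<integral>x. g i x \<partial>lborel))"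
      unfolding eq by (subst product_integral_prod) (simp_all add: int B prod.reindex[OF inj] k)
  qed simp_all
qed

lemma std_gaussian_prod:
  fixes g :: "'n::finite \<Rightarrow> real \<Rightarrow> 'b::{real_normed_field, banach, second_countable_topology}"
  assumes [measurable]: "\<And>i. g i \<in> borel_measurable borel"
    and int: "\<And>i. integrable lborel (\<lambda>x. std_normal_density x *\<^sub>R g i x)"
  shows "integrable std_gaussian (\<lambda>x::real^'n. \<Prod>i\<in>UNIV. g i (x $ i))" (is ?I)
    and "(\<integral>x. (\<Prod>i\<in>UNIV. g i ((x::real^'n) $ i)) \<partial>std_gaussian)
      = (\<Prod>i\<in>UNIV. (\<integral>x. std_normal_density x *\<^sub>R g i x \<partial>lborel))" (is ?E)
proof -
  have eq: "(\<Prod>i\<in>UNIV. std_normal_density (x $ i)) *\<^sub>R (\<Prod>i\<in>UNIV. g i (x $ i))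
      = (\<Prod>i\<in>UNIV. std_normal_density (x $ i) *\<^sub>R g i (x $ i))" for x :: "real^'n"
    by (simp add: scaleR_conv_of_real prod.distrib)
  show ?I unfolding std_gaussian_def
    by (subst integrable_density) (auto simp: eq prod_nonneg intro!: lborel_vec_prod(1) int)
  show ?E unfolding std_gaussian_def
    by (subst integral_density) (auto simp: eq prod_nonneg intro!: lborel_vec_prod(2) int)
qed

lemma prob_space_std_gaussian: "prob_space (std_gaussian :: (real^'n::finite) measure)"
proof
  have "emeasure (std_gaussian :: (real^'n) measure) UNIV
      = (\<integral>\<^sup>+x. ennreal (\<Prod>i\<in>UNIV. std_normal_density ((x::real^'n) $ i)) \<partial>lborel)"
    unfolding std_gaussian_def by (subst emeasure_density) auto
  also have "\<dots> = ennreal (\<integral>x. (\<Prod>i\<in>UNIV. std_normal_density ((x::real^'n) $ i)) \<partial>lborel)"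
    by (rule nn_integral_eq_integral) (auto intro!: lborel_vec_prod(1) prod_nonneg)
  also have "\<dots> = 1" by (subst lborel_vec_prod(2)) auto
  finally show "emeasure (std_gaussian :: (real^'n) measure) (space std_gaussian) = 1" by simp
qed

interpretation sg: prob_space "std_gaussian :: (real^'n::finite) measure"
  by (rule prob_space_std_gaussian)

interpretation sg: borel_finite "std_gaussian :: (real^'n::finite) measure"
  by unfold_locales simp

lemma integrable_poly_normal: "integrable lborel (\<lambda>x. std_normal_density x * poly p x)"
  unfolding poly_altdef sum_distrib_left
proof (rule Bochner_Integration.integrable_sum)
  fix i
  have "integrable lborel (\<lambda>x. coeff p i * (std_normal_density x * x ^ i))"
    by (intro Bochner_Integration.integrable_mult_right integrable_std_normal_moment)
  then show "integrable lborel (\<lambda>x. std_normal_density x * (coeff p i * x ^ i))"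
    by (simp add: mult.left_commute)
qed

lemma sqi_poly_funs:
  assumes "P \<in> poly_funs d"
  shows "sqi (std_gaussian :: (real^'n::finite) measure) P"
proof -
  from poly_funs_cases[OF assms] obtain c
    where c: "P = (\<lambda>x. \<Sum>e | (\<Sum>i\<in>UNIV. e i) \<le> d. c e * (\<Prod>i\<in>UNIV. x $ i ^ e i))" .
  show ?thesis unfolding c
  proof (intro sqi_sum sqi_cmult)
    fix e :: "'n \<Rightarrow> nat"
    have "integrable std_gaussian (\<lambda>x::real^'n. \<Prod>i\<in>UNIV. (x $ i ^ e i)\<^sup>2)"
      by (rule std_gaussian_prod) (auto simp: power_mult[symmetric] integrable_std_normal_moment)
    then show "sqi (std_gaussian :: (real^'n) measure) (\<lambda>x. \<Prod>i\<in>UNIV. x $ i ^ e i)"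
      by (auto simp: sqi_def prod_power_distrib)
  qed
qed

section \<open>Hermite polynomials\<close>

text \<open>
  The probabilists' Hermite polynomials. The recursion is the one that integration by parts
  against the normal density produces.
\<close>

fun He :: "nat \<Rightarrow> real poly" where
  "He 0 = 1"
| "He (Suc n) = [:0, 1:] * He n - pderiv (He n)"

lemma degree_He: "degree (He n) \<le> n"
proof (induction n)
  case (Suc n)
  have "degree ([:0, 1:] * He n) \<le> Suc n"
    using Suc degree_mult_le[of "[:0, 1:]" "He n"] by simp
  moreover have "degree (pderiv (He n)) \<le> Suc n" using Suc by (simp add: degree_pderiv)
  ultimately show ?case by (simp add: degree_diff_le)
qed simp

lemma integrable_cis_poly_normal:
  "integrable lborel (\<lambda>x. std_normal_density x *\<^sub>R (cis (u * x) * of_real (poly p x)))"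
proof (rule Bochner_Integration.integrable_bound[OF integrable_poly_normal[of p]])
  have [measurable]: "poly p \<in> borel_measurable borel"
    by (intro borel_measurable_continuous_onI continuous_intros)
  have [measurable]: "(\<lambda>x. cis (u * x)) \<in> borel_measurable borel"
    by (intro borel_measurable_continuous_onI continuous_intros)
  show "(\<lambda>x. std_normal_density x *\<^sub>R (cis (u * x) * of_real (poly p x))) \<in> borel_measurable lborel"
    by measurable
qed (auto simp: norm_mult abs_mult)

lemma tendsto_normal_poly: "((\<lambda>x. std_normal_density x * poly p x) \<longlongrightarrow> 0) at_infinity"
proof -
  have 1: "((\<lambda>x::real. \<bar>x\<bar> ^ k / exp \<bar>x\<bar>) \<longlongrightarrow> 0) at_infinity" for k
    using filterlim_compose[OF tendsto_power_div_exp_0[of k] filterlim_norm_at_top[where 'a=real]] by simp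
  have 2: "((\<lambda>x. std_normal_density x * x ^ k) \<longlongrightarrow> 0) at_infinity" for k
  proof (rule Lim_null_comparison)
    show "((\<lambda>x::real. exp (1/2) * (\<bar>x\<bar> ^ k / exp \<bar>x\<bar>)) \<longlongrightarrow> 0) at_infinity"
      by (rule tendsto_mult_right_zero[OF 1])
    show "\<forall>\<^sub>F x in at_infinity. norm (std_normal_density x * x ^ k) \<le> exp (1/2) * (\<bar>x\<bar> ^ k / exp \<bar>x\<bar>)"
    proof (rule always_eventually, rule allI)
      fix x :: real
      have "0 \<le> (\<bar>x\<bar> - 1)\<^sup>2" by simp
      then have "- x\<^sup>2 / 2 \<le> 1 / 2 - \<bar>x\<bar>" by (simp add: power2_diff)
      then have "exp (- x\<^sup>2 / 2) \<le> exp (1/2) / exp \<bar>x\<bar>" by (simp add: exp_diff[symmetric])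
      moreover have "1 / sqrt (2 * pi) \<le> 1" using pi_gt3 by (simp add: real_le_rsqrt)
      ultimately have "std_normal_density x \<le> exp (1/2) / exp \<bar>x\<bar>"
        unfolding std_normal_density_def
        by (smt (verit, best) exp_ge_zero mult_left_le_one_le divide_nonneg_nonneg real_sqrt_ge_zero pi_gt_zero)
      then have "std_normal_density x * \<bar>x\<bar> ^ k \<le> exp (1/2) / exp \<bar>x\<bar> * \<bar>x\<bar> ^ k"
        by (rule mult_right_mono) simp
      then show "norm (std_normal_density x * x ^ k) \<le> exp (1/2) * (\<bar>x\<bar> ^ k / exp \<bar>x\<bar>)"
        by (simp add: abs_mult power_abs)
    qed
  qed
  have "((\<lambda>x. \<Sum>i\<le>degree p. coeff p i * (std_normal_density x * x ^ i)) \<longlongrightarrow> 0) at_infinity"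
    by (rule tendsto_null_sum) (rule tendsto_mult_right_zero[OF 2])
  then show ?thesis by (simp add: poly_altdef sum_distrib_left mult.left_commute)
qed

lemma std_normal_density_deriv:
  "(std_normal_density has_real_derivative (- x * std_normal_density x)) (at x)"
  unfolding std_normal_density_def[abs_def] by (auto intro!: derivative_eq_intros simp: field_simps)

text \<open>
  The derivative of the product of density, \<open>cis (u * x)\<close> and \<open>p x\<close>
  integrates to zero.
\<close>

lemma normal_by_parts:
  "(\<integral>x. std_normal_density x *\<^sub>R (cis (u * x) * of_real (poly ([:0, 1:] * p - pderiv p) x)) \<partial>lborel)
    = \<i> * of_real u * (\<integral>x. std_normal_density x *\<^sub>R (cis (u * x) * of_real (poly p x)) \<partial>lborel)"
proof -
  define F where "F x = std_normal_density x *\<^sub>R (cis (u * x) * of_real (poly p x))" for x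
  define G where "G x = std_normal_density x *\<^sub>R (cis (u * x) * of_real (poly ([:0, 1:] * p - pderiv p) x))" for x
  define f where "f x = \<i> * of_real u * F x - G x" for x
  have iF: "integrable lborel F" and iG: "integrable lborel G"
    unfolding F_def G_def by (rule integrable_cis_poly_normal)+
  have cis_d: "((\<lambda>x. cis (u * x)) has_vector_derivative \<i> * of_real u * cis (u * x)) (at x)" for x
  proof -
    have "((\<lambda>z. exp (\<i> * of_real u * z)) has_field_derivative \<i> * of_real u * exp (\<i> * of_real u * of_real x)) (at (of_real x))"
      by (auto intro!: derivative_eq_intros)
    from has_vector_derivative_real_field[OF this] show ?thesis by (simp add: cis_conv_exp mult.assoc)
  qed
  have d: "(F has_vector_derivative f x) (at x)" for x
  proof -
    have p: "((\<lambda>x. complex_of_real (poly p x)) has_vector_derivative of_real (poly (pderiv p) x)) (at x)"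
      using poly_DERIV[of p x] by (intro has_vector_derivative_of_real)
       (simp add: has_real_derivative_iff_has_vector_derivative)
    have n: "(std_normal_density has_vector_derivative - x * std_normal_density x) (at x)"
      using std_normal_density_deriv[of x] by (simp add: has_real_derivative_iff_has_vector_derivative)
    show ?thesis unfolding F_def
      by (rule has_vector_derivative_eq_rhs[OF has_vector_derivative_scaleR[OF _ has_vector_derivative_mult[OF cis_d p]]])
        (use std_normal_density_deriv[of x] in \<open>auto simp: f_def F_def G_def scaleR_conv_of_real algebra_simps\<close>)
  qed
  have c: "isCont f x" for x
  proof -
    have "isCont (\<lambda>x. cis (u * x)) x" using cis_d[of x] by (rule has_vector_derivative_continuous)
    moreover have "isCont std_normal_density x" using std_normal_density_deriv[of x] by (rule DERIV_isCont)
    ultimately show ?thesis unfolding f_def F_def G_def by (intro continuous_intros)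
  qed
  have lim: "(F \<longlongrightarrow> 0) at_infinity"
    by (rule tendsto_norm_zero_cancel)
      (use tendsto_rabs_zero[OF tendsto_normal_poly[of p]] in \<open>simp add: F_def norm_mult abs_mult\<close>)
  have "(LBINT x=-\<infinity>..\<infinity>. f x) = 0 - 0"
  proof (rule interval_integral_FTC_integrable)
    show "set_integrable lborel (einterval (-\<infinity>) \<infinity>) f"
      unfolding f_def set_integrable_def using iF iG by simp
    show "((F \<circ> real_of_ereal) \<longlongrightarrow> 0) (at_right (- \<infinity>))" "((F \<circ> real_of_ereal) \<longlongrightarrow> 0) (at_left \<infinity>)"
      using tendsto_mono[OF at_bot_le_at_infinity lim] tendsto_mono[OF at_top_le_at_infinity lim]
      by (simp_all add: ereal_tendsto_simps)
  qed (use d c in auto)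
  then have "(\<integral>x. f x \<partial>lborel) = 0"
    by (simp add: interval_lebesgue_integral_def set_lebesgue_integral_def)
  then have "\<i> * of_real u * (\<integral>x. F x \<partial>lborel) = (\<integral>x. G x \<partial>lborel)"
    using iF iG by (simp add: f_def)
  then show ?thesis by (simp add: F_def G_def)
qed

lemma integral_cis_std_normal:
  "(\<integral>x. std_normal_density x *\<^sub>R cis (u * x) \<partial>lborel) = of_real (exp (- u\<^sup>2 / 2))"
proof -
  have "(\<integral>x. std_normal_density x *\<^sub>R cis (u * x) \<partial>lborel) = char std_normal_distribution u"
    unfolding char_def by (subst integral_density) (auto simp: cis_conv_exp)
  then show ?thesis by (simp add: char_std_normal_distribution)
qed

lemma integral_cis_He:
  "(\<integral>x. std_normal_density x *\<^sub>R (cis (u * x) * of_real (poly (He n) x)) \<partial>lborel)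
    = (\<i> * of_real u) ^ n * of_real (exp (- u\<^sup>2 / 2))"
proof (induction n)
  case 0
  then show ?case using integral_cis_std_normal[of u] by simp
next
  case (Suc n)
  show ?case unfolding He.simps normal_by_parts Suc by simp
qed

text \<open>
  Multivariate Hermite polynomials, indexed by tuples of coordinates \<open>I 0, \<dots>, I (q -
  1)\<close> instead of multi-indices: \<open>k\<close> has multiplicity \<open>card {t. I t =
  k}\<close>. With this redundant indexing the powers of a bilinear form expand without
  multinomial coefficients.
\<close>

definition hermite :: "nat \<Rightarrow> (nat \<Rightarrow> 'n) \<Rightarrow> real^'n::finite \<Rightarrow> real" where
  "hermite q I x = (\<Prod>k\<in>UNIV. poly (He (card {t\<in>{..<q}. I t = k})) (x $ k))"

lemma hermite_poly_funs: "hermite q (I :: nat \<Rightarrow> 'n::finite) \<in> poly_funs q"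
proof -
  have "(\<lambda>x::real^'n. \<Prod>k\<in>UNIV. poly (He (card {t\<in>{..<q}. I t = k})) (x $ k))
      \<in> poly_funs (\<Sum>k\<in>UNIV. card {t\<in>{..<q}. I t = k})"
    by (intro poly_funs_prod poly_funs_mono[OF poly_funs_poly] degree_He) auto
  also have "(\<Sum>k\<in>UNIV. card {t\<in>{..<q}. I t = k}) = q"
    using sum.group[of "{..<q}" "UNIV :: 'n set" I "\<lambda>_. 1::nat"] by simp
  finally show ?thesis unfolding hermite_def[abs_def] .
qed

text \<open>
  Each coordinate contributes \<open>(\<i> u\<^sub>k)^n exp (- u\<^sub>k\<^sup>2 / 2)\<close>;
  the power \<open>\<i>^q\<close> turns into a phase shift by \<open>q\<close> quarter turns.
\<close>

lemma integral_cos_hermite: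
  fixes u :: "real^'n::finite" and I :: "nat \<Rightarrow> 'n"
  shows "(\<integral>x. cos (u \<bullet> x + \<theta>) * hermite q I x \<partial>std_gaussian)
    = exp (- (norm u)\<^sup>2 / 2) * cos (\<theta> + real q * pi / 2) * (\<Prod>t<q. u $ I t)"
proof -
  define n where "n k = card {t\<in>{..<q}. I t = k}" for k
  define g where "g k y = cis (u $ k * y) * of_real (poly (He (n k)) y)" for k y
  have sumn: "(\<Sum>k\<in>UNIV. n k) = q"
    using sum.group[of "{..<q}" "UNIV :: 'n set" I "\<lambda>_. 1::nat"] by (simp add: n_def)
  have [measurable]: "g k \<in> borel_measurable borel" for k
    unfolding g_def by (intro borel_measurable_continuous_onI continuous_intros)
  have int: "integrable lborel (\<lambda>y. std_normal_density y *\<^sub>R g k y)" for k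
    unfolding g_def by (rule integrable_cis_poly_normal)
  have cis_sum: "(\<Prod>k\<in>A. cis (f k)) = cis (\<Sum>k\<in>A. f k)" for A :: "'n set" and f
    by (induction A rule: infinite_finite_induct) (auto simp: cis_mult)
  have "cos (u \<bullet> x + \<theta>) * hermite q I x = Re (cis \<theta> * (\<Prod>k\<in>UNIV. g k (x $ k)))" for x
  proof -
    have "(\<Prod>k\<in>UNIV. g k (x $ k)) = cis (u \<bullet> x) * of_real (hermite q I x)"
      unfolding g_def prod.distrib cis_sum by (simp add: hermite_def n_def inner_vec_def)
    then have "cis \<theta> * (\<Prod>k\<in>UNIV. g k (x $ k)) = cis (u \<bullet> x + \<theta>) * of_real (hermite q I x)"
      by (simp add: mult.assoc[symmetric] cis_mult add.commute)
    then show ?thesis by simp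
  qed
  then have "(\<integral>x. cos (u \<bullet> x + \<theta>) * hermite q I x \<partial>std_gaussian)
      = (\<integral>x. Re (cis \<theta> * (\<Prod>k\<in>UNIV. g k (x $ k))) \<partial>std_gaussian)" by simp
  also have "\<dots> = Re (\<integral>x. cis \<theta> * (\<Prod>k\<in>UNIV. g k (x $ k)) \<partial>std_gaussian)"
    by (rule integral_Re) (intro integrable_mult_right std_gaussian_prod(1) int; measurable)
  also have "(\<integral>x. cis \<theta> * (\<Prod>k\<in>UNIV. g k (x $ k)) \<partial>std_gaussian)
      = cis \<theta> * (\<Prod>k\<in>UNIV. (\<i> * of_real (u $ k)) ^ n k * of_real (exp (- (u $ k)\<^sup>2 / 2)))"
  proof -
    have "(\<integral>x. (\<Prod>k\<in>UNIV. g k (x $ k)) \<partial>std_gaussian) = (\<Prod>k\<in>UNIV. (\<integral>y. std_normal_density y *\<^sub>R g k y \<partial>lborel))"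
      by (rule std_gaussian_prod(2)[OF _ int]) measurable
    then show ?thesis by (simp add: g_def integral_cis_He)
  qed
  also have "(\<Prod>k\<in>UNIV. (\<i> * of_real (u $ k)) ^ n k * of_real (exp (- (u $ k)\<^sup>2 / 2)))
      = \<i> ^ q * of_real ((\<Prod>k\<in>UNIV. (u $ k) ^ n k) * exp (- (norm u)\<^sup>2 / 2))"
  proof -
    have "(\<Prod>k\<in>UNIV. \<i> ^ n k) = \<i> ^ q" by (simp add: power_sum[symmetric] sumn)
    moreover have "(\<Prod>k\<in>UNIV. exp (- (u $ k)\<^sup>2 / 2)) = exp (- (norm u)\<^sup>2 / 2)"
      by (simp add: exp_sum[symmetric] norm_vec_def L2_set_def sum_nonneg sum_negf sum_divide_distrib)
    moreover have "(\<Prod>k\<in>UNIV. (\<i> * of_real (u $ k)) ^ n k * of_real (exp (- (u $ k)\<^sup>2 / 2)))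
      = (\<Prod>k\<in>UNIV. \<i> ^ n k) * of_real ((\<Prod>k\<in>UNIV. (u $ k) ^ n k) * (\<Prod>k\<in>UNIV. exp (- (u $ k)\<^sup>2 / 2)))"
      unfolding power_mult_distrib prod.distrib of_real_mult of_real_prod of_real_power by simp
    ultimately show ?thesis by simp
  qed
  also have "(\<Prod>k\<in>UNIV. (u $ k) ^ n k) = (\<Prod>t<q. u $ I t)"
  proof -
    have "(\<Prod>k\<in>UNIV. (u $ k) ^ n k) = (\<Prod>k\<in>UNIV. \<Prod>t\<in>{t\<in>{..<q}. I t = k}. u $ I t)"
      by (intro prod.cong refl) (simp add: n_def)
    also have "\<dots> = (\<Prod>t<q. u $ I t)" by (rule prod.group) auto
    finally show ?thesis .
  qed
  also have "cis \<theta> * (\<i> ^ q * of_real ((\<Prod>t<q. u $ I t) * exp (- (norm u)\<^sup>2 / 2)))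
      = of_real ((\<Prod>t<q. u $ I t) * exp (- (norm u)\<^sup>2 / 2)) * cis (\<theta> + real q * pi / 2)"
  proof -
    have "\<i> ^ q = cis (real q * (pi / 2))" using Complex.DeMoivre[of "pi / 2" q] by simp
    then have "cis \<theta> * \<i> ^ q = cis (\<theta> + real q * pi / 2)" by (simp add: cis_mult)
    then show ?thesis by (simp only: mult.assoc[symmetric]) (simp only: mult.commute)
  qed
  also have "Re (of_real ((\<Prod>t<q. u $ I t) * exp (- (norm u)\<^sup>2 / 2)) * cis (\<theta> + real q * pi / 2))
      = (\<Prod>t<q. u $ I t) * exp (- (norm u)\<^sup>2 / 2) * cos (\<theta> + real q * pi / 2)"
  proof -
    have "Re (of_real r * cis t) = r * cos t" for r t by simp
    then show ?thesis .
  qed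
  finally show ?thesis by (simp only: mult_ac)
qed

section \<open>Pairs of standard Gaussian vectors\<close>

text \<open>
  Joint normality of two standard Gaussian vectors with cross covariance matrix
  \<open>R\<close>, expressed by the integrals of cosines. This is all that the covariance
  estimates use, and it avoids treating \<open>(Z, Z')\<close> as a vector of double dimension.
  The phase \<open>\<theta>\<close> makes it equivalent to a statement on the joint
  characteristic function.
\<close>

definition std_pair :: "'a measure \<Rightarrow> ('a \<Rightarrow> real^'n::finite) \<Rightarrow> ('a \<Rightarrow> real^'n) \<Rightarrow> real^'n^'n \<Rightarrow> bool" where
  "std_pair M Z Z' R \<longleftrightarrow> Z \<in> borel_measurable M \<and> Z' \<in> borel_measurable M \<and>
    (\<forall>u v \<theta>. (\<integral>\<omega>. cos (u \<bullet> Z \<omega> + v \<bullet> Z' \<omega> + \<theta>) \<partial>M)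
      = exp (- ((norm u)\<^sup>2 + (norm v)\<^sup>2) / 2 - u \<bullet> (R *v v)) * cos \<theta>)"

lemma integral_cos_std_gaussian:
  "(\<integral>x. cos (u \<bullet> x + \<theta>) \<partial>std_gaussian) = exp (- (norm u)\<^sup>2 / 2) * cos \<theta>"
  using integral_cos_hermite[of u \<theta> 0 undefined] by (simp add: hermite_def)

lemma std_gaussian_law:
  assumes "prob_space M" "Z \<in> borel_measurable M"
    and "\<And>u \<theta>. (\<integral>\<omega>. cos (u \<bullet> Z \<omega> + \<theta>) \<partial>M) = exp (- (norm u)\<^sup>2 / 2) * cos \<theta>"
  shows "distr M borel Z = std_gaussian"
proof (rule prob_measure_eqI_cos)
  show "prob_space (distr M borel Z)" using assms by (intro prob_space.prob_space_distr)
  show "(\<integral>x. cos (u \<bullet> x + \<theta>) \<partial>distr M borel Z) = (\<integral>x. cos (u \<bullet> x + \<theta>) \<partial>std_gaussian)" for u \<theta>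
    using assms by (subst integral_distr) (auto simp: integral_cos_std_gaussian)
qed (auto simp: prob_space_std_gaussian)

lemma std_pair_law:
  assumes "prob_space M" "std_pair M Z Z' R"
  shows "distr M borel Z = std_gaussian" "distr M borel Z' = std_gaussian"
proof -
  have *: "(\<integral>\<omega>. cos (u \<bullet> Z \<omega> + v \<bullet> Z' \<omega> + \<theta>) \<partial>M)
      = exp (- ((norm u)\<^sup>2 + (norm v)\<^sup>2) / 2 - u \<bullet> (R *v v)) * cos \<theta>" for u v \<theta>
    using assms(2) by (auto simp: std_pair_def)
  have m: "Z \<in> borel_measurable M" "Z' \<in> borel_measurable M"
    using assms(2) by (auto simp: std_pair_def)
  show "distr M borel Z = std_gaussian"
    using *[of _ 0] by (intro std_gaussian_law assms m) simp
  show "distr M borel Z' = std_gaussian"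
    using *[of 0] by (intro std_gaussian_law assms m) simp
qed

lemma std_pair_self:
  assumes "distr M borel Z = std_gaussian" and m: "Z \<in> borel_measurable M"
  shows "std_pair M Z Z (mat 1)"
  unfolding std_pair_def
proof (intro conjI allI m)
  fix u v \<theta>
  have "(\<integral>\<omega>. cos (u \<bullet> Z \<omega> + v \<bullet> Z \<omega> + \<theta>) \<partial>M) = (\<integral>x. cos ((u + v) \<bullet> x + \<theta>) \<partial>distr M borel Z)"
    using m by (subst integral_distr) (auto simp: inner_add_left)
  also have "\<dots> = exp (- (norm (u + v))\<^sup>2 / 2) * cos \<theta>"
    by (simp add: assms integral_cos_std_gaussian)
  also have "- (norm (u + v))\<^sup>2 / 2 = - ((norm u)\<^sup>2 + (norm v)\<^sup>2) / 2 - u \<bullet> (mat 1 *v v)"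
    by (simp add: power2_norm_eq_inner inner_add_left inner_add_right inner_commute field_simps)
  finally show "(\<integral>\<omega>. cos (u \<bullet> Z \<omega> + v \<bullet> Z \<omega> + \<theta>) \<partial>M)
      = exp (- ((norm u)\<^sup>2 + (norm v)\<^sup>2) / 2 - u \<bullet> (mat 1 *v v)) * cos \<theta>" .
qed

lemma law_transfer:
  assumes law: "distr M borel Z = \<mu>" and m: "Z \<in> borel_measurable M" and f: "f \<in> borel_measurable borel"
  shows "(\<integral>\<omega>. f (Z \<omega>) \<partial>M) = (\<integral>x. (f x :: real) \<partial>\<mu>)"
    and "nrm M (\<lambda>\<omega>. f (Z \<omega>)) = nrm \<mu> f"
    and "sqi M (\<lambda>\<omega>. f (Z \<omega>)) \<longleftrightarrow> sqi \<mu> f"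
proof -
  have m2: "(\<lambda>x. (f x)\<^sup>2) \<in> borel_measurable borel" using f by simp
  show "(\<integral>\<omega>. f (Z \<omega>) \<partial>M) = (\<integral>x. f x \<partial>\<mu>)"
    unfolding law[symmetric] using m f by (subst integral_distr) auto
  show "nrm M (\<lambda>\<omega>. f (Z \<omega>)) = nrm \<mu> f"
    unfolding nrm_def law[symmetric] by (subst integral_distr[OF m m2]) simp
  have "f \<in> borel_measurable \<mu>" unfolding law[symmetric] using f by simp
  moreover have "(\<lambda>\<omega>. f (Z \<omega>)) \<in> borel_measurable M" using m f by simp
  ultimately show "sqi M (\<lambda>\<omega>. f (Z \<omega>)) \<longleftrightarrow> sqi \<mu> f"
    unfolding sqi_def unfolding law[symmetric] by (subst integrable_distr_eq[OF m m2]) simp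
qed

lemma sqi_std_gaussianD: "sqi std_gaussian f \<Longrightarrow> f \<in> borel_measurable borel"
  by (auto simp: sqi_def)

lemma std_pair_cos_cos:
  assumes M: "prob_space M" and p: "std_pair M Z Z' R"
  shows "(\<integral>\<omega>. cos (u \<bullet> Z \<omega> + \<theta>) * cos (v \<bullet> Z' \<omega> + \<eta>) \<partial>M)
    = exp (- ((norm u)\<^sup>2 + (norm v)\<^sup>2) / 2)
      * ((exp (u \<bullet> (R *v v)) * cos (\<theta> - \<eta>) + exp (- (u \<bullet> (R *v v))) * cos (\<theta> + \<eta>)) / 2)"
proof -
  interpret prob_space M by (rule M)
  have [measurable]: "Z \<in> borel_measurable M" "Z' \<in> borel_measurable M"
    using p by (auto simp: std_pair_def)
  have E: "(\<integral>\<omega>. cos (u \<bullet> Z \<omega> + v \<bullet> Z' \<omega> + \<theta>) \<partial>M)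
      = exp (- ((norm u)\<^sup>2 + (norm v)\<^sup>2) / 2 - u \<bullet> (R *v v)) * cos \<theta>" for v \<theta>
    using p by (auto simp: std_pair_def)
  have neg: "u \<bullet> (R *v (- v)) = - (u \<bullet> (R *v v))"
    using matrix_vector_mult_diff_distrib[of R 0 v] by simp
  have int: "integrable M (\<lambda>\<omega>. cos (u \<bullet> Z \<omega> + v \<bullet> Z' \<omega> + \<theta>))" for v \<theta>
    by (rule integrable_const_bound[of _ 1]) auto
  have "cos (u \<bullet> Z \<omega> + \<theta>) * cos (v \<bullet> Z' \<omega> + \<eta>)
      = cos (u \<bullet> Z \<omega> + (- v) \<bullet> Z' \<omega> + (\<theta> - \<eta>)) / 2 + cos (u \<bullet> Z \<omega> + v \<bullet> Z' \<omega> + (\<theta> + \<eta>)) / 2" for \<omega>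
  proof -
    have "u \<bullet> Z \<omega> + (- v) \<bullet> Z' \<omega> + (\<theta> - \<eta>) = (u \<bullet> Z \<omega> + \<theta>) - (v \<bullet> Z' \<omega> + \<eta>)"
      "u \<bullet> Z \<omega> + v \<bullet> Z' \<omega> + (\<theta> + \<eta>) = (u \<bullet> Z \<omega> + \<theta>) + (v \<bullet> Z' \<omega> + \<eta>)" by simp_all
    then show ?thesis by (simp only: cos_times_cos add_divide_distrib)
  qed
  then have "(\<integral>\<omega>. cos (u \<bullet> Z \<omega> + \<theta>) * cos (v \<bullet> Z' \<omega> + \<eta>) \<partial>M)
      = (\<integral>\<omega>. cos (u \<bullet> Z \<omega> + (- v) \<bullet> Z' \<omega> + (\<theta> - \<eta>)) / 2 + cos (u \<bullet> Z \<omega> + v \<bullet> Z' \<omega> + (\<theta> + \<eta>)) / 2 \<partial>M)"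
    by simp
  also have "\<dots> = exp (- ((norm u)\<^sup>2 + (norm v)\<^sup>2) / 2 + u \<bullet> (R *v v)) * cos (\<theta> - \<eta>) / 2
      + exp (- ((norm u)\<^sup>2 + (norm v)\<^sup>2) / 2 - u \<bullet> (R *v v)) * cos (\<theta> + \<eta>) / 2"
    using int[of "- v"] int[of v]
    by (subst Bochner_Integration.integral_add) (simp_all del: minus_add_distrib inner_minus_left
        add: E neg)
  also have "\<dots> = exp (- ((norm u)\<^sup>2 + (norm v)\<^sup>2) / 2)
      * ((exp (u \<bullet> (R *v v)) * cos (\<theta> - \<eta>) + exp (- (u \<bullet> (R *v v))) * cos (\<theta> + \<eta>)) / 2)"
  proof -
    have "exp (x + s) * a / 2 + exp (x - s) * b / 2 = exp x * ((exp s * a + exp (- s) * b) / 2)" for x s a b :: real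
      by (simp add: exp_add exp_diff exp_minus field_simps)
    then show ?thesis .
  qed
  finally show ?thesis .
qed

section \<open>Hermite coefficients\<close>

definition hermite_coeff :: "nat \<Rightarrow> (nat \<Rightarrow> 'n) \<Rightarrow> (real^'n::finite \<Rightarrow> real) \<Rightarrow> real" where
  "hermite_coeff q I f = (\<integral>x. f x * hermite q I x \<partial>std_gaussian)"

text \<open>
  Extensional functions, so that there are \<open>CARD('n) ^ q\<close> tuples of length
  \<open>q\<close>.
\<close>

abbreviation idx_tuples :: "nat \<Rightarrow> (nat \<Rightarrow> 'n::finite) set" where
  "idx_tuples q \<equiv> PiE {..<q} (\<lambda>_. UNIV)"

lemma finite_idx_tuples [simp]: "finite (idx_tuples q :: (nat \<Rightarrow> 'n::finite) set)"
  by (rule finite_PiE) auto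

lemma sqi_hermite: "sqi std_gaussian (hermite q (I :: nat \<Rightarrow> 'n::finite))"
  by (rule sqi_poly_funs[OF hermite_poly_funs])

lemma hermite_coeff_add:
  assumes "sqi std_gaussian f" "sqi std_gaussian g"
  shows "hermite_coeff q I (\<lambda>x. f x + g x) = hermite_coeff q I f + hermite_coeff q I g"
  using sqi_mult[OF assms(1) sqi_hermite[of q I]] sqi_mult[OF assms(2) sqi_hermite[of q I]]
  by (simp add: hermite_coeff_def distrib_right)

lemma hermite_coeff_single:
  "hermite_coeff q I (trig [(c, u, \<theta>)])
    = c * exp (- (norm u)\<^sup>2 / 2) * cos (\<theta> + real q * pi / 2) * (\<Prod>t<q. u $ I t)"
  using integral_cos_hermite[of u \<theta> q I]
  by (simp add: hermite_coeff_def mult.assoc)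

lemma hermite_coeff_Cons: "hermite_coeff q I (trig (a # xs)) = hermite_coeff q I (trig [a]) + hermite_coeff q I (trig xs)"
proof -
  have "trig (a # xs) = (\<lambda>x. trig [a] x + trig xs x)"
    using trig_append[of "[a]" xs] by auto
  then show ?thesis by (simp only: hermite_coeff_add sg.sqi_trig)
qed

lemma hermite_coeff_zero [simp]: "hermite_coeff q I (\<lambda>x. 0) = 0"
  by (simp add: hermite_coeff_def)

lemma bilinear_power:
  fixes u v :: "real^'n::finite"
  shows "(u \<bullet> (R *v v)) ^ q = (\<Sum>I\<in>idx_tuples q. \<Sum>J\<in>idx_tuples q.
    (\<Prod>t<q. R $ I t $ J t) * (\<Prod>t<q. u $ I t) * (\<Prod>t<q. v $ J t))"
proof -
  have "u \<bullet> (R *v v) = (\<Sum>i\<in>UNIV. \<Sum>j\<in>UNIV. R $ i $ j * u $ i * v $ j)"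
    by (simp add: inner_vec_def matrix_vector_mult_def sum_distrib_left algebra_simps)
  then have "(u \<bullet> (R *v v)) ^ q = (\<Prod>t<q. \<Sum>i\<in>UNIV. \<Sum>j\<in>UNIV. R $ i $ j * u $ i * v $ j)"
    by simp
  also have "\<dots> = (\<Sum>I\<in>idx_tuples q. \<Prod>t<q. \<Sum>j\<in>UNIV. R $ I t $ j * u $ I t * v $ j)"
    by (rule prod_sum_PiE) auto
  also have "\<dots> = (\<Sum>I\<in>idx_tuples q. \<Sum>J\<in>idx_tuples q. \<Prod>t<q. R $ I t $ J t * u $ I t * v $ J t)"
    by (intro sum.cong refl prod_sum_PiE) auto
  finally show ?thesis by (simp add: prod.distrib)
qed

text \<open>
  The contribution of the \<open>q\<close>-th Hermite level to the covariance of \<open>f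
  (Z)\<close> and \<open>g (Z')\<close>.
\<close>

definition chaos :: "real^'n^'n \<Rightarrow> nat \<Rightarrow> (real^'n::finite \<Rightarrow> real) \<Rightarrow> (real^'n \<Rightarrow> real) \<Rightarrow> real" where
  "chaos R q f g = (\<Sum>I\<in>idx_tuples q. \<Sum>J\<in>idx_tuples q.
    (\<Prod>t<q. R $ I t $ J t) * hermite_coeff q I f * hermite_coeff q J g) / fact q"

text \<open>
  \<open>2 cos (\<theta> + q\<pi>/2) cos (\<eta> + q\<pi>/2) = cos (\<theta> - \<eta>) + (-1)^q
  cos (\<theta> + \<eta>)\<close>, which splits the series into those of \<open>exp s\<close>
  and \<open>exp (- s)\<close>.
\<close>

lemma cos_quarter_product:
  "(\<lambda>q. s ^ q / fact q * (cos (\<theta> + real q * pi / 2) * cos (\<eta> + real q * pi / 2)))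
    sums ((exp s * cos (\<theta> - \<eta>) + exp (- s) * cos (\<theta> + \<eta>)) / 2)"
proof -
  have "(\<lambda>q. s ^ q / fact q) sums exp s" "(\<lambda>q. (- s) ^ q / fact q) sums exp (- s)"
    using exp_converges[of s] exp_converges[of "- s"] by (simp_all add: divide_inverse mult.commute)
  then have "(\<lambda>q. (s ^ q / fact q * cos (\<theta> - \<eta>) + (- s) ^ q / fact q * cos (\<theta> + \<eta>)) / 2)
      sums ((exp s * cos (\<theta> - \<eta>) + exp (- s) * cos (\<theta> + \<eta>)) / 2)"
    by (intro sums_divide sums_add sums_mult2)
  moreover have "(s ^ q / fact q * cos (\<theta> - \<eta>) + (- s) ^ q / fact q * cos (\<theta> + \<eta>)) / 2
      = s ^ q / fact q * (cos (\<theta> + real q * pi / 2) * cos (\<eta> + real q * pi / 2))" for q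
  proof -
    have "cos (\<theta> + real q * pi / 2 + (\<eta> + real q * pi / 2)) = cos (\<theta> + \<eta> + real q * pi)"
      by (simp add: algebra_simps)
    also have "\<dots> = (- 1) ^ q * cos (\<theta> + \<eta>)"
      by (simp add: cos_add[of "\<theta> + \<eta>"] mult.commute[of _ pi])
    finally have "cos (\<theta> + real q * pi / 2) * cos (\<eta> + real q * pi / 2)
        = (cos (\<theta> - \<eta>) + (- 1) ^ q * cos (\<theta> + \<eta>)) / 2"
      by (simp add: cos_times_cos)
    moreover have "(- s) ^ q = (-1) ^ q * s ^ q" by (rule power_minus)
    ultimately show ?thesis by (simp add: field_simps)
  qed
  ultimately show ?thesis by simp
qed

lemma chaos_add_left: "chaos R q (trig (a # xs)) g = chaos R q (trig [a]) g + chaos R q (trig xs) g"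
  unfolding chaos_def hermite_coeff_Cons[of q _ a xs]
  by (simp add: algebra_simps sum.distrib add_divide_distrib)

lemma chaos_add_right: "chaos R q f (trig (a # xs)) = chaos R q f (trig [a]) + chaos R q f (trig xs)"
  unfolding chaos_def hermite_coeff_Cons[of q _ a xs]
  by (simp add: algebra_simps sum.distrib add_divide_distrib)

text \<open>
  For two cosines both sides are explicit and the series is \<open>cos_quarter_product\<close>
  with \<open>s = u \<bullet> (R *v v)\<close>; bilinearity does the rest. No convergence in
  mean of Hermite expansions is involved.
\<close>

lemma std_pair_chaos:
  assumes M: "prob_space M" and p: "std_pair M Z Z' R"
  shows "(\<lambda>q. chaos R q (trig xs) (trig ys)) sums (\<integral>\<omega>. trig xs (Z \<omega>) * trig ys (Z' \<omega>) \<partial>M)"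
proof -
  interpret prob_space M by (rule M)
  have [measurable]: "Z \<in> borel_measurable M" "Z' \<in> borel_measurable M"
    using p by (auto simp: std_pair_def)
  have sq: "sqi M (\<lambda>\<omega>. trig xs (Z \<omega>))" "sqi M (\<lambda>\<omega>. trig xs (Z' \<omega>))" for xs
    using law_transfer(3)[OF std_pair_law(1)[OF M p], of "trig xs"]
      law_transfer(3)[OF std_pair_law(2)[OF M p], of "trig xs"] sg.sqi_trig[of xs] by auto
  have single: "(\<lambda>q. chaos R q (trig [a]) (trig [b])) sums (\<integral>\<omega>. trig [a] (Z \<omega>) * trig [b] (Z' \<omega>) \<partial>M)" for a b
  proof -
    obtain c u \<theta> where a: "a = (c, u, \<theta>)" by (cases a)
    obtain d v \<eta> where b: "b = (d, v, \<eta>)" by (cases b)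
    have "chaos R q (trig [a]) (trig [b]) = c * d * exp (- ((norm u)\<^sup>2 + (norm v)\<^sup>2) / 2)
      * ((u \<bullet> (R *v v)) ^ q / fact q * (cos (\<theta> + real q * pi / 2) * cos (\<eta> + real q * pi / 2)))" for q
    proof -
      have e: "exp (- ((norm u)\<^sup>2 + (norm v)\<^sup>2) / 2) = exp (- (norm u)\<^sup>2 / 2) * exp (- (norm v)\<^sup>2 / 2)"
        by (simp add: exp_add[symmetric] add_divide_distrib)
      have "(\<Sum>I\<in>idx_tuples q. \<Sum>J\<in>idx_tuples q. (\<Prod>t<q. R $ I t $ J t) * hermite_coeff q I (trig [a]) * hermite_coeff q J (trig [b]))
          = c * d * (exp (- (norm u)\<^sup>2 / 2) * exp (- (norm v)\<^sup>2 / 2))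
             * (cos (\<theta> + real q * pi / 2) * cos (\<eta> + real q * pi / 2)) * (u \<bullet> (R *v v)) ^ q"
        unfolding a b hermite_coeff_single bilinear_power sum_distrib_left by (intro sum.cong refl) (simp only: mult_ac)
      then have "chaos R q (trig [a]) (trig [b]) = c * d * (exp (- (norm u)\<^sup>2 / 2) * exp (- (norm v)\<^sup>2 / 2))
             * (cos (\<theta> + real q * pi / 2) * cos (\<eta> + real q * pi / 2)) * (u \<bullet> (R *v v)) ^ q / fact q"
        unfolding chaos_def by (rule arg_cong)
      also have "\<dots> = c * d * (exp (- (norm u)\<^sup>2 / 2) * exp (- (norm v)\<^sup>2 / 2))
          * ((u \<bullet> (R *v v)) ^ q / fact q * (cos (\<theta> + real q * pi / 2) * cos (\<eta> + real q * pi / 2)))"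
      proof -
        have "x * y * w * t * p / f = x * y * w * (p / f * t)" for x y w t p f :: real by simp
        then show ?thesis .
      qed
      finally show ?thesis unfolding e .
    qed
    then have "(\<lambda>q. chaos R q (trig [a]) (trig [b])) sums (c * d * exp (- ((norm u)\<^sup>2 + (norm v)\<^sup>2) / 2) *
       ((exp (u \<bullet> (R *v v)) * cos (\<theta> - \<eta>) + exp (- (u \<bullet> (R *v v))) * cos (\<theta> + \<eta>)) / 2))"
      using sums_mult[OF cos_quarter_product[of "u \<bullet> (R *v v)" \<theta> \<eta>]] by simp
    moreover have "(\<integral>\<omega>. trig [a] (Z \<omega>) * trig [b] (Z' \<omega>) \<partial>M)
        = c * d * (\<integral>\<omega>. cos (u \<bullet> Z \<omega> + \<theta>) * cos (v \<bullet> Z' \<omega> + \<eta>) \<partial>M)"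
      by (subst integral_mult_right_zero[symmetric]) (simp add: a b mult_ac)
    ultimately show ?thesis unfolding std_pair_cos_cos[OF M p] by (simp only: mult.assoc)
  qed
  have left: "(\<lambda>q. chaos R q (trig [a]) (trig ys)) sums (\<integral>\<omega>. trig [a] (Z \<omega>) * trig ys (Z' \<omega>) \<partial>M)" for a
  proof (induction ys)
    case Nil
    then show ?case by (simp add: chaos_def)
  next
    case (Cons b ys)
    have "(\<integral>\<omega>. trig [a] (Z \<omega>) * trig (b # ys) (Z' \<omega>) \<partial>M)
        = (\<integral>\<omega>. trig [a] (Z \<omega>) * trig [b] (Z' \<omega>) + trig [a] (Z \<omega>) * trig ys (Z' \<omega>) \<partial>M)"
      using trig_append[of "[b]" ys] by (simp add: distrib_left)
    also have "\<dots> = (\<integral>\<omega>. trig [a] (Z \<omega>) * trig [b] (Z' \<omega>) \<partial>M) + (\<integral>\<omega>. trig [a] (Z \<omega>) * trig ys (Z' \<omega>) \<partial>M)"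
      by (intro Bochner_Integration.integral_add sqi_mult sq)
    finally show ?case using sums_add[OF single[of a b] Cons] unfolding chaos_add_right[of R _ "trig [a]" b ys] by simp
  qed
  show ?thesis
  proof (induction xs)
    case Nil
    then show ?case by (simp add: chaos_def)
  next
    case (Cons a xs)
    have "(\<integral>\<omega>. trig (a # xs) (Z \<omega>) * trig ys (Z' \<omega>) \<partial>M)
        = (\<integral>\<omega>. trig [a] (Z \<omega>) * trig ys (Z' \<omega>) + trig xs (Z \<omega>) * trig ys (Z' \<omega>) \<partial>M)"
      using trig_append[of "[a]" xs] by (simp add: distrib_right)
    also have "\<dots> = (\<integral>\<omega>. trig [a] (Z \<omega>) * trig ys (Z' \<omega>) \<partial>M) + (\<integral>\<omega>. trig xs (Z \<omega>) * trig ys (Z' \<omega>) \<partial>M)"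
      by (intro Bochner_Integration.integral_add sqi_mult sq)
    finally show ?case using sums_add[OF left[of a] Cons] unfolding chaos_add_left[of R _ a xs "trig ys"] by simp
  qed
qed

definition hnorm :: "nat \<Rightarrow> (real^'n::finite \<Rightarrow> real) \<Rightarrow> real" where
  "hnorm q f = sqrt (\<Sum>I\<in>idx_tuples q. (hermite_coeff q I f)\<^sup>2)"

lemma hnorm_nonneg: "0 \<le> hnorm q f" by (simp add: hnorm_def sum_nonneg)

text \<open>
  The expansion of the covariance for the pair \<open>(Z, Z)\<close>, whose cross covariance is
  the identity.
\<close>

lemma chaos_parseval: "(\<lambda>q. (hnorm q (trig xs))\<^sup>2 / fact q) sums (nrm std_gaussian (trig xs :: real^'n::finite \<Rightarrow> real))\<^sup>2"
proof -
  have "std_pair std_gaussian (\<lambda>x. x) (\<lambda>x. x) (mat 1 :: real^'n^'n)"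
    by (rule std_pair_self) (auto simp: distr_id2)
  from std_pair_chaos[OF prob_space_std_gaussian this, of xs xs]
  have "(\<lambda>q. chaos (mat 1) q (trig xs) (trig xs)) sums (nrm std_gaussian (trig xs :: real^'n \<Rightarrow> real))\<^sup>2"
    unfolding nrm_sq by (simp add: power2_eq_square)
  moreover have "chaos (mat 1) q (trig xs) (trig xs) = (hnorm q (trig xs :: real^'n \<Rightarrow> real))\<^sup>2 / fact q" for q
  proof -
    have "(\<Sum>J\<in>idx_tuples q. (\<Prod>t<q. mat 1 $ I t $ J t) * hermite_coeff q I (trig xs) * hermite_coeff q J (trig xs)) = (hermite_coeff q I (trig xs))\<^sup>2"
      if I: "I \<in> idx_tuples q" for I :: "nat \<Rightarrow> 'n"
    proof -
      have "(\<Prod>t<q. mat 1 $ I t $ J t) = (if J = I then 1 else (0::real))" if J: "J \<in> idx_tuples q" for J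
      proof (cases "J = I")
        case False
        then obtain t where "t < q" "I t \<noteq> J t"
          using PiE_ext[OF J I] by fastforce
        then show ?thesis using False by (auto simp: mat_def intro!: prod_zero)
      qed (simp add: mat_def)
      then have "(\<Sum>J\<in>idx_tuples q. (\<Prod>t<q. mat 1 $ I t $ J t) * hermite_coeff q I (trig xs) * hermite_coeff q J (trig xs))
          = (\<Sum>J\<in>idx_tuples q. if J = I then hermite_coeff q I (trig xs) * hermite_coeff q I (trig xs) else 0)"
        by (intro sum.cong) auto
      then show ?thesis using I by (simp add: power2_eq_square)
    qed
    then show ?thesis by (simp add: chaos_def hnorm_def sum_nonneg)
  qed
  ultimately show ?thesis by simp
qed

text \<open>
  Cauchy-Schwarz over the \<open>CARD('n) ^ q\<close> tuples, once for each of the two sums.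
\<close>

lemma chaos_bound:
  fixes R :: "real^'n^'n::finite"
  assumes R: "\<And>i j. \<bar>R $ i $ j\<bar> \<le> r"
  shows "\<bar>chaos R q f g\<bar> \<le> (real CARD('n) * r) ^ q * (hnorm q f * hnorm q g) / fact q"
proof -
  have r: "0 \<le> r" using R[of undefined undefined] by (rule order_trans[OF abs_ge_zero])
  have s: "(\<Sum>I\<in>idx_tuples q. \<bar>hermite_coeff q I f\<bar>) \<le> sqrt (real CARD('n) ^ q) * hnorm q f" for f :: "real^'n \<Rightarrow> real"
  proof -
    have "(\<Sum>I\<in>idx_tuples q. 1 * \<bar>hermite_coeff q I f\<bar>)\<^sup>2 \<le> (\<Sum>I\<in>(idx_tuples q :: (nat \<Rightarrow> 'n) set). 1\<^sup>2) * (\<Sum>I\<in>idx_tuples q. \<bar>hermite_coeff q I f\<bar>\<^sup>2)"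
      by (rule Cauchy_Schwarz_ineq_sum)
    also have "\<dots> = real CARD('n) ^ q * (\<Sum>I\<in>idx_tuples q. (hermite_coeff q I f)\<^sup>2)"
      by (simp add: card_PiE)
    finally have "sqrt ((\<Sum>I\<in>idx_tuples q. \<bar>hermite_coeff q I f\<bar>)\<^sup>2) \<le> sqrt (real CARD('n) ^ q * (\<Sum>I\<in>idx_tuples q. (hermite_coeff q I f)\<^sup>2))"
      by (simp del: real_sqrt_abs)
    then show ?thesis by (simp add: hnorm_def real_sqrt_mult sum_nonneg)
  qed
  have "\<bar>\<Sum>I\<in>idx_tuples q. \<Sum>J\<in>idx_tuples q. (\<Prod>t<q. R $ I t $ J t) * hermite_coeff q I f * hermite_coeff q J g\<bar>
      \<le> (\<Sum>I\<in>idx_tuples q. \<Sum>J\<in>idx_tuples q. \<bar>(\<Prod>t<q. R $ I t $ J t) * hermite_coeff q I f * hermite_coeff q J g\<bar>)"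
    by (rule order_trans[OF sum_abs sum_mono[OF sum_abs]])
  also have "\<dots> \<le> (\<Sum>I\<in>idx_tuples q. \<Sum>J\<in>idx_tuples q. r ^ q * (\<bar>hermite_coeff q I f\<bar> * \<bar>hermite_coeff q J g\<bar>))"
  proof (intro sum_mono)
    fix I J :: "nat \<Rightarrow> 'n"
    have "\<bar>\<Prod>t<q. R $ I t $ J t\<bar> \<le> (\<Prod>t<q. r)"
      unfolding abs_prod by (rule prod_mono) (use R in auto)
    then show "\<bar>(\<Prod>t<q. R $ I t $ J t) * hermite_coeff q I f * hermite_coeff q J g\<bar> \<le> r ^ q * (\<bar>hermite_coeff q I f\<bar> * \<bar>hermite_coeff q J g\<bar>)"
      by (simp add: abs_mult mult.assoc mult_right_mono)
  qed
  also have "\<dots> = r ^ q * ((\<Sum>I\<in>idx_tuples q. \<bar>hermite_coeff q I f\<bar>) * (\<Sum>J\<in>idx_tuples q. \<bar>hermite_coeff q J g\<bar>))"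
    unfolding sum_product unfolding sum_distrib_left by (rule refl)
  also have "\<dots> \<le> r ^ q * ((sqrt (real CARD('n) ^ q) * hnorm q f) * (sqrt (real CARD('n) ^ q) * hnorm q g))"
    by (intro mult_left_mono mult_mono s) (auto simp: r sum_nonneg hnorm_nonneg)
  also have "\<dots> = (real CARD('n) * r) ^ q * (hnorm q f * hnorm q g)"
    by (simp add: power_mult_distrib mult_ac)
  finally show ?thesis
    by (simp add: chaos_def divide_right_mono)
qed

text \<open>
  A trigonometric polynomial is never orthogonal to all polynomials of low degree exactly. The
  low levels are therefore kept as an error term, which vanishes in the limit when
  \<open>xs\<close> approximates a function of rank \<open>m\<close>.
\<close>

lemma std_pair_trig_bound:
  fixes R :: "real^'n^'n::finite"
  assumes M: "prob_space M" and p: "std_pair M Z Z' R"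
    and R: "\<And>i j. \<bar>R $ i $ j\<bar> \<le> r" and r1: "real CARD('n) * r \<le> 1"
  shows "\<bar>\<integral>\<omega>. trig xs (Z \<omega>) * trig ys (Z' \<omega>) \<partial>M\<bar>
    \<le> nrm std_gaussian (trig ys) * (\<Sum>q<m. hnorm q (trig xs))
      + (real CARD('n) * r) ^ m * (nrm std_gaussian (trig xs) * nrm std_gaussian (trig ys))"
proof -
  define \<rho> where "\<rho> = real CARD('n) * r"
  have r: "0 \<le> r" using R[of undefined undefined] by (rule order_trans[OF abs_ge_zero])
  then have \<rho>: "0 \<le> \<rho>" "\<rho> \<le> 1" using r1 by (auto simp: \<rho>_def)
  define \<alpha> where "\<alpha> q = hnorm q (trig xs) / sqrt (fact q)" for q
  define \<beta> where "\<beta> q = hnorm q (trig ys) / sqrt (fact q)" for q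
  have nn: "0 \<le> \<alpha> q" "0 \<le> \<beta> q" for q by (simp_all add: \<alpha>_def \<beta>_def hnorm_nonneg)
  have sa: "(\<lambda>q. (\<alpha> q)\<^sup>2) sums (nrm std_gaussian (trig xs :: real^'n \<Rightarrow> real))\<^sup>2" 
    and sb: "(\<lambda>q. (\<beta> q)\<^sup>2) sums (nrm std_gaussian (trig ys :: real^'n \<Rightarrow> real))\<^sup>2"
    using chaos_parseval[of xs] chaos_parseval[of ys] by (simp_all add: \<alpha>_def \<beta>_def power_divide)
  have fa: "(\<Sum>q\<in>A. (\<alpha> q)\<^sup>2) \<le> (nrm std_gaussian (trig xs :: real^'n \<Rightarrow> real))\<^sup>2" if "finite A" for A
    using sum_le_suminf[OF sums_summable[OF sa] that] sums_unique[OF sa] by simp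
  have fb: "(\<Sum>q\<in>A. (\<beta> q)\<^sup>2) \<le> (nrm std_gaussian (trig ys :: real^'n \<Rightarrow> real))\<^sup>2" if "finite A" for A
    using sum_le_suminf[OF sums_summable[OF sb] that] sums_unique[OF sb] by simp
  have b1: "\<beta> q \<le> nrm std_gaussian (trig ys :: real^'n \<Rightarrow> real)" for q
    by (rule power2_le_imp_le) (use fb[of "{q}"] in simp_all)
  have a1: "\<alpha> q \<le> hnorm q (trig xs)" for q
    using hnorm_nonneg[of q "trig xs"] by (simp add: \<alpha>_def divide_le_eq mult_le_cancel_left1 real_le_rsqrt)
  have t: "\<bar>chaos R q (trig xs) (trig ys)\<bar> \<le>
      (if q < m then nrm std_gaussian (trig ys) * hnorm q (trig xs) else 0) + \<rho> ^ m * (\<alpha> q * \<beta> q)" for q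
  proof -
    have "\<bar>chaos R q (trig xs) (trig ys)\<bar> \<le> \<rho> ^ q * (\<alpha> q * \<beta> q)"
      using chaos_bound[OF R, of q "trig xs" "trig ys"]
      by (simp add: \<rho>_def \<alpha>_def \<beta>_def real_sqrt_mult[symmetric])
    also have "\<dots> \<le> (if q < m then nrm std_gaussian (trig ys) * hnorm q (trig xs) else 0) + \<rho> ^ m * (\<alpha> q * \<beta> q)"
    proof (cases "q < m")
      case True
      have "\<rho> ^ q * (\<alpha> q * \<beta> q) \<le> 1 * (hnorm q (trig xs) * nrm std_gaussian (trig ys :: real^'n \<Rightarrow> real))"
        by (intro mult_mono a1 b1 power_le_one \<rho>) (auto simp: nn hnorm_nonneg)
      moreover have "0 \<le> \<rho> ^ m * (\<alpha> q * \<beta> q)" using \<rho> nn by simp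
      ultimately show ?thesis using True by (simp add: mult.commute)
    next
      case False
      then have "\<rho> ^ q \<le> \<rho> ^ m" using \<rho> by (intro power_decreasing) auto
      then have "\<rho> ^ q * (\<alpha> q * \<beta> q) \<le> \<rho> ^ m * (\<alpha> q * \<beta> q)"
        using nn by (intro mult_right_mono mult_nonneg_nonneg) auto
      then show ?thesis using False by simp
    qed
    finally show ?thesis .
  qed
  have part: "\<bar>\<Sum>q<N. chaos R q (trig xs) (trig ys)\<bar> \<le> nrm std_gaussian (trig ys) * (\<Sum>q<m. hnorm q (trig xs))
      + \<rho> ^ m * (nrm std_gaussian (trig xs) * nrm std_gaussian (trig ys))" for N
  proof -
    have "(\<Sum>q<N. \<alpha> q * \<beta> q)\<^sup>2 \<le> (\<Sum>q<N. (\<alpha> q)\<^sup>2) * (\<Sum>q<N. (\<beta> q)\<^sup>2)" by (rule Cauchy_Schwarz_ineq_sum)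
    also have "\<dots> \<le> (nrm std_gaussian (trig xs :: real^'n \<Rightarrow> real))\<^sup>2 * (nrm std_gaussian (trig ys :: real^'n \<Rightarrow> real))\<^sup>2"
      by (intro mult_mono fa fb) (auto simp: sum_nonneg)
    finally have "(\<Sum>q<N. \<alpha> q * \<beta> q)\<^sup>2 \<le> (nrm std_gaussian (trig xs :: real^'n \<Rightarrow> real) * nrm std_gaussian (trig ys :: real^'n \<Rightarrow> real))\<^sup>2"
      by (simp only: power_mult_distrib)
    then have "(\<Sum>q<N. \<alpha> q * \<beta> q) \<le> nrm std_gaussian (trig xs :: real^'n \<Rightarrow> real) * nrm std_gaussian (trig ys :: real^'n \<Rightarrow> real)"
      by (rule power2_le_imp_le[OF _ mult_nonneg_nonneg[OF nrm_nonneg nrm_nonneg]])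
    then have 1: "\<rho> ^ m * (\<Sum>q<N. \<alpha> q * \<beta> q) \<le> \<rho> ^ m * (nrm std_gaussian (trig xs) * nrm std_gaussian (trig ys))"
      using \<rho> by (intro mult_left_mono) auto
    have "(\<Sum>q<N. if q < m then nrm std_gaussian (trig ys :: real^'n \<Rightarrow> real) * hnorm q (trig xs) else 0)
        = (\<Sum>q\<in>{..<N} \<inter> {..<m}. nrm std_gaussian (trig ys :: real^'n \<Rightarrow> real) * hnorm q (trig xs))"
      by (subst sum.inter_restrict) (auto intro: sum.cong)
    also have "\<dots> \<le> (\<Sum>q<m. nrm std_gaussian (trig ys :: real^'n \<Rightarrow> real) * hnorm q (trig xs))"
      by (intro sum_mono2) (auto simp: hnorm_nonneg)
    finally have 2: "(\<Sum>q<N. if q < m then nrm std_gaussian (trig ys :: real^'n \<Rightarrow> real) * hnorm q (trig xs) else 0)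
      \<le> nrm std_gaussian (trig ys) * (\<Sum>q<m. hnorm q (trig xs))" by (simp add: sum_distrib_left)
    have "\<bar>\<Sum>q<N. chaos R q (trig xs) (trig ys)\<bar> \<le> (\<Sum>q<N. \<bar>chaos R q (trig xs) (trig ys)\<bar>)" by (rule sum_abs)
    also have "\<dots> \<le> (\<Sum>q<N. (if q < m then nrm std_gaussian (trig ys) * hnorm q (trig xs) else 0) + \<rho> ^ m * (\<alpha> q * \<beta> q))"
      by (intro sum_mono t)
    finally show ?thesis using 1 2 by (simp add: sum.distrib sum_distrib_left)
  qed
  have "(\<lambda>N. \<bar>\<Sum>q<N. chaos R q (trig xs) (trig ys)\<bar>) \<longlonglongrightarrow> \<bar>\<integral>\<omega>. trig xs (Z \<omega>) * trig ys (Z' \<omega>) \<partial>M\<bar>"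
    using std_pair_chaos[OF M p, of xs ys] by (intro tendsto_rabs) (simp add: sums_def)
  from LIMSEQ_le_const2[OF this] part show ?thesis unfolding \<rho>_def by blast
qed

lemma std_pair_L2:
  assumes M: "prob_space M" and p: "std_pair M Z Z' R" and f: "sqi std_gaussian f"
  shows "sqi M (\<lambda>\<omega>. f (Z \<omega>))" "sqi M (\<lambda>\<omega>. f (Z' \<omega>))"
    "nrm M (\<lambda>\<omega>. f (Z \<omega>)) = nrm std_gaussian f" "nrm M (\<lambda>\<omega>. f (Z' \<omega>)) = nrm std_gaussian f"
proof -
  have m: "Z \<in> borel_measurable M" "Z' \<in> borel_measurable M" using p by (auto simp: std_pair_def)
  note t = law_transfer[OF std_pair_law(1)[OF M p] m(1) sqi_std_gaussianD[OF f]]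
    law_transfer[OF std_pair_law(2)[OF M p] m(2) sqi_std_gaussianD[OF f]]
  show "sqi M (\<lambda>\<omega>. f (Z \<omega>))" "sqi M (\<lambda>\<omega>. f (Z' \<omega>))"
    "nrm M (\<lambda>\<omega>. f (Z \<omega>)) = nrm std_gaussian f" "nrm M (\<lambda>\<omega>. f (Z' \<omega>)) = nrm std_gaussian f"
    using t f by auto
qed

lemma std_pair_inner_diff:
  assumes M: "prob_space M" and p: "std_pair M Z Z' R"
    and s: "sqi std_gaussian f" "sqi std_gaussian g" "sqi std_gaussian f'" "sqi std_gaussian g'"
  shows "\<bar>(\<integral>\<omega>. f (Z \<omega>) * g (Z' \<omega>) \<partial>M) - (\<integral>\<omega>. f' (Z \<omega>) * g' (Z' \<omega>) \<partial>M)\<bar>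
    \<le> nrm std_gaussian (\<lambda>x. f x - f' x) * nrm std_gaussian g + nrm std_gaussian f' * nrm std_gaussian (\<lambda>x. g x - g' x)"
  using L2_inner_diff[of M "\<lambda>\<omega>. f (Z \<omega>)" "\<lambda>\<omega>. g (Z' \<omega>)" "\<lambda>\<omega>. f' (Z \<omega>)" "\<lambda>\<omega>. g' (Z' \<omega>)"]
    std_pair_L2[OF M p s(1)] std_pair_L2[OF M p s(2)] std_pair_L2[OF M p s(3)] std_pair_L2[OF M p s(4)]
    std_pair_L2(3)[OF M p sqi_diff[OF s(1,3)]] std_pair_L2(4)[OF M p sqi_diff[OF s(2,4)]]
  by simp

text \<open>
  If \<open>CARD('n) * r > 1\<close> this is weaker than Cauchy-Schwarz. Otherwise approximate
  \<open>f\<close> and \<open>g\<close> by trigonometric polynomials; the Hermite coefficients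
  of the approximations of \<open>f\<close> below level \<open>m\<close> converge to those of
  \<open>f\<close>, which are zero.
\<close>

theorem gaussian_covariance_bound:
  fixes R :: "real^'n^'n::finite"
  assumes M: "prob_space M" and p: "std_pair M Z Z' R"
    and R: "\<And>i j. \<bar>R $ i $ j\<bar> \<le> r"
    and f: "sqi std_gaussian f" and g: "sqi std_gaussian g"
    and rank: "\<And>P. P \<in> poly_funs (m - 1) \<Longrightarrow> (\<integral>x. P x * f x \<partial>std_gaussian) = 0"
  shows "\<bar>\<integral>\<omega>. f (Z \<omega>) * g (Z' \<omega>) \<partial>M\<bar>
    \<le> (real CARD('n) * r) ^ m * (nrm std_gaussian f * nrm std_gaussian g)"
proof (cases "real CARD('n) * r \<le> 1")
  case False
  have "\<bar>\<integral>\<omega>. f (Z \<omega>) * g (Z' \<omega>) \<partial>M\<bar> \<le> 1 * (nrm std_gaussian f * nrm std_gaussian g)"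
    using L2_Cauchy_Schwarz[of M "\<lambda>\<omega>. f (Z \<omega>)" "\<lambda>\<omega>. g (Z' \<omega>)"] std_pair_L2[OF M p f] std_pair_L2[OF M p g] by simp
  also have "\<dots> \<le> (real CARD('n) * r) ^ m * (nrm std_gaussian f * nrm std_gaussian g)"
    using False by (intro mult_right_mono one_le_power) auto
  finally show ?thesis .
next
  case True
  obtain X where X: "(\<lambda>n. nrm std_gaussian (\<lambda>x. f x - trig (X n) x)) \<longlonglongrightarrow> 0"
    using sg.trig_dense_seq[OF f] .
  obtain Y where Y: "(\<lambda>n. nrm std_gaussian (\<lambda>x. g x - trig (Y n) x)) \<longlonglongrightarrow> 0"
    using sg.trig_dense_seq[OF g] .
  have nX: "(\<lambda>n. nrm std_gaussian (trig (X n) :: real^'n \<Rightarrow> real)) \<longlonglongrightarrow> nrm std_gaussian f"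
  proof (rule LIM_zero_cancel, rule Lim_null_comparison[OF _ X], rule always_eventually, rule allI)
    fix n show "norm (nrm std_gaussian (trig (X n) :: real^'n \<Rightarrow> real) - nrm std_gaussian f) \<le> nrm std_gaussian (\<lambda>x. f x - trig (X n) x)"
      using nrm_triangle_sub[OF f sg.sqi_trig[of "X n"]] nrm_triangle_sub[OF sg.sqi_trig[of "X n"] f]
        nrm_minus_commute[of std_gaussian f "trig (X n)"] by simp
  qed
  have nY: "(\<lambda>n. nrm std_gaussian (trig (Y n) :: real^'n \<Rightarrow> real)) \<longlonglongrightarrow> nrm std_gaussian g"
  proof (rule LIM_zero_cancel, rule Lim_null_comparison[OF _ Y], rule always_eventually, rule allI)
    fix n show "norm (nrm std_gaussian (trig (Y n) :: real^'n \<Rightarrow> real) - nrm std_gaussian g) \<le> nrm std_gaussian (\<lambda>x. g x - trig (Y n) x)"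
      using nrm_triangle_sub[OF g sg.sqi_trig[of "Y n"]] nrm_triangle_sub[OF sg.sqi_trig[of "Y n"] g]
        nrm_minus_commute[of std_gaussian g "trig (Y n)"] by simp
  qed
  have hX: "(\<lambda>n. hnorm q (trig (X n) :: real^'n \<Rightarrow> real)) \<longlonglongrightarrow> 0" if "q < m" for q
  proof -
    have "(\<lambda>n. hermite_coeff q I (trig (X n))) \<longlonglongrightarrow> 0" for I :: "nat \<Rightarrow> 'n"
    proof (rule Lim_null_comparison)
      have h0: "hermite_coeff q I f = 0"
        using rank[OF poly_funs_mono[OF hermite_poly_funs[of q I]]] that by (simp add: hermite_coeff_def mult.commute)
      have "\<bar>hermite_coeff q I (trig (X n))\<bar> \<le> nrm std_gaussian (\<lambda>x. f x - trig (X n) x) * nrm std_gaussian (hermite q I)" for n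
        using L2_inner_diff[OF f sqi_hermite[of q I] sg.sqi_trig[of "X n"] sqi_hermite[of q I]] h0
        by (simp add: hermite_coeff_def nrm_def)
      then show "\<forall>\<^sub>F n in sequentially. norm (hermite_coeff q I (trig (X n))) \<le> nrm std_gaussian (\<lambda>x. f x - trig (X n) x) * nrm std_gaussian (hermite q I)"
        by (auto intro: always_eventually)
      show "(\<lambda>n. nrm std_gaussian (\<lambda>x. f x - trig (X n) x) * nrm std_gaussian (hermite q I)) \<longlonglongrightarrow> 0"
        by (rule tendsto_mult_left_zero[OF X])
    qed
    then have "(\<lambda>n. sqrt (\<Sum>I\<in>idx_tuples q. (hermite_coeff q I (trig (X n)))\<^sup>2)) \<longlonglongrightarrow> sqrt (\<Sum>I\<in>(idx_tuples q :: (nat \<Rightarrow> 'n) set). 0\<^sup>2)"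
      by (intro tendsto_intros)
    then show ?thesis by (simp add: hnorm_def)
  qed
  define B where "B n = nrm std_gaussian (trig (Y n) :: real^'n \<Rightarrow> real) * (\<Sum>q<m. hnorm q (trig (X n) :: real^'n \<Rightarrow> real))
      + (real CARD('n) * r) ^ m * (nrm std_gaussian (trig (X n) :: real^'n \<Rightarrow> real) * nrm std_gaussian (trig (Y n) :: real^'n \<Rightarrow> real))" for n
  have "B \<longlonglongrightarrow> nrm std_gaussian g * (\<Sum>q<m. 0) + (real CARD('n) * r) ^ m * (nrm std_gaussian f * nrm std_gaussian g)"
    unfolding B_def by (intro tendsto_intros nX nY hX) auto
  moreover define E where "E n = \<bar>\<integral>\<omega>. trig (X n) (Z \<omega>) * trig (Y n) (Z' \<omega>) \<partial>M\<bar>" for n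
  have "E \<longlonglongrightarrow> \<bar>\<integral>\<omega>. f (Z \<omega>) * g (Z' \<omega>) \<partial>M\<bar>"
    unfolding E_def
  proof (rule tendsto_rabs, rule LIM_zero_cancel, rule Lim_null_comparison)
    show "\<forall>\<^sub>F n in sequentially. norm ((\<integral>\<omega>. trig (X n) (Z \<omega>) * trig (Y n) (Z' \<omega>) \<partial>M) - (\<integral>\<omega>. f (Z \<omega>) * g (Z' \<omega>) \<partial>M))
       \<le> nrm std_gaussian (\<lambda>x. f x - trig (X n) x) * nrm std_gaussian (trig (Y n) :: real^'n \<Rightarrow> real)
        + nrm std_gaussian f * nrm std_gaussian (\<lambda>x. g x - trig (Y n) x)"
    proof (rule always_eventually, rule allI)
      fix n
      show "norm ((\<integral>\<omega>. trig (X n) (Z \<omega>) * trig (Y n) (Z' \<omega>) \<partial>M) - (\<integral>\<omega>. f (Z \<omega>) * g (Z' \<omega>) \<partial>M))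
       \<le> nrm std_gaussian (\<lambda>x. f x - trig (X n) x) * nrm std_gaussian (trig (Y n) :: real^'n \<Rightarrow> real)
        + nrm std_gaussian f * nrm std_gaussian (\<lambda>x. g x - trig (Y n) x)"
        using std_pair_inner_diff[OF M p sg.sqi_trig[of "X n"] sg.sqi_trig[of "Y n"] f g]
          nrm_minus_commute[of std_gaussian f "trig (X n)"] nrm_minus_commute[of std_gaussian g "trig (Y n)"] by simp
    qed
    have "(\<lambda>n. nrm std_gaussian (\<lambda>x. f x - trig (X n) x) * nrm std_gaussian (trig (Y n) :: real^'n \<Rightarrow> real)
        + nrm std_gaussian f * nrm std_gaussian (\<lambda>x. g x - trig (Y n) x)) \<longlonglongrightarrow> 0 * nrm std_gaussian g + nrm std_gaussian f * 0"
      by (intro tendsto_intros X Y nY)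
    then show "(\<lambda>n. nrm std_gaussian (\<lambda>x. f x - trig (X n) x) * nrm std_gaussian (trig (Y n) :: real^'n \<Rightarrow> real)
        + nrm std_gaussian f * nrm std_gaussian (\<lambda>x. g x - trig (Y n) x)) \<longlonglongrightarrow> 0" by simp
  qed
  moreover have "E n \<le> B n" for n
    unfolding E_def B_def by (rule std_pair_trig_bound[OF M p R True])
  ultimately show ?thesis using LIMSEQ_le[of E _ B] by auto
qed

text \<open>
  The covariance of two trigonometric polynomials is an explicit continuous function of
  \<open>R\<close>.
\<close>

lemma std_pair_trig_continuous:
  fixes R0 :: "real^'n^'n::finite"
  assumes M: "prob_space M" and e: "e > 0"
  shows "\<exists>d>0. \<forall>Z Z' R Z0 Z0'. std_pair M Z Z' R \<longrightarrow> std_pair M Z0 Z0' R0 \<longrightarrow> norm (R - R0) < d \<longrightarrow>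
    \<bar>(\<integral>\<omega>. trig xs (Z \<omega>) * trig ys (Z' \<omega>) \<partial>M) - (\<integral>\<omega>. trig xs (Z0 \<omega>) * trig ys (Z0' \<omega>) \<partial>M)\<bar> < e"
proof -
  define \<Psi> where "\<Psi> R = (\<Sum>(c, u, \<theta>)\<leftarrow>xs. \<Sum>(d, v, \<eta>)\<leftarrow>ys. c * d * (exp (- ((norm u)\<^sup>2 + (norm v)\<^sup>2) / 2)
      * ((exp (u \<bullet> (R *v v)) * cos (\<theta> - \<eta>) + exp (- (u \<bullet> (R *v v))) * cos (\<theta> + \<eta>)) / 2)))" for R :: "real^'n^'n"
  have eq: "(\<integral>\<omega>. trig xs (Z \<omega>) * trig ys (Z' \<omega>) \<partial>M) = \<Psi> R" if p: "std_pair M Z Z' R" for Z Z' R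
  proof -
    interpret prob_space M by (rule M)
    have [measurable]: "Z \<in> borel_measurable M" "Z' \<in> borel_measurable M"
      using p by (auto simp: std_pair_def)
    have int: "integrable M (\<lambda>\<omega>. trig xs (Z \<omega>) * trig ys (Z' \<omega>))" for xs ys
      by (intro sqi_mult std_pair_L2[OF M p] sg.sqi_trig)
    have 1: "(\<integral>\<omega>. trig [(c, u, \<theta>)] (Z \<omega>) * trig ys (Z' \<omega>) \<partial>M)
       = (\<Sum>(d, v, \<eta>)\<leftarrow>ys. c * d * (exp (- ((norm u)\<^sup>2 + (norm v)\<^sup>2) / 2)
      * ((exp (u \<bullet> (R *v v)) * cos (\<theta> - \<eta>) + exp (- (u \<bullet> (R *v v))) * cos (\<theta> + \<eta>)) / 2)))" for c u \<theta> ys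
    proof (induction ys)
      case (Cons b ys)
      obtain d v \<eta> where b: "b = (d, v, \<eta>)" by (cases b)
      have "(\<integral>\<omega>. trig [(c, u, \<theta>)] (Z \<omega>) * trig (b # ys) (Z' \<omega>) \<partial>M)
          = (\<integral>\<omega>. trig [(c, u, \<theta>)] (Z \<omega>) * trig [b] (Z' \<omega>) + trig [(c, u, \<theta>)] (Z \<omega>) * trig ys (Z' \<omega>) \<partial>M)"
        using trig_append[of "[b]" ys] by (simp add: distrib_left)
      also have "\<dots> = (\<integral>\<omega>. trig [(c, u, \<theta>)] (Z \<omega>) * trig [b] (Z' \<omega>) \<partial>M) + (\<integral>\<omega>. trig [(c, u, \<theta>)] (Z \<omega>) * trig ys (Z' \<omega>) \<partial>M)"
        by (intro Bochner_Integration.integral_add int)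
      also have "(\<integral>\<omega>. trig [(c, u, \<theta>)] (Z \<omega>) * trig [b] (Z' \<omega>) \<partial>M)
          = c * d * (\<integral>\<omega>. cos (u \<bullet> Z \<omega> + \<theta>) * cos (v \<bullet> Z' \<omega> + \<eta>) \<partial>M)"
        by (subst integral_mult_right_zero[symmetric]) (simp add: b mult_ac)
      finally show ?case unfolding Cons b std_pair_cos_cos[OF M p] by simp
    qed simp
    have "(\<integral>\<omega>. trig zs (Z \<omega>) * trig ys (Z' \<omega>) \<partial>M) = (\<Sum>(c, u, \<theta>)\<leftarrow>zs. \<Sum>(d, v, \<eta>)\<leftarrow>ys. c * d * (exp (- ((norm u)\<^sup>2 + (norm v)\<^sup>2) / 2)
      * ((exp (u \<bullet> (R *v v)) * cos (\<theta> - \<eta>) + exp (- (u \<bullet> (R *v v))) * cos (\<theta> + \<eta>)) / 2)))" for zs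
    proof (induction zs)
      case (Cons a zs)
      obtain c u \<theta> where a: "a = (c, u, \<theta>)" by (cases a)
      have "(\<integral>\<omega>. trig (a # zs) (Z \<omega>) * trig ys (Z' \<omega>) \<partial>M)
          = (\<integral>\<omega>. trig [a] (Z \<omega>) * trig ys (Z' \<omega>) + trig zs (Z \<omega>) * trig ys (Z' \<omega>) \<partial>M)"
        using trig_append[of "[a]" zs] by (simp add: distrib_right)
      also have "\<dots> = (\<integral>\<omega>. trig [a] (Z \<omega>) * trig ys (Z' \<omega>) \<partial>M) + (\<integral>\<omega>. trig zs (Z \<omega>) * trig ys (Z' \<omega>) \<partial>M)"
        by (intro Bochner_Integration.integral_add int)
      finally show ?case unfolding Cons a 1 by simp
    qed simp
    then show ?thesis by (simp add: \<Psi>_def)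
  qed
  have mvc: "continuous (at R0) (\<lambda>R::real^'n^'n. u \<bullet> (R *v v))" for u v R0
  proof -
    have "u \<bullet> (R *v v) = (\<Sum>i\<in>UNIV. \<Sum>j\<in>UNIV. u $ i * (R $ i $ j * v $ j))" for R :: "real^'n^'n"
      by (simp add: inner_vec_def matrix_vector_mult_def sum_distrib_left)
    then show ?thesis unfolding isCont_def by (simp only:) (intro tendsto_intros)
  qed
  have c2: "continuous (at R0) (\<lambda>R::real^'n^'n. \<Sum>(d, v, \<eta>)\<leftarrow>ys. c * d * (exp (- ((norm u)\<^sup>2 + (norm v)\<^sup>2) / 2)
      * ((exp (u \<bullet> (R *v v)) * cos (\<theta> - \<eta>) + exp (- (u \<bullet> (R *v v))) * cos (\<theta> + \<eta>)) / 2)))" for c u \<theta>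
  proof (induction ys)
    case (Cons b ys)
    then show ?case by (cases b) (auto intro!: continuous_intros mvc)
  qed simp
  have "continuous (at R0) \<Psi>" unfolding \<Psi>_def
  proof (induction xs)
    case (Cons a xs)
    obtain c u \<theta> where a: "a = (c, u, \<theta>)" by (cases a)
    show ?case unfolding a list.map sum_list.Cons prod.case by (rule continuous_add[OF c2 Cons])
  qed simp
  then obtain d where "d > 0" "\<And>R. norm (R - R0) < d \<Longrightarrow> \<bar>\<Psi> R - \<Psi> R0\<bar> < e"
    using e unfolding continuous_at_eps_delta dist_norm by (auto simp: dist_real_def)
  then show ?thesis using eq by (intro exI[of _ d]) auto
qed

text \<open>
  Approximate \<open>f\<close> and \<open>g\<close> by trigonometric polynomials. The error does
  not depend on \<open>R\<close>, because the marginal laws do not; hence \<open>d\<close>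
  depends on the functions and on \<open>R0\<close> only.
\<close>

theorem std_pair_continuous:
  fixes R0 :: "real^'n^'n::finite"
  assumes M: "prob_space M" and e: "e > 0" and f: "sqi std_gaussian f" and g: "sqi std_gaussian g"
  shows "\<exists>d>0. \<forall>Z Z' R Z0 Z0'. std_pair M Z Z' R \<longrightarrow> std_pair M Z0 Z0' R0 \<longrightarrow> norm (R - R0) < d \<longrightarrow>
    \<bar>(\<integral>\<omega>. f (Z \<omega>) * g (Z' \<omega>) \<partial>M) - (\<integral>\<omega>. f (Z0 \<omega>) * g (Z0' \<omega>) \<partial>M)\<bar> < e"
proof -
  let ?n = "nrm (std_gaussian :: (real^'n) measure)"
  have "e / (8 * (?n g + 1)) > 0" using e by (simp add: add_nonneg_pos)
  from sg.apprE[OF sg.trig_dense[OF f] this] obtain xs where xs: "?n (\<lambda>x. f x - trig xs x) < e / (8 * (?n g + 1))" .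
  have "e / (8 * (?n (trig xs) + 1)) > 0" using e by (simp add: add_nonneg_pos)
  from sg.apprE[OF sg.trig_dense[OF g] this] obtain ys where ys: "?n (\<lambda>x. g x - trig ys x) < e / (8 * (?n (trig xs) + 1))" .
  have pos: "?n g + 1 > 0" "?n (trig xs) + 1 > 0" by (simp_all add: add_nonneg_pos)
  have "?n (\<lambda>x. f x - trig xs x) * (?n g + 1) < e / 8" using xs pos by (simp add: field_simps)
  then have 1: "?n (\<lambda>x. f x - trig xs x) * ?n g < e / 8"
    using nrm_nonneg[of std_gaussian "\<lambda>x. f x - trig xs x"] unfolding distrib_left by linarith
  have "?n (\<lambda>x. g x - trig ys x) * (?n (trig xs) + 1) < e / 8" using ys pos by (simp add: field_simps)
  then have 2: "?n (trig xs) * ?n (\<lambda>x. g x - trig ys x) < e / 8"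
    using nrm_nonneg[of std_gaussian "\<lambda>x. g x - trig ys x"] unfolding distrib_left mult.commute[of "?n (trig xs)"] by linarith
  have 3: "\<bar>(\<integral>\<omega>. f (Z \<omega>) * g (Z' \<omega>) \<partial>M) - (\<integral>\<omega>. trig xs (Z \<omega>) * trig ys (Z' \<omega>) \<partial>M)\<bar> < e / 4"
    if p: "std_pair M Z Z' R" for Z Z' and R
    using std_pair_inner_diff[OF M p f g sg.sqi_trig[of xs] sg.sqi_trig[of ys]] 1 2 by linarith
  have "e / 2 > 0" using e by simp
  from std_pair_trig_continuous[OF M this, of R0 xs ys] obtain d where d: "d > 0"
    "\<And>Z Z' R Z0 Z0'. std_pair M Z Z' R \<Longrightarrow> std_pair M Z0 Z0' R0 \<Longrightarrow> norm (R - R0) < d \<Longrightarrow>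
    \<bar>(\<integral>\<omega>. trig xs (Z \<omega>) * trig ys (Z' \<omega>) \<partial>M) - (\<integral>\<omega>. trig xs (Z0 \<omega>) * trig ys (Z0' \<omega>) \<partial>M)\<bar> < e / 2" by blast
  show ?thesis
  proof (intro exI[of _ d] conjI allI impI d(1))
    fix Z Z' R Z0 Z0' assume p: "std_pair M Z Z' R" and p0: "std_pair M Z0 Z0' R0" and n: "norm (R - R0) < d"
    show "\<bar>(\<integral>\<omega>. f (Z \<omega>) * g (Z' \<omega>) \<partial>M) - (\<integral>\<omega>. f (Z0 \<omega>) * g (Z0' \<omega>) \<partial>M)\<bar> < e"
      using 3[OF p] 3[OF p0] d(2)[OF p p0 n] by linarith
  qed
qed

text \<open>
  Expand the square: \<open>\<parallel>f(Z) - f(Z')\<parallel>\<^sup>2 = 2 (E f(Z) f(Z) - E f(Z)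
  f(Z'))\<close>, and apply continuity at the identity matrix, the cross covariance of
  \<open>(Z, Z)\<close>.
\<close>

theorem std_pair_near_identity:
  assumes M: "prob_space M" and e: "e > 0" and f: "sqi (std_gaussian :: (real^'n::finite) measure) f"
  shows "\<exists>d>0. \<forall>Z Z' R. std_pair M Z Z' R \<longrightarrow> norm (R - mat 1) < d \<longrightarrow> nrm M (\<lambda>\<omega>. f (Z \<omega>) - f (Z' \<omega>)) < e"
proof -
  have "e\<^sup>2 / 2 > 0" using e by simp
  from std_pair_continuous[OF M this f f, of "mat 1"] obtain d where d: "d > 0"
    "\<And>Z Z' R Z0 Z0'. std_pair M Z Z' R \<Longrightarrow> std_pair M Z0 Z0' (mat 1) \<Longrightarrow> norm (R - mat 1) < d \<Longrightarrow>
    \<bar>(\<integral>\<omega>. f (Z \<omega>) * f (Z' \<omega>) \<partial>M) - (\<integral>\<omega>. f (Z0 \<omega>) * f (Z0' \<omega>) \<partial>M)\<bar> < e\<^sup>2 / 2" by blast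
  show ?thesis
  proof (intro exI[of _ d] conjI allI impI d(1))
    fix Z Z' and R :: "real^'n^'n" assume p: "std_pair M Z Z' R" and n: "norm (R - mat 1) < d"
    have m: "Z \<in> borel_measurable M" using p by (simp add: std_pair_def)
    note s = std_pair_L2[OF M p f]
    have sm: "integrable M (\<lambda>\<omega>. f (Z \<omega>) * f (Z' \<omega>))" by (rule sqi_mult[OF s(1,2)])
    have "(nrm M (\<lambda>\<omega>. f (Z \<omega>) - f (Z' \<omega>)))\<^sup>2 = (\<integral>\<omega>. (f (Z \<omega>))\<^sup>2 + (f (Z' \<omega>))\<^sup>2 - 2 * (f (Z \<omega>) * f (Z' \<omega>)) \<partial>M)"
      by (simp add: nrm_sq power2_diff algebra_simps)
    also have "\<dots> = (nrm M (\<lambda>\<omega>. f (Z \<omega>)))\<^sup>2 + (nrm M (\<lambda>\<omega>. f (Z' \<omega>)))\<^sup>2 - 2 * (\<integral>\<omega>. f (Z \<omega>) * f (Z' \<omega>) \<partial>M)"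
      using sm sqiD[OF s(1)] sqiD[OF s(2)] by (simp add: nrm_sq)
    also have "\<dots> = 2 * ((\<integral>\<omega>. f (Z \<omega>) * f (Z \<omega>) \<partial>M) - (\<integral>\<omega>. f (Z \<omega>) * f (Z' \<omega>) \<partial>M))"
    proof -
      have "(nrm M (\<lambda>\<omega>. f (Z \<omega>)))\<^sup>2 = (nrm M (\<lambda>\<omega>. f (Z' \<omega>)))\<^sup>2" by (simp add: s(3,4))
      then show ?thesis unfolding nrm_sq by (simp add: power2_eq_square)
    qed
    also have "\<dots> < e\<^sup>2"
    proof -
      have "(\<integral>\<omega>. f (Z \<omega>) * f (Z \<omega>) \<partial>M) - (\<integral>\<omega>. f (Z \<omega>) * f (Z' \<omega>) \<partial>M) < e\<^sup>2 / 2"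
        using d(2)[OF p std_pair_self[OF std_pair_law(1)[OF M p] m] n] unfolding abs_less_iff by argo
      then show ?thesis by simp
    qed
    finally show "nrm M (\<lambda>\<omega>. f (Z \<omega>) - f (Z' \<omega>)) < e" using e by (simp add: power2_less_imp_less)
  qed
qed

section \<open>Functions of finitely many independent variables\<close>

text \<open>
  The \<open>\<sigma>\<close>-algebra generated by the \<open>\<epsilon> i\<close> with \<open>i
  \<in> I\<close>.
\<close>

definition fld :: "'a measure \<Rightarrow> (int \<Rightarrow> 'a \<Rightarrow> real) \<Rightarrow> int set \<Rightarrow> 'a measure" where
  "fld M \<epsilon> I = vimage_algebra (space M) (\<lambda>\<omega>. \<lambda>i\<in>I. \<epsilon> i \<omega>) (PiM I (\<lambda>_. borel))"

lemma space_fld [simp]: "space (fld M \<epsilon> I) = space M"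
  by (simp add: fld_def)

lemma fld_coord: "i \<in> I \<Longrightarrow> \<epsilon> i \<in> borel_measurable (fld M \<epsilon> I)"
proof -
  assume i: "i \<in> I"
  have "(\<lambda>\<omega>. \<lambda>i\<in>I. \<epsilon> i \<omega>) \<in> measurable (fld M \<epsilon> I) (PiM I (\<lambda>_. borel))"
    unfolding fld_def by (rule measurable_vimage_algebra1) (auto simp: space_PiM)
  from measurable_compose[OF this measurable_component_singleton[OF i]] i
  show ?thesis by simp
qed

lemma fld_mono:
  assumes "I \<subseteq> J" "X \<in> borel_measurable (fld M \<epsilon> I)"
  shows "X \<in> borel_measurable (fld M \<epsilon> J)"
proof -
  have m: "(\<lambda>\<omega>. \<lambda>i\<in>I. \<epsilon> i \<omega>) \<in> measurable (fld M \<epsilon> J) (PiM I (\<lambda>_. borel))"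
    using assms(1) by (intro measurable_restrict fld_coord) auto
  have "(\<lambda>x. x) \<in> measurable (fld M \<epsilon> J) (fld M \<epsilon> I)"
    using m unfolding fld_def[of _ _ I] by (intro measurable_vimage_algebra2) auto
  from measurable_compose[OF this assms(2)] show ?thesis by simp
qed

lemma fld_measurable:
  assumes \<epsilon>: "\<And>i. \<epsilon> i \<in> borel_measurable M" and X: "X \<in> borel_measurable (fld M \<epsilon> I)"
  shows "X \<in> borel_measurable M"
proof -
  have m: "(\<lambda>\<omega>. \<lambda>i\<in>I. \<epsilon> i \<omega>) \<in> measurable M (PiM I (\<lambda>_. borel))"
    using \<epsilon> by (intro measurable_restrict) auto
  have "(\<lambda>x. x) \<in> measurable M (fld M \<epsilon> I)"
    using m unfolding fld_def[of _ _ I] by (intro measurable_vimage_algebra2) auto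
  from measurable_compose[OF this X] show ?thesis by simp
qed

context prob_space
begin

lemma fld_indep:
  fixes X Y :: "'a \<Rightarrow> 'b::{real_normed_field, banach, second_countable_topology}"
  assumes ind: "indep_vars (\<lambda>_. borel) \<epsilon> UNIV" and IJ: "I \<inter> J = {}"
    and X: "X \<in> borel_measurable (fld M \<epsilon> I)" and Y: "Y \<in> borel_measurable (fld M \<epsilon> J)"
    and iX: "integrable M X" and iY: "integrable M Y"
  shows "expectation (\<lambda>\<omega>. X \<omega> * Y \<omega>) = expectation X * expectation Y"
proof -
  have "indep_var (PiM I (\<lambda>_. borel)) (\<lambda>\<omega>. \<lambda>i\<in>I. \<epsilon> i \<omega>) (PiM J (\<lambda>_. borel)) (\<lambda>\<omega>. \<lambda>i\<in>J. \<epsilon> i \<omega>)"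
    using indep_var_restrict[OF ind IJ] by simp
  then have iset: "indep_set (sets (fld M \<epsilon> I)) (sets (fld M \<epsilon> J))"
    unfolding indep_var_eq by (simp add: fld_def sets_vimage_algebra)
  have sub: "sigma_sets (space M) {X -` A \<inter> space M |A. A \<in> sets borel} \<subseteq> sets (fld M \<epsilon> I)"
    if "X \<in> borel_measurable (fld M \<epsilon> I)" for X :: "'a \<Rightarrow> 'b" and I
    using measurable_sets[OF that] sets.sigma_sets_subset[of "{X -` A \<inter> space M |A. A \<in> sets borel}" "fld M \<epsilon> I"]
    by auto
  have "indep_set (sigma_sets (space M) {X -` A \<inter> space M |A. A \<in> sets borel})
      (sigma_sets (space M) {Y -` A \<inter> space M |A. A \<in> sets borel})"
    using iset sub[OF X] sub[OF Y] unfolding indep_sets2_eq by blast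
  then have "indep_var borel X borel Y"
    unfolding indep_var_eq using iX iY by (auto dest: borel_measurable_integrable)
  then show ?thesis by (rule indep_var_lebesgue_integral[OF _ iX iY])
qed

text \<open>
  Variables measurable for \<open>near D k\<close> and \<open>near D l\<close> are independent
  as soon as \<open>\<bar>k - l\<bar> > 2 * D\<close>; this produces the number \<open>4 * D +
  1\<close> of relevant neighbours below.
\<close>

abbreviation near :: "nat \<Rightarrow> nat \<Rightarrow> int set" where
  "near w k \<equiv> {i. \<bar>i - int k\<bar> \<le> int w}"

lemma card_near: "card {l \<in> {1..N::nat}. \<bar>int l - int k\<bar> \<le> int w} \<le> 2 * w + 1"
proof -
  have "card {l \<in> {1..N::nat}. \<bar>int l - int k\<bar> \<le> int w} \<le> card {k - w..k + w}"
    by (rule card_mono) auto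
  then show ?thesis by simp
qed

text \<open>
  Of the covariances of \<open>e k\<close> with the other terms only the \<open>4 * D +
  1\<close> neighbouring ones can be different from zero.
\<close>

lemma local_variance:
  fixes e :: "nat \<Rightarrow> 'a \<Rightarrow> real"
  assumes ind: "indep_vars (\<lambda>_. borel) \<epsilon> UNIV"
    and m: "\<And>k. k \<in> {1..N} \<Longrightarrow> e k \<in> borel_measurable (fld M \<epsilon> (near D k))"
    and s: "\<And>k. k \<in> {1..N} \<Longrightarrow> sqi M (e k)" and z: "\<And>k. k \<in> {1..N} \<Longrightarrow> expectation (e k) = 0"
    and V: "\<And>k. k \<in> {1..N} \<Longrightarrow> expectation (\<lambda>\<omega>. (e k \<omega>)\<^sup>2) \<le> V"
  shows "expectation (\<lambda>\<omega>. (\<Sum>k=1..N. e k \<omega>)\<^sup>2) \<le> real N * real (4 * D + 1) * V"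
proof -
  have "expectation (\<lambda>\<omega>. (\<Sum>k=1..N. e k \<omega>)\<^sup>2) = (\<Sum>k=1..N. \<Sum>l=1..N. expectation (\<lambda>\<omega>. e k \<omega> * e l \<omega>))"
    unfolding power2_eq_square sum_product
    by (subst Bochner_Integration.integral_sum) (auto intro!: sum.cong Bochner_Integration.integral_sum Bochner_Integration.integrable_sum sqi_mult s)
  also have "\<dots> \<le> (\<Sum>k=1..N. real (4 * D + 1) * V)"
  proof (rule sum_mono)
    fix k assume k: "k \<in> {1..N}"
    have V0: "0 \<le> V" using V[OF k] by (rule order_trans[rotated]) simp
    have "(\<Sum>l=1..N. expectation (\<lambda>\<omega>. e k \<omega> * e l \<omega>)) \<le> (\<Sum>l=1..N. if \<bar>int l - int k\<bar> \<le> int (2 * D) then V else 0)"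
    proof (rule sum_mono)
      fix l assume l: "l \<in> {1..N}"
      show "expectation (\<lambda>\<omega>. e k \<omega> * e l \<omega>) \<le> (if \<bar>int l - int k\<bar> \<le> int (2 * D) then V else 0)"
      proof (cases "\<bar>int l - int k\<bar> \<le> int (2 * D)")
        case True
        have "\<bar>expectation (\<lambda>\<omega>. e k \<omega> * e l \<omega>)\<bar> \<le> nrm M (e k) * nrm M (e l)"
          by (rule L2_Cauchy_Schwarz[OF s[OF k] s[OF l]])
        also have "\<dots> \<le> sqrt V * sqrt V"
          unfolding nrm_def by (intro mult_mono real_sqrt_le_mono V k l) (auto simp: V0)
        finally show ?thesis using True V0 by simp
      next
        case False
        have "near D k \<inter> near D l = {}" using False by auto
        from fld_indep[OF ind this m[OF k] m[OF l] sqi_integrable[OF s[OF k]] sqi_integrable[OF s[OF l]]]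
        show ?thesis using z[OF k] False by simp
      qed
    qed
    also have "\<dots> = real (card {l \<in> {1..N}. \<bar>int l - int k\<bar> \<le> int (2 * D)}) * V"
      by (simp add: sum.If_cases Int_def)
    also have "\<dots> \<le> real (4 * D + 1) * V"
      using card_near[of N k "2 * D"] by (intro mult_right_mono V0) simp
    finally show "(\<Sum>l=1..N. expectation (\<lambda>\<omega>. e k \<omega> * e l \<omega>)) \<le> real (4 * D + 1) * V" .
  qed
  finally show ?thesis by simp
qed

lemma has_vector_derivative_mean_value_bound:
  fixes h :: "real \<Rightarrow> 'b::real_normed_vector"
  assumes d: "\<And>s. \<bar>s\<bar> \<le> \<bar>t\<bar> \<Longrightarrow> (h has_vector_derivative h' s) (at s)"
    and B: "\<And>s. \<bar>s\<bar> \<le> \<bar>t\<bar> \<Longrightarrow> norm (h' s) \<le> B"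
  shows "norm (h t - h 0) \<le> \<bar>t\<bar> * B"
proof -
  have "norm (h t - h 0) \<le> B * norm (t - 0)"
  proof (rule differentiable_bound[where S="{- \<bar>t\<bar>..\<bar>t\<bar>}" and f'="\<lambda>s x. x *\<^sub>R h' s"])
    fix s assume "s \<in> {- \<bar>t\<bar>..\<bar>t\<bar>}"
    then have s: "\<bar>s\<bar> \<le> \<bar>t\<bar>" by auto
    show "(h has_derivative (\<lambda>x. x *\<^sub>R h' s)) (at s within {- \<bar>t\<bar>..\<bar>t\<bar>})"
      using d[OF s] by (auto simp: has_vector_derivative_def intro: has_derivative_at_withinI)
    show "onorm (\<lambda>x. x *\<^sub>R h' s) \<le> B"
    proof (rule onorm_le)
      fix x show "norm (x *\<^sub>R h' s) \<le> B * norm x"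
        using mult_right_mono[OF B[OF s], of "norm x"] by (simp add: mult.commute)
    qed
  qed auto
  then show ?thesis by (simp add: mult.commute)
qed

text \<open>
  Differentiation under the expectation, with a remainder of second order since \<open>S\<close>
  is bounded.
\<close>

lemma char_has_derivative:
  assumes S: "S \<in> borel_measurable M" and b: "\<And>\<omega>. \<omega> \<in> space M \<Longrightarrow> \<bar>S \<omega>\<bar> \<le> b"
  shows "((\<lambda>t. expectation (\<lambda>\<omega>. iexp (t * S \<omega>))) has_vector_derivative
    expectation (\<lambda>\<omega>. \<i> * S \<omega> * iexp (t * S \<omega>))) (at t)"
proof -
  define \<phi> where "\<phi> t = expectation (\<lambda>\<omega>. iexp (t * S \<omega>))" for t
  define \<phi>' where "\<phi>' t = expectation (\<lambda>\<omega>. \<i> * S \<omega> * iexp (t * S \<omega>))" for t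
  have [measurable]: "S \<in> borel_measurable M" by fact
  have i1: "integrable M (\<lambda>\<omega>. iexp (t * S \<omega>))" for t
    by (rule integrable_const_bound[of _ 1]) auto
  have i2: "integrable M (\<lambda>\<omega>. \<i> * S \<omega> * iexp (t * S \<omega>))" for t
    by (rule integrable_const_bound[of _ b]) (auto simp: norm_mult b)
  have bd: "norm (\<phi> (t + h) - \<phi> t - h *\<^sub>R \<phi>' t) \<le> (b\<^sup>2 / 2) * h\<^sup>2" for h
  proof -
    have "\<phi> (t + h) - \<phi> t - h *\<^sub>R \<phi>' t
        = expectation (\<lambda>\<omega>. iexp ((t + h) * S \<omega>) - iexp (t * S \<omega>) - h *\<^sub>R (\<i> * S \<omega> * iexp (t * S \<omega>)))"
      unfolding \<phi>_def \<phi>'_def using i1[of "t + h"] i1[of t] i2[of t] by simp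
    also have "norm \<dots> \<le> (b\<^sup>2 / 2) * h\<^sup>2"
    proof (rule order_trans[OF integral_norm_bound])
      have p: "norm (iexp ((t + h) * S \<omega>) - iexp (t * S \<omega>) - h *\<^sub>R (\<i> * S \<omega> * iexp (t * S \<omega>))) \<le> (b\<^sup>2 / 2) * h\<^sup>2"
        if w: "\<omega> \<in> space M" for \<omega>
      proof -
        have "iexp ((t + h) * S \<omega>) - iexp (t * S \<omega>) - h *\<^sub>R (\<i> * S \<omega> * iexp (t * S \<omega>))
            = iexp (t * S \<omega>) * (iexp (h * S \<omega>) - (\<Sum>k\<le>1. (\<i> * (h * S \<omega>))^k / fact k))"
          by (simp add: distrib_right exp_add scaleR_conv_of_real algebra_simps)
        then have "norm (iexp ((t + h) * S \<omega>) - iexp (t * S \<omega>) - h *\<^sub>R (\<i> * S \<omega> * iexp (t * S \<omega>)))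
            = norm (iexp (h * S \<omega>) - (\<Sum>k\<le>1. (\<i> * (h * S \<omega>))^k / fact k))"
          by (simp add: norm_mult)
        also have "\<dots> \<le> \<bar>h * S \<omega>\<bar> ^ Suc 1 / fact (Suc 1)"
          using iexp_approx1[of "h * S \<omega>" 1] by simp
        also have "\<dots> = h\<^sup>2 * (\<bar>S \<omega>\<bar>\<^sup>2) / 2" by (simp add: abs_mult power2_eq_square[symmetric] power_mult_distrib)
        also have "\<dots> \<le> h\<^sup>2 * b\<^sup>2 / 2"
          using b[OF w] by (intro divide_right_mono mult_left_mono power_mono) auto
        finally show ?thesis by (simp add: mult_ac)
      qed
      have "expectation (\<lambda>\<omega>. norm (iexp ((t + h) * S \<omega>) - iexp (t * S \<omega>) - h *\<^sub>R (\<i> * S \<omega> * iexp (t * S \<omega>))))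
          \<le> expectation (\<lambda>\<omega>. (b\<^sup>2 / 2) * h\<^sup>2)"
      proof (rule integral_mono[OF integrable_norm integrable_const p])
        show "integrable M (\<lambda>\<omega>. iexp ((t + h) * S \<omega>) - iexp (t * S \<omega>) - h *\<^sub>R (\<i> * S \<omega> * iexp (t * S \<omega>)))"
          by (intro Bochner_Integration.integrable_diff integrable_scaleR_right i1 i2)
      qed
      then show "expectation (\<lambda>\<omega>. norm (iexp ((t + h) * S \<omega>) - iexp (t * S \<omega>) - h *\<^sub>R (\<i> * S \<omega> * iexp (t * S \<omega>))))
          \<le> (b\<^sup>2 / 2) * h\<^sup>2" by (simp add: prob_space)
    qed
    finally show ?thesis .
  qed
  have "((\<lambda>h. norm (\<phi> (t + h) - \<phi> t - h *\<^sub>R \<phi>' t) / norm h) \<longlongrightarrow> 0) (at 0)"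
  proof (rule Lim_null_comparison)
    show "\<forall>\<^sub>F h in at 0. norm (norm (\<phi> (t + h) - \<phi> t - h *\<^sub>R \<phi>' t) / norm h) \<le> (b\<^sup>2 / 2) * \<bar>h\<bar>"
      unfolding eventually_at_filter
    proof (rule always_eventually, intro allI impI)
      fix h :: real assume "h \<noteq> 0"
      then show "norm (norm (\<phi> (t + h) - \<phi> t - h *\<^sub>R \<phi>' t) / norm h) \<le> (b\<^sup>2 / 2) * \<bar>h\<bar>"
        using bd[of h] by (simp add: divide_le_eq power2_eq_square mult.assoc)
    qed
    show "((\<lambda>h::real. (b\<^sup>2 / 2) * \<bar>h\<bar>) \<longlongrightarrow> 0) (at 0)"
      by (intro tendsto_mult_right_zero tendsto_rabs_zero tendsto_ident_at)
  qed
  then have "(\<phi> has_vector_derivative \<phi>' t) (at t)"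
    unfolding has_vector_derivative_def has_derivative_at
    by (auto intro: bounded_linear_scaleR_left)
  then show ?thesis unfolding \<phi>_def \<phi>'_def .
qed

text \<open>
  Let \<open>\<eta> k\<close> be the part of \<open>S\<close> that comes from the neighbours of
  \<open>k\<close>. Then \<open>\<xi> k\<close> is independent of \<open>S - \<eta> k\<close>,
  so in \<open>E \<xi>\<^sub>k exp (\<i> t S)\<close> the leading term vanishes and the first
  order term is \<open>\<i> t E \<xi>\<^sub>k \<eta>\<^sub>k exp (\<i> t S)\<close>. Summing
  over \<open>k\<close> gives \<open>\<phi>'(t) \<approx> - t E T exp (\<i> t S)\<close> with
  \<open>T = \<Sum>\<^sub>k \<xi>\<^sub>k \<eta>\<^sub>k / \<surd>N\<close>. The variable
  \<open>T\<close> has mean \<open>E S\<^sup>2\<close>, and it is nearly constant because it is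
  again a normalized sum of local terms. So \<open>\<phi>' \<approx> - \<sigma>2 t
  \<phi>\<close>, and integrating \<open>exp (\<sigma>2 t\<^sup>2 / 2) \<phi>(t)\<close> yields
  the bound.
\<close>

theorem local_char_bound:
  fixes \<xi> :: "nat \<Rightarrow> 'a \<Rightarrow> real"
  assumes ind: "indep_vars (\<lambda>_. borel) \<epsilon> UNIV" and N: "N \<ge> 1"
    and m: "\<And>k. k \<in> {1..N} \<Longrightarrow> \<xi> k \<in> borel_measurable (fld M \<epsilon> (near D k))"
    and B: "\<And>k \<omega>. k \<in> {1..N} \<Longrightarrow> \<bar>\<xi> k \<omega>\<bar> \<le> B" and z: "\<And>k. k \<in> {1..N} \<Longrightarrow> expectation (\<xi> k) = 0"
  defines "S \<equiv> \<lambda>\<omega>. (\<Sum>k=1..N. \<xi> k \<omega>) / sqrt (real N)"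
  shows "norm (expectation (\<lambda>\<omega>. iexp (t * S \<omega>)) - exp (- expectation (\<lambda>\<omega>. (S \<omega>)\<^sup>2) * t\<^sup>2 / 2))
    \<le> (B ^ 3 * real (4 * D + 1) ^ 2 * \<bar>t\<bar> ^ 3 + B\<^sup>2 * real (4 * D + 1) * sqrt (real (12 * D + 1)) * t\<^sup>2) / sqrt (real N)"
proof -
  define c where "c = real (4 * D + 1)"
  define h where "h = c * B / sqrt (real N)"
  define \<sigma>2 where "\<sigma>2 = expectation (\<lambda>\<omega>. (S \<omega>)\<^sup>2)"
  define nb where "nb k = {l \<in> {1..N}. \<bar>int l - int k\<bar> \<le> int (2 * D)}" for k
  define \<eta> where "\<eta> k \<omega> = (\<Sum>l\<in>nb k. \<xi> l \<omega>) / sqrt (real N)" for k \<omega>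
  have ind_m: "\<epsilon> i \<in> borel_measurable M" for i using ind by (auto simp: indep_vars_def)
  have N0: "sqrt (real N) > 0" using N by simp
  have B0: "0 \<le> B" using B[of 1 undefined] N by (auto intro: order_trans[OF abs_ge_zero])
  have h0: "0 \<le> h" "0 \<le> c" using B0 N0 by (simp_all add: h_def c_def)
  have \<xi>m [measurable]: "\<xi> k \<in> borel_measurable M" if "k \<in> {1..N}" for k
    by (rule fld_measurable[OF ind_m m[OF that]])
  have nbs: "nb k \<subseteq> {1..N}" for k by (auto simp: nb_def)
  have \<eta>b: "\<bar>\<eta> k \<omega>\<bar> \<le> h" for k \<omega>
  proof -
    have "\<bar>\<Sum>l\<in>nb k. \<xi> l \<omega>\<bar> \<le> (\<Sum>l\<in>nb k. B)"
      using nbs[of k] by (intro order_trans[OF sum_abs] sum_mono B) auto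
    also have "\<dots> = real (card (nb k)) * B" by simp
    also have "\<dots> \<le> c * B" using card_near[of N k "2 * D"] B0
      by (intro mult_right_mono) (auto simp: c_def nb_def)
    finally show ?thesis using N0 by (simp add: \<eta>_def h_def divide_right_mono abs_divide)
  qed
  have \<eta>m [measurable]: "\<eta> k \<in> borel_measurable M" for k
    unfolding \<eta>_def using nbs[of k] by (intro borel_measurable_divide borel_measurable_sum) auto
  have Sm [measurable]: "S \<in> borel_measurable M"
    unfolding S_def by (intro borel_measurable_divide borel_measurable_sum) auto
  have Sb: "\<bar>S \<omega>\<bar> \<le> real N * B / sqrt (real N)" for \<omega>
  proof -
    have "\<bar>\<Sum>k=1..N. \<xi> k \<omega>\<bar> \<le> (\<Sum>k=1..N. B)"
      by (intro order_trans[OF sum_abs] sum_mono B) auto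
    then show ?thesis using N0 by (simp add: S_def divide_right_mono abs_divide)
  qed
  \<comment> \<open>removing the neighbours of \<open>k\<close> leaves a variable independent of \<open>\<xi> k\<close>\<close>
  have rest: "(\<lambda>\<omega>. S \<omega> - \<eta> k \<omega>) \<in> borel_measurable (fld M \<epsilon> (- near D k))" if k: "k \<in> {1..N}" for k
  proof -
    have eq: "(\<lambda>\<omega>. S \<omega> - \<eta> k \<omega>) = (\<lambda>\<omega>. (\<Sum>l\<in>{1..N} - nb k. \<xi> l \<omega>) / sqrt (real N))"
      using nbs[of k] by (simp add: S_def \<eta>_def diff_divide_distrib sum_diff)
    have "\<xi> l \<in> borel_measurable (fld M \<epsilon> (- near D k))" if l: "l \<in> {1..N} - nb k" for l
      by (rule fld_mono[OF _ m]) (use l in \<open>auto simp: nb_def\<close>)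
    then show ?thesis unfolding eq by (intro borel_measurable_divide borel_measurable_sum) auto
  qed
  have dis: "near D k \<inter> - near D k = {}" for k by auto
  have E0: "expectation (\<lambda>\<omega>. of_real (\<xi> k \<omega>) * iexp (t * (S \<omega> - \<eta> k \<omega>))) = 0" if k: "k \<in> {1..N}" for k t
  proof -
    have r [measurable]: "(\<lambda>\<omega>. S \<omega> - \<eta> k \<omega>) \<in> borel_measurable (fld M \<epsilon> (- near D k))" by (rule rest[OF k])
    have "expectation (\<lambda>\<omega>. of_real (\<xi> k \<omega>) * iexp (t * (S \<omega> - \<eta> k \<omega>)))
        = expectation (\<lambda>\<omega>. complex_of_real (\<xi> k \<omega>)) * expectation (\<lambda>\<omega>. iexp (t * (S \<omega> - \<eta> k \<omega>)))"
    proof (rule fld_indep[OF ind dis])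
      show "(\<lambda>\<omega>. complex_of_real (\<xi> k \<omega>)) \<in> borel_measurable (fld M \<epsilon> (near D k))"
        using m[OF k] by measurable
      show "(\<lambda>\<omega>. iexp (t * (S \<omega> - \<eta> k \<omega>))) \<in> borel_measurable (fld M \<epsilon> (- near D k))" by measurable
      show "integrable M (\<lambda>\<omega>. complex_of_real (\<xi> k \<omega>))"
        by (rule integrable_const_bound[of _ B]) (use B[OF k] k in auto)
      show "integrable M (\<lambda>\<omega>. iexp (t * (S \<omega> - \<eta> k \<omega>)))"
        by (rule integrable_const_bound[of _ 1]) auto
    qed
    then show ?thesis using z[OF k] by (simp add: integral_complex_of_real)
  qed
  have E1: "expectation (\<lambda>\<omega>. \<xi> k \<omega> * (S \<omega> - \<eta> k \<omega>)) = 0" if k: "k \<in> {1..N}" for k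
  proof -
    have "expectation (\<lambda>\<omega>. \<xi> k \<omega> * (S \<omega> - \<eta> k \<omega>)) = expectation (\<xi> k) * expectation (\<lambda>\<omega>. S \<omega> - \<eta> k \<omega>)"
    proof (rule fld_indep[OF ind dis m[OF k] rest[OF k]])
      show "integrable M (\<xi> k)" by (rule integrable_const_bound[of _ B]) (use B[OF k] k in auto)
      show "integrable M (\<lambda>\<omega>. S \<omega> - \<eta> k \<omega>)"
        by (rule integrable_const_bound[of _ "real N * B / sqrt (real N) + h"])
          (use Sb \<eta>b in \<open>auto intro!: AE_I2 order_trans[OF abs_triangle_ineq4] add_mono\<close>)
    qed
    then show ?thesis using z[OF k] by simp
  qed
  define T where "T \<omega> = (\<Sum>k=1..N. \<xi> k \<omega> * \<eta> k \<omega>) / sqrt (real N)" for \<omega>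
  have p_b: "\<bar>\<xi> k \<omega> * \<eta> k \<omega>\<bar> \<le> B * h" if "k \<in> {1..N}" for k \<omega>
    unfolding abs_mult by (intro mult_mono B that \<eta>b) (auto simp: B0)
  have p_s: "sqi M (\<lambda>\<omega>. \<xi> k \<omega> * \<eta> k \<omega>)" if "k \<in> {1..N}" for k
    by (rule sqi_bounded[of _ "B * h"]) (use p_b that in auto)
  have p_i: "integrable M (\<lambda>\<omega>. \<xi> k \<omega> * \<eta> k \<omega>)" if "k \<in> {1..N}" for k
    by (rule sqi_integrable[OF p_s[OF that]])
  have Tm [measurable]: "T \<in> borel_measurable M"
    unfolding T_def by (intro borel_measurable_divide borel_measurable_sum borel_measurable_times) auto
  have Ti: "integrable M T" unfolding T_def divide_inverse
    by (intro integrable_mult_left Bochner_Integration.integrable_sum p_i)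
  have ET: "expectation T = \<sigma>2"
  proof -
    have SS: "(\<lambda>\<omega>. (S \<omega>)\<^sup>2) = (\<lambda>\<omega>. (\<Sum>k=1..N. \<xi> k \<omega> * S \<omega>) / sqrt (real N))"
      unfolding sum_distrib_right[symmetric] by (auto simp: S_def power2_eq_square)
    have i: "integrable M (\<lambda>\<omega>. \<xi> k \<omega> * S \<omega>)" if "k \<in> {1..N}" for k
      by (rule sqi_mult; rule sqi_bounded) (use B that Sb in auto)
    have "\<sigma>2 = (\<Sum>k=1..N. expectation (\<lambda>\<omega>. \<xi> k \<omega> * S \<omega>)) / sqrt (real N)"
      unfolding \<sigma>2_def SS by (simp add: i Bochner_Integration.integral_sum)
    also have "\<dots> = (\<Sum>k=1..N. expectation (\<lambda>\<omega>. \<xi> k \<omega> * \<eta> k \<omega>)) / sqrt (real N)"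
    proof (intro arg_cong2[where f="(/)"] sum.cong refl)
      fix k assume k: "k \<in> {1..N}"
      show "expectation (\<lambda>\<omega>. \<xi> k \<omega> * S \<omega>) = expectation (\<lambda>\<omega>. \<xi> k \<omega> * \<eta> k \<omega>)"
        using E1[OF k] i[OF k] p_i[OF k] by (simp add: right_diff_distrib)
    qed
    also have "\<dots> = expectation T" unfolding T_def by (simp add: p_i Bochner_Integration.integral_sum)
    finally show ?thesis ..
  qed
  \<comment> \<open>\<open>\<xi> k * \<eta> k\<close> depends on the noise within distance \<open>3 * D\<close> of \<open>k\<close>, whence \<open>12 * D + 1\<close>\<close>
  have VT: "nrm M (\<lambda>\<omega>. T \<omega> - \<sigma>2) \<le> sqrt (real (12 * D + 1)) * (B * h)"
  proof -
    define e where "e k \<omega> = \<xi> k \<omega> * \<eta> k \<omega> - expectation (\<lambda>\<omega>. \<xi> k \<omega> * \<eta> k \<omega>)" for k \<omega>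
    have "expectation (\<lambda>\<omega>. (\<Sum>k=1..N. e k \<omega>)\<^sup>2) \<le> real N * real (4 * (3 * D) + 1) * (B * h)\<^sup>2"
    proof (rule local_variance[OF ind])
      fix k assume k: "k \<in> {1..N}"
      have "\<xi> l \<in> borel_measurable (fld M \<epsilon> (near (3 * D) k))" if "l \<in> nb k" for l
        by (rule fld_mono[OF _ m]) (use that in \<open>auto simp: nb_def\<close>)
      then have [measurable]: "\<eta> k \<in> borel_measurable (fld M \<epsilon> (near (3 * D) k))"
        unfolding \<eta>_def by (intro borel_measurable_divide borel_measurable_sum) auto
      have [measurable]: "\<xi> k \<in> borel_measurable (fld M \<epsilon> (near (3 * D) k))"
        by (rule fld_mono[OF _ m]) (use k in auto)
      show "e k \<in> borel_measurable (fld M \<epsilon> (near (3 * D) k))" unfolding e_def by measurable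
      show "sqi M (e k)" unfolding e_def by (intro sqi_diff p_s k sqi_bounded[OF _ order_refl]) auto
      show "expectation (e k) = 0" unfolding e_def using p_i[OF k] by (simp add: prob_space)
      have "expectation (\<lambda>\<omega>. (e k \<omega>)\<^sup>2) = variance (\<lambda>\<omega>. \<xi> k \<omega> * \<eta> k \<omega>)" by (simp add: e_def)
      also have "\<dots> = expectation (\<lambda>\<omega>. (\<xi> k \<omega> * \<eta> k \<omega>)\<^sup>2) - (expectation (\<lambda>\<omega>. \<xi> k \<omega> * \<eta> k \<omega>))\<^sup>2"
        using p_s[OF k] by (intro variance_eq p_i k) (auto simp: sqi_def)
      also have "\<dots> \<le> expectation (\<lambda>\<omega>. (\<xi> k \<omega> * \<eta> k \<omega>)\<^sup>2)" by simp
      also have "\<dots> \<le> expectation (\<lambda>\<omega>. (B * h)\<^sup>2)"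
        using p_s[OF k] p_b[OF k] B0 h0 by (intro integral_mono) (auto simp: sqi_def abs_le_square_iff[symmetric])
      finally show "expectation (\<lambda>\<omega>. (e k \<omega>)\<^sup>2) \<le> (B * h)\<^sup>2" by (simp add: prob_space)
    qed
    moreover have "T \<omega> - \<sigma>2 = (\<Sum>k=1..N. e k \<omega>) / sqrt (real N)" for \<omega>
      unfolding ET[symmetric] T_def e_def
      by (simp add: p_i Bochner_Integration.integral_sum sum_subtractf diff_divide_distrib)
    ultimately have "(nrm M (\<lambda>\<omega>. T \<omega> - \<sigma>2))\<^sup>2 \<le> real (12 * D + 1) * (B * h)\<^sup>2"
      using N by (simp add: nrm_sq power_divide divide_le_eq mult_ac)
    then have "sqrt ((nrm M (\<lambda>\<omega>. T \<omega> - \<sigma>2))\<^sup>2) \<le> sqrt (real (12 * D + 1) * (B * h)\<^sup>2)"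
      by (rule real_sqrt_le_mono)
    then show ?thesis using B0 h0 by (simp add: real_sqrt_mult del: of_nat_add of_nat_mult)
  qed
  define \<phi> where "\<phi> t = expectation (\<lambda>\<omega>. iexp (t * S \<omega>))" for t
  define \<phi>' where "\<phi>' t = expectation (\<lambda>\<omega>. \<i> * S \<omega> * iexp (t * S \<omega>))" for t
  have \<phi>d: "(\<phi> has_vector_derivative \<phi>' t) (at t)" for t
    unfolding \<phi>_def \<phi>'_def by (rule char_has_derivative) (auto intro: Sb)
  have ie: "integrable M (\<lambda>\<omega>. of_real (g \<omega>) * iexp (t * S \<omega>))"
    if [measurable]: "g \<in> borel_measurable M" and "\<And>\<omega>. \<bar>g \<omega>\<bar> \<le> b" for g b t
    by (rule integrable_const_bound[of _ b]) (use that in \<open>auto simp: norm_mult\<close>)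
  have main: "norm (\<phi>' t + of_real (\<sigma>2 * t) * \<phi> t)
      \<le> sqrt (real N) * B * (t\<^sup>2 * h\<^sup>2 / 2) + \<bar>t\<bar> * (sqrt (real (12 * D + 1)) * (B * h))" for t
  proof -
    define r where "r k \<omega> = iexp (t * S \<omega>) - iexp (t * (S \<omega> - \<eta> k \<omega>)) - \<i> * (t * \<eta> k \<omega>) * iexp (t * S \<omega>)" for k \<omega>
    have r: "norm (r k \<omega>) \<le> t\<^sup>2 * h\<^sup>2 / 2" for k \<omega>
    proof -
      have "r k \<omega> = - iexp (t * S \<omega>) * (iexp (- t * \<eta> k \<omega>) - (\<Sum>j\<le>1. (\<i> * (- t * \<eta> k \<omega>))^j / fact j))"
        by (simp add: r_def algebra_simps exp_diff exp_minus divide_inverse)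
      then have "norm (r k \<omega>) = norm (iexp (- t * \<eta> k \<omega>) - (\<Sum>j\<le>1. (\<i> * (- t * \<eta> k \<omega>))^j / fact j))"
        by (simp only: norm_mult norm_minus_cancel norm_exp_i_times mult_1_left)
      also have "\<dots> \<le> \<bar>- t * \<eta> k \<omega>\<bar> ^ Suc 1 / fact (Suc 1)"
        using iexp_approx1[of "- t * \<eta> k \<omega>" 1] by simp
      also have "\<dots> = t\<^sup>2 * \<bar>\<eta> k \<omega>\<bar>\<^sup>2 / 2" by (simp add: power2_eq_square[symmetric] power_mult_distrib)
      also have "\<dots> \<le> t\<^sup>2 * h\<^sup>2 / 2"
        using \<eta>b[of k \<omega>] by (intro divide_right_mono mult_left_mono power_mono) auto
      finally show ?thesis .
    qed
    have rm [measurable]: "r k \<in> borel_measurable M" for k unfolding r_def by measurable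
    have step: "norm (expectation (\<lambda>\<omega>. of_real (\<xi> k \<omega>) * iexp (t * S \<omega>))
        - \<i> * t * expectation (\<lambda>\<omega>. of_real (\<xi> k \<omega> * \<eta> k \<omega>) * iexp (t * S \<omega>))) \<le> B * (t\<^sup>2 * h\<^sup>2 / 2)"
      if k: "k \<in> {1..N}" for k
    proof -
      have [measurable]: "\<xi> k \<in> borel_measurable M" by (rule \<xi>m[OF k])
      have i1: "integrable M (\<lambda>\<omega>. of_real (\<xi> k \<omega>) * iexp (t * S \<omega>))" by (rule ie[of _ B]) (use B k in auto)
      have i2: "integrable M (\<lambda>\<omega>. of_real (\<xi> k \<omega> * \<eta> k \<omega>) * iexp (t * S \<omega>))" by (rule ie[of _ "B * h"]) (use p_b k in auto)
      have i3: "integrable M (\<lambda>\<omega>. of_real (\<xi> k \<omega>) * iexp (t * (S \<omega> - \<eta> k \<omega>)))"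
        by (rule integrable_const_bound[of _ B]) (use B[OF k] in \<open>auto simp: norm_mult\<close>)
      have rb: "norm (of_real (\<xi> k \<omega>) * r k \<omega>) \<le> B * (t\<^sup>2 * h\<^sup>2 / 2)" for \<omega>
        unfolding norm_mult using B[OF k] r B0 by (intro mult_mono) auto
      have i4: "integrable M (\<lambda>\<omega>. of_real (\<xi> k \<omega>) * r k \<omega>)"
        by (rule integrable_const_bound[OF AE_I2[OF rb]]) measurable
      have eq: "of_real (\<xi> k \<omega>) * iexp (t * S \<omega>) = of_real (\<xi> k \<omega>) * iexp (t * (S \<omega> - \<eta> k \<omega>))
          + \<i> * t * (of_real (\<xi> k \<omega> * \<eta> k \<omega>) * iexp (t * S \<omega>)) + of_real (\<xi> k \<omega>) * r k \<omega>" for \<omega>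
        by (simp add: r_def algebra_simps)
      have "expectation (\<lambda>\<omega>. of_real (\<xi> k \<omega>) * iexp (t * S \<omega>))
          = expectation (\<lambda>\<omega>. of_real (\<xi> k \<omega>) * iexp (t * (S \<omega> - \<eta> k \<omega>)))
            + \<i> * t * expectation (\<lambda>\<omega>. of_real (\<xi> k \<omega> * \<eta> k \<omega>) * iexp (t * S \<omega>))
            + expectation (\<lambda>\<omega>. of_real (\<xi> k \<omega>) * r k \<omega>)"
        unfolding eq using i2 i3 i4
        by (simp only: Bochner_Integration.integral_add integral_mult_right_zero
            Bochner_Integration.integrable_add integrable_mult_right)
      then have "norm (expectation (\<lambda>\<omega>. of_real (\<xi> k \<omega>) * iexp (t * S \<omega>))
        - \<i> * t * expectation (\<lambda>\<omega>. of_real (\<xi> k \<omega> * \<eta> k \<omega>) * iexp (t * S \<omega>)))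
        = norm (expectation (\<lambda>\<omega>. of_real (\<xi> k \<omega>) * r k \<omega>))"
        using E0[OF k, of t] by simp
      also have "\<dots> \<le> expectation (\<lambda>\<omega>. norm (of_real (\<xi> k \<omega>) * r k \<omega>))" by (rule integral_norm_bound)
      also have "\<dots> \<le> expectation (\<lambda>\<omega>. B * (t\<^sup>2 * h\<^sup>2 / 2))"
      proof (rule integral_mono)
        show "norm (of_real (\<xi> k \<omega>) * r k \<omega>) \<le> B * (t\<^sup>2 * h\<^sup>2 / 2)" for \<omega> by (rule rb)
      qed (use i4 in auto)
      finally show ?thesis by (simp add: prob_space)
    qed
    have sN: "complex_of_real (sqrt (real N)) \<noteq> 0" using N0 by simp
    have A: "\<phi>' t = (\<Sum>k=1..N. \<i> * expectation (\<lambda>\<omega>. of_real (\<xi> k \<omega>) * iexp (t * S \<omega>))) / sqrt (real N)"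
    proof -
      have "\<i> * S \<omega> * iexp (t * S \<omega>) = (\<Sum>k=1..N. \<i> * (of_real (\<xi> k \<omega>) * iexp (t * S \<omega>))) / sqrt (real N)" for \<omega>
        unfolding sum_distrib_left[symmetric] sum_distrib_right[symmetric]
        by (simp add: S_def)
      moreover have "integrable M (\<lambda>\<omega>. of_real (\<xi> k \<omega>) * iexp (t * S \<omega>))" if "k \<in> {1..N}" for k
        by (rule ie[of _ B]) (use B that in auto)
      ultimately show ?thesis unfolding \<phi>'_def
        by (simp add: Bochner_Integration.integral_sum)
    qed
    have C: "expectation (\<lambda>\<omega>. of_real (T \<omega>) * iexp (t * S \<omega>))
        = (\<Sum>k=1..N. expectation (\<lambda>\<omega>. of_real (\<xi> k \<omega> * \<eta> k \<omega>) * iexp (t * S \<omega>))) / sqrt (real N)"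
    proof -
      have "of_real (T \<omega>) * iexp (t * S \<omega>) = (\<Sum>k=1..N. of_real (\<xi> k \<omega> * \<eta> k \<omega>) * iexp (t * S \<omega>)) / sqrt (real N)" for \<omega>
        unfolding sum_distrib_right[symmetric] by (simp add: T_def)
      moreover have "integrable M (\<lambda>\<omega>. of_real (\<xi> k \<omega> * \<eta> k \<omega>) * iexp (t * S \<omega>))" if "k \<in> {1..N}" for k
        by (rule ie[of _ "B * h"]) (use p_b that in auto)
      ultimately show ?thesis by (simp add: Bochner_Integration.integral_sum)
    qed
    have "norm (\<phi>' t + t * expectation (\<lambda>\<omega>. of_real (T \<omega>) * iexp (t * S \<omega>))) \<le> sqrt (real N) * B * (t\<^sup>2 * h\<^sup>2 / 2)"
    proof -
      have eq: "\<phi>' t + t * expectation (\<lambda>\<omega>. of_real (T \<omega>) * iexp (t * S \<omega>))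
        = \<i> * (\<Sum>k=1..N. expectation (\<lambda>\<omega>. of_real (\<xi> k \<omega>) * iexp (t * S \<omega>))
        - \<i> * t * expectation (\<lambda>\<omega>. of_real (\<xi> k \<omega> * \<eta> k \<omega>) * iexp (t * S \<omega>))) / sqrt (real N)"
        unfolding A C by (simp add: sum_subtractf sum_distrib_left[symmetric] algebra_simps add_divide_distrib)
      have "norm (\<phi>' t + t * expectation (\<lambda>\<omega>. of_real (T \<omega>) * iexp (t * S \<omega>)))
        = norm (\<Sum>k=1..N. expectation (\<lambda>\<omega>. of_real (\<xi> k \<omega>) * iexp (t * S \<omega>))
        - \<i> * t * expectation (\<lambda>\<omega>. of_real (\<xi> k \<omega> * \<eta> k \<omega>) * iexp (t * S \<omega>))) / sqrt (real N)"
        unfolding eq norm_divide norm_mult by simp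
      also have "\<dots> \<le> (\<Sum>k=1..N. B * (t\<^sup>2 * h\<^sup>2 / 2)) / sqrt (real N)"
        by (intro divide_right_mono sum_norm_le step) auto
      also have "\<dots> = sqrt (real N) * B * (t\<^sup>2 * h\<^sup>2 / 2)" using N0 by (simp add: field_simps)
      finally show ?thesis .
    qed
    moreover have "norm (t * expectation (\<lambda>\<omega>. of_real (T \<omega>) * iexp (t * S \<omega>)) - of_real (\<sigma>2 * t) * \<phi> t)
        \<le> \<bar>t\<bar> * (sqrt (real (12 * D + 1)) * (B * h))"
    proof -
      have iT: "integrable M (\<lambda>\<omega>. of_real (T \<omega>) * iexp (t * S \<omega>))"
      proof (rule ie[of _ "(\<Sum>k=1..N. B * h) / sqrt (real N)"])
        show "\<bar>T \<omega>\<bar> \<le> (\<Sum>k=1..N. B * h) / sqrt (real N)" for \<omega>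
          unfolding T_def abs_divide using N0
          by (intro divide_mono order_trans[OF sum_abs] sum_mono p_b) (auto intro!: sum_nonneg simp: B0 h0)
      qed measurable
      have i1: "integrable M (\<lambda>\<omega>. iexp (t * S \<omega>))" by (rule integrable_const_bound[of _ 1]) auto
      have eq: "t * expectation (\<lambda>\<omega>. of_real (T \<omega>) * iexp (t * S \<omega>)) - of_real (\<sigma>2 * t) * \<phi> t
          = t * expectation (\<lambda>\<omega>. of_real (T \<omega> - \<sigma>2) * iexp (t * S \<omega>))"
        unfolding \<phi>_def using iT i1 by (simp add: left_diff_distrib right_diff_distrib)
      have "norm (t * expectation (\<lambda>\<omega>. of_real (T \<omega>) * iexp (t * S \<omega>)) - of_real (\<sigma>2 * t) * \<phi> t)
          = \<bar>t\<bar> * norm (expectation (\<lambda>\<omega>. of_real (T \<omega> - \<sigma>2) * iexp (t * S \<omega>)))"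
        unfolding eq norm_mult norm_of_real ..
      also have "\<dots> \<le> \<bar>t\<bar> * expectation (\<lambda>\<omega>. norm (of_real (T \<omega> - \<sigma>2) * iexp (t * S \<omega>)))"
        by (intro mult_left_mono integral_norm_bound) simp
      also have "\<dots> = \<bar>t\<bar> * expectation (\<lambda>\<omega>. \<bar>T \<omega> - \<sigma>2\<bar>)"
        by (simp add: norm_mult del: of_real_diff)
      also have "\<dots> \<le> \<bar>t\<bar> * nrm M (\<lambda>\<omega>. T \<omega> - \<sigma>2)"
      proof (intro mult_left_mono L1_le_nrm)
        have "sqi M T" unfolding T_def divide_inverse
          using sqi_cmult[OF sqi_sum[of "{1..N}" M "\<lambda>k \<omega>. \<xi> k \<omega> * \<eta> k \<omega>", OF p_s], of "inverse (sqrt (real N))"] by (simp add: mult.commute)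
        then show "sqi M (\<lambda>\<omega>. T \<omega> - \<sigma>2)" by (intro sqi_diff sqi_bounded[OF _ order_refl]) auto
      qed simp
      also have "\<dots> \<le> \<bar>t\<bar> * (sqrt (real (12 * D + 1)) * (B * h))" by (intro mult_left_mono VT) simp
      finally show ?thesis .
    qed
    ultimately show ?thesis
      using norm_triangle_ineq[of "\<phi>' t + t * expectation (\<lambda>\<omega>. of_real (T \<omega>) * iexp (t * S \<omega>))"
        "- (t * expectation (\<lambda>\<omega>. of_real (T \<omega>) * iexp (t * S \<omega>)) - of_real (\<sigma>2 * t) * \<phi> t)"]
      by (simp only: norm_minus_cancel) (simp add: algebra_simps)
  qed
  have \<sigma>0: "0 \<le> \<sigma>2" by (simp add: \<sigma>2_def)
  define b where "b t = sqrt (real N) * B * (t\<^sup>2 * h\<^sup>2 / 2) + \<bar>t\<bar> * (sqrt (real (12 * D + 1)) * (B * h))" for t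
  \<comment> \<open>the integrating factor of the limiting differential equation\<close>
  define H where "H t = of_real (exp (\<sigma>2 * t\<^sup>2 / 2)) * \<phi> t" for t
  have Hd: "(H has_vector_derivative of_real (exp (\<sigma>2 * s\<^sup>2 / 2)) * (\<phi>' s + of_real (\<sigma>2 * s) * \<phi> s)) (at s)" for s
  proof -
    have "((\<lambda>t. exp (\<sigma>2 * t\<^sup>2 / 2)) has_real_derivative \<sigma>2 * s * exp (\<sigma>2 * s\<^sup>2 / 2)) (at s)"
      by (auto intro!: derivative_eq_intros)
    then have "((\<lambda>t. complex_of_real (exp (\<sigma>2 * t\<^sup>2 / 2))) has_vector_derivative of_real (\<sigma>2 * s * exp (\<sigma>2 * s\<^sup>2 / 2))) (at s)"
      by (intro has_vector_derivative_of_real) (simp add: has_real_derivative_iff_has_vector_derivative)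
    from has_vector_derivative_mult[OF this \<phi>d[of s]]
    show ?thesis unfolding H_def by (simp add: algebra_simps)
  qed
  have "norm (H t - H 0) \<le> \<bar>t\<bar> * (exp (\<sigma>2 * t\<^sup>2 / 2) * b t)"
  proof (rule has_vector_derivative_mean_value_bound[OF Hd])
    fix s assume s: "\<bar>s\<bar> \<le> \<bar>t\<bar>"
    then have s2: "s\<^sup>2 \<le> t\<^sup>2" by (simp add: abs_le_square_iff)
    have "b s \<le> b t" unfolding b_def using s s2 B0 h0 N0
      by (intro add_mono mult_left_mono mult_right_mono divide_right_mono) auto
    moreover have "exp (\<sigma>2 * s\<^sup>2 / 2) \<le> exp (\<sigma>2 * t\<^sup>2 / 2)" using s2 \<sigma>0 by (simp add: mult_left_mono)
    moreover have "norm (\<phi>' s + of_real (\<sigma>2 * s) * \<phi> s) \<le> b s" unfolding b_def by (rule main)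
    ultimately show "norm (of_real (exp (\<sigma>2 * s\<^sup>2 / 2)) * (\<phi>' s + of_real (\<sigma>2 * s) * \<phi> s)) \<le> exp (\<sigma>2 * t\<^sup>2 / 2) * b t"
      unfolding norm_mult by (intro mult_mono) auto
  qed
  moreover have "H 0 = 1" by (simp add: H_def \<phi>_def prob_space)
  moreover have "\<phi> t - exp (- \<sigma>2 * t\<^sup>2 / 2) = of_real (exp (- \<sigma>2 * t\<^sup>2 / 2)) * (H t - 1)"
  proof -
    have "of_real (exp (- \<sigma>2 * t\<^sup>2 / 2)) * H t = of_real (exp (- \<sigma>2 * t\<^sup>2 / 2) * exp (\<sigma>2 * t\<^sup>2 / 2)) * \<phi> t"
      by (simp only: H_def of_real_mult mult.assoc)
    also have "exp (- \<sigma>2 * t\<^sup>2 / 2) * exp (\<sigma>2 * t\<^sup>2 / 2) = 1" by (simp add: exp_add[symmetric])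
    finally show ?thesis by (simp only: right_diff_distrib of_real_1 mult_1_left mult_1_right)
  qed
  ultimately have "norm (\<phi> t - exp (- \<sigma>2 * t\<^sup>2 / 2)) \<le> exp (- \<sigma>2 * t\<^sup>2 / 2) * (\<bar>t\<bar> * (exp (\<sigma>2 * t\<^sup>2 / 2) * b t))"
    by (simp only: norm_mult norm_of_real abs_exp_cancel) (intro mult_left_mono; simp)
  also have "\<dots> = \<bar>t\<bar> * b t * (exp (- \<sigma>2 * t\<^sup>2 / 2) * exp (\<sigma>2 * t\<^sup>2 / 2))" by (simp only: mult_ac)
  also have "\<dots> = \<bar>t\<bar> * b t" by (simp add: exp_add[symmetric])
  also have "\<bar>t\<bar> * b t \<le> (B ^ 3 * c ^ 2 * \<bar>t\<bar> ^ 3 + B\<^sup>2 * c * sqrt (real (12 * D + 1)) * t\<^sup>2) / sqrt (real N)"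
  proof -
    have bt: "b t = (B ^ 3 * c ^ 2 * t\<^sup>2 / 2 + B\<^sup>2 * c * sqrt (real (12 * D + 1)) * \<bar>t\<bar>) / sqrt (real N)"
    proof -
      have "sqrt (real N) * B * (t\<^sup>2 * h\<^sup>2 / 2) = B ^ 3 * c ^ 2 * t\<^sup>2 / 2 / sqrt (real N)"
        using N0 N by (simp add: h_def power_divide field_simps power2_eq_square power3_eq_cube)
      then show ?thesis unfolding b_def
        by (simp add: h_def add_divide_distrib power2_eq_square mult_ac)
    qed
    have t2: "t\<^sup>2 = \<bar>t\<bar> * \<bar>t\<bar>" by (simp add: power2_eq_square)
    have "\<bar>t\<bar> * (B ^ 3 * c ^ 2 * t\<^sup>2 / 2 + B\<^sup>2 * c * sqrt (real (12 * D + 1)) * \<bar>t\<bar>)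
      = B ^ 3 * c ^ 2 * \<bar>t\<bar> ^ 3 / 2 + B\<^sup>2 * c * sqrt (real (12 * D + 1)) * t\<^sup>2"
      unfolding t2 power3_eq_cube by (simp only: distrib_left mult_ac times_divide_eq_right)
    also have "\<dots> \<le> B ^ 3 * c ^ 2 * \<bar>t\<bar> ^ 3 + B\<^sup>2 * c * sqrt (real (12 * D + 1)) * t\<^sup>2"
      using B0 h0 by simp
    finally show ?thesis unfolding bt using N0 by (simp only: times_divide_eq_right divide_right_mono less_imp_le)
  qed
  finally show ?thesis unfolding \<phi>_def \<sigma>2_def c_def by simp
qed

end

section \<open>Square roots of positive definite matrices\<close>

lemma sym_inner:
  fixes A :: "real^'n^'n::finite"
  assumes "transpose A = A"
  shows "x \<bullet> (A *v y) = (A *v x) \<bullet> y"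
  using dot_lmul_matrix[of x A y] assms by (metis transpose_matrix_vector)

lemma sym_from_inner:
  fixes A :: "real^'n^'n::finite"
  assumes "\<And>x y. x \<bullet> (A *v y) = (A *v x) \<bullet> y"
  shows "transpose A = A"
proof -
  have e: "axis i 1 \<bullet> (A *v axis j 1) = A $ i $ j" for i j
    by (simp add: inner_axis' matrix_vector_mult_basis column_def)
  have "A $ i $ j = A $ j $ i" for i j
    using assms[of "axis i 1" "axis j 1"] e[of i j] e[of j i] by (simp add: inner_commute)
  then show ?thesis by (simp add: transpose_def vec_eq_iff)
qed

lemma psd_Cauchy_Schwarz:
  fixes A :: "real^'n^'n::finite"
  assumes sym: "transpose A = A" and psd: "\<And>x. 0 \<le> x \<bullet> (A *v x)"
  shows "(x \<bullet> (A *v y))\<^sup>2 \<le> (x \<bullet> (A *v x)) * (y \<bullet> (A *v y))"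
proof -
  define a b c where "a = x \<bullet> (A *v x)" and "b = y \<bullet> (A *v y)" and "c = x \<bullet> (A *v y)"
  have yx: "y \<bullet> (A *v x) = c" using sym_inner[OF sym, of y x] by (simp add: c_def inner_commute)
  have q: "0 \<le> a - 2 * t * c + t\<^sup>2 * b" for t
  proof -
    have "0 \<le> (x - t *\<^sub>R y) \<bullet> (A *v (x - t *\<^sub>R y))" by (rule psd)
    also have "\<dots> = a - 2 * t * c + t\<^sup>2 * b"
      using yx by (simp add: a_def b_def c_def[symmetric] matrix_vector_mult_diff_distrib inner_diff_left inner_diff_right
          matrix_vector_mult_scaleR power2_eq_square algebra_simps)
    finally show ?thesis .
  qed
  have "0 \<le> a" "0 \<le> b" unfolding a_def b_def by (rule psd)+
  have "c\<^sup>2 \<le> a * b"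
  proof (cases "b = 0")
    case True
    have "c = 0"
    proof (rule ccontr)
      assume "c \<noteq> 0"
      then show False using q[of "(a + 1) / (2 * c)"] True by simp
    qed
    then show ?thesis using True by simp
  next
    case False
    then have "b > 0" using \<open>0 \<le> b\<close> by simp
    then show ?thesis using q[of "c / b"] by (simp add: field_simps power2_eq_square)
  qed
  then show ?thesis by (simp add: a_def b_def c_def)
qed

text \<open>
  Positive definiteness with a lower bound on the spectrum, in a form that allows perturbation
  and needs no eigenvalues.
\<close>

definition posdef :: "real \<Rightarrow> real^'n^'n::finite \<Rightarrow> bool" where
  "posdef c A \<longleftrightarrow> 0 < c \<and> transpose A = A \<and> (\<forall>x. c * (norm x)\<^sup>2 \<le> x \<bullet> (A *v x))"

text \<open>
  With \<open>C\<close> above the spectrum, \<open>T = 1 - A / C\<close> has norm at most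
  \<open>t = 1 - c / C < 1\<close>, and \<open>(1 - S)\<^sup>2 = 1 - T\<close> means \<open>S =
  (T + S\<^sup>2) / 2\<close>. This is a fixed point equation for a contraction of the symmetric
  operators of norm at most \<open>r = 1 - \<surd>(c / C)\<close>; the radius is the fixed point
  of the corresponding scalar equation, so the lower bound for \<open>1 - S\<close> is the sharp
  one.
\<close>

lemma posdef_sqrt_exists:
  fixes A :: "real^'n^'n::finite"
  assumes A: "posdef c A"
  shows "\<exists>B. posdef (sqrt c) B \<and> B ** B = A"
proof -
  have c: "0 < c" and sym: "transpose A = A" and lo: "\<And>x. c * (norm x)\<^sup>2 \<le> x \<bullet> (A *v x)"
    using A by (auto simp: posdef_def)
  define C where "C = onorm ((*v) A) + c"
  have on: "0 \<le> onorm ((*v) A)" by (rule onorm_pos_le) (rule matrix_vector_mul_bounded_linear)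
  have C: "0 < C" "c \<le> C" using c on by (auto simp: C_def)
  have up: "x \<bullet> (A *v x) \<le> C * (norm x)\<^sup>2" for x
  proof -
    have "x \<bullet> (A *v x) \<le> norm x * norm (A *v x)" by (rule norm_cauchy_schwarz)
    also have "\<dots> \<le> norm x * (onorm ((*v) A) * norm x)"
      by (intro mult_left_mono onorm matrix_vector_mul_bounded_linear) auto
    also have "\<dots> \<le> C * (norm x)\<^sup>2" using c by (simp add: C_def power2_eq_square algebra_simps)
    finally show ?thesis .
  qed
  define t where "t = 1 - c / C"
  define r where "r = 1 - sqrt (c / C)"
  have t: "0 \<le> t" "t < 1" using c C by (auto simp: t_def)
  have r: "0 \<le> r" "r < 1" using c C by (auto simp: r_def)
  have rt: "(t + r\<^sup>2) / 2 = r"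
    using c C by (simp add: r_def t_def power2_diff field_simps)
  define Tm where "Tm = mat 1 - (1 / C) *\<^sub>R A"
  have Tm: "Tm *v x = x - (1 / C) *\<^sub>R (A *v x)" for x
    by (simp add: Tm_def matrix_vector_mult_diff_rdistrib scaleR_matrix_vector_assoc)
  have Tsym: "transpose Tm = Tm"
    by (rule sym_from_inner) (simp add: Tm inner_diff_left inner_diff_right sym_inner[OF sym])
  have Tlo: "0 \<le> x \<bullet> (Tm *v x)" for x
    using up[of x] C by (simp add: Tm inner_diff_right power2_norm_eq_inner field_simps)
  have Tup: "x \<bullet> (Tm *v x) \<le> t * (norm x)\<^sup>2" for x
    using lo[of x] C by (simp add: Tm t_def inner_diff_right power2_norm_eq_inner field_simps)
  define T where "T = Blinfun ((*v) Tm)"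
  have T: "blinfun_apply T x = Tm *v x" for x
    by (simp add: T_def bounded_linear_Blinfun_apply matrix_vector_mul_bounded_linear)
  have nT: "norm T \<le> t"
  proof (rule norm_blinfun_bound[OF t(1)])
    fix x
    define y where "y = Tm *v x"
    have "((norm y)\<^sup>2)\<^sup>2 = (y \<bullet> (Tm *v x))\<^sup>2" by (simp add: y_def power2_norm_eq_inner)
    also have "\<dots> \<le> (y \<bullet> (Tm *v y)) * (x \<bullet> (Tm *v x))" by (rule psd_Cauchy_Schwarz[OF Tsym Tlo])
    also have "\<dots> \<le> (t * (norm y)\<^sup>2) * (t * (norm x)\<^sup>2)"
      by (intro mult_mono Tup) (auto simp: Tlo t)
    also have "\<dots> = (norm y * (t * norm x))\<^sup>2" by (simp add: power2_eq_square)
    finally have "norm y * norm y \<le> norm y * (t * norm x)"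
      unfolding power2_eq_square[of "norm y"] by (rule power2_le_imp_le) (use t in auto)
    then have "norm y \<le> t * norm x" by (cases "y = 0") (use t in auto)
    then show "norm (blinfun_apply T x) \<le> t * norm x" by (simp add: T y_def)
  qed
  define X where "X = {S :: (real^'n) \<Rightarrow>\<^sub>L (real^'n). norm S \<le> r \<and> (\<forall>x y. x \<bullet> blinfun_apply S y = blinfun_apply S x \<bullet> y)}"
  define F where "F S = (1/2) *\<^sub>R (T + (S o\<^sub>L S))" for S :: "(real^'n) \<Rightarrow>\<^sub>L (real^'n)"
  have closed_X: "closed X"
  proof -
    have "X = {S. norm S \<le> r} \<inter> (\<Inter>x. \<Inter>y. {S. x \<bullet> blinfun_apply S y = blinfun_apply S x \<bullet> y})"
      by (auto simp: X_def)
    moreover have "closed \<dots>"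
      by (intro closed_Int closed_INT ballI closed_Collect_le closed_Collect_eq continuous_intros)
    ultimately show ?thesis by simp
  qed
  note comp = complete_eq_closed[THEN iffD2, OF closed_X]
  have "0 \<in> X" using r by (simp add: X_def)
  have FX: "F ` X \<subseteq> X"
  proof
    fix S' assume "S' \<in> F ` X"
    then obtain S where S: "S \<in> X" "S' = F S" by auto
    have "norm (F S) \<le> (1/2) * (norm T + norm S * norm S)"
    proof -
      have "norm (T + (S o\<^sub>L S)) \<le> norm T + norm (S o\<^sub>L S)" by (rule norm_triangle_ineq)
      also have "\<dots> \<le> norm T + norm S * norm S" using norm_blinfun_compose[of S S] by simp
      finally show ?thesis by (simp add: F_def)
    qed
    also have "\<dots> \<le> (1/2) * (t + r\<^sup>2)"
      using nT S r by (intro mult_left_mono add_mono) (auto simp: X_def power2_eq_square intro: mult_mono)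
    finally have "norm (F S) \<le> r" using rt by simp
    moreover have "x \<bullet> blinfun_apply (F S) y = blinfun_apply (F S) x \<bullet> y" for x y
      using S by (simp add: F_def X_def scaleR_blinfun.rep_eq plus_blinfun.rep_eq T inner_add_left inner_add_right sym_inner[OF Tsym])
    ultimately show "S' \<in> X" using S by (simp add: X_def)
  qed
  have lip: "dist (F S) (F S') \<le> r * dist S S'" if "S \<in> X" "S' \<in> X" for S S'
  proof -
    have "F S - F S' = (1/2) *\<^sub>R ((S o\<^sub>L (S - S')) + ((S - S') o\<^sub>L S'))"
      by (rule blinfun_eqI) (simp add: F_def blinfun.bilinear_simps algebra_simps)
    then have "norm (F S - F S') \<le> (1/2) * (norm S * norm (S - S') + norm (S - S') * norm S')"
      by (simp, intro order_trans[OF norm_triangle_ineq] add_mono norm_blinfun_compose)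
    also have "\<dots> \<le> (1/2) * (r * norm (S - S') + norm (S - S') * r)"
      using that by (intro mult_left_mono add_mono mult_right_mono) (auto simp: X_def)
    finally show ?thesis by (simp add: dist_norm mult.commute)
  qed
  obtain S where S: "S \<in> X" "F S = S"
    using Banach_fix[OF comp _ r FX] lip \<open>0 \<in> X\<close> by blast
  have Sx: "blinfun_apply S (blinfun_apply S x) = 2 *\<^sub>R blinfun_apply S x - Tm *v x" for x
  proof -
    have "blinfun_apply S x = (1/2) *\<^sub>R (Tm *v x + blinfun_apply S (blinfun_apply S x))"
      using arg_cong[OF S(2), of "\<lambda>S. blinfun_apply S x"] by (simp add: F_def scaleR_blinfun.rep_eq plus_blinfun.rep_eq T)
    then have "2 *\<^sub>R blinfun_apply S x = 2 *\<^sub>R ((1/2) *\<^sub>R (Tm *v x + blinfun_apply S (blinfun_apply S x)))" by simp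
    also have "\<dots> = Tm *v x + blinfun_apply S (blinfun_apply S x)" by (simp only: scaleR_scaleR) simp
    finally show ?thesis by (simp add: algebra_simps)
  qed
  define B where "B = sqrt C *\<^sub>R (mat 1 - matrix (blinfun_apply S))"
  have mS: "matrix (blinfun_apply S) *v x = blinfun_apply S x" for x
    using fun_cong[OF matrix_vector_mul(3)[OF blinfun.bounded_linear_right[of S]], of x] by simp
  have B: "B *v x = sqrt C *\<^sub>R (x - blinfun_apply S x)" for x
    by (simp add: B_def scaleR_matrix_vector_assoc[symmetric] matrix_vector_mult_diff_rdistrib mS)
  have "B ** B = A"
  proof (rule matrix_eq[THEN iffD2], rule allI)
    fix x
    have "(B ** B) *v x = B *v (B *v x)" by (simp add: matrix_vector_mul_assoc)
    also have "\<dots> = C *\<^sub>R (x - 2 *\<^sub>R blinfun_apply S x + blinfun_apply S (blinfun_apply S x))"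
      using C by (simp add: B blinfun.bilinear_simps scaleR_diff_right scaleR_2 algebra_simps)
    also have "\<dots> = A *v x" unfolding Sx using C by (simp add: Tm)
    finally show "(B ** B) *v x = A *v x" .
  qed
  moreover have "transpose B = B"
    by (rule sym_from_inner) (use S in \<open>simp add: B inner_diff_left inner_diff_right X_def\<close>)
  moreover have "sqrt c * (norm x)\<^sup>2 \<le> x \<bullet> (B *v x)" for x
  proof -
    have "x \<bullet> blinfun_apply S x \<le> norm x * norm (blinfun_apply S x)" by (rule norm_cauchy_schwarz)
    also have "\<dots> \<le> norm x * (r * norm x)"
      using S by (intro mult_left_mono order_trans[OF norm_blinfun] mult_right_mono) (auto simp: X_def)
    finally have "(1 - r) * (norm x)\<^sup>2 \<le> x \<bullet> (x - blinfun_apply S x)"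
      by (simp add: inner_diff_right power2_norm_eq_inner[symmetric] power2_eq_square algebra_simps)
    then have "sqrt C * ((1 - r) * (norm x)\<^sup>2) \<le> sqrt C * (x \<bullet> (x - blinfun_apply S x))"
      using C by (intro mult_left_mono) auto
    moreover have "sqrt C * ((1 - r) * (norm x)\<^sup>2) = sqrt c * (norm x)\<^sup>2"
      using C c by (simp add: r_def real_sqrt_divide)
    ultimately show ?thesis by (simp add: B)
  qed
  ultimately show ?thesis using c by (intro exI[of _ B]) (simp add: posdef_def)
qed

lemma inner_matrix_columns:
  fixes D E :: "real^'n^'n::finite"
  shows "D \<bullet> E = (\<Sum>j\<in>UNIV. column j D \<bullet> column j E)"
  unfolding inner_vec_def column_def by (simp, rule sum.swap)

text \<open>
  Pairing \<open>B\<^sup>2 - B'\<^sup>2 = B D + D B'\<close>, where \<open>D = B - B'\<close>,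
  with \<open>D\<close> splits into two positive quadratic forms, evaluated on the columns and
  on the rows of \<open>D\<close>. With equal squares this is the uniqueness of the root.
\<close>

lemma matrix_sqrt_lipschitz:
  fixes B B' :: "real^'n^'n::finite"
  assumes B: "posdef b B" and B': "transpose B' = B'" "\<And>x. 0 \<le> x \<bullet> (B' *v x)"
  shows "b * norm (B - B') \<le> norm (B ** B - B' ** B')"
proof -
  define D where "D = B - B'"
  have b: "b > 0" "\<And>x. b * (norm x)\<^sup>2 \<le> x \<bullet> (B *v x)" and Bs: "transpose B = B" using B by (auto simp: posdef_def)
  have e: "B ** B - B' ** B' = B ** D + D ** B'"
    unfolding D_def by (simp add: vec_eq_iff matrix_matrix_mult_def algebra_simps sum_subtractf sum.distrib[symmetric])
  have 1: "b * (norm D)\<^sup>2 \<le> D \<bullet> (B ** D)"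
  proof -
    have cm: "column j (B ** D) = B *v column j D" for j
      by (simp add: vec_eq_iff column_def matrix_matrix_mult_def matrix_vector_mult_def)
    have "b * (norm D)\<^sup>2 = (\<Sum>j\<in>UNIV. b * (norm (column j D))\<^sup>2)"
      unfolding power2_norm_eq_inner inner_matrix_columns[of D D] sum_distrib_left ..
    also have "\<dots> \<le> (\<Sum>j\<in>UNIV. column j D \<bullet> (B *v column j D))" by (intro sum_mono b)
    also have "\<dots> = D \<bullet> (B ** D)" by (simp add: inner_matrix_columns cm)
    finally show ?thesis .
  qed
  have 2: "0 \<le> D \<bullet> (D ** B')"
  proof -
    have rm: "(D ** B') $ i = B' *v (D $ i)" for i
    proof -
      have "(D ** B') $ i = (D $ i) v* B'"
        by (simp add: vec_eq_iff matrix_matrix_mult_def vector_matrix_mult_def mult.commute)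
      then show ?thesis using B'(1) by (metis transpose_matrix_vector)
    qed
    have "D \<bullet> (D ** B') = (\<Sum>i\<in>UNIV. D $ i \<bullet> (B' *v (D $ i)))"
      unfolding inner_vec_def[of D] rm ..
    then show ?thesis by (simp add: sum_nonneg B'(2))
  qed
  have "b * (norm D)\<^sup>2 \<le> D \<bullet> (B ** B - B' ** B')" unfolding e using 1 2 by (simp add: inner_add_right)
  also have "\<dots> \<le> norm D * norm (B ** B - B' ** B')" by (rule norm_cauchy_schwarz)
  finally have "norm D * (b * norm D) \<le> norm D * norm (B ** B - B' ** B')" by (simp add: power2_eq_square mult_ac)
  then show ?thesis unfolding D_def[symmetric] by (cases "D = 0") auto
qed

lemma matrix_sqrt_posdef:
  fixes A :: "real^'n^'n::finite"
  assumes A: "posdef c A"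
  shows "posdef (sqrt c) (matrix_sqrt A)" "matrix_sqrt A ** matrix_sqrt A = A"
proof -
  obtain B where B: "posdef (sqrt c) B" "B ** B = A" using posdef_sqrt_exists[OF A] by blast
  have "matrix_sqrt A = B" unfolding matrix_sqrt_def
  proof (rule the_equality)
    have "0 \<le> x \<bullet> (B *v x)" for x
      using B(1) unfolding posdef_def by (meson less_imp_le mult_nonneg_nonneg order_trans zero_le_power2)
    then show "transpose B = B \<and> (\<forall>x. 0 \<le> x \<bullet> (B *v x)) \<and> B ** B = A" using B by (auto simp: posdef_def)
    fix B' assume "transpose B' = B' \<and> (\<forall>x. 0 \<le> x \<bullet> (B' *v x)) \<and> B' ** B' = A"
    then have "sqrt c * norm (B - B') \<le> 0" using matrix_sqrt_lipschitz[OF B(1), of B'] B(2) by simp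
    moreover have "sqrt c > 0" using B(1) by (simp add: posdef_def)
    ultimately have "norm (B - B') = 0" by (metis mult_le_cancel_left_pos mult_zero_right norm_le_zero_iff norm_eq_zero)
    then show "B' = B" by simp
  qed
  then show "posdef (sqrt c) (matrix_sqrt A)" "matrix_sqrt A ** matrix_sqrt A = A" using B by auto
qed

lemma matrix_inv_inverse:
  fixes A :: "real^'n^'n::finite"
  assumes "invertible A"
  shows matrix_inv_right: "A ** matrix_inv A = mat 1" and matrix_inv_left: "matrix_inv A ** A = mat 1"
proof -
  have "A ** matrix_inv A = mat 1 \<and> matrix_inv A ** A = mat 1"
    unfolding matrix_inv_def by (rule someI_ex) (use assms in \<open>simp add: invertible_def\<close>)
  then show "A ** matrix_inv A = mat 1" "matrix_inv A ** A = mat 1" by auto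
qed

text \<open>
  Well-behaved only for positive definite matrices, see \<open>inv_sqrt_props\<close>.
\<close>

definition inv_sqrt :: "real^'n^'n::finite \<Rightarrow> real^'n^'n" where
  "inv_sqrt A = matrix_inv (matrix_sqrt A)"

lemma norm_matrix_vector_le:
  fixes A :: "real^'n^'m::finite"
  shows "norm (A *v x) \<le> norm A * norm x"
proof -
  have "norm (A *v x) = L2_set (\<lambda>i. \<bar>A $ i \<bullet> x\<bar>) UNIV"
    by (simp add: norm_vec_def matrix_vector_mult_def inner_vec_def)
  also have "\<dots> \<le> L2_set (\<lambda>i. norm (A $ i) * norm x) UNIV"
    by (rule L2_set_mono) (auto simp: Cauchy_Schwarz_ineq2)
  also have "\<dots> = norm A * norm x"
    by (simp add: L2_set_left_distrib[symmetric] norm_vec_def[of A])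
  finally show ?thesis .
qed

lemma inv_sqrt_props:
  fixes A :: "real^'n^'n::finite"
  assumes A: "posdef c A"
  shows "matrix_sqrt A ** inv_sqrt A = mat 1" "inv_sqrt A ** matrix_sqrt A = mat 1"
    and "transpose (inv_sqrt A) = inv_sqrt A" and "norm (inv_sqrt A *v x) \<le> norm x / sqrt c"
    and "\<bar>inv_sqrt A $ i $ j\<bar> \<le> 1 / sqrt c"
    and "inv_sqrt A ** A ** inv_sqrt A = mat 1"
proof -
  define B where "B = matrix_sqrt A"
  have c: "0 < sqrt c" and sym: "transpose B = B" and lo: "\<And>x. sqrt c * (norm x)\<^sup>2 \<le> x \<bullet> (B *v x)" and BB: "B ** B = A"
    using matrix_sqrt_posdef[OF A] by (auto simp: posdef_def B_def)
  have nB: "sqrt c * norm x \<le> norm (B *v x)" for x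
  proof (cases "x = 0")
    case False
    have "sqrt c * norm x * norm x \<le> norm (B *v x) * norm x"
      using order_trans[OF lo norm_cauchy_schwarz, of x] by (simp add: power2_eq_square mult_ac)
    then show ?thesis using False by simp
  qed simp
  have "inj ((*v) B)"
  proof (rule injI)
    fix x y assume "B *v x = B *v y"
    then have "B *v (x - y) = 0" by (simp add: matrix_vector_mult_diff_distrib)
    then have "sqrt c * norm (x - y) \<le> 0" using nB[of "x - y"] by simp
    then show "x = y" using c by (simp add: mult_le_0_iff)
  qed
  then have inv: "invertible B" by (simp add: invertible_left_inverse matrix_left_invertible_injective)
  show 1: "matrix_sqrt A ** inv_sqrt A = mat 1" and 2: "inv_sqrt A ** matrix_sqrt A = mat 1"
    using matrix_inv_right[OF inv] matrix_inv_left[OF inv] by (simp_all add: inv_sqrt_def B_def)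
  have "transpose (inv_sqrt A) ** B = mat 1"
    using arg_cong[OF 1, of transpose] sym by (simp add: matrix_transpose_mul B_def transpose_mat)
  then have "transpose (inv_sqrt A) ** B ** inv_sqrt A = inv_sqrt A" by simp
  then show "transpose (inv_sqrt A) = inv_sqrt A" using 1 by (simp add: matrix_mul_assoc[symmetric] B_def)
  show n: "norm (inv_sqrt A *v x) \<le> norm x / sqrt c" for x
  proof -
    have "B *v (inv_sqrt A *v x) = x" using 1 by (simp add: matrix_vector_mul_assoc B_def)
    then show ?thesis using nB[of "inv_sqrt A *v x"] c by (simp add: field_simps)
  qed
  have "\<bar>inv_sqrt A $ i $ j\<bar> = \<bar>(inv_sqrt A *v axis j 1) $ i\<bar>" by (simp add: matrix_vector_mult_basis column_def)
  also have "\<dots> \<le> norm (inv_sqrt A *v axis j 1)" by (rule component_le_norm_cart)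
  also have "\<dots> \<le> 1 / sqrt c" using n[of "axis j 1"] by simp
  finally show "\<bar>inv_sqrt A $ i $ j\<bar> \<le> 1 / sqrt c" .
  have "inv_sqrt A ** A ** inv_sqrt A = (inv_sqrt A ** B) ** (B ** inv_sqrt A)" by (simp add: BB[symmetric] matrix_mul_assoc)
  then show "inv_sqrt A ** A ** inv_sqrt A = mat 1" using 1 2 by (simp add: B_def)
qed

text \<open>
  The resolvent identity \<open>B^-1 - B'^-1 = B^-1 (B' - B) B'^-1\<close> for the square roots.
\<close>

lemma inv_sqrt_lipschitz:
  fixes A A' :: "real^'n^'n::finite"
  assumes A: "posdef c A" and A': "posdef c A'"
  shows "\<bar>inv_sqrt A $ i $ j - inv_sqrt A' $ i $ j\<bar> \<le> norm (A - A') / (c * sqrt c)"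
proof -
  define B B' where "B = matrix_sqrt A" and "B' = matrix_sqrt A'"
  have c: "0 < c" using A by (simp add: posdef_def)
  have psd: "0 \<le> x \<bullet> (B *v x)" for x
    using matrix_sqrt_posdef(1)[OF A] unfolding posdef_def B_def by (meson less_imp_le mult_nonneg_nonneg order_trans zero_le_power2)
  have "sqrt c * norm (B' - B) \<le> norm (B' ** B' - B ** B)"
    by (rule matrix_sqrt_lipschitz) (use matrix_sqrt_posdef(1)[OF A] matrix_sqrt_posdef(1)[OF A'] psd in \<open>auto simp: posdef_def B_def B'_def\<close>)
  then have BB: "norm (B' - B) \<le> norm (A - A') / sqrt c"
    using c by (simp add: B_def B'_def matrix_sqrt_posdef[OF A] matrix_sqrt_posdef[OF A'] field_simps norm_minus_commute)
  define x where "x = inv_sqrt A' *v axis j 1"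
  define y where "y = inv_sqrt A *v axis i 1"
  have "inv_sqrt A = inv_sqrt A ** (B' ** inv_sqrt A')" "inv_sqrt A' = (inv_sqrt A ** B) ** inv_sqrt A'"
    using inv_sqrt_props(2)[OF A] inv_sqrt_props(1)[OF A'] by (simp_all add: B_def B'_def)
  then have "inv_sqrt A *v z - inv_sqrt A' *v z = inv_sqrt A *v ((B' - B) *v (inv_sqrt A' *v z))" for z
    by (metis matrix_vector_mul_assoc matrix_vector_mult_diff_distrib matrix_vector_mult_diff_rdistrib)
  then have eq: "inv_sqrt A *v axis j 1 - inv_sqrt A' *v axis j 1 = inv_sqrt A *v ((B' - B) *v x)" by (simp add: x_def)
  have "inv_sqrt A $ i $ j - inv_sqrt A' $ i $ j = axis i 1 \<bullet> (inv_sqrt A *v axis j 1 - inv_sqrt A' *v axis j 1)"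
    by (simp add: inner_axis' matrix_vector_mult_basis column_def)
  also have "\<dots> = y \<bullet> ((B' - B) *v x)"
    unfolding eq y_def by (rule sym_inner[OF inv_sqrt_props(3)[OF A]])
  finally have "\<bar>inv_sqrt A $ i $ j - inv_sqrt A' $ i $ j\<bar> \<le> norm y * norm ((B' - B) *v x)"
    using Cauchy_Schwarz_ineq2 by metis
  also have "\<dots> \<le> (1 / sqrt c) * (norm (A - A') / sqrt c * (1 / sqrt c))"
  proof (intro mult_mono order_trans[OF norm_matrix_vector_le] BB)
    show "norm y \<le> 1 / sqrt c" "norm x \<le> 1 / sqrt c"
      using inv_sqrt_props(4)[OF A, of "axis i 1"] inv_sqrt_props(4)[OF A', of "axis j 1"] by (simp_all add: x_def y_def)
  qed (use c in auto)
  also have "\<dots> = norm (A - A') / (c * sqrt c)" using c by (simp add: field_simps)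
  finally show ?thesis .
qed

lemma posdef_perturb:
  fixes A A' :: "real^'n^'n::finite"
  assumes A: "posdef c A" and sym: "transpose A' = A'" and n: "norm (A' - A) \<le> c - c'" and c': "0 < c'"
  shows "posdef c' A'"
  unfolding posdef_def
proof (intro conjI allI c' sym)
  fix x
  have "\<bar>x \<bullet> ((A' - A) *v x)\<bar> \<le> norm x * norm ((A' - A) *v x)" by (rule Cauchy_Schwarz_ineq2)
  also have "\<dots> \<le> norm x * ((c - c') * norm x)"
    by (intro mult_left_mono order_trans[OF norm_matrix_vector_le] mult_right_mono n) auto
  finally have "x \<bullet> ((A' - A) *v x) \<ge> - ((c - c') * (norm x)\<^sup>2)" by (simp add: power2_eq_square mult_ac)
  moreover have "c * (norm x)\<^sup>2 \<le> x \<bullet> (A *v x)" using A by (simp add: posdef_def)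
  ultimately show "c' * (norm x)\<^sup>2 \<le> x \<bullet> (A' *v x)"
    by (simp add: matrix_vector_mult_diff_rdistrib inner_diff_right algebra_simps)
qed

text \<open>
  A bound on the inverse bounds the spectrum of \<open>A\<close> away from zero: apply
  Cauchy-Schwarz for the form \<open>A\<close> to \<open>x\<close> and \<open>y = A^-1
  x\<close>.
\<close>

lemma posdef_of_inverse:
  fixes A :: "real^'n^'n::finite"
  assumes sym: "transpose A = A" and psd: "\<And>x. 0 \<le> x \<bullet> (A *v x)" and inv: "invertible A"
    and C: "spectral_norm (matrix_inv A) \<le> C" "0 < C"
  shows "posdef (1 / C) A"
  unfolding posdef_def
proof (intro conjI allI sym)
  show "0 < 1 / C" using C by simp
  fix x :: "real^'n"
  define y where "y = matrix_inv A *v x"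
  have Ay: "A *v y = x" using matrix_inv_right[OF inv] by (simp add: y_def matrix_vector_mul_assoc)
  have "norm y \<le> spectral_norm (matrix_inv A) * norm x"
    unfolding y_def spectral_norm_def by (rule onorm[OF matrix_vector_mul_bounded_linear])
  also have "\<dots> \<le> C * norm x" by (intro mult_right_mono C) auto
  finally have ny: "norm y \<le> C * norm x" .
  have "((norm x)\<^sup>2)\<^sup>2 = (x \<bullet> (A *v y))\<^sup>2" by (simp add: Ay power2_norm_eq_inner)
  also have "\<dots> \<le> (x \<bullet> (A *v x)) * (y \<bullet> (A *v y))" by (rule psd_Cauchy_Schwarz[OF sym psd])
  also have "y \<bullet> (A *v y) \<le> norm y * norm x" unfolding Ay by (rule norm_cauchy_schwarz)
  also have "\<dots> \<le> C * norm x * norm x" by (intro mult_right_mono ny) auto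
  finally have "(norm x)\<^sup>2 * (norm x)\<^sup>2 \<le> (x \<bullet> (A *v x)) * (C * (norm x)\<^sup>2)"
    using psd[of x] by (simp add: power2_eq_square mult_left_mono mult.assoc)
  then have "(norm x)\<^sup>2 * (norm x)\<^sup>2 \<le> (x \<bullet> (A *v x)) * C * (norm x)\<^sup>2" by (simp only: mult.assoc)
  then have "(norm x)\<^sup>2 \<le> (x \<bullet> (A *v x)) * C" if "x \<noteq> 0"
    by (rule mult_right_le_imp_le) (use that in simp)
  then show "1 / C * (norm x)\<^sup>2 \<le> x \<bullet> (A *v x)" using C by (cases "x = 0") (auto simp: field_simps)
qed

section \<open>Square summable sequences\<close>

abbreviation "\<Z> \<equiv> count_space (UNIV :: int set)"

lemma integrable_Z_shift: "integrable \<Z> f \<Longrightarrow> integrable \<Z> (\<lambda>j. f (j + l) :: real)"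
  using integrable_bij_count_space[of "\<lambda>j. j + l" UNIV UNIV f] by (simp add: bij_plus_right)

lemma integral_Z_shift: "(\<integral>j. f (j + l) \<partial>\<Z>) = (\<integral>j. (f j :: real) \<partial>\<Z>)"
  using integral_bij_count_space[of "\<lambda>j. j + l" UNIV UNIV f] by (simp add: bij_plus_right)

lemma bij_minus_left: "bij (\<lambda>i::int. t - i)"
  by (rule bij_betw_byWitness[where f'="\<lambda>i. t - i"]) auto

lemma integrable_Z_reflect: "integrable \<Z> f \<Longrightarrow> integrable \<Z> (\<lambda>j. f (t - j) :: real)"
  using integrable_bij_count_space[of "\<lambda>j. t - j" UNIV UNIV f] bij_minus_left by simp

lemma integral_Z_reflect: "(\<integral>j. f (t - j) \<partial>\<Z>) = (\<integral>j. (f j :: real) \<partial>\<Z>)"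
  using integral_bij_count_space[of "\<lambda>j. t - j" UNIV UNIV f] bij_minus_left by simp

lemma integrable_Z_iff_summable:
  fixes f :: "int \<Rightarrow> real"
  shows "integrable \<Z> f \<longleftrightarrow> (\<lambda>j. \<bar>f j\<bar>) summable_on UNIV"
  using abs_summable_equivalent[of f UNIV] by (simp add: Infinite_Set_Sum.abs_summable_on_def)

lemma integral_Z_infsum:
  fixes f :: "int \<Rightarrow> real"
  assumes "integrable \<Z> f"
  shows "f summable_on UNIV" "infsum f UNIV = (\<integral>j. f j \<partial>\<Z>)"
proof -
  have "Infinite_Set_Sum.abs_summable_on f UNIV" using assms by (simp add: Infinite_Set_Sum.abs_summable_on_def)
  from infsetsum_infsum[OF this] show "infsum f UNIV = (\<integral>j. f j \<partial>\<Z>)" by (simp add: infsetsum_def)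
  show "f summable_on UNIV"
  proof (rule abs_summable_summable)
    show "(\<lambda>j. norm (f j)) summable_on UNIV"
      using assms unfolding integrable_Z_iff_summable real_norm_def .
  qed
qed

lemma sum_le_integral_Z:
  fixes f :: "int \<Rightarrow> real"
  assumes f: "integrable \<Z> f" "\<And>j. 0 \<le> f j" and F: "finite F"
  shows "sum f F \<le> (\<integral>j. f j \<partial>\<Z>)"
  using finite_sum_le_infsum[OF integral_Z_infsum(1)[OF f(1)] F] f(2) by (simp add: integral_Z_infsum(2)[OF f(1)])

lemma integrable_Z_bounded_sums:
  fixes f :: "int \<Rightarrow> real"
  assumes "\<And>j. 0 \<le> f j" "\<And>F. finite F \<Longrightarrow> sum f F \<le> C"
  shows "integrable \<Z> f"
  unfolding integrable_Z_iff_summable using assms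
  by (intro nonneg_bdd_above_summable_on) (auto intro!: bdd_aboveI2[of _ _ C])

lemma integrable_Z_symmetric:
  fixes g :: "nat \<Rightarrow> real"
  assumes "summable g" "\<And>n. 0 \<le> g n"
  shows "integrable \<Z> (\<lambda>j. g (nat \<bar>j\<bar>))"
proof -
  have s: "g summable_on UNIV" "(\<lambda>n. g (Suc n)) summable_on UNIV"
    using assms by (auto intro!: summable_nonneg_imp_summable_on simp: summable_Suc_iff)
  have "(\<lambda>j. g (nat \<bar>j\<bar>)) summable_on (range int)"
    by (subst summable_on_reindex) (use s in \<open>auto simp: comp_def\<close>)
  moreover have "(\<lambda>j. g (nat \<bar>j\<bar>)) summable_on (range (\<lambda>n. - int (Suc n)))"
    by (subst summable_on_reindex) (use s in \<open>auto simp: comp_def inj_def nat_add_distrib simp del: of_nat_Suc\<close>)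
  moreover have "range int \<inter> range (\<lambda>n. - int (Suc n)) = {}" by auto
  ultimately have "(\<lambda>j. g (nat \<bar>j\<bar>)) summable_on (range int \<union> range (\<lambda>n. - int (Suc n)))"
    by (rule summable_on_Un_disjoint)
  also have "range int \<union> range (\<lambda>n. - int (Suc n)) = UNIV"
  proof -
    have "j \<in> range int \<union> range (\<lambda>n. - int (Suc n))" for j
      by (cases j rule: int_cases) auto
    then show ?thesis by auto
  qed
  finally show ?thesis unfolding integrable_Z_iff_summable using assms(2) by simp
qed

lemma integrable_envelope:
  fixes u :: "int \<Rightarrow> real"
  assumes u: "\<And>j. u j = max 1 (real_of_int \<bar>j\<bar> powr a)" and s: "0 < s" "a * s > 1" and K: "0 \<le> K"
  shows "integrable \<Z> (\<lambda>j. (K / u j) powr s)"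
proof -
  define g where "g n = K powr s * (if n = 0 then 1 else real n powr (- (a * s)))" for n
  have a: "a > 0" using s by (metis less_trans mult_nonpos_nonneg not_le order_less_imp_le zero_less_one)
  have "summable (\<lambda>n. real n powr (- (a * s)))" using s by (simp add: summable_real_powr_iff)
  then have "summable (\<lambda>n. if n = 0 then 1 else real n powr (- (a * s)))"
    by (rule summable_cong[THEN iffD1, rotated]) (auto simp: eventually_sequentially intro!: exI[of _ 1])
  then have "summable g" unfolding g_def by (rule summable_mult)
  then have "integrable \<Z> (\<lambda>j. g (nat \<bar>j\<bar>))" by (rule integrable_Z_symmetric) (simp add: g_def)
  moreover have "(K / u j) powr s = g (nat \<bar>j\<bar>)" for j
  proof (cases "j = 0")
    case True then show ?thesis by (simp add: u g_def)
  next
    case False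
    then have "1 \<le> real_of_int \<bar>j\<bar>" by linarith
    then have "1 \<le> real_of_int \<bar>j\<bar> powr a" using a by (simp add: ge_one_powr_ge_zero)
    then have uj: "u j = real_of_int \<bar>j\<bar> powr a" by (simp add: u)
    have "(K / u j) powr s = K powr s / (real_of_int \<bar>j\<bar> powr a) powr s"
      unfolding uj by (rule powr_divide)
    then show ?thesis using False unfolding g_def
      by (simp add: powr_powr powr_minus_divide)
  qed
  ultimately show ?thesis by simp
qed

text \<open>
  The convex function \<open>y ^ m\<close> lies above its tangent at \<open>s\<close>. This
  replaces Hoelder's inequality in the next proof.
\<close>

lemma power_tangent:
  fixes y s :: real
  assumes "0 \<le> y" "0 \<le> s"
  shows "real m * s ^ (m - 1) * y \<le> y ^ m + (real m - 1) * s ^ m"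
proof (induction m)
  case 0
  then show ?case by simp
next
  case (Suc m)
  show ?case
  proof (cases "m = 0")
    case True then show ?thesis by simp
  next
    case False
    then have sm: "s ^ m = s * s ^ (m - 1)" by (simp add: power_eq_if)
    have "0 \<le> (y ^ m - s ^ m) * (y - s)"
      using assms by (cases "s \<le> y") (auto intro!: mult_nonneg_nonneg mult_nonpos_nonpos simp: power_mono)
    then have 1: "s ^ m * y \<le> y ^ Suc m + s ^ Suc m - s * y ^ m" by (simp add: algebra_simps)
    have "s * (real m * s ^ (m - 1) * y) \<le> s * (y ^ m + (real m - 1) * s ^ m)"
      using Suc assms by (intro mult_left_mono) auto
    then have 2: "real m * s ^ m * y \<le> s * y ^ m + (real m - 1) * s ^ Suc m"
      using sm by (simp add: algebra_simps)
    show ?thesis using 1 2 by (simp add: algebra_simps)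
  qed
qed

text \<open>
  Young's inequality for the convolution of \<open>b\<close> with its reflection, \<open>1/p +
  1/p = 1 + 1/m\<close>. Write \<open>b j * b (j + l) = w * y\<close> with the weight \<open>w =
  (b j * b (j + l))^(p/2)\<close>, whose sum over \<open>j\<close> is at most \<open>\<Sum>
  b^p\<close>; the exponent \<open>p\<close> is the one for which \<open>w * y^m = (b j * b (j +
  l))^p\<close>. Jensen's inequality bounds \<open>\<beta> l ^ m\<close> by a multiple of
  \<open>\<Sum>\<^sub>j b\<^sub>j^p b\<^sub>j\<^sub>+\<^sub>l^p\<close>, which is summable over
  \<open>l\<close>.
\<close>

lemma young_convolution:
  fixes b :: "int \<Rightarrow> real" and m :: nat
  assumes b: "\<And>j. 0 \<le> b j" and m: "1 \<le> m" and p: "p = 2 * real m / (real m + 1)"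
    and bp: "integrable \<Z> (\<lambda>j. b j powr p)" and b2: "integrable \<Z> (\<lambda>j. (b j)\<^sup>2)"
  shows "integrable \<Z> (\<lambda>l. (\<integral>j. b j * b (j + l) \<partial>\<Z>) ^ m)"
proof -
  define \<beta> where "\<beta> l = (\<integral>j. b j * b (j + l) \<partial>\<Z>)" for l
  define P where "P j = b j powr p" for j
  \<comment> \<open>the summand \<open>1\<close> only serves to make \<open>S\<close> positive\<close>
  define S where "S = (\<integral>j. P j \<partial>\<Z>) + 1"
  have P0: "0 \<le> P j" for j by (simp add: P_def)
  have S0: "0 \<le> (\<integral>j. P j \<partial>\<Z>)" using P0 by simp
  then have S: "S > 0" by (simp add: S_def)
  have iP: "integrable \<Z> P" using bp by (simp add: P_def[abs_def])
  have sb: "sqi \<Z> b" "sqi \<Z> (\<lambda>j. b (j + l))" for l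
    using b2 integrable_Z_shift[OF b2, of l] by (simp_all add: sqi_def)
  have ib: "integrable \<Z> (\<lambda>j. b j * b (j + l))" for l by (rule sqi_mult[OF sb])
  have iPP: "integrable \<Z> (\<lambda>j. P j * P (j + l))" for l
  proof (rule Bochner_Integration.integrable_bound)
    show "integrable \<Z> (\<lambda>j. P j * S)" using iP by simp
    have "P (j + l) \<le> S" for j
      using sum_le_integral_Z[OF iP P0, of "{j + l}"] by (simp add: S_def)
    then show "AE j in \<Z>. norm (P j * P (j + l)) \<le> norm (P j * S)"
      using P0 S by (intro AE_I2) (simp add: abs_mult mult_left_mono)
  qed simp
  have \<beta>0: "0 \<le> \<beta> l" for l unfolding \<beta>_def using b by simp
  have bound: "\<beta> l ^ m \<le> S ^ (m - 1) * (\<integral>j. P j * P (j + l) \<partial>\<Z>)" for l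
  proof -
    define w where "w j = (b j * b (j + l)) powr (p / 2)" for j
    define y where "y j = (b j * b (j + l)) powr (1 - p / 2)" for j
    define s where "s = \<beta> l / S"
    have s: "0 \<le> s" using \<beta>0 S by (simp add: s_def)
    have wy: "w j * y j = b j * b (j + l)" for j
      using b by (simp add: w_def y_def powr_add[symmetric])
    have wym: "w j * y j ^ m = P j * P (j + l)" for j
    proof (cases "b j * b (j + l) = 0")
      case True then show ?thesis by (auto simp: w_def P_def)
    next
      case False
      then have pos: "0 < b j * b (j + l)" using b by (metis less_eq_real_def mult_nonneg_nonneg)
      have "y j ^ m = (b j * b (j + l)) powr (real m * (1 - p / 2))"
        unfolding y_def by (subst powr_power) (use m pos in \<open>auto simp: mult.commute\<close>)
      then have "w j * y j ^ m = (b j * b (j + l)) powr (p / 2 + real m * (1 - p / 2))"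
        by (simp add: w_def powr_add)
      also have "p / 2 + real m * (1 - p / 2) = p"
      proof -
        have "p * (real m + 1) = 2 * real m" by (simp add: p)
        then show ?thesis by (simp add: algebra_simps)
      qed
      also have "(b j * b (j + l)) powr p = P j * P (j + l)" using b by (simp add: P_def powr_mult)
      finally show ?thesis .
    qed
    have w: "0 \<le> w j" "w j \<le> (P j + P (j + l)) / 2" for j
    proof -
      have "w j = b j powr (p / 2) * b (j + l) powr (p / 2)" using b by (simp add: w_def powr_mult)
      moreover have "P j = (b j powr (p / 2))\<^sup>2" for j
        by (simp add: P_def power2_eq_square powr_add[symmetric])
      ultimately show "w j \<le> (P j + P (j + l)) / 2"
        using sum_squares_bound[of "b j powr (p / 2)" "b (j + l) powr (p / 2)"] by simp
    qed (simp add: w_def)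
    have iw: "integrable \<Z> w"
      by (rule Bochner_Integration.integrable_bound[of _ "\<lambda>j. (P j + P (j + l)) / 2"])
        (use w iP integrable_Z_shift[OF iP, of l] in \<open>auto intro!: AE_I2 order_trans[OF _ abs_ge_self]\<close>)
    have "(\<integral>j. w j \<partial>\<Z>) \<le> (\<integral>j. (P j + P (j + l)) / 2 \<partial>\<Z>)"
      using iw w iP integrable_Z_shift[OF iP, of l] by (intro integral_mono) auto
    also have "\<dots> = (\<integral>j. P j \<partial>\<Z>)"
      using iP integrable_Z_shift[OF iP, of l] by (simp add: integral_Z_shift)
    finally have W: "(\<integral>j. w j \<partial>\<Z>) \<le> S" by (simp add: S_def)
    have "real m * s ^ (m - 1) * (b j * b (j + l)) \<le> P j * P (j + l) + (real m - 1) * s ^ m * w j" for j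
    proof -
      have "w j * (real m * s ^ (m - 1) * y j) \<le> w j * (y j ^ m + (real m - 1) * s ^ m)"
        by (intro mult_left_mono power_tangent w s) (simp add: y_def)
      then show ?thesis unfolding wy[symmetric] wym[symmetric] by (simp add: algebra_simps)
    qed
    then have "(\<integral>j. real m * s ^ (m - 1) * (b j * b (j + l)) \<partial>\<Z>)
        \<le> (\<integral>j. P j * P (j + l) + (real m - 1) * s ^ m * w j \<partial>\<Z>)"
      using ib[of l] iPP[of l] iw by (intro integral_mono) auto
    then have "real m * s ^ (m - 1) * \<beta> l \<le> (\<integral>j. P j * P (j + l) \<partial>\<Z>) + (real m - 1) * s ^ m * (\<integral>j. w j \<partial>\<Z>)"
      using ib[of l] iPP[of l] iw by (simp add: \<beta>_def)
    also have "(real m - 1) * s ^ m * (\<integral>j. w j \<partial>\<Z>) \<le> (real m - 1) * s ^ m * S"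
      using W s m by (intro mult_left_mono) auto
    also have "s ^ m = s ^ (m - 1) * s" using m by (simp add: power_eq_if)
    also have \<open>\<beta> l = s * S\<close> using S by (simp add: s_def)
    finally have "s ^ (m - 1) * s * S \<le> (\<integral>j. P j * P (j + l) \<partial>\<Z>)" by (simp add: algebra_simps)
    then have "S ^ (m - 1) * (s ^ (m - 1) * s * S) \<le> S ^ (m - 1) * (\<integral>j. P j * P (j + l) \<partial>\<Z>)"
      using S by (intro mult_left_mono) auto
    moreover have "S ^ (m - 1) * (s ^ (m - 1) * s * S) = (s * S) ^ m"
      using m by (simp add: power_eq_if[of _ m] power_mult_distrib)
    moreover have "s * S = \<beta> l" using S by (simp add: s_def)
    ultimately show ?thesis by (simp only:)
  qed
  have "integrable \<Z> (\<lambda>l. \<beta> l ^ m)"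
  proof (rule integrable_Z_bounded_sums[where C="S ^ (m - 1) * (\<integral>j. P j * S \<partial>\<Z>)"])
    fix F :: "int set" assume F: "finite F"
    have "(\<Sum>l\<in>F. \<beta> l ^ m) \<le> (\<Sum>l\<in>F. S ^ (m - 1) * (\<integral>j. P j * P (j + l) \<partial>\<Z>))"
      by (intro sum_mono bound)
    also have "\<dots> = S ^ (m - 1) * (\<integral>j. P j * (\<Sum>l\<in>F. P (j + l)) \<partial>\<Z>)"
    proof -
      have "(\<integral>j. P j * (\<Sum>l\<in>F. P (j + l)) \<partial>\<Z>) = (\<Sum>l\<in>F. \<integral>j. P j * P (j + l) \<partial>\<Z>)"
        unfolding sum_distrib_left by (rule Bochner_Integration.integral_sum) (rule iPP)
      then show ?thesis by (simp only: sum_distrib_left[symmetric])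
    qed
    also have "\<dots> \<le> S ^ (m - 1) * (\<integral>j. P j * S \<partial>\<Z>)"
    proof (rule mult_left_mono[OF integral_mono])
      show "integrable \<Z> (\<lambda>j. P j * (\<Sum>l\<in>F. P (j + l)))" by (simp add: sum_distrib_left iPP)
      show "integrable \<Z> (\<lambda>j. P j * S)" using iP by simp
      fix j
      have "(\<Sum>l\<in>F. P (j + l)) = sum P ((\<lambda>l. j + l) ` F)" by (subst sum.reindex) (auto simp: inj_on_def)
      also have "\<dots> \<le> S" using sum_le_integral_Z[OF iP P0, of "(\<lambda>l. j + l) ` F"] F by (simp add: S_def)
      finally show "P j * (\<Sum>l\<in>F. P (j + l)) \<le> P j * S" by (intro mult_left_mono P0)
    qed (use S in auto)
    finally show "(\<Sum>l\<in>F. \<beta> l ^ m) \<le> S ^ (m - 1) * (\<integral>j. P j * S \<partial>\<Z>)" .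
  qed (simp add: \<beta>0)
  then show ?thesis by (simp add: \<beta>_def)
qed

section \<open>Linear functionals of Gaussian noise\<close>

lemma borel_measurable_vec:
  fixes W :: "'a \<Rightarrow> real^'n::finite"
  assumes "\<And>a. (\<lambda>\<omega>. W \<omega> $ a) \<in> borel_measurable N"
  shows "W \<in> borel_measurable N"
proof -
  have "(\<lambda>\<omega>. W \<omega> \<bullet> i) \<in> borel_measurable N" if "i \<in> Basis" for i
    using that assms by (auto simp: Basis_vec_def inner_axis)
  then show ?thesis by (subst borel_measurable_euclidean_space) auto
qed

locale gaussian_noise = prob_space +
  fixes \<epsilon> :: "int \<Rightarrow> 'a \<Rightarrow> real"
  assumes noise_indep: "indep_vars (\<lambda>_. borel) \<epsilon> UNIV"
    and noise_normal: "\<And>k. distributed M lborel (\<epsilon> k) std_normal_density"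
begin

lemma noise_measurable [measurable]: "\<epsilon> i \<in> borel_measurable M"
  using noise_indep by (auto simp: indep_vars_def)

lemma noise_sqi: "sqi M (\<epsilon> i)"
  unfolding sqi_def
proof
  have "integrable lborel (\<lambda>x. std_normal_density x * x\<^sup>2)" by (rule integrable_std_normal_moment)
  then show "integrable M (\<lambda>x. (\<epsilon> i x)\<^sup>2)"
    using distributed_integrable[OF noise_normal[of i], of "\<lambda>x. x\<^sup>2"] by simp
qed simp

lemma noise_cov: "expectation (\<lambda>\<omega>. \<epsilon> i \<omega> * \<epsilon> j \<omega>) = (if i = j then 1 else 0)"
proof (cases "i = j")
  case True
  have "variance (\<epsilon> j) = 1" "expectation (\<epsilon> j) = 0"
    using standard_normal_distributed_variance[OF noise_normal[of j]] standard_normal_distributed_expectation[OF noise_normal[of j]] by auto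
  then show ?thesis using True by (simp add: power2_eq_square)
next
  case False
  from fld_indep[OF noise_indep, of "{i}" "{j}", OF _ fld_coord fld_coord sqi_integrable[OF noise_sqi] sqi_integrable[OF noise_sqi]]
  show ?thesis using False standard_normal_distributed_expectation[OF noise_normal[of i]] by simp
qed

definition partial :: "(int \<Rightarrow> real) \<Rightarrow> int set \<Rightarrow> 'a \<Rightarrow> real" where
  "partial c F \<omega> = (\<Sum>j\<in>F. c j * \<epsilon> j \<omega>)"

lemma partial_sqi: "sqi M (partial c F)"
  unfolding partial_def[abs_def] by (intro sqi_sum sqi_cmult noise_sqi)

lemma partial_norm: "(nrm M (partial c F))\<^sup>2 = (\<Sum>j\<in>F. (c j)\<^sup>2)"
proof (cases "finite F")
  case True
  have "(nrm M (partial c F))\<^sup>2 = expectation (\<lambda>\<omega>. \<Sum>i\<in>F. \<Sum>j\<in>F. (c i * c j) * (\<epsilon> i \<omega> * \<epsilon> j \<omega>))"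
    unfolding nrm_sq by (simp add: partial_def power2_eq_square sum_product mult_ac)
  also have "\<dots> = (\<Sum>i\<in>F. \<Sum>j\<in>F. (c i * c j) * expectation (\<lambda>\<omega>. \<epsilon> i \<omega> * \<epsilon> j \<omega>))"
    by (simp add: Bochner_Integration.integral_sum sqi_mult noise_sqi)
  also have "\<dots> = (\<Sum>i\<in>F. (c i)\<^sup>2)"
    unfolding noise_cov using True by (simp add: if_distrib[of "\<lambda>x. _ * x"] power2_eq_square cong: if_cong)
  finally show ?thesis .
qed (simp add: partial_def nrm_def)

lemma noise_char: "expectation (\<lambda>\<omega>. cis (x * \<epsilon> i \<omega>)) = of_real (exp (- x\<^sup>2 / 2))"
proof -
  have [measurable]: "(\<lambda>y. cis (x * y)) \<in> borel_measurable borel"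
    by (intro borel_measurable_continuous_onI continuous_intros)
  have d: "distr M lborel (\<epsilon> i) = density lborel std_normal_density"
    using noise_normal[of i] by (simp add: distributed_def)
  have "expectation (\<lambda>\<omega>. cis (x * \<epsilon> i \<omega>)) = (\<integral>y. cis (x * y) \<partial>distr M lborel (\<epsilon> i))"
    by (subst integral_distr) auto
  also have "\<dots> = (\<integral>y. std_normal_density y *\<^sub>R cis (x * y) \<partial>lborel)"
    unfolding d by (subst integral_density) auto
  finally show ?thesis by (simp add: integral_cis_std_normal)
qed

lemma partial_cos:
  assumes F: "finite F"
  shows "expectation (\<lambda>\<omega>. cos (partial c F \<omega> + \<theta>)) = exp (- (\<Sum>j\<in>F. (c j)\<^sup>2) / 2) * cos \<theta>"
proof -
  have cis_m [measurable]: "(\<lambda>y. cis (x * y)) \<in> borel_measurable borel" for x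
    by (intro borel_measurable_continuous_onI continuous_intros)
  have cis_sum: "cis (\<Sum>j\<in>F. g j) = (\<Prod>j\<in>F. cis (g j))" for g
    using F by (induction F) (auto simp: cis_mult[symmetric])
  have ind: "indep_vars (\<lambda>_. borel) (\<lambda>j \<omega>. cis (c j * \<epsilon> j \<omega>)) F"
    by (rule indep_vars_compose2[where Y="\<lambda>j y. cis (c j * y)", OF indep_vars_subset[OF noise_indep]]) auto
  have "expectation (\<lambda>\<omega>. cis (partial c F \<omega>)) = expectation (\<lambda>\<omega>. \<Prod>j\<in>F. cis (c j * \<epsilon> j \<omega>))"
    by (simp add: partial_def cis_sum)
  also have "\<dots> = (\<Prod>j\<in>F. expectation (\<lambda>\<omega>. cis (c j * \<epsilon> j \<omega>)))"
  proof (rule indep_vars_lebesgue_integral[OF F ind])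
    show "integrable M (\<lambda>\<omega>. cis (c i * \<epsilon> i \<omega>))" for i
      by (rule integrable_const_bound[of _ 1]) auto
  qed
  also have "\<dots> = of_real (exp (- (\<Sum>j\<in>F. (c j)\<^sup>2) / 2))"
    using F by (simp add: noise_char exp_sum[symmetric] sum_negf sum_divide_distrib flip: of_real_prod)
  finally have E: "expectation (\<lambda>\<omega>. cis (partial c F \<omega>)) = of_real (exp (- (\<Sum>j\<in>F. (c j)\<^sup>2) / 2))" .
  have [measurable]: "partial c F \<in> borel_measurable M" using partial_sqi by (rule sqiD)
  have cis1: "cis \<in> borel_measurable borel" using cis_m[of 1] by simp
  have [measurable]: "(\<lambda>\<omega>. cis (partial c F \<omega>)) \<in> borel_measurable M"
    by (rule measurable_compose[OF _ cis1]) simp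
  have i: "integrable M (\<lambda>\<omega>. cis (partial c F \<omega>))" by (rule integrable_const_bound[of _ 1]) auto
  have "expectation (\<lambda>\<omega>. cos (partial c F \<omega> + \<theta>)) = expectation (\<lambda>\<omega>. Re (cis \<theta> * cis (partial c F \<omega>)))"
    by (simp add: cis_mult add.commute)
  also have "\<dots> = Re (cis \<theta> * expectation (\<lambda>\<omega>. cis (partial c F \<omega>)))"
    using i by (subst integral_Re) simp_all
  also have "\<dots> = exp (- (\<Sum>j\<in>F. (c j)\<^sup>2) / 2) * cos \<theta>" unfolding E by simp
  finally show ?thesis .
qed

text \<open>
  \<open>U\<close> is the mean-square convergent series \<open>\<Sum>\<^sub>j c j * \<epsilon>
  j\<close>. The coefficients are attached to the noise variables rather than to lags, so that
  sums of such variables for different times have the sums of the coefficients.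
\<close>

definition lin :: "(int \<Rightarrow> real) \<Rightarrow> ('a \<Rightarrow> real) \<Rightarrow> bool" where
  "lin c U \<longleftrightarrow> sqi \<Z> c \<and> sqi M U \<and>
    ((\<lambda>F. nrm M (\<lambda>\<omega>. U \<omega> - partial c F \<omega>)) \<longlongrightarrow> 0) (finite_subsets_at_top UNIV)"

lemma linD: "lin c U \<Longrightarrow> sqi \<Z> c" "lin c U \<Longrightarrow> sqi M U"
  by (auto simp: lin_def)

text \<open>
  Reindexing by \<open>i = t - j\<close> permutes the finite subsets of the integers.
\<close>

lemma mean_square_sum_lin:
  assumes a: "sqi \<Z> a" and s: "mean_square_sum M (\<lambda>j \<omega>. a j * \<epsilon> (t - j) \<omega>) U"
  shows "lin (\<lambda>i. a (t - i)) U"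
proof -
  have Um [measurable]: "U \<in> borel_measurable M" using s by (simp add: mean_square_sum_def)
  have lim: "((\<lambda>F. \<integral>\<^sup>+\<omega>. ennreal ((U \<omega> - (\<Sum>j\<in>F. a j * \<epsilon> (t - j) \<omega>))\<^sup>2) \<partial>M) \<longlongrightarrow> 0) (finite_subsets_at_top UNIV)"
    using s by (simp add: mean_square_sum_def)
  have re: "(\<Sum>j\<in>F. a j * \<epsilon> (t - j) \<omega>) = partial (\<lambda>i. a (t - i)) ((\<lambda>j. t - j) ` F) \<omega>" for F \<omega>
    unfolding partial_def by (subst sum.reindex) (auto simp: inj_on_def)
  have fm: "filtermap ((`) (\<lambda>j. t - j)) (finite_subsets_at_top UNIV) = finite_subsets_at_top UNIV"
    by (rule filtermap_image_finite_subsets_at_top[of "\<lambda>j. t - j" UNIV, unfolded bij_is_surj[OF bij_minus_left]])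
      (auto simp: inj_on_def)
  have "((\<lambda>F. \<integral>\<^sup>+\<omega>. ennreal ((U \<omega> - partial (\<lambda>i. a (t - i)) F \<omega>)\<^sup>2) \<partial>M) \<longlongrightarrow> 0) (filtermap ((`) (\<lambda>j. t - j)) (finite_subsets_at_top UNIV))"
    unfolding filterlim_filtermap using lim by (simp add: re)
  then have lim2: "((\<lambda>F. \<integral>\<^sup>+\<omega>. ennreal ((U \<omega> - partial (\<lambda>i. a (t - i)) F \<omega>)\<^sup>2) \<partial>M) \<longlongrightarrow> 0) (finite_subsets_at_top UNIV)"
    unfolding fm .
  have pm [measurable]: "partial (\<lambda>i. a (t - i)) F \<in> borel_measurable M" for F using partial_sqi by (rule sqiD)
  have ev: "\<forall>\<^sub>F F in finite_subsets_at_top UNIV. (\<integral>\<^sup>+\<omega>. ennreal ((U \<omega> - partial (\<lambda>i. a (t - i)) F \<omega>)\<^sup>2) \<partial>M) < 1"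
    using order_tendstoD(2)[OF lim2, of 1] by simp
  have "\<exists>F. (\<integral>\<^sup>+\<omega>. ennreal ((U \<omega> - partial (\<lambda>i. a (t - i)) F \<omega>)\<^sup>2) \<partial>M) < 1"
    using eventually_happens[OF ev] finite_subsets_at_top_neq_bot by blast
  then obtain F0 where F0: "(\<integral>\<^sup>+\<omega>. ennreal ((U \<omega> - partial (\<lambda>i. a (t - i)) F0 \<omega>)\<^sup>2) \<partial>M) < 1" by blast
  have "sqi M (\<lambda>\<omega>. U \<omega> - partial (\<lambda>i. a (t - i)) F0 \<omega>)"
    unfolding sqi_def
  proof
    show "integrable M (\<lambda>\<omega>. (U \<omega> - partial (\<lambda>i. a (t - i)) F0 \<omega>)\<^sup>2)"
      using F0 by (intro integrableI_bounded) (auto intro: less_trans)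
  qed simp
  from sqi_add[OF this partial_sqi[of "\<lambda>i. a (t - i)" F0]] have sU: "sqi M U" by simp
  have "(\<integral>\<^sup>+\<omega>. ennreal ((U \<omega> - partial (\<lambda>i. a (t - i)) F \<omega>)\<^sup>2) \<partial>M)
      = ennreal ((nrm M (\<lambda>\<omega>. U \<omega> - partial (\<lambda>i. a (t - i)) F \<omega>))\<^sup>2)" for F
    unfolding nrm_sq using sqi_diff[OF sU partial_sqi[of "\<lambda>i. a (t - i)" F]]
    by (intro nn_integral_eq_integral) (auto simp: sqi_def)
  with lim2 have "((\<lambda>F. ennreal ((nrm M (\<lambda>\<omega>. U \<omega> - partial (\<lambda>i. a (t - i)) F \<omega>))\<^sup>2)) \<longlongrightarrow> ennreal 0) (finite_subsets_at_top UNIV)"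
    by simp
  then have "((\<lambda>F. (nrm M (\<lambda>\<omega>. U \<omega> - partial (\<lambda>i. a (t - i)) F \<omega>))\<^sup>2) \<longlongrightarrow> 0) (finite_subsets_at_top UNIV)"
    by (subst (asm) tendsto_ennreal_iff) auto
  from tendsto_real_sqrt[OF this]
  have "((\<lambda>F. nrm M (\<lambda>\<omega>. U \<omega> - partial (\<lambda>i. a (t - i)) F \<omega>)) \<longlongrightarrow> 0) (finite_subsets_at_top UNIV)" by simp
  then show ?thesis using a sU integrable_Z_reflect[of "\<lambda>i. (a i)\<^sup>2" t] by (auto simp: lin_def sqi_def)
qed

lemma lin_finite:
  assumes "finite F" "\<And>j. j \<notin> F \<Longrightarrow> c j = 0"
  shows "lin c (partial c F)"
  unfolding lin_def
proof (intro conjI)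
  have "integrable \<Z> (\<lambda>j. (c j)\<^sup>2)"
  proof (rule integrable_Z_bounded_sums[where C="\<Sum>j\<in>F. (c j)\<^sup>2"])
    fix G :: "int set" assume "finite G"
    then have "(\<Sum>j\<in>G. (c j)\<^sup>2) = (\<Sum>j\<in>G \<inter> F. (c j)\<^sup>2)"
      using assms(2) by (intro sum.mono_neutral_right) auto
    also have "\<dots> \<le> (\<Sum>j\<in>F. (c j)\<^sup>2)" using assms(1) by (intro sum_mono2) auto
    finally show "(\<Sum>j\<in>G. (c j)\<^sup>2) \<le> (\<Sum>j\<in>F. (c j)\<^sup>2)" .
  qed simp
  then show "sqi \<Z> c" by (simp add: sqi_def)
  have "\<forall>\<^sub>F G in finite_subsets_at_top UNIV. finite G \<and> F \<subseteq> G"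
    unfolding eventually_finite_subsets_at_top using assms(1) by blast
  then have "\<forall>\<^sub>F G in finite_subsets_at_top UNIV. nrm M (\<lambda>\<omega>. partial c F \<omega> - partial c G \<omega>) = 0"
  proof eventually_elim
    case (elim G)
    then have "partial c G \<omega> = partial c F \<omega>" for \<omega>
      unfolding partial_def by (intro sum.mono_neutral_right) (auto simp: assms(2))
    then show ?case by (simp add: nrm_def)
  qed
  then show "((\<lambda>G. nrm M (\<lambda>\<omega>. partial c F \<omega> - partial c G \<omega>)) \<longlongrightarrow> 0) (finite_subsets_at_top UNIV)"
    by (rule tendsto_eventually)
qed (rule partial_sqi)

lemma lin_add:
  assumes "lin c U" "lin d V" shows "lin (\<lambda>j. c j + d j) (\<lambda>\<omega>. U \<omega> + V \<omega>)"
  unfolding lin_def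
proof (intro conjI sqi_add linD[OF assms(1)] linD[OF assms(2)])
  have p: "partial (\<lambda>j. c j + d j) F \<omega> = partial c F \<omega> + partial d F \<omega>" for F \<omega>
    by (simp add: partial_def sum.distrib distrib_right)
  show "((\<lambda>F. nrm M (\<lambda>\<omega>. U \<omega> + V \<omega> - partial (\<lambda>j. c j + d j) F \<omega>)) \<longlongrightarrow> 0) (finite_subsets_at_top UNIV)"
  proof (rule Lim_null_comparison)
    show "\<forall>\<^sub>F F in finite_subsets_at_top UNIV. norm (nrm M (\<lambda>\<omega>. U \<omega> + V \<omega> - partial (\<lambda>j. c j + d j) F \<omega>))
       \<le> nrm M (\<lambda>\<omega>. U \<omega> - partial c F \<omega>) + nrm M (\<lambda>\<omega>. V \<omega> - partial d F \<omega>)"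
    proof (rule always_eventually, rule allI)
      fix F
      have "(\<lambda>\<omega>. U \<omega> + V \<omega> - partial (\<lambda>j. c j + d j) F \<omega>) = (\<lambda>\<omega>. (U \<omega> - partial c F \<omega>) + (V \<omega> - partial d F \<omega>))"
        by (auto simp: p)
      then show "norm (nrm M (\<lambda>\<omega>. U \<omega> + V \<omega> - partial (\<lambda>j. c j + d j) F \<omega>))
       \<le> nrm M (\<lambda>\<omega>. U \<omega> - partial c F \<omega>) + nrm M (\<lambda>\<omega>. V \<omega> - partial d F \<omega>)"
        using nrm_triangle[OF sqi_diff[OF linD(2)[OF assms(1)] partial_sqi[of c F]] sqi_diff[OF linD(2)[OF assms(2)] partial_sqi[of d F]]]
        by simp
    qed
    show "((\<lambda>F. nrm M (\<lambda>\<omega>. U \<omega> - partial c F \<omega>) + nrm M (\<lambda>\<omega>. V \<omega> - partial d F \<omega>)) \<longlongrightarrow> 0) (finite_subsets_at_top UNIV)"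
      using assms by (intro tendsto_add_zero) (auto simp: lin_def)
  qed
qed

lemma lin_cmult:
  assumes "lin c U" shows "lin (\<lambda>j. x * c j) (\<lambda>\<omega>. x * U \<omega>)"
  unfolding lin_def
proof (intro conjI sqi_cmult linD[OF assms(1)])
  have "nrm M (\<lambda>\<omega>. x * U \<omega> - partial (\<lambda>j. x * c j) F \<omega>) = \<bar>x\<bar> * nrm M (\<lambda>\<omega>. U \<omega> - partial c F \<omega>)" for F
    unfolding nrm_cmult[symmetric] by (simp add: partial_def sum_distrib_left right_diff_distrib mult.assoc)
  then show "((\<lambda>F. nrm M (\<lambda>\<omega>. x * U \<omega> - partial (\<lambda>j. x * c j) F \<omega>)) \<longlongrightarrow> 0) (finite_subsets_at_top UNIV)"
    using assms by (simp add: lin_def tendsto_mult_right_zero)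
qed

lemma lin_sum:
  assumes "finite A" "\<And>a. a \<in> A \<Longrightarrow> lin (c a) (U a)"
  shows "lin (\<lambda>j. \<Sum>a\<in>A. c a j) (\<lambda>\<omega>. \<Sum>a\<in>A. U a \<omega>)"
  using assms
proof (induction A)
  case empty
  have "lin (\<lambda>_. 0) (partial (\<lambda>_. 0) {})" by (rule lin_finite) auto
  then show ?case by (simp add: partial_def[abs_def])
next
  case (insert a A)
  then show ?case using lin_add[of "c a" "U a"] by simp
qed

lemma sum_tendsto_Z:
  assumes "sqi \<Z> c"
  shows "((\<lambda>F. \<Sum>j\<in>F. (c j)\<^sup>2) \<longlongrightarrow> (nrm \<Z> c)\<^sup>2) (finite_subsets_at_top UNIV)"
proof -
  have i: "integrable \<Z> (\<lambda>j. (c j)\<^sup>2)" using assms by (simp add: sqi_def)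
  have "((\<lambda>j. (c j)\<^sup>2) has_sum (nrm \<Z> c)\<^sup>2) UNIV"
    using has_sum_infsum[OF integral_Z_infsum(1)[OF i]] unfolding integral_Z_infsum(2)[OF i] nrm_sq .
  then show ?thesis by (simp add: has_sum_def)
qed

lemma lin_norm:
  assumes "lin c U" shows "nrm M U = nrm \<Z> c"
proof -
  have "((\<lambda>F. nrm M (partial c F)) \<longlongrightarrow> nrm M U) (finite_subsets_at_top UNIV)"
  proof (rule LIM_zero_cancel, rule Lim_null_comparison)
    show "\<forall>\<^sub>F F in finite_subsets_at_top UNIV. norm (nrm M (partial c F) - nrm M U) \<le> nrm M (\<lambda>\<omega>. U \<omega> - partial c F \<omega>)"
    proof (rule always_eventually, rule allI)
      fix F show "norm (nrm M (partial c F) - nrm M U) \<le> nrm M (\<lambda>\<omega>. U \<omega> - partial c F \<omega>)"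
        using nrm_triangle_sub[OF linD(2)[OF assms] partial_sqi[of c F]] nrm_triangle_sub[OF partial_sqi[of c F] linD(2)[OF assms]]
          nrm_minus_commute[of M U "partial c F"] by (simp add: abs_le_iff)
    qed
  qed (use assms in \<open>simp add: lin_def\<close>)
  from tendsto_power[OF this, of 2]
  have "((\<lambda>F. \<Sum>j\<in>F. (c j)\<^sup>2) \<longlongrightarrow> (nrm M U)\<^sup>2) (finite_subsets_at_top UNIV)" by (simp add: partial_norm)
  from tendsto_unique[OF _ this sum_tendsto_Z[OF linD(1)[OF assms]]]
  show ?thesis by simp
qed

lemma lin_cos:
  assumes "lin c U"
  shows "expectation (\<lambda>\<omega>. cos (U \<omega> + \<theta>)) = exp (- (nrm \<Z> c)\<^sup>2 / 2) * cos \<theta>"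
proof -
  have [measurable]: "U \<in> borel_measurable M" "partial c F \<in> borel_measurable M" for F
    using linD(2)[OF assms] partial_sqi[of c F] by (auto simp: sqi_def)
  have ic: "integrable M (\<lambda>\<omega>. cos (g \<omega> + \<theta>))" if [measurable]: "g \<in> borel_measurable M" for g
    by (rule integrable_const_bound[of _ 1]) auto
  have "((\<lambda>F. expectation (\<lambda>\<omega>. cos (partial c F \<omega> + \<theta>))) \<longlongrightarrow> expectation (\<lambda>\<omega>. cos (U \<omega> + \<theta>))) (finite_subsets_at_top UNIV)"
  proof (rule LIM_zero_cancel, rule Lim_null_comparison)
    show "\<forall>\<^sub>F F in finite_subsets_at_top UNIV. norm (expectation (\<lambda>\<omega>. cos (partial c F \<omega> + \<theta>)) - expectation (\<lambda>\<omega>. cos (U \<omega> + \<theta>)))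
      \<le> nrm M (\<lambda>\<omega>. U \<omega> - partial c F \<omega>)"
    proof (rule always_eventually, rule allI)
      fix F
      have s: "sqi M (\<lambda>\<omega>. U \<omega> - partial c F \<omega>)" by (intro sqi_diff linD(2)[OF assms] partial_sqi)
      have cl: "\<bar>cos a - cos b\<bar> \<le> \<bar>b - a\<bar>" for a b :: real
      proof -
        have "cos a - cos b = 2 * (sin ((a + b) / 2) * sin ((b - a) / 2))" by (simp add: cos_diff_cos)
        also have "\<bar>\<dots>\<bar> \<le> 2 * (1 * \<bar>(b - a) / 2\<bar>)"
          unfolding abs_mult by (intro mult_mono abs_sin_x_le_abs_x abs_sin_le_one) auto
        finally show ?thesis by simp
      qed
      have "norm (expectation (\<lambda>\<omega>. cos (partial c F \<omega> + \<theta>)) - expectation (\<lambda>\<omega>. cos (U \<omega> + \<theta>)))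
          = norm (expectation (\<lambda>\<omega>. cos (partial c F \<omega> + \<theta>) - cos (U \<omega> + \<theta>)))"
        by (subst Bochner_Integration.integral_diff) (auto intro: ic)
      also have "\<dots> \<le> expectation (\<lambda>\<omega>. norm (cos (partial c F \<omega> + \<theta>) - cos (U \<omega> + \<theta>)))" by (rule integral_norm_bound)
      also have "\<dots> \<le> expectation (\<lambda>\<omega>. \<bar>U \<omega> - partial c F \<omega>\<bar>)"
      proof (rule integral_mono)
        show "integrable M (\<lambda>\<omega>. norm (cos (partial c F \<omega> + \<theta>) - cos (U \<omega> + \<theta>)))"
          by (intro integrable_norm Bochner_Integration.integrable_diff ic) auto
        show "integrable M (\<lambda>\<omega>. \<bar>U \<omega> - partial c F \<omega>\<bar>)" using sqi_integrable[OF s] by simp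
        show "norm (cos (partial c F \<omega> + \<theta>) - cos (U \<omega> + \<theta>)) \<le> \<bar>U \<omega> - partial c F \<omega>\<bar>" for \<omega>
          using cl[of "partial c F \<omega> + \<theta>" "U \<omega> + \<theta>"] by simp
      qed
      also have "\<dots> \<le> nrm M (\<lambda>\<omega>. U \<omega> - partial c F \<omega>)" by (rule L1_le_nrm[OF s])
      finally show "norm (expectation (\<lambda>\<omega>. cos (partial c F \<omega> + \<theta>)) - expectation (\<lambda>\<omega>. cos (U \<omega> + \<theta>)))
        \<le> nrm M (\<lambda>\<omega>. U \<omega> - partial c F \<omega>)" .
    qed
  qed (use assms in \<open>simp add: lin_def\<close>)
  moreover have "((\<lambda>F. expectation (\<lambda>\<omega>. cos (partial c F \<omega> + \<theta>))) \<longlongrightarrow> exp (- (nrm \<Z> c)\<^sup>2 / 2) * cos \<theta>) (finite_subsets_at_top UNIV)"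
  proof (rule Lim_transform_eventually)
    show "((\<lambda>F. exp (- (\<Sum>j\<in>F. (c j)\<^sup>2) / 2) * cos \<theta>) \<longlongrightarrow> exp (- (nrm \<Z> c)\<^sup>2 / 2) * cos \<theta>) (finite_subsets_at_top UNIV)"
      by (intro tendsto_intros sum_tendsto_Z linD(1)[OF assms]) simp
    show "\<forall>\<^sub>F F in finite_subsets_at_top UNIV. exp (- (\<Sum>j\<in>F. (c j)\<^sup>2) / 2) * cos \<theta> = expectation (\<lambda>\<omega>. cos (partial c F \<omega> + \<theta>))"
      by (rule eventually_finite_subsets_at_top_weakI) (simp add: partial_cos)
  qed
  ultimately show ?thesis by (rule tendsto_unique[rotated]) simp
qed

lemma lin_inner:
  assumes "lin c U" "lin d V"
  shows "expectation (\<lambda>\<omega>. U \<omega> * V \<omega>) = (\<integral>j. c j * d j \<partial>\<Z>)"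
proof -
  have gen: "4 * (\<integral>x. f x * g x \<partial>N) = (nrm N (\<lambda>x. f x + g x))\<^sup>2 - (nrm N (\<lambda>x. f x + (-1) * g x))\<^sup>2"
    if s: "sqi N f" "sqi N g" for N and f g :: "'z \<Rightarrow> real"
  proof -
    have "(nrm N (\<lambda>x. f x + k * g x))\<^sup>2 = (\<integral>x. (f x)\<^sup>2 \<partial>N) + k\<^sup>2 * (\<integral>x. (g x)\<^sup>2 \<partial>N) + 2 * k * (\<integral>x. f x * g x \<partial>N)" for k
    proof -
      have "(nrm N (\<lambda>x. f x + k * g x))\<^sup>2 = (\<integral>x. (f x)\<^sup>2 + k\<^sup>2 * (g x)\<^sup>2 + 2 * k * (f x * g x) \<partial>N)"
        unfolding nrm_sq by (simp add: power2_sum power_mult_distrib mult_ac)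
      then show ?thesis using sqi_mult[OF s] sqiD[OF s(1)] sqiD[OF s(2)] by simp
    qed
    from this[of 1] this[of "-1"] show ?thesis by simp
  qed
  have "lin (\<lambda>j. c j + (-1) * d j) (\<lambda>\<omega>. U \<omega> + (-1) * V \<omega>)" by (intro lin_add lin_cmult assms)
  from lin_norm[OF this] lin_norm[OF lin_add[OF assms]] gen[OF linD(2)[OF assms(1)] linD(2)[OF assms(2)]]
    gen[OF linD(1)[OF assms(1)] linD(1)[OF assms(2)]]
  show ?thesis by simp
qed

text \<open>
  A linear combination of coordinates of \<open>Z\<close> and \<open>Z'\<close> is again a
  linear functional of the noise, hence Gaussian with variance given by its coefficients.
\<close>

lemma lin_std_pair:
  fixes z z' :: "'n::finite \<Rightarrow> int \<Rightarrow> real"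
  assumes z: "\<And>a. lin (z a) (\<lambda>\<omega>. Z \<omega> $ a)" and z': "\<And>a. lin (z' a) (\<lambda>\<omega>. Z' \<omega> $ a)"
    and o: "\<And>a b. (\<integral>j. z a j * z b j \<partial>\<Z>) = (if a = b then 1 else 0)"
    and o': "\<And>a b. (\<integral>j. z' a j * z' b j \<partial>\<Z>) = (if a = b then 1 else 0)"
    and R: "\<And>a b. (\<integral>j. z a j * z' b j \<partial>\<Z>) = R $ a $ b"
  shows "std_pair M Z Z' R"
  unfolding std_pair_def
proof (intro conjI allI)
  have m: "(\<lambda>\<omega>. Z \<omega> $ a) \<in> borel_measurable M" "(\<lambda>\<omega>. Z' \<omega> $ a) \<in> borel_measurable M" for a
    using linD(2)[OF z[of a]] linD(2)[OF z'[of a]] by (auto simp: sqi_def)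
  show "Z \<in> borel_measurable M" "Z' \<in> borel_measurable M" by (intro borel_measurable_vec m)+
  fix u v \<theta>
  have l: "lin (\<lambda>j. (\<Sum>a\<in>UNIV. u $ a * z a j) + (\<Sum>b\<in>UNIV. v $ b * z' b j)) (\<lambda>\<omega>. u \<bullet> Z \<omega> + v \<bullet> Z' \<omega>)"
    unfolding inner_vec_def inner_real_def by (intro lin_add lin_sum lin_cmult z z') auto
  have s: "sqi \<Z> (z a)" "sqi \<Z> (z' a)" for a using z z' by (auto dest: linD)
  have ip: "(\<integral>j. (\<Sum>a\<in>UNIV. x $ a * f a j) * (\<Sum>b\<in>UNIV. y $ b * g b j) \<partial>\<Z>) = (\<Sum>a\<in>UNIV. \<Sum>b\<in>UNIV. x $ a * y $ b * (\<integral>j. f a j * g b j \<partial>\<Z>))"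
    if fg: "\<And>a. sqi \<Z> (f a)" "\<And>a. sqi \<Z> (g a)" for f g :: "'n \<Rightarrow> int \<Rightarrow> real" and x y :: "real^'n"
  proof -
    have "(\<Sum>a\<in>UNIV. x $ a * f a j) * (\<Sum>b\<in>UNIV. y $ b * g b j) = (\<Sum>a\<in>UNIV. \<Sum>b\<in>UNIV. x $ a * y $ b * (f a j * g b j))" for j
      unfolding sum_product by (simp add: mult_ac)
    then show ?thesis by (simp add: Bochner_Integration.integral_sum sqi_mult fg)
  qed
  define p q where "p j = (\<Sum>a\<in>UNIV. u $ a * z a j)" and "q j = (\<Sum>b\<in>UNIV. v $ b * z' b j)" for j
  have spq: "sqi \<Z> p" "sqi \<Z> q" unfolding p_def[abs_def] q_def[abs_def] by (intro sqi_sum sqi_cmult s)+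
  have "(nrm \<Z> (\<lambda>j. p j + q j))\<^sup>2 = (\<integral>j. p j * p j + q j * q j + 2 * (p j * q j) \<partial>\<Z>)"
    unfolding nrm_sq by (simp add: power2_eq_square algebra_simps)
  also have "\<dots> = (\<integral>j. p j * p j \<partial>\<Z>) + (\<integral>j. q j * q j \<partial>\<Z>) + 2 * (\<integral>j. p j * q j \<partial>\<Z>)"
    using sqi_mult[OF spq(1,1)] sqi_mult[OF spq(2,2)] sqi_mult[OF spq] by simp
  also have "(\<integral>j. p j * p j \<partial>\<Z>) = (norm u)\<^sup>2"
    unfolding p_def by (subst ip) (simp_all add: s o if_distrib[of "\<lambda>x. _ * x"] power2_norm_eq_inner inner_vec_def cong: if_cong)
  also have "(\<integral>j. q j * q j \<partial>\<Z>) = (norm v)\<^sup>2"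
    unfolding q_def by (subst ip) (simp_all add: s o' if_distrib[of "\<lambda>x. _ * x"] power2_norm_eq_inner inner_vec_def cong: if_cong)
  also have "(\<integral>j. p j * q j \<partial>\<Z>) = u \<bullet> (R *v v)"
    unfolding p_def q_def by (subst ip) (simp_all add: s R inner_vec_def matrix_vector_mult_def sum_distrib_left mult_ac)
  finally have n: "(nrm \<Z> (\<lambda>j. (\<Sum>a\<in>UNIV. u $ a * z a j) + (\<Sum>b\<in>UNIV. v $ b * z' b j)))\<^sup>2 = (norm u)\<^sup>2 + (norm v)\<^sup>2 + 2 * (u \<bullet> (R *v v))"
    unfolding p_def q_def .
  show "expectation (\<lambda>\<omega>. cos (u \<bullet> Z \<omega> + v \<bullet> Z' \<omega> + \<theta>)) = exp (- ((norm u)\<^sup>2 + (norm v)\<^sup>2) / 2 - u \<bullet> (R *v v)) * cos \<theta>"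
    unfolding lin_cos[OF l] n by (simp add: field_simps)
qed

end

section \<open>Approximation by local sums\<close>

text \<open>
  If the sums \<open>S n\<close> are approximated, uniformly in large \<open>n\<close>, by
  normalized sums of bounded local variables and their variances converge, then so do their
  characteristic functions: that of the approximating sum \<open>T\<close> is nearly Gaussian by
  \<open>local_char_bound\<close>, and both the characteristic function and the variance change
  little between \<open>S n\<close> and \<open>T\<close>.
\<close>

lemma (in prob_space) local_approx_char_limit:
  fixes S :: "nat \<Rightarrow> 'a \<Rightarrow> real"
  assumes ind: "indep_vars (\<lambda>_. borel) \<epsilon> UNIV"
    and S: "\<And>n. n \<ge> n0 \<Longrightarrow> sqi M (S n)"
    and var: "(\<lambda>n. (nrm M (S n))\<^sup>2) \<longlonglongrightarrow> \<sigma>2"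
    and appr: "\<And>\<eta>. 0 < \<eta> \<Longrightarrow> \<exists>D B n1. \<forall>n\<ge>n1. \<exists>\<xi>. (\<forall>k\<in>{1..n}. \<xi> k \<in> borel_measurable (fld M \<epsilon> (near D k))
        \<and> (\<forall>\<omega>. \<bar>\<xi> k \<omega>\<bar> \<le> B) \<and> expectation (\<xi> k) = 0)
        \<and> nrm M (\<lambda>\<omega>. S n \<omega> - (\<Sum>k=1..n. \<xi> k \<omega>) / sqrt (real n)) \<le> \<eta>"
  shows "(\<lambda>n. expectation (\<lambda>\<omega>. iexp (t * S n \<omega>))) \<longlonglongrightarrow> of_real (exp (- \<sigma>2 * t\<^sup>2 / 2))"
proof (rule LIMSEQ_I)
  fix r :: real assume r: "0 < r"
  have \<sigma>0: "0 \<le> \<sigma>2" by (rule LIMSEQ_le_const[OF var]) simp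
  \<comment> \<open>the total effect of an approximation error \<open>\<eta>\<close> on the characteristic function is below \<open>A * \<eta>\<close>\<close>
  define A where "A = \<bar>t\<bar> + t\<^sup>2 / 2 * (2 * (sqrt \<sigma>2 + 1) + 1) + 1"
  have A: "A > 0" by (simp add: A_def \<sigma>0 add_nonneg_pos)
  define \<eta> where "\<eta> = min 1 (r / (4 * A))"
  have \<eta>: "0 < \<eta>" "\<eta> \<le> 1" "A * \<eta> \<le> r / 4" using r A by (auto simp: \<eta>_def min_def field_simps)
  from appr[OF \<eta>(1)] obtain D B n1 where ap: "\<And>n. n \<ge> n1 \<Longrightarrow> \<exists>\<xi>. (\<forall>k\<in>{1..n}. \<xi> k \<in> borel_measurable (fld M \<epsilon> (near D k))
        \<and> (\<forall>\<omega>. \<bar>\<xi> k \<omega>\<bar> \<le> B) \<and> expectation (\<xi> k) = 0)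
        \<and> nrm M (\<lambda>\<omega>. S n \<omega> - (\<Sum>k=1..n. \<xi> k \<omega>) / sqrt (real n)) \<le> \<eta>" by blast
  define C where "C = B ^ 3 * real (4 * D + 1) ^ 2 * \<bar>t\<bar> ^ 3 + B\<^sup>2 * real (4 * D + 1) * sqrt (real (12 * D + 1)) * t\<^sup>2"
  have "(\<lambda>n. C / sqrt (real n)) \<longlonglongrightarrow> 0"
    by (rule real_tendsto_divide_at_top[OF tendsto_const filterlim_compose[OF sqrt_at_top filterlim_real_sequentially]])
  from order_tendstoD(2)[OF this, of "r / 4"] r obtain n2 where n2: "\<And>n. n \<ge> n2 \<Longrightarrow> C / sqrt (real n) < r / 4"
    by (auto simp: eventually_sequentially)
  have "(\<lambda>n. \<bar>(nrm M (S n))\<^sup>2 - \<sigma>2\<bar> * t\<^sup>2 / 2) \<longlonglongrightarrow> \<bar>\<sigma>2 - \<sigma>2\<bar> * t\<^sup>2 / 2" by (intro tendsto_intros var) auto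
  then have "(\<lambda>n. \<bar>(nrm M (S n))\<^sup>2 - \<sigma>2\<bar> * t\<^sup>2 / 2) \<longlonglongrightarrow> 0" by simp
  from order_tendstoD(2)[OF this, of "r / 4"] r obtain n3 where n3: "\<And>n. n \<ge> n3 \<Longrightarrow> \<bar>(nrm M (S n))\<^sup>2 - \<sigma>2\<bar> * t\<^sup>2 / 2 < r / 4"
    by (auto simp: eventually_sequentially)
  have "(\<lambda>n. nrm M (S n)) \<longlonglongrightarrow> sqrt \<sigma>2" using tendsto_real_sqrt[OF var] by simp
  from order_tendstoD(2)[OF this, of "sqrt \<sigma>2 + 1"] obtain n4 where n4: "\<And>n. n \<ge> n4 \<Longrightarrow> nrm M (S n) < sqrt \<sigma>2 + 1"
    by (auto simp: eventually_sequentially)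
  show "\<exists>no. \<forall>n\<ge>no. norm (expectation (\<lambda>\<omega>. iexp (t * S n \<omega>)) - of_real (exp (- \<sigma>2 * t\<^sup>2 / 2))) < r"
  proof (intro exI allI impI)
    fix n assume "max (max n0 n1) (max (max n2 n3) (max n4 1)) \<le> n"
    then have n: "n \<ge> n0" "n \<ge> n1" "n \<ge> n2" "n \<ge> n3" "n \<ge> n4" "n \<ge> 1" by auto
    obtain \<xi> where \<xi>: "\<And>k. k \<in> {1..n} \<Longrightarrow> \<xi> k \<in> borel_measurable (fld M \<epsilon> (near D k))"
      "\<And>k \<omega>. k \<in> {1..n} \<Longrightarrow> \<bar>\<xi> k \<omega>\<bar> \<le> B" "\<And>k. k \<in> {1..n} \<Longrightarrow> expectation (\<xi> k) = 0"
      and d: "nrm M (\<lambda>\<omega>. S n \<omega> - (\<Sum>k=1..n. \<xi> k \<omega>) / sqrt (real n)) \<le> \<eta>"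
      using ap[OF n(2)] by blast
    define T where "T \<omega> = (\<Sum>k=1..n. \<xi> k \<omega>) / sqrt (real n)" for \<omega>
    have em: "\<epsilon> i \<in> borel_measurable M" for i using ind by (auto simp: indep_vars_def)
    have xm: "\<xi> k \<in> borel_measurable M" if "k \<in> {1..n}" for k by (rule fld_measurable[OF em \<xi>(1)[OF that]])
    have sT: "sqi M T"
    proof -
      have "sqi M (\<lambda>\<omega>. \<Sum>k=1..n. \<xi> k \<omega>)" by (intro sqi_sum sqi_bounded[of _ B] xm \<xi>(2))
      from sqi_cmult[OF this, of "1 / sqrt (real n)"] show ?thesis by (simp add: T_def[abs_def])
    qed
    have sS: "sqi M (S n)" by (rule S[OF n(1)])
    have [measurable]: "S n \<in> borel_measurable M" "T \<in> borel_measurable M" using sS sT by (auto simp: sqi_def)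
    have d': "nrm M (\<lambda>\<omega>. S n \<omega> - T \<omega>) \<le> \<eta>" using d by (simp add: T_def)
    have i: "integrable M (\<lambda>\<omega>. iexp (t * S n \<omega>))" "integrable M (\<lambda>\<omega>. iexp (t * T \<omega>))"
      by (rule integrable_const_bound[of _ 1]; auto)+
    have 1: "norm (expectation (\<lambda>\<omega>. iexp (t * S n \<omega>)) - expectation (\<lambda>\<omega>. iexp (t * T \<omega>))) \<le> \<bar>t\<bar> * \<eta>"
    proof -
      have "norm (expectation (\<lambda>\<omega>. iexp (t * S n \<omega>)) - expectation (\<lambda>\<omega>. iexp (t * T \<omega>)))
          = norm (expectation (\<lambda>\<omega>. iexp (t * S n \<omega>) - iexp (t * T \<omega>)))"
        by (subst Bochner_Integration.integral_diff[OF i]) (rule refl)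
      also have "\<dots> \<le> expectation (\<lambda>\<omega>. norm (iexp (t * S n \<omega>) - iexp (t * T \<omega>)))" by (rule integral_norm_bound)
      also have "\<dots> \<le> expectation (\<lambda>\<omega>. \<bar>t\<bar> * \<bar>S n \<omega> - T \<omega>\<bar>)"
      proof (rule integral_mono)
        show "integrable M (\<lambda>\<omega>. norm (iexp (t * S n \<omega>) - iexp (t * T \<omega>)))"
          by (intro integrable_norm Bochner_Integration.integrable_diff i)
        show "integrable M (\<lambda>\<omega>. \<bar>t\<bar> * \<bar>S n \<omega> - T \<omega>\<bar>)"
          using sqi_integrable[OF sqi_diff[OF sS sT]] by simp
        fix \<omega>
        have "iexp (t * S n \<omega>) - iexp (t * T \<omega>)
            = iexp (t * T \<omega>) * (iexp (t * (S n \<omega> - T \<omega>)) - (\<Sum>k\<le>0. (\<i> * (t * (S n \<omega> - T \<omega>))) ^ k / fact k))"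
          by (simp add: right_diff_distrib exp_add[symmetric] algebra_simps)
        then have "norm (iexp (t * S n \<omega>) - iexp (t * T \<omega>))
            = norm (iexp (t * (S n \<omega> - T \<omega>)) - (\<Sum>k\<le>0. (\<i> * (t * (S n \<omega> - T \<omega>))) ^ k / fact k))"
          by (simp only: norm_mult norm_exp_i_times mult_1_left)
        also have "\<dots> \<le> \<bar>t * (S n \<omega> - T \<omega>)\<bar> ^ Suc 0 / fact (Suc 0)"
          using iexp_approx1[of "t * (S n \<omega> - T \<omega>)" 0] by simp
        finally show "norm (iexp (t * S n \<omega>) - iexp (t * T \<omega>)) \<le> \<bar>t\<bar> * \<bar>S n \<omega> - T \<omega>\<bar>"
          by (simp add: abs_mult)
      qed
      also have "\<dots> = \<bar>t\<bar> * expectation (\<lambda>\<omega>. \<bar>S n \<omega> - T \<omega>\<bar>)" by simp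
      also have "\<dots> \<le> \<bar>t\<bar> * \<eta>"
        by (intro mult_left_mono order_trans[OF L1_le_nrm d'] sqi_diff sS sT) auto
      finally show ?thesis .
    qed
    define \<tau>2 where "\<tau>2 = expectation (\<lambda>\<omega>. (T \<omega>)\<^sup>2)"
    have \<tau>n: "\<tau>2 = (nrm M T)\<^sup>2" by (simp add: \<tau>2_def nrm_sq)
    have 2: "norm (expectation (\<lambda>\<omega>. iexp (t * T \<omega>)) - exp (- \<tau>2 * t\<^sup>2 / 2)) \<le> C / sqrt (real n)"
      using local_char_bound[OF ind n(6) \<xi>, of t] unfolding \<tau>2_def C_def T_def by simp
    have 3: "\<bar>exp (- \<tau>2 * t\<^sup>2 / 2) - exp (- \<sigma>2 * t\<^sup>2 / 2)\<bar> \<le> \<bar>\<tau>2 - \<sigma>2\<bar> * t\<^sup>2 / 2"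
    proof -
      have e: "exp (- y) - exp (- x) \<le> x - y" if "0 \<le> y" "y \<le> x" for x y :: real
      proof -
        have "exp (- y) - exp (- x) = exp (- y) * (1 - exp (y - x))" by (simp add: right_diff_distrib exp_add[symmetric])
        also have "\<dots> \<le> 1 * (x - y)"
        proof (rule mult_mono)
          show "1 - exp (y - x) \<le> x - y" using exp_ge_add_one_self[of "y - x"] by linarith
        qed (use that in auto)
        finally show ?thesis by simp
      qed
      have 0: "0 \<le> \<tau>2 * t\<^sup>2 / 2" "0 \<le> \<sigma>2 * t\<^sup>2 / 2" using \<sigma>0 by (auto simp: \<tau>n)
      have eq: "\<bar>\<tau>2 - \<sigma>2\<bar> * t\<^sup>2 / 2 = \<bar>\<tau>2 * t\<^sup>2 / 2 - \<sigma>2 * t\<^sup>2 / 2\<bar>"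
        by (simp add: left_diff_distrib[symmetric] diff_divide_distrib[symmetric] abs_mult)
      show ?thesis unfolding eq
      proof (cases "\<tau>2 * t\<^sup>2 / 2 \<le> \<sigma>2 * t\<^sup>2 / 2")
        case True
        have "exp (- (\<sigma>2 * t\<^sup>2 / 2)) \<le> exp (- (\<tau>2 * t\<^sup>2 / 2))" using True by simp
        then show "\<bar>exp (- \<tau>2 * t\<^sup>2 / 2) - exp (- \<sigma>2 * t\<^sup>2 / 2)\<bar> \<le> \<bar>\<tau>2 * t\<^sup>2 / 2 - \<sigma>2 * t\<^sup>2 / 2\<bar>"
          using e[OF 0(1) True] True by simp
      next
        case False
        then have F: "\<sigma>2 * t\<^sup>2 / 2 \<le> \<tau>2 * t\<^sup>2 / 2" by simp
        have "exp (- (\<tau>2 * t\<^sup>2 / 2)) \<le> exp (- (\<sigma>2 * t\<^sup>2 / 2))" using F by simp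
        then show "\<bar>exp (- \<tau>2 * t\<^sup>2 / 2) - exp (- \<sigma>2 * t\<^sup>2 / 2)\<bar> \<le> \<bar>\<tau>2 * t\<^sup>2 / 2 - \<sigma>2 * t\<^sup>2 / 2\<bar>"
          using e[OF 0(2) F] F by simp
      qed
    qed
    have 4: "\<bar>\<tau>2 - (nrm M (S n))\<^sup>2\<bar> \<le> \<eta> * (2 * (sqrt \<sigma>2 + 1) + 1)"
    proof -
      define x y where "x = nrm M T" and "y = nrm M (S n)"
      have xy: "\<bar>x - y\<bar> \<le> \<eta>"
        using nrm_triangle_sub[OF sS sT] nrm_triangle_sub[OF sT sS] nrm_minus_commute[of M "S n" T] d'
        by (simp add: x_def y_def abs_le_iff)
      have y: "0 \<le> y" "y \<le> sqrt \<sigma>2 + 1" "0 \<le> x" using n4[OF n(5)] by (auto simp: x_def y_def)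
      have "\<bar>x\<^sup>2 - y\<^sup>2\<bar> = \<bar>x - y\<bar> * (x + y)" using y by (simp add: square_diff_square_factored power2_eq_square abs_mult)
      also have "\<dots> \<le> \<eta> * (2 * (sqrt \<sigma>2 + 1) + 1)"
        using xy y \<eta> by (intro mult_mono) auto
      finally show ?thesis by (simp add: \<tau>n x_def y_def)
    qed
    have "\<bar>\<tau>2 - \<sigma>2\<bar> \<le> \<eta> * (2 * (sqrt \<sigma>2 + 1) + 1) + \<bar>(nrm M (S n))\<^sup>2 - \<sigma>2\<bar>" using 4 by linarith
    then have "\<bar>\<tau>2 - \<sigma>2\<bar> * (t\<^sup>2 / 2) \<le> (\<eta> * (2 * (sqrt \<sigma>2 + 1) + 1) + \<bar>(nrm M (S n))\<^sup>2 - \<sigma>2\<bar>) * (t\<^sup>2 / 2)"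
      by (rule mult_right_mono) simp
    then have 5: "\<bar>\<tau>2 - \<sigma>2\<bar> * t\<^sup>2 / 2 \<le> \<eta> * (t\<^sup>2 / 2 * (2 * (sqrt \<sigma>2 + 1) + 1)) + \<bar>(nrm M (S n))\<^sup>2 - \<sigma>2\<bar> * t\<^sup>2 / 2"
      by (simp add: algebra_simps)
    have 6: "\<bar>t\<bar> * \<eta> + \<eta> * (t\<^sup>2 / 2 * (2 * (sqrt \<sigma>2 + 1) + 1)) \<le> r / 4"
    proof -
      have "\<bar>t\<bar> * \<eta> + \<eta> * (t\<^sup>2 / 2 * (2 * (sqrt \<sigma>2 + 1) + 1)) = (A - 1) * \<eta>" by (simp add: A_def algebra_simps)
      also have "\<dots> \<le> A * \<eta>" using \<eta> by (intro mult_right_mono) auto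
      finally show ?thesis using \<eta>(3) by linarith
    qed
    have "norm (expectation (\<lambda>\<omega>. iexp (t * S n \<omega>)) - of_real (exp (- \<sigma>2 * t\<^sup>2 / 2)))
        \<le> norm (expectation (\<lambda>\<omega>. iexp (t * S n \<omega>)) - expectation (\<lambda>\<omega>. iexp (t * T \<omega>)))
          + norm (expectation (\<lambda>\<omega>. iexp (t * T \<omega>)) - exp (- \<tau>2 * t\<^sup>2 / 2))
          + norm (complex_of_real (exp (- \<tau>2 * t\<^sup>2 / 2)) - of_real (exp (- \<sigma>2 * t\<^sup>2 / 2)))"
      using norm_triangle_ineq[of "expectation (\<lambda>\<omega>. iexp (t * S n \<omega>)) - expectation (\<lambda>\<omega>. iexp (t * T \<omega>))"
          "expectation (\<lambda>\<omega>. iexp (t * T \<omega>)) - exp (- \<tau>2 * t\<^sup>2 / 2)"]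
        norm_triangle_ineq[of "expectation (\<lambda>\<omega>. iexp (t * S n \<omega>)) - expectation (\<lambda>\<omega>. iexp (t * T \<omega>)) +
          (expectation (\<lambda>\<omega>. iexp (t * T \<omega>)) - exp (- \<tau>2 * t\<^sup>2 / 2))"
          "complex_of_real (exp (- \<tau>2 * t\<^sup>2 / 2)) - of_real (exp (- \<sigma>2 * t\<^sup>2 / 2))"]
      by (simp only: diff_add_cancel add_diff_eq)
    also have "norm (complex_of_real (exp (- \<tau>2 * t\<^sup>2 / 2)) - of_real (exp (- \<sigma>2 * t\<^sup>2 / 2)))
        = \<bar>exp (- \<tau>2 * t\<^sup>2 / 2) - exp (- \<sigma>2 * t\<^sup>2 / 2)\<bar>"
      by (simp only: of_real_diff[symmetric] norm_of_real)
    finally show "norm (expectation (\<lambda>\<omega>. iexp (t * S n \<omega>)) - of_real (exp (- \<sigma>2 * t\<^sup>2 / 2))) < r"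
      using 1 2 3 5 6 n2[OF n(3)] n3[OF n(4)] r by linarith
  qed
qed

section \<open>Standardized coefficient sequences\<close>

text \<open>
  Covariance matrices are handled through coefficients: \<open>gram y\<close> is the covariance
  matrix of the vector with coordinates \<open>\<Sum>\<^sub>j y a j * \<epsilon> j\<close>,
  \<open>std y\<close> are the coefficients of the standardized vector, and
  \<open>crossm\<close> below is the cross covariance matrix of two standardized vectors.
\<close>

definition gram :: "('n \<Rightarrow> int \<Rightarrow> real) \<Rightarrow> real^'n^'n::finite" where
  "gram y = (\<chi> a b. \<integral>j. y a j * y b j \<partial>\<Z>)"

definition std :: "('n \<Rightarrow> int \<Rightarrow> real) \<Rightarrow> 'n::finite \<Rightarrow> int \<Rightarrow> real" where
  "std y a j = (\<Sum>i\<in>UNIV. inv_sqrt (gram y) $ a $ i * y i j)"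

lemma gram_symmetric: "transpose (gram y) = gram y"
  by (simp add: gram_def transpose_def vec_eq_iff mult.commute)

lemma gram_quadratic:
  fixes y :: "'n::finite \<Rightarrow> int \<Rightarrow> real"
  assumes "\<And>a. sqi \<Z> (y a)"
  shows "x \<bullet> (gram y *v x) = (nrm \<Z> (\<lambda>j. \<Sum>a\<in>UNIV. x $ a * y a j))\<^sup>2"
proof -
  have "(nrm \<Z> (\<lambda>j. \<Sum>a\<in>UNIV. x $ a * y a j))\<^sup>2
      = (\<integral>j. (\<Sum>a\<in>UNIV. \<Sum>b\<in>UNIV. x $ a * x $ b * (y a j * y b j)) \<partial>\<Z>)"
    unfolding nrm_sq unfolding power2_eq_square sum_product by (simp add: mult_ac)
  also have "\<dots> = (\<Sum>a\<in>UNIV. \<Sum>b\<in>UNIV. x $ a * x $ b * (\<integral>j. y a j * y b j \<partial>\<Z>))"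
    by (simp add: Bochner_Integration.integral_sum sqi_mult assms)
  also have "\<dots> = x \<bullet> (gram y *v x)"
    by (simp add: inner_vec_def matrix_vector_mult_def gram_def sum_distrib_left mult_ac)
  finally show ?thesis ..
qed

lemma sqi_std: "(\<And>a. sqi \<Z> (y a)) \<Longrightarrow> sqi \<Z> (std y a)"
  unfolding std_def[abs_def] by (intro sqi_sum sqi_cmult)

lemma std_inner:
  fixes y y' :: "'n::finite \<Rightarrow> int \<Rightarrow> real"
  assumes "\<And>a. sqi \<Z> (y a)" "\<And>a. sqi \<Z> (y' a)"
  shows "(\<integral>s. std y a s * std y' b s \<partial>\<Z>)
    = (\<Sum>i\<in>UNIV. \<Sum>j\<in>UNIV. inv_sqrt (gram y) $ a $ i * inv_sqrt (gram y') $ b $ j * (\<integral>s. y i s * y' j s \<partial>\<Z>))"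
proof -
  have "std y a s * std y' b s = (\<Sum>i\<in>UNIV. \<Sum>j\<in>UNIV. inv_sqrt (gram y) $ a $ i * inv_sqrt (gram y') $ b $ j * (y i s * y' j s))" for s
    unfolding std_def sum_product by (simp add: mult_ac)
  then show ?thesis by (simp add: Bochner_Integration.integral_sum sqi_mult assms)
qed

lemma std_orthonormal:
  fixes y :: "'n::finite \<Rightarrow> int \<Rightarrow> real"
  assumes s: "\<And>a. sqi \<Z> (y a)" and p: "posdef c (gram y)"
  shows "(\<integral>s. std y a s * std y b s \<partial>\<Z>) = (if a = b then 1 else 0)"
proof -
  have sym: "inv_sqrt (gram y) $ b $ j = inv_sqrt (gram y) $ j $ b" for j
  proof -
    have "inv_sqrt (gram y) $ b $ j = transpose (inv_sqrt (gram y)) $ b $ j" by (simp only: inv_sqrt_props(3)[OF p])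
    then show ?thesis by (simp add: transpose_def)
  qed
  have "(\<integral>s. std y a s * std y b s \<partial>\<Z>)
      = (\<Sum>i\<in>UNIV. \<Sum>j\<in>UNIV. inv_sqrt (gram y) $ a $ i * inv_sqrt (gram y) $ j $ b * gram y $ i $ j)"
    unfolding std_inner[OF s s] sym by (simp add: gram_def)
  also have "\<dots> = (\<Sum>j\<in>UNIV. \<Sum>i\<in>UNIV. inv_sqrt (gram y) $ a $ i * inv_sqrt (gram y) $ j $ b * gram y $ i $ j)"
    by (rule sum.swap)
  also have "\<dots> = (inv_sqrt (gram y) ** gram y ** inv_sqrt (gram y)) $ a $ b"
  proof -
    have "(inv_sqrt (gram y) ** gram y ** inv_sqrt (gram y)) $ a $ b
        = (\<Sum>j\<in>UNIV. (\<Sum>i\<in>UNIV. inv_sqrt (gram y) $ a $ i * gram y $ i $ j) * inv_sqrt (gram y) $ j $ b)"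
      by (simp add: matrix_matrix_mult_def)
    also have "\<dots> = (\<Sum>j\<in>UNIV. \<Sum>i\<in>UNIV. inv_sqrt (gram y) $ a $ i * inv_sqrt (gram y) $ j $ b * gram y $ i $ j)"
      unfolding sum_distrib_right by (intro sum.cong refl) (simp only: mult_ac)
    finally show ?thesis ..
  qed
  also have "\<dots> = (if a = b then 1 else 0)" unfolding inv_sqrt_props(6)[OF p] by (simp add: mat_def)
  finally show ?thesis .
qed

lemma std_nrm:
  assumes s: "\<And>a. sqi \<Z> (y a)" and p: "posdef c (gram y)"
  shows "nrm \<Z> (std y a) = 1"
  using std_orthonormal[OF s p, of a a] by (simp add: nrm_def power2_eq_square)

lemma norm_matrix_le_entries:
  fixes A :: "real^'n^'n::finite"
  assumes "\<And>i j. \<bar>A $ i $ j\<bar> \<le> e"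
  shows "norm A \<le> (real CARD('n))\<^sup>2 * e"
proof -
  have "norm A \<le> (\<Sum>i\<in>UNIV. norm (A $ i))" unfolding norm_vec_def[of A] by (rule L2_set_le_sum) simp
  also have "\<dots> \<le> (\<Sum>i\<in>(UNIV :: 'n set). \<Sum>j\<in>(UNIV :: 'n set). e)"
  proof (rule sum_mono)
    fix i
    have "norm (A $ i) \<le> (\<Sum>j\<in>UNIV. \<bar>A $ i $ j\<bar>)" by (rule norm_le_l1_cart)
    also have "\<dots> \<le> (\<Sum>j\<in>(UNIV :: 'n set). e)" by (intro sum_mono assms)
    finally show "norm (A $ i) \<le> (\<Sum>j\<in>(UNIV :: 'n set). e)" .
  qed
  also have "\<dots> = (real CARD('n))\<^sup>2 * e" by (simp add: power2_eq_square)
  finally show ?thesis .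
qed

lemma gram_close:
  fixes y v :: "'n::finite \<Rightarrow> int \<Rightarrow> real"
  assumes s: "\<And>a. sqi \<Z> (y a)" "\<And>a. sqi \<Z> (v a)"
    and B: "\<And>a. nrm \<Z> (y a) \<le> B" "\<And>a. nrm \<Z> (v a) \<le> B"
    and d: "\<And>a. nrm \<Z> (\<lambda>j. y a j - v a j) \<le> \<delta>"
  shows "norm (gram y - gram v) \<le> (real CARD('n))\<^sup>2 * (2 * B * \<delta>)"
proof (rule norm_matrix_le_entries)
  fix a b
  have B0: "0 \<le> B" using B(1)[of a] nrm_nonneg[of \<Z> "y a"] by linarith
  have "\<bar>(gram y - gram v) $ a $ b\<bar> \<le> nrm \<Z> (\<lambda>j. y a j - v a j) * nrm \<Z> (y b) + nrm \<Z> (v a) * nrm \<Z> (\<lambda>j. y b j - v b j)"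
    using L2_inner_diff[OF s(1)[of a] s(1)[of b] s(2)[of a] s(2)[of b]] by (simp add: gram_def)
  also have "\<dots> \<le> \<delta> * B + B * \<delta>"
    by (intro add_mono mult_mono B d) (use B0 order_trans[OF nrm_nonneg d[of a]] in auto)
  finally show "\<bar>(gram y - gram v) $ a $ b\<bar> \<le> 2 * B * \<delta>" by simp
qed

text \<open>
  The Lipschitz constant of standardization, for sequences of norm at most \<open>B\<close> and
  covariance matrices bounded below by \<open>c\<close>.
\<close>

definition stdC :: "'n::finite itself \<Rightarrow> real \<Rightarrow> real \<Rightarrow> real" where
  "stdC _ c B = real CARD('n) * ((real CARD('n))\<^sup>2 * (2 * B) / (c * sqrt c) * B + 1 / sqrt c)"

lemma std_close:
  fixes y v :: "'n::finite \<Rightarrow> int \<Rightarrow> real"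
  assumes s: "\<And>a. sqi \<Z> (y a)" "\<And>a. sqi \<Z> (v a)"
    and p: "posdef c (gram y)" "posdef c (gram v)"
    and B: "\<And>a. nrm \<Z> (y a) \<le> B" "\<And>a. nrm \<Z> (v a) \<le> B"
    and d: "\<And>a. nrm \<Z> (\<lambda>j. y a j - v a j) \<le> \<delta>"
  shows "nrm \<Z> (\<lambda>j. std y a j - std v a j) \<le> stdC TYPE('n) c B * \<delta>"
proof -
  have c: "0 < c" using p(1) by (simp add: posdef_def)
  have B0: "0 \<le> B" using B(1)[of a] nrm_nonneg[of \<Z> "y a"] by linarith
  have d0: "0 \<le> \<delta>" using d[of a] nrm_nonneg[of \<Z> "\<lambda>j. y a j - v a j"] by linarith
  define Q where "Q = (real CARD('n))\<^sup>2 * (2 * B) / (c * sqrt c) * B + 1 / sqrt c"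
  have eq: "(\<lambda>j. std y a j - std v a j) = (\<lambda>j. \<Sum>i\<in>UNIV. (inv_sqrt (gram y) $ a $ i - inv_sqrt (gram v) $ a $ i) * y i j
      + inv_sqrt (gram v) $ a $ i * (y i j - v i j))"
    by (auto simp: std_def sum_subtractf[symmetric] algebra_simps)
  have "nrm \<Z> (\<lambda>j. std y a j - std v a j) \<le> (\<Sum>i\<in>UNIV. nrm \<Z> (\<lambda>j. (inv_sqrt (gram y) $ a $ i - inv_sqrt (gram v) $ a $ i) * y i j
      + inv_sqrt (gram v) $ a $ i * (y i j - v i j)))"
    unfolding eq by (rule nrm_sum_le) (intro sqi_add sqi_cmult sqi_diff s)
  also have "\<dots> \<le> (\<Sum>i\<in>(UNIV :: 'n set). Q * \<delta>)"
  proof (rule sum_mono)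
    fix i :: 'n
    have "nrm \<Z> (\<lambda>j. (inv_sqrt (gram y) $ a $ i - inv_sqrt (gram v) $ a $ i) * y i j + inv_sqrt (gram v) $ a $ i * (y i j - v i j))
        \<le> \<bar>inv_sqrt (gram y) $ a $ i - inv_sqrt (gram v) $ a $ i\<bar> * nrm \<Z> (y i) + \<bar>inv_sqrt (gram v) $ a $ i\<bar> * nrm \<Z> (\<lambda>j. y i j - v i j)"
      unfolding nrm_cmult[symmetric] by (intro nrm_triangle sqi_cmult sqi_diff s)
    also have "\<dots> \<le> (real CARD('n))\<^sup>2 * (2 * B * \<delta>) / (c * sqrt c) * B + 1 / sqrt c * \<delta>"
    proof (intro add_mono mult_mono B d inv_sqrt_props(5)[OF p(2)])
      show "\<bar>inv_sqrt (gram y) $ a $ i - inv_sqrt (gram v) $ a $ i\<bar> \<le> (real CARD('n))\<^sup>2 * (2 * B * \<delta>) / (c * sqrt c)"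
        by (rule order_trans[OF inv_sqrt_lipschitz[OF p]]) (intro divide_right_mono gram_close s B d, use c in simp)
    qed (use c B0 d0 in auto)
    also have "\<dots> = Q * \<delta>" by (simp add: Q_def algebra_simps)
    finally show "nrm \<Z> (\<lambda>j. (inv_sqrt (gram y) $ a $ i - inv_sqrt (gram v) $ a $ i) * y i j + inv_sqrt (gram v) $ a $ i * (y i j - v i j)) \<le> Q * \<delta>" .
  qed
  also have "\<dots> = stdC TYPE('n) c B * \<delta>" by (simp add: stdC_def Q_def)
  finally show ?thesis .
qed

definition crossm :: "('n \<Rightarrow> int \<Rightarrow> real) \<Rightarrow> ('n \<Rightarrow> int \<Rightarrow> real) \<Rightarrow> real^'n^'n::finite" where
  "crossm y y' = (\<chi> a b. \<integral>s. std y a s * std y' b s \<partial>\<Z>)"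

lemma crossm_close:
  fixes y v y' v' :: "'n::finite \<Rightarrow> int \<Rightarrow> real"
  assumes s: "\<And>a. sqi \<Z> (y a)" "\<And>a. sqi \<Z> (v a)" "\<And>a. sqi \<Z> (y' a)" "\<And>a. sqi \<Z> (v' a)"
    and p: "posdef c (gram y)" "posdef c (gram v)" "posdef c (gram y')" "posdef c (gram v')"
    and B: "\<And>a. nrm \<Z> (y a) \<le> B" "\<And>a. nrm \<Z> (v a) \<le> B" "\<And>a. nrm \<Z> (y' a) \<le> B" "\<And>a. nrm \<Z> (v' a) \<le> B"
    and d: "\<And>a. nrm \<Z> (\<lambda>j. y a j - v a j) \<le> \<delta>" "\<And>a. nrm \<Z> (\<lambda>j. y' a j - v' a j) \<le> \<delta>"
  shows "norm (crossm y y' - crossm v v') \<le> (real CARD('n))\<^sup>2 * (2 * stdC TYPE('n) c B * \<delta>)"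
proof (rule norm_matrix_le_entries)
  fix a b
  have "\<bar>(crossm y y' - crossm v v') $ a $ b\<bar>
      \<le> nrm \<Z> (\<lambda>j. std y a j - std v a j) * nrm \<Z> (std y' b) + nrm \<Z> (std v a) * nrm \<Z> (\<lambda>j. std y' b j - std v' b j)"
    using L2_inner_diff[OF sqi_std[OF s(1)] sqi_std[OF s(3)] sqi_std[OF s(2)] sqi_std[OF s(4)]] by (simp add: crossm_def)
  also have "\<dots> \<le> stdC TYPE('n) c B * \<delta> + stdC TYPE('n) c B * \<delta>"
    unfolding std_nrm[OF s(3) p(3)] std_nrm[OF s(2) p(2)]
    using std_close[OF s(1,2) p(1,2) B(1,2) d(1), of a] std_close[OF s(3,4) p(3,4) B(3,4) d(2), of b] by linarith
  also have "\<dots> = 2 * stdC TYPE('n) c B * \<delta>" by simp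
  finally show "\<bar>(crossm y y' - crossm v v') $ a $ b\<bar> \<le> 2 * stdC TYPE('n) c B * \<delta>" .
qed

lemma crossm_self:
  assumes s: "\<And>a. sqi \<Z> (y a)" and p: "posdef c (gram y)"
  shows "crossm y y = mat 1"
  by (simp add: crossm_def vec_eq_iff mat_def std_orthonormal[OF s p])

section \<open>Envelopes\<close>

text \<open>
  The coefficients of the window at time \<open>k\<close> are dominated by translates of one
  sequence \<open>b\<close>; \<open>conv\<close> is the summability of \<open>m\<close>-th
  powers of covariances.
\<close>

locale envelope =
  fixes b :: "int \<Rightarrow> real" and idx :: "'n::finite \<Rightarrow> nat" and m :: nat
  assumes b0: "\<And>j. 0 \<le> b j" and sqi_b: "sqi \<Z> b" and m1: "1 \<le> m"
    and conv: "integrable \<Z> (\<lambda>l. (\<integral>j. b j * b (j + l) \<partial>\<Z>) ^ m)"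
begin

definition env :: "int \<Rightarrow> ('n \<Rightarrow> int \<Rightarrow> real) \<Rightarrow> bool" where
  "env k y \<longleftrightarrow> (\<forall>a i. \<bar>y a i\<bar> \<le> b (k + int (idx a) - i))"

definition conv_b :: "int \<Rightarrow> real" where
  "conv_b l = (\<integral>j. b j * b (j + l) \<partial>\<Z>)"

definition cross :: "real \<Rightarrow> int \<Rightarrow> real" where
  "cross c h = (\<Sum>i\<in>UNIV. \<Sum>j\<in>UNIV. conv_b (h + int (idx j) - int (idx i))) / c"

text \<open>
  A bound for \<open>(\<nu> * max \<bar>R i j\<bar>) ^ m\<close>, the factor of
  \<open>gaussian_covariance_bound\<close>, for windows at distance \<open>h\<close>.
\<close>

definition rho :: "real \<Rightarrow> int \<Rightarrow> real" where
  "rho c h = (real CARD('n) * cross c h) ^ m"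

lemma env_sqi: "env k y \<Longrightarrow> sqi \<Z> (y a)"
proof (rule sqi_bound[of _ "\<lambda>i. b (k + int (idx a) - i)"])
  show "sqi \<Z> (\<lambda>i. b (k + int (idx a) - i))"
    using sqi_b integrable_Z_reflect[of "\<lambda>i. (b i)\<^sup>2"] by (simp add: sqi_def)
qed (auto simp: env_def b0)

lemma env_nrm: "env k y \<Longrightarrow> nrm \<Z> (y a) \<le> nrm \<Z> b"
proof -
  assume e: "env k y"
  have s: "sqi \<Z> (\<lambda>i. b (k + int (idx a) - i))"
    using sqi_b integrable_Z_reflect[of "\<lambda>i. (b i)\<^sup>2"] by (simp add: sqi_def)
  have "(\<integral>i. (y a i)\<^sup>2 \<partial>\<Z>) \<le> (\<integral>i. (b (k + int (idx a) - i))\<^sup>2 \<partial>\<Z>)"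
    using env_sqi[OF e, of a] s e by (intro integral_mono) (auto simp: sqi_def env_def b0 abs_le_square_iff[symmetric])
  also have "\<dots> = (\<integral>i. (b i)\<^sup>2 \<partial>\<Z>)" by (rule integral_Z_reflect[of "\<lambda>i. (b i)\<^sup>2"])
  finally show "nrm \<Z> (y a) \<le> nrm \<Z> b" by (simp add: nrm_def)
qed

lemma conv_b_nonneg: "0 \<le> conv_b l" by (simp add: conv_b_def b0)

lemma cross_nonneg: "0 < c \<Longrightarrow> 0 \<le> cross c h"
  by (simp add: cross_def sum_nonneg conv_b_nonneg)

lemma rho_nonneg: "0 < c \<Longrightarrow> 0 \<le> rho c h"
  by (simp add: rho_def cross_nonneg)

lemma rho_integrable: assumes c: "0 < c" shows "integrable \<Z> (rho c)"
proof -
  define N where "N = real CARD('n)"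
  have i: "integrable \<Z> (\<lambda>h. conv_b (h + int (idx j) - int (idx i)) ^ m)" for i j
    using integrable_Z_shift[OF conv, of "int (idx j) - int (idx i)"] by (simp add: conv_b_def add_diff_eq)
  have bd: "rho c h \<le> (N / c) ^ m * ((N\<^sup>2) ^ m * (\<Sum>i\<in>UNIV. \<Sum>j\<in>UNIV. conv_b (h + int (idx j) - int (idx i)) ^ m))" for h
  proof -
    define f where "f i j = conv_b (h + int (idx j) - int (idx i))" for i j
    define s where "s = (\<Sum>i\<in>UNIV. \<Sum>j\<in>UNIV. f i j ^ m)"
    have f0: "0 \<le> f i j" for i j by (simp add: f_def conv_b_nonneg)
    define M where "M = Max (range (\<lambda>(i, j). f i j))"
    have le: "f i j \<le> M" for i j unfolding M_def by (rule Max_ge) (auto intro!: rev_image_eqI[of "(i, j)"])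
    have "M \<in> range (\<lambda>(i, j). f i j)" unfolding M_def by (rule Max_in) auto
    then obtain i0 j0 where M: "M = f i0 j0" by auto
    have "f i0 j0 ^ m \<le> (\<Sum>j\<in>UNIV. f i0 j ^ m)" by (rule member_le_sum) (auto simp: f0)
    also have "\<dots> \<le> s" unfolding s_def
      by (rule member_le_sum[of i0 UNIV "\<lambda>i. \<Sum>j\<in>UNIV. f i j ^ m"]) (auto simp: f0 sum_nonneg)
    finally have Ms: "M ^ m \<le> s" by (simp add: M)
    have "(\<Sum>i\<in>UNIV. \<Sum>j\<in>UNIV. f i j) \<le> (\<Sum>i\<in>(UNIV :: 'n set). \<Sum>j\<in>(UNIV :: 'n set). M)" by (intro sum_mono le)
    also have "\<dots> = N\<^sup>2 * M" by (simp add: N_def power2_eq_square)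
    finally have "(\<Sum>i\<in>UNIV. \<Sum>j\<in>UNIV. f i j) ^ m \<le> (N\<^sup>2 * M) ^ m"
      by (intro power_mono) (auto simp: f0 sum_nonneg)
    also have "\<dots> \<le> (N\<^sup>2) ^ m * s" using Ms by (simp add: power_mult_distrib mult_left_mono N_def)
    finally have "(N / c) ^ m * (\<Sum>i\<in>UNIV. \<Sum>j\<in>UNIV. f i j) ^ m \<le> (N / c) ^ m * ((N\<^sup>2) ^ m * s)"
      using c by (intro mult_left_mono) (auto simp: N_def)
    moreover have "rho c h = (N / c) ^ m * (\<Sum>i\<in>UNIV. \<Sum>j\<in>UNIV. f i j) ^ m"
      by (simp add: rho_def cross_def f_def N_def power_mult_distrib[symmetric])
    ultimately show ?thesis by (simp add: s_def f_def)
  qed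
  show ?thesis
  proof (rule Bochner_Integration.integrable_bound)
    show "integrable \<Z> (\<lambda>h. (N / c) ^ m * ((N\<^sup>2) ^ m * (\<Sum>i\<in>UNIV. \<Sum>j\<in>UNIV. conv_b (h + int (idx j) - int (idx i)) ^ m)))"
      by (intro integrable_mult_right Bochner_Integration.integrable_sum i)
    show "AE h in \<Z>. norm (rho c h) \<le> norm ((N / c) ^ m * ((N\<^sup>2) ^ m * (\<Sum>i\<in>UNIV. \<Sum>j\<in>UNIV. conv_b (h + int (idx j) - int (idx i)) ^ m)))"
      using bd rho_nonneg[OF c] by (intro AE_I2) (auto intro: order_trans[OF _ abs_ge_self])
  qed simp
qed

text \<open>
  The entries of \<open>inv_sqrt\<close> are at most \<open>1 / \<surd>c\<close> and there are
  two such factors, which gives the denominator \<open>c\<close>.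
\<close>

lemma crossm_bound:
  assumes e: "env k y" "env l y'" and p: "posdef c (gram y)" "posdef c (gram y')"
  shows "\<bar>crossm y y' $ a $ a'\<bar> \<le> cross c (l - k)"
proof -
  have c: "0 < c" using p(1) by (simp add: posdef_def)
  have s: "sqi \<Z> (y i)" "sqi \<Z> (y' i)" for i using e by (auto intro: env_sqi)
  have q: "\<bar>\<integral>s. y i s * y' j s \<partial>\<Z>\<bar> \<le> conv_b (l - k + int (idx j) - int (idx i))" for i j
  proof -
    have sb: "sqi \<Z> (\<lambda>s. b (t - s))" for t
      using sqi_b integrable_Z_reflect[of "\<lambda>i. (b i)\<^sup>2"] by (simp add: sqi_def)
    have "\<bar>\<integral>s. y i s * y' j s \<partial>\<Z>\<bar> \<le> (\<integral>s. \<bar>y i s * y' j s\<bar> \<partial>\<Z>)" by (rule integral_abs_bound)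
    also have "\<dots> \<le> (\<integral>s. b (k + int (idx i) - s) * b (l + int (idx j) - s) \<partial>\<Z>)"
      unfolding abs_mult using e sqi_mult[OF s(1)[of i] s(2)[of j]]
      by (intro integral_mono mult_mono sqi_mult[OF sb sb]) (auto simp: env_def b0 abs_mult[symmetric])
    also have "\<dots> = (\<integral>s. b (k + int (idx i) - s) * b (k + int (idx i) - s + (l - k + int (idx j) - int (idx i))) \<partial>\<Z>)"
      by (simp add: algebra_simps)
    also have "\<dots> = conv_b (l - k + int (idx j) - int (idx i))"
      unfolding conv_b_def by (rule integral_Z_reflect[of "\<lambda>s. b s * b (s + (l - k + int (idx j) - int (idx i)))"])
    finally show ?thesis .
  qed
  have "\<bar>crossm y y' $ a $ a'\<bar> \<le> (\<Sum>i\<in>UNIV. \<Sum>j\<in>UNIV. \<bar>inv_sqrt (gram y) $ a $ i * inv_sqrt (gram y') $ a' $ j * (\<integral>s. y i s * y' j s \<partial>\<Z>)\<bar>)"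
    unfolding crossm_def vec_lambda_beta std_inner[OF s] by (rule order_trans[OF sum_abs sum_mono[OF sum_abs]])
  also have "\<dots> \<le> (\<Sum>i\<in>UNIV. \<Sum>j\<in>UNIV. 1 / sqrt c * (1 / sqrt c) * conv_b (l - k + int (idx j) - int (idx i)))"
    unfolding abs_mult
    by (intro sum_mono mult_mono q inv_sqrt_props(5)[OF p(1)] inv_sqrt_props(5)[OF p(2)]) (use c in auto)
  also have "\<dots> = cross c (l - k)"
    unfolding cross_def sum_divide_distrib using c by (intro sum.cong refl) simp
  finally show ?thesis .
qed

end

lemma (in gaussian_noise) lin_standardize:
  fixes y :: "'n::finite \<Rightarrow> int \<Rightarrow> real"
  assumes "\<And>a. lin (y a) (\<lambda>\<omega>. Y \<omega> $ a)"
  shows "lin (std y a) (\<lambda>\<omega>. (inv_sqrt (gram y) *v Y \<omega>) $ a)"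
  unfolding std_def[abs_def] matrix_vector_mult_def
  by (simp, intro lin_sum lin_cmult assms) simp

lemma (in gaussian_noise) std_pair_standardize:
  fixes y y' :: "'n::finite \<Rightarrow> int \<Rightarrow> real"
  assumes l: "\<And>a. lin (y a) (\<lambda>\<omega>. Y \<omega> $ a)" "\<And>a. lin (y' a) (\<lambda>\<omega>. Y' \<omega> $ a)"
    and p: "posdef c (gram y)" "posdef c' (gram y')"
  shows "std_pair M (\<lambda>\<omega>. inv_sqrt (gram y) *v Y \<omega>) (\<lambda>\<omega>. inv_sqrt (gram y') *v Y' \<omega>) (crossm y y')"
proof (rule lin_std_pair[where z="std y" and z'="std y'"])
  have s: "sqi \<Z> (y a)" "sqi \<Z> (y' a)" for a using l by (auto dest: linD)
  show "(\<integral>j. std y a j * std y b j \<partial>\<Z>) = (if a = b then 1 else 0)" for a b by (rule std_orthonormal[OF s(1) p(1)])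
  show "(\<integral>j. std y' a j * std y' b j \<partial>\<Z>) = (if a = b then 1 else 0)" for a b by (rule std_orthonormal[OF s(2) p(2)])
qed (auto intro: lin_standardize l simp: crossm_def)

section \<open>The triangular array\<close>

text \<open>
  The array in terms of the noise: \<open>x n t\<close> and \<open>w \<tau> t\<close> are the
  coefficients of \<open>X\<^sub>t\<^sub>,\<^sub>n\<close> and of
  \<open>W\<^sub>\<tau>(t)\<close> with respect to the \<open>\<epsilon> i\<close>. The
  convergence of coefficients is required in mean square (\<open>x_lim\<close>), which follows
  from coordinatewise convergence by domination. The conditions on \<open>ft n k\<close> are
  required only for nondegenerate covariance matrices; degenerate ones can occur for finitely
  many \<open>n\<close>.
\<close>

locale gaussian_array = gaussian_noise M \<epsilon> + envelope b idx m
  for M :: "'a measure" and \<epsilon> :: "int \<Rightarrow> 'a \<Rightarrow> real" and b :: "int \<Rightarrow> real"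
    and idx :: "'n::finite \<Rightarrow> nat" and m :: nat +
  fixes x :: "nat \<Rightarrow> nat \<Rightarrow> int \<Rightarrow> real" and w :: "real \<Rightarrow> int \<Rightarrow> int \<Rightarrow> real"
    and Y :: "nat \<Rightarrow> nat \<Rightarrow> 'a \<Rightarrow> real^'n" and V :: "real \<Rightarrow> int \<Rightarrow> 'a \<Rightarrow> real^'n"
    and ft :: "nat \<Rightarrow> nat \<Rightarrow> real^'n \<Rightarrow> real" and \<phi>t :: "real \<Rightarrow> real^'n \<Rightarrow> real"
    and c0 :: real and d :: "nat \<Rightarrow> real"
  assumes idx_le: "\<And>i. idx i \<le> CARD('n)"
    and x_bound: "\<And>n t i. 1 \<le> n \<Longrightarrow> t \<in> {1..n + CARD('n)} \<Longrightarrow> \<bar>x n t i\<bar> \<le> b (int t - i)"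
    and w_bound: "\<And>\<tau> t i. \<tau> \<in> {0<..1} \<Longrightarrow> \<bar>w \<tau> t i\<bar> \<le> b (t - i)"
    and w_shift: "\<And>\<tau> t s i. w \<tau> (t + s) (i + s) = w \<tau> t i"
    and x_lim: "\<And>L e. 0 < e \<Longrightarrow> \<exists>N. \<forall>n\<ge>N. \<forall>\<tau>\<in>{0<..1}. \<forall>t\<in>{1..n + CARD('n)}.
        \<bar>\<lfloor>real n * \<tau>\<rfloor> - int t\<bar> \<le> L \<longrightarrow> nrm \<Z> (\<lambda>i. x n t i - w \<tau> (int t) i) \<le> e"
    and Y_lin: "\<And>n k a. 1 \<le> k \<Longrightarrow> k \<le> n \<Longrightarrow> lin (x n (k + idx a)) (\<lambda>\<omega>. Y n k \<omega> $ a)"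
    and V_lin: "\<And>\<tau> j a. \<tau> \<in> {0<..1} \<Longrightarrow> lin (w \<tau> (j + int (idx a))) (\<lambda>\<omega>. V \<tau> j \<omega> $ a)"
    and W_posdef: "\<And>\<tau>. \<tau> \<in> {0<..1} \<Longrightarrow> posdef c0 (gram (\<lambda>a. w \<tau> (int (idx a))))"
    and ft_props: "\<And>n k c. 1 \<le> k \<Longrightarrow> k \<le> n \<Longrightarrow> posdef c (gram (\<lambda>a. x n (k + idx a))) \<Longrightarrow>
        sqi std_gaussian (ft n k) \<and> (\<forall>P\<in>poly_funs (m - 1). (\<integral>z. P z * ft n k z \<partial>std_gaussian) = 0)"
    and \<phi>t_sqi: "\<And>\<tau>. \<tau> \<in> {0<..1} \<Longrightarrow> sqi std_gaussian (\<phi>t \<tau>)"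
    and \<phi>t_continuous: "\<And>\<tau>. \<tau> \<in> {0<..1} \<Longrightarrow>
        ((\<lambda>s. nrm std_gaussian (\<lambda>z. \<phi>t s z - \<phi>t \<tau> z)) \<longlongrightarrow> 0) (at \<tau> within {0<..1})"
    and d_lim: "d \<longlonglongrightarrow> 0"
    and ft_\<phi>t: "\<forall>\<^sub>F n in sequentially. \<forall>\<tau>\<in>{0<..1}.
        nrm std_gaussian (\<lambda>z. ft n (max 1 (nat \<lfloor>\<tau> * real n\<rfloor>)) z - \<phi>t \<tau> z) \<le> d n"
begin

abbreviation "\<gamma> \<equiv> (std_gaussian :: (real^'n) measure)"
abbreviation "bn \<equiv> nrm \<Z> b"

text \<open>
  Coefficients of the windows of the array (\<open>yX\<close>), of the frozen stationary
  processes (\<open>yW\<close>), and of the array with every moving average cut off at lag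
  \<open>J\<close> (\<open>yT\<close>).
\<close>

definition yX :: "nat \<Rightarrow> nat \<Rightarrow> 'n \<Rightarrow> int \<Rightarrow> real" where "yX n k a = x n (k + idx a)"
definition yW :: "real \<Rightarrow> int \<Rightarrow> 'n \<Rightarrow> int \<Rightarrow> real" where "yW \<tau> k a = w \<tau> (k + int (idx a))"
definition yT :: "nat \<Rightarrow> nat \<Rightarrow> nat \<Rightarrow> 'n \<Rightarrow> int \<Rightarrow> real" where
  "yT J n k a i = (if \<bar>int k + int (idx a) - i\<bar> \<le> int J then x n (k + idx a) i else 0)"

lemma env_X: "1 \<le> k \<Longrightarrow> k \<le> n \<Longrightarrow> env (int k) (yX n k)"
  using x_bound[of n "k + idx a" for a] idx_le by (auto simp: env_def yX_def add_mono)

lemma env_T: "1 \<le> k \<Longrightarrow> k \<le> n \<Longrightarrow> env (int k) (yT J n k)"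
  using env_X[of k n] b0 by (auto simp: env_def yX_def yT_def)

lemma env_W: "\<tau> \<in> {0<..1} \<Longrightarrow> env k (yW \<tau> k)"
  using w_bound by (auto simp: env_def yW_def)

lemma c0_pos: "0 < c0" using W_posdef[of 1] by (simp add: posdef_def)

lemma yW_inner_shift: "(\<integral>s. yW \<tau> (k + h) i s * yW \<tau> (l + h) j s \<partial>\<Z>) = (\<integral>s. yW \<tau> k i s * yW \<tau> l j s \<partial>\<Z>)"
proof -
  have "yW \<tau> (k + h) i (s + h) = yW \<tau> k i s" for k i s
    using w_shift[of \<tau> "k + int (idx i)" h s] by (simp add: yW_def algebra_simps)
  then show ?thesis
    using integral_Z_shift[of "\<lambda>s. yW \<tau> (k + h) i s * yW \<tau> (l + h) j s" h] by simp
qed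

lemma gram_W: "gram (yW \<tau> k) = gram (yW \<tau> 0)"
  unfolding gram_def using yW_inner_shift[of \<tau> 0 k _ 0] by simp

lemma posdef_W: "\<tau> \<in> {0<..1} \<Longrightarrow> posdef c0 (gram (yW \<tau> k))"
  unfolding gram_W[of \<tau> k] using W_posdef[of \<tau>] by (simp add: yW_def[abs_def])

lemma crossm_W:
  assumes "\<tau> \<in> {0<..1}"
  shows "crossm (yW \<tau> k) (yW \<tau> (k + h)) = crossm (yW \<tau> 0) (yW \<tau> h)"
proof -
  have s: "sqi \<Z> (yW \<tau> k a)" for k a by (rule env_sqi[OF env_W[OF assms]])
  show ?thesis unfolding crossm_def std_inner[OF s s] gram_W[of \<tau> k] gram_W[of \<tau> h] gram_W[of \<tau> "k + h"]
    using yW_inner_shift[of \<tau> 0 k _ h] by (simp add: add.commute)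
qed

text \<open>
  Half of the lower bound for the limiting covariance matrices leaves room for two
  perturbations: \<open>3 * c0 / 4\<close> for the array and \<open>c0 / 2\<close> for the
  truncated array.
\<close>

definition c :: real where "c = c0 / 2"

lemma c_pos: "0 < c" using c0_pos by (simp add: c_def)

lemma posdef_mono: "posdef a A \<Longrightarrow> 0 < a' \<Longrightarrow> a' \<le> a \<Longrightarrow> posdef a' A"
  unfolding posdef_def by (meson mult_right_mono order_trans zero_le_power2)

lemma posdef_Wc: "\<tau> \<in> {0<..1} \<Longrightarrow> posdef c (gram (yW \<tau> k))"
  using posdef_mono[OF posdef_W, of \<tau> c] c_pos by (simp add: c_def)

lemma posdef_close:
  assumes s: "\<And>a. sqi \<Z> (y a)" "\<And>a. sqi \<Z> (v a)"
    and B: "\<And>a. nrm \<Z> (y a) \<le> bn" "\<And>a. nrm \<Z> (v a) \<le> bn"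
    and d: "\<And>a. nrm \<Z> (\<lambda>j. y a j - v a j) \<le> \<delta>"
    and \<delta>: "(real CARD('n))\<^sup>2 * (2 * bn * \<delta>) \<le> p - p'" and p: "posdef p (gram v)" and p': "0 < p'"
  shows "posdef p' (gram (y :: 'n \<Rightarrow> int \<Rightarrow> real))"
  by (rule posdef_perturb[OF p gram_symmetric order_trans[OF gram_close[OF s B d] \<delta>] p'])

lemma delta_exists:
  assumes "0 < e" obtains \<delta> where "0 < \<delta>" "(real CARD('n))\<^sup>2 * (2 * bn * \<delta>) \<le> e"
proof
  define D where "D = (real CARD('n))\<^sup>2 * (2 * bn) + 1"
  have D: "0 < D" by (simp add: D_def add_nonneg_pos)
  show "0 < e / D" using assms D by simp
  have "(real CARD('n))\<^sup>2 * (2 * bn * (e / D)) = (D - 1) * e / D" by (simp add: D_def)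
  also have "\<dots> \<le> D * e / D" using assms D by (intro divide_right_mono mult_right_mono) auto
  finally show "(real CARD('n))\<^sup>2 * (2 * bn * (e / D)) \<le> e" using D by simp
qed

lemma floor_ratio: "1 \<le> n \<Longrightarrow> \<lfloor>real n * (real k / real n)\<rfloor> = int k"
  by simp

lemma X_close_W:
  assumes "0 < e"
  shows "\<exists>N. \<forall>n\<ge>N. \<forall>k\<in>{1..n}. \<forall>a. nrm \<Z> (\<lambda>i. yX n k a i - yW (real k / real n) (int k) a i) \<le> e"
proof -
  from x_lim[OF assms, of "int CARD('n)"] obtain N where N: "\<And>n \<tau> t. n \<ge> N \<Longrightarrow> \<tau> \<in> {0<..1} \<Longrightarrow> t \<in> {1..n + CARD('n)} \<Longrightarrow>
    \<bar>\<lfloor>real n * \<tau>\<rfloor> - int t\<bar> \<le> int CARD('n) \<Longrightarrow> nrm \<Z> (\<lambda>i. x n t i - w \<tau> (int t) i) \<le> e" by blast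
  show ?thesis
  proof (intro exI[of _ N] allI impI ballI)
    fix n k a assume n: "N \<le> n" and k: "k \<in> {1..n}"
    have "nrm \<Z> (\<lambda>i. x n (k + idx a) i - w (real k / real n) (int (k + idx a)) i) \<le> e"
    proof (rule N[OF n])
      show "real k / real n \<in> {0<..1}" using k by auto
      show "k + idx a \<in> {1..n + CARD('n)}" using k idx_le[of a] by auto
      show "\<bar>\<lfloor>real n * (real k / real n)\<rfloor> - int (k + idx a)\<bar> \<le> int CARD('n)"
        using k idx_le[of a] by (subst floor_ratio) auto
    qed
    then show "nrm \<Z> (\<lambda>i. yX n k a i - yW (real k / real n) (int k) a i) \<le> e"
      by (simp add: yX_def yW_def)
  qed
qed

text \<open>
  At time \<open>k\<close> the array is compared with the stationary process frozen at
  \<open>\<tau> = k / n\<close>.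
\<close>

lemma posdef_X_ex: "\<exists>N\<ge>1. \<forall>n\<ge>N. \<forall>k\<in>{1..n}. posdef (3 * c0 / 4) (gram (yX n k))"
proof -
  obtain \<delta> where \<delta>: "0 < \<delta>" "(real CARD('n))\<^sup>2 * (2 * bn * \<delta>) \<le> c0 / 4"
    using delta_exists[of "c0 / 4"] c0_pos by auto
  from X_close_W[OF \<delta>(1)] obtain N where N: "\<And>n k a. n \<ge> N \<Longrightarrow> k \<in> {1..n} \<Longrightarrow>
    nrm \<Z> (\<lambda>i. yX n k a i - yW (real k / real n) (int k) a i) \<le> \<delta>" by blast
  show ?thesis
  proof (intro exI[of _ "max 1 N"] conjI allI impI ballI)
    fix n k assume n: "max 1 N \<le> n" and k: "k \<in> {1..n}"
    have t: "real k / real n \<in> {0<..1}" using k by auto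
    have e: "env (int k) (yX n k)" using k by (intro env_X) auto
    show "posdef (3 * c0 / 4) (gram (yX n k))"
    proof (rule posdef_close[OF env_sqi[OF e] env_sqi[OF env_W[OF t]] env_nrm[OF e] env_nrm[OF env_W[OF t]]])
      show "nrm \<Z> (\<lambda>i. yX n k a i - yW (real k / real n) (int k) a i) \<le> \<delta>" for a
        using N[of n k a] n k by simp
    qed (use \<delta> c0_pos posdef_W[OF t] in auto)
  qed simp
qed

text \<open>
  From \<open>n1\<close> on all covariance matrices of the array are uniformly nondegenerate.
\<close>

definition n1 :: nat where
  "n1 = (SOME N. 1 \<le> N \<and> (\<forall>n\<ge>N. \<forall>k\<in>{1..n}. posdef (3 * c0 / 4) (gram (yX n k))))"

lemma n1: "1 \<le> n1" "n \<ge> n1 \<Longrightarrow> k \<in> {1..n} \<Longrightarrow> posdef (3 * c0 / 4) (gram (yX n k))"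
  using someI_ex[OF posdef_X_ex[unfolded Bex_def]] by (auto simp: n1_def)

lemma posdef_X: "n \<ge> n1 \<Longrightarrow> k \<in> {1..n} \<Longrightarrow> posdef c (gram (yX n k))"
  using posdef_mono[OF n1(2), of n k c] c0_pos by (simp add: c_def)

definition tail :: "nat \<Rightarrow> real" where
  "tail J = nrm \<Z> (\<lambda>i. if \<bar>i\<bar> \<le> int J then 0 else b i)"

lemma tail_lim: "tail \<longlonglongrightarrow> 0"
proof -
  have "(\<lambda>J. nrm \<Z> (\<lambda>i. (if \<bar>i\<bar> \<le> int J then 0 else b i) - 0)) \<longlonglongrightarrow> 0"
  proof (rule nrm_dominated[OF _ _ sqi_b])
    show "\<bar>(if \<bar>i\<bar> \<le> int J then 0 else b i) - 0\<bar> \<le> b i" for J i using b0 by auto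
    show "(\<lambda>J. if \<bar>i\<bar> \<le> int J then 0 else b i) \<longlonglongrightarrow> 0" for i
      by (rule tendsto_eventually) (auto simp: eventually_sequentially intro!: exI[of _ "nat \<bar>i\<bar>"])
  qed auto
  then show ?thesis by (simp add: tail_def[abs_def])
qed

lemma T_close_X:
  assumes k: "1 \<le> k" "k \<le> n"
  shows "nrm \<Z> (\<lambda>i. yT J n k a i - yX n k a i) \<le> tail J"
proof -
  define g where "g i = (if \<bar>i\<bar> \<le> int J then 0 else b i)" for i
  have sg: "integrable \<Z> (\<lambda>i. (g i)\<^sup>2)"
    by (rule Bochner_Integration.integrable_bound[of _ "\<lambda>i. (b i)\<^sup>2"]) (use sqi_b in \<open>auto simp: g_def sqi_def\<close>)
  have s: "sqi \<Z> (\<lambda>i. yT J n k a i - yX n k a i)" by (intro sqi_diff env_sqi[OF env_T[OF k]] env_sqi[OF env_X[OF k]])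
  have "(\<integral>i. (yT J n k a i - yX n k a i)\<^sup>2 \<partial>\<Z>) \<le> (\<integral>i. (g (int k + int (idx a) - i))\<^sup>2 \<partial>\<Z>)"
  proof (rule integral_mono)
    show "integrable \<Z> (\<lambda>i. (g (int k + int (idx a) - i))\<^sup>2)" by (rule integrable_Z_reflect[OF sg])
    show "(yT J n k a i - yX n k a i)\<^sup>2 \<le> (g (int k + int (idx a) - i))\<^sup>2" for i
      using env_X[OF k] b0 by (auto simp: env_def yT_def yX_def g_def abs_le_square_iff[symmetric])
  qed (use s in \<open>simp add: sqi_def\<close>)
  also have "\<dots> = (\<integral>i. (g i)\<^sup>2 \<partial>\<Z>)" by (rule integral_Z_reflect)
  finally show ?thesis by (simp add: nrm_def tail_def g_def)
qed

lemma posdef_T_ex: "\<exists>J0. \<forall>J\<ge>J0. \<forall>n\<ge>n1. \<forall>k\<in>{1..n}. posdef c (gram (yT J n k))"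
proof -
  obtain \<delta> where \<delta>: "0 < \<delta>" "(real CARD('n))\<^sup>2 * (2 * bn * \<delta>) \<le> c0 / 4"
    using delta_exists[of "c0 / 4"] c0_pos by auto
  from order_tendstoD(2)[OF tail_lim \<delta>(1)] obtain J0 where J0: "\<And>J. J \<ge> J0 \<Longrightarrow> tail J < \<delta>"
    by (auto simp: eventually_sequentially)
  show ?thesis
  proof (intro exI[of _ J0] allI impI ballI)
    fix J n k assume J: "J0 \<le> J" and n: "n1 \<le> n" and k: "k \<in> {1..n}"
    then have k': "1 \<le> k" "k \<le> n" by auto
    show "posdef c (gram (yT J n k))"
    proof (rule posdef_close[OF env_sqi[OF env_T[OF k']] env_sqi[OF env_X[OF k']] env_nrm[OF env_T[OF k']] env_nrm[OF env_X[OF k']]])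
      show "nrm \<Z> (\<lambda>i. yT J n k a i - yX n k a i) \<le> \<delta>" for a
        using T_close_X[OF k', of J a] J0[OF J] by simp
      show "(real CARD('n))\<^sup>2 * (2 * bn * \<delta>) \<le> 3 * c0 / 4 - c" using \<delta> by (simp add: c_def)
    qed (use n1(2)[OF n k] c_pos in auto)
  qed
qed

text \<open>
  From the window \<open>J0\<close> on the truncated vectors are uniformly nondegenerate.
\<close>

definition J0 :: nat where
  "J0 = (SOME J0. \<forall>J\<ge>J0. \<forall>n\<ge>n1. \<forall>k\<in>{1..n}. posdef c (gram (yT J n k)))"

lemma posdef_T: "J \<ge> J0 \<Longrightarrow> n \<ge> n1 \<Longrightarrow> k \<in> {1..n} \<Longrightarrow> posdef c (gram (yT J n k))"
  using someI_ex[OF posdef_T_ex] by (auto simp: J0_def)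

section \<open>The standardized vectors\<close>

text \<open>
  The standardized windows of the array, of the truncated array, and of the frozen process.
\<close>

definition Z :: "nat \<Rightarrow> nat \<Rightarrow> 'a \<Rightarrow> real^'n" where
  "Z n k \<omega> = inv_sqrt (gram (yX n k)) *v Y n k \<omega>"

definition YT :: "nat \<Rightarrow> nat \<Rightarrow> nat \<Rightarrow> 'a \<Rightarrow> real^'n" where
  "YT J n k \<omega> = (\<chi> a. partial (yT J n k a) {i. \<bar>int k + int (idx a) - i\<bar> \<le> int J} \<omega>)"

definition ZT :: "nat \<Rightarrow> nat \<Rightarrow> nat \<Rightarrow> 'a \<Rightarrow> real^'n" where
  "ZT J n k \<omega> = inv_sqrt (gram (yT J n k)) *v YT J n k \<omega>"

definition ZV :: "real \<Rightarrow> int \<Rightarrow> 'a \<Rightarrow> real^'n" where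
  "ZV \<tau> j \<omega> = inv_sqrt (gram (yW \<tau> 0)) *v V \<tau> j \<omega>"

lemma lin_X: "1 \<le> k \<Longrightarrow> k \<le> n \<Longrightarrow> lin (yX n k a) (\<lambda>\<omega>. Y n k \<omega> $ a)"
  unfolding yX_def by (rule Y_lin)

lemma lin_T: "lin (yT J n k a) (\<lambda>\<omega>. YT J n k \<omega> $ a)"
proof -
  have "{i. \<bar>int k + int (idx a) - i\<bar> \<le> int J} \<subseteq> {int k + int (idx a) - int J..int k + int (idx a) + int J}" by auto
  then have "finite {i. \<bar>int k + int (idx a) - i\<bar> \<le> int J}" by (rule finite_subset) simp
  from lin_finite[OF this, of "yT J n k a"] show ?thesis by (simp add: YT_def yT_def)
qed

lemma pair_XX:
  assumes "n \<ge> n1" "k \<in> {1..n}" "l \<in> {1..n}"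
  shows "std_pair M (Z n k) (Z n l) (crossm (yX n k) (yX n l))"
  unfolding Z_def[abs_def] using assms by (intro std_pair_standardize[where c=c and c'=c] posdef_X lin_X) auto

lemma pair_XT:
  assumes "n \<ge> n1" "J \<ge> J0" "k \<in> {1..n}" "l \<in> {1..n}"
  shows "std_pair M (Z n k) (ZT J n l) (crossm (yX n k) (yT J n l))"
  unfolding Z_def[abs_def] ZT_def[abs_def] using assms by (intro std_pair_standardize[where c=c and c'=c] posdef_X posdef_T lin_X lin_T) auto

lemma pair_TX:
  assumes "n \<ge> n1" "J \<ge> J0" "k \<in> {1..n}" "l \<in> {1..n}"
  shows "std_pair M (ZT J n k) (Z n l) (crossm (yT J n k) (yX n l))"
  unfolding Z_def[abs_def] ZT_def[abs_def] using assms by (intro std_pair_standardize[where c=c and c'=c] posdef_X posdef_T lin_X lin_T) auto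

lemma pair_TT:
  assumes "n \<ge> n1" "J \<ge> J0" "k \<in> {1..n}" "l \<in> {1..n}"
  shows "std_pair M (ZT J n k) (ZT J n l) (crossm (yT J n k) (yT J n l))"
  unfolding ZT_def[abs_def] using assms by (intro std_pair_standardize[where c=c and c'=c] posdef_T lin_T) auto

lemma pair_VV:
  assumes "\<tau> \<in> {0<..1}"
  shows "std_pair M (ZV \<tau> j) (ZV \<tau> h) (crossm (yW \<tau> j) (yW \<tau> h))"
proof -
  have l: "lin (yW \<tau> j a) (\<lambda>\<omega>. V \<tau> j \<omega> $ a)" for j a unfolding yW_def by (rule V_lin[OF assms])
  show ?thesis
    using std_pair_standardize[OF l l posdef_W[OF assms] posdef_W[OF assms], of j h]
    unfolding ZV_def[abs_def] gram_W[of \<tau> j] gram_W[of \<tau> h] .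
qed

lemma ft_sqi: "n \<ge> n1 \<Longrightarrow> k \<in> {1..n} \<Longrightarrow> sqi \<gamma> (ft n k)"
  using ft_props[of k n c] posdef_X[of n k] by (auto simp: yX_def[abs_def])

lemma ft_rank: "n \<ge> n1 \<Longrightarrow> k \<in> {1..n} \<Longrightarrow> P \<in> poly_funs (m - 1) \<Longrightarrow> (\<integral>z. P z * ft n k z \<partial>\<gamma>) = 0"
  using ft_props[of k n c] posdef_X[of n k] by (auto simp: yX_def[abs_def])

lemma ft_mean: "n \<ge> n1 \<Longrightarrow> k \<in> {1..n} \<Longrightarrow> (\<integral>z. ft n k z \<partial>\<gamma>) = 0"
  using ft_rank[OF _ _ poly_funs_const[of 1]] by simp

lemma cov_rho:
  assumes p: "std_pair M U U' (crossm y y')" and e: "env k y" "env l y'"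
    and pd: "posdef c (gram y)" "posdef c (gram y')"
    and f: "sqi \<gamma> f" "sqi \<gamma> g" and rank: "\<And>P. P \<in> poly_funs (m - 1) \<Longrightarrow> (\<integral>z. P z * f z \<partial>\<gamma>) = 0"
  shows "\<bar>expectation (\<lambda>\<omega>. f (U \<omega>) * g (U' \<omega>))\<bar> \<le> rho c (l - k) * (nrm \<gamma> f * nrm \<gamma> g)"
  unfolding rho_def
  by (rule gaussian_covariance_bound[OF prob_space_axioms p crossm_bound[OF e pd] f rank])

lemma ev_ft_\<phi>t:
  assumes "0 < e"
  shows "\<exists>N\<ge>n1. \<forall>n\<ge>N. \<forall>\<tau>\<in>{0<..1}. nrm \<gamma> (\<lambda>z. ft n (max 1 (nat \<lfloor>\<tau> * real n\<rfloor>)) z - \<phi>t \<tau> z) \<le> e"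
proof -
  have "\<forall>\<^sub>F n in sequentially. \<forall>\<tau>\<in>{0<..1}. nrm \<gamma> (\<lambda>z. ft n (max 1 (nat \<lfloor>\<tau> * real n\<rfloor>)) z - \<phi>t \<tau> z) \<le> e"
    using ft_\<phi>t order_tendstoD(2)[OF d_lim assms] by eventually_elim force
  then obtain N where "\<And>n. n \<ge> N \<Longrightarrow> \<forall>\<tau>\<in>{0<..1}. nrm \<gamma> (\<lambda>z. ft n (max 1 (nat \<lfloor>\<tau> * real n\<rfloor>)) z - \<phi>t \<tau> z) \<le> e"
    by (auto simp: eventually_sequentially)
  then show ?thesis by (intro exI[of _ "max n1 N"]) auto
qed

lemma index_range: "\<tau> \<in> {0<..1} \<Longrightarrow> 1 \<le> n \<Longrightarrow> max 1 (nat \<lfloor>\<tau> * real n\<rfloor>) \<in> {1..n}"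
proof -
  assume t: "\<tau> \<in> {0<..1}" and n: "1 \<le> n"
  have "\<tau> * real n \<le> real n" using t by (simp add: mult_left_le_one_le)
  then have "\<lfloor>\<tau> * real n\<rfloor> \<le> int n" by linarith
  then show ?thesis using n by auto
qed

text \<open>
  The function \<open>ft n k\<close> is close to \<open>\<phi>t (k / n)\<close>, and this is
  close to \<open>ft N k'\<close> with \<open>k' = \<lfloor>k N / n\<rfloor>\<close>, both by
  the uniform convergence assumption. This compactness property replaces continuity of
  \<open>\<phi>t\<close> up to the end point \<open>0\<close>, where \<open>\<phi>t\<close> is
  not defined.
\<close>

lemma finite_net:
  assumes "0 < e"
  shows "\<exists>N\<ge>n1. \<forall>n\<ge>N. \<forall>k\<in>{1..n}. \<exists>k'\<in>{1..N}. nrm \<gamma> (\<lambda>z. ft n k z - ft N k' z) \<le> e"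
proof -
  from ev_ft_\<phi>t[of "e / 2"] assms obtain N where N: "N \<ge> n1" "\<And>n \<tau>. n \<ge> N \<Longrightarrow> \<tau> \<in> {0<..1} \<Longrightarrow>
    nrm \<gamma> (\<lambda>z. ft n (max 1 (nat \<lfloor>\<tau> * real n\<rfloor>)) z - \<phi>t \<tau> z) \<le> e / 2" by auto
  show ?thesis
  proof (intro exI[of _ N] conjI allI impI ballI N(1))
    fix n k assume n: "N \<le> n" and k: "k \<in> {1..n}"
    define \<tau> where "\<tau> = real k / real n"
    have t: "\<tau> \<in> {0<..1}" using k by (auto simp: \<tau>_def)
    have k1: "max 1 (nat \<lfloor>\<tau> * real n\<rfloor>) = k" using k by (simp add: \<tau>_def)
    define k' where "k' = max 1 (nat \<lfloor>\<tau> * real N\<rfloor>)"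
    have k': "k' \<in> {1..N}" unfolding k'_def using t n1(1) N(1) by (intro index_range) auto
    have s: "sqi \<gamma> (ft n k)" "sqi \<gamma> (ft N k')" using n N(1) k k' by (auto intro!: ft_sqi)
    have "nrm \<gamma> (\<lambda>z. ft n k z - ft N k' z) \<le> nrm \<gamma> (\<lambda>z. ft n k z - \<phi>t \<tau> z) + nrm \<gamma> (\<lambda>z. \<phi>t \<tau> z - ft N k' z)"
      by (rule nrm_triangle3[OF s(1) \<phi>t_sqi[OF t] s(2)])
    also have "\<dots> \<le> e / 2 + e / 2"
      using N(2)[OF n t] N(2)[OF order_refl t] unfolding k1 k'_def[symmetric]
      by (simp add: nrm_minus_commute[of \<gamma> "\<phi>t \<tau>"])
    finally show "\<exists>k'\<in>{1..N}. nrm \<gamma> (\<lambda>z. ft n k z - ft N k' z) \<le> e" using k' by auto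
  qed
qed

lemma uniform_norm:
  "\<exists>C N. 0 \<le> C \<and> N \<ge> n1 \<and> (\<forall>n\<ge>N. \<forall>k\<in>{1..n}. nrm \<gamma> (ft n k) \<le> C) \<and> (\<forall>\<tau>\<in>{0<..1}. nrm \<gamma> (\<phi>t \<tau>) \<le> C)"
proof -
  obtain N where N: "N \<ge> n1" "\<And>n k. n \<ge> N \<Longrightarrow> k \<in> {1..n} \<Longrightarrow> \<exists>k'\<in>{1..N}. nrm \<gamma> (\<lambda>z. ft n k z - ft N k' z) \<le> 1"
    using finite_net[of 1] by auto
  obtain N' where N': "N' \<ge> n1" "\<And>n \<tau>. n \<ge> N' \<Longrightarrow> \<tau> \<in> {0<..1} \<Longrightarrow>
    nrm \<gamma> (\<lambda>z. ft n (max 1 (nat \<lfloor>\<tau> * real n\<rfloor>)) z - \<phi>t \<tau> z) \<le> 1" using ev_ft_\<phi>t[of 1] by auto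
  define C where "C = (\<Sum>k\<in>{1..N}. nrm \<gamma> (ft N k)) + 1"
  have C: "nrm \<gamma> (ft n k) \<le> C" if n: "n \<ge> N" and k: "k \<in> {1..n}" for n k
  proof -
    obtain k' where k': "k' \<in> {1..N}" "nrm \<gamma> (\<lambda>z. ft n k z - ft N k' z) \<le> 1" using N(2)[OF n k] by auto
    have "nrm \<gamma> (ft n k) \<le> nrm \<gamma> (ft N k') + nrm \<gamma> (\<lambda>z. ft n k z - ft N k' z)"
      using n N(1) k k' by (intro nrm_triangle_sub ft_sqi) auto
    moreover have "nrm \<gamma> (ft N k') \<le> (\<Sum>k\<in>{1..N}. nrm \<gamma> (ft N k))"
      by (rule member_le_sum[OF k'(1)]) auto
    ultimately show ?thesis using k'(2) by (simp add: C_def)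
  qed
  have \<phi>: "nrm \<gamma> (\<phi>t \<tau>) \<le> C + 1" if t: "\<tau> \<in> {0<..1}" for \<tau>
  proof -
    define n where "n = max N N'"
    define k where "k = max 1 (nat \<lfloor>\<tau> * real n\<rfloor>)"
    have n: "n \<ge> N" "n \<ge> N'" "n \<ge> n1" using N by (auto simp: n_def)
    have k: "k \<in> {1..n}" unfolding k_def using t n n1(1) by (intro index_range) auto
    have "nrm \<gamma> (\<phi>t \<tau>) \<le> nrm \<gamma> (ft n k) + nrm \<gamma> (\<lambda>z. \<phi>t \<tau> z - ft n k z)"
      by (intro nrm_triangle_sub \<phi>t_sqi t ft_sqi n k)
    then show ?thesis using C[OF n(1) k] N'(2)[OF n(2) t] unfolding k_def[symmetric]
      by (simp add: nrm_minus_commute[of \<gamma> "\<phi>t \<tau>"])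
  qed
  have "0 \<le> C" by (simp add: C_def sum_nonneg add_nonneg_nonneg)
  then show ?thesis using C \<phi> N(1) by (intro exI[of _ "C + 1"] exI[of _ N]) force
qed

text \<open>
  \<open>Cf\<close> bounds the norms of all \<open>\<phi>t \<tau>\<close>, and of all \<open>ft
  n k\<close> with \<open>n \<ge> n2\<close>.
\<close>

definition Cf :: real where
  "Cf = (SOME C. \<exists>N. 0 \<le> C \<and> N \<ge> n1 \<and> (\<forall>n\<ge>N. \<forall>k\<in>{1..n}. nrm \<gamma> (ft n k) \<le> C) \<and> (\<forall>\<tau>\<in>{0<..1}. nrm \<gamma> (\<phi>t \<tau>) \<le> C))"
definition n2 :: nat where
  "n2 = (SOME N. 0 \<le> Cf \<and> N \<ge> n1 \<and> (\<forall>n\<ge>N. \<forall>k\<in>{1..n}. nrm \<gamma> (ft n k) \<le> Cf) \<and> (\<forall>\<tau>\<in>{0<..1}. nrm \<gamma> (\<phi>t \<tau>) \<le> Cf))"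

lemma Cf: "0 \<le> Cf" "n2 \<ge> n1" "n \<ge> n2 \<Longrightarrow> k \<in> {1..n} \<Longrightarrow> nrm \<gamma> (ft n k) \<le> Cf" "\<tau> \<in> {0<..1} \<Longrightarrow> nrm \<gamma> (\<phi>t \<tau>) \<le> Cf"
  using someI_ex[OF someI_ex[OF uniform_norm, folded Cf_def], folded n2_def] by auto

text \<open>
  The rank condition passes to limits in \<open>L\<^sup>2\<close>.
\<close>

lemma \<phi>t_rank:
  assumes t: "\<tau> \<in> {0<..1}" and P: "P \<in> poly_funs (m - 1)"
  shows "(\<integral>z. P z * \<phi>t \<tau> z \<partial>\<gamma>) = 0"
proof -
  have sP: "sqi \<gamma> P" by (rule sqi_poly_funs[OF P])
  have key: "\<bar>\<integral>z. P z * \<phi>t \<tau> z \<partial>\<gamma>\<bar> \<le> nrm \<gamma> P * e" if e0: "0 < e" for e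
  proof -
    obtain N where N: "N \<ge> n1" "nrm \<gamma> (\<lambda>z. ft N (max 1 (nat \<lfloor>\<tau> * real N\<rfloor>)) z - \<phi>t \<tau> z) \<le> e"
      using ev_ft_\<phi>t[OF e0] t by blast
    define k where "k = max 1 (nat \<lfloor>\<tau> * real N\<rfloor>)"
    have k: "k \<in> {1..N}" unfolding k_def using t N n1(1) by (intro index_range) auto
    have "\<bar>(\<integral>z. P z * ft N k z \<partial>\<gamma>) - (\<integral>z. P z * \<phi>t \<tau> z \<partial>\<gamma>)\<bar>
        \<le> nrm \<gamma> (\<lambda>z. P z - P z) * nrm \<gamma> (ft N k) + nrm \<gamma> P * nrm \<gamma> (\<lambda>z. ft N k z - \<phi>t \<tau> z)"
      by (intro L2_inner_diff sP ft_sqi[OF N(1) k] \<phi>t_sqi[OF t])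
    also have "\<dots> \<le> nrm \<gamma> P * e" using N(2) unfolding k_def[symmetric] by (simp add: nrm_def[of _ "\<lambda>_. 0"] mult_left_mono)
    finally show ?thesis using ft_rank[OF N(1) k P] by simp
  qed
  have "\<bar>\<integral>z. P z * \<phi>t \<tau> z \<partial>\<gamma>\<bar> \<le> 0"
  proof (rule field_le_epsilon)
    fix e :: real assume e: "0 < e"
    have p: "0 < nrm \<gamma> P + 1" by (simp add: add_nonneg_pos)
    have "\<bar>\<integral>z. P z * \<phi>t \<tau> z \<partial>\<gamma>\<bar> \<le> nrm \<gamma> P * (e / (nrm \<gamma> P + 1))" by (rule key) (use e p in simp)
    also have "\<dots> \<le> e" using e p by (simp add: field_simps)
    finally show "\<bar>\<integral>z. P z * \<phi>t \<tau> z \<partial>\<gamma>\<bar> \<le> 0 + e" by simp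
  qed
  then show ?thesis by simp
qed

end

section \<open>Riemann sums\<close>

lemma ceiling_range:
  assumes "\<tau> \<in> {0<..1}" "1 \<le> n"
  shows "1 \<le> \<lceil>\<tau> * real n\<rceil>" "\<lceil>\<tau> * real n\<rceil> \<le> int n" "nat \<lceil>\<tau> * real n\<rceil> \<in> {1..n}"
proof -
  have "0 < \<tau> * real n" using assms by simp
  then show 1: "1 \<le> \<lceil>\<tau> * real n\<rceil>" by linarith
  have "\<tau> * real n \<le> real n" using assms by (simp add: mult_left_le_one_le)
  then show 2: "\<lceil>\<tau> * real n\<rceil> \<le> int n" by linarith
  show "nat \<lceil>\<tau> * real n\<rceil> \<in> {1..n}" using 1 2 unfolding atLeastAtMost_iff by linarith
qed

text \<open>
  An average over \<open>k\<close> is an integral over \<open>\<tau>\<close> with \<open>k =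
  \<lceil>\<tau> n\<rceil>\<close>: each \<open>k\<close> corresponds to the interval \<open>((k
  - 1)/n, k/n]\<close>, and rounding up makes these intervals partition \<open>(0, 1]\<close>.
\<close>

lemma riemann_step:
  fixes g :: "nat \<Rightarrow> real"
  assumes n: "1 \<le> n"
  shows "integrable lborel (\<lambda>\<tau>. indicator {0<..1} \<tau> * g (nat \<lceil>\<tau> * real n\<rceil>))" (is ?I)
    and "(\<integral>\<tau>. indicator {0<..1} \<tau> * g (nat \<lceil>\<tau> * real n\<rceil>) \<partial>lborel) = (\<Sum>k=1..n. g k) / real n" (is ?E)
proof -
  define A where "A k = {(real k - 1) / real n <.. real k / real n}" for k
  have n0: "0 < real n" using n by simp
  have A: "\<tau> \<in> A k \<longleftrightarrow> \<lceil>\<tau> * real n\<rceil> = int k" for \<tau> k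
    using n0 by (auto simp: A_def ceiling_eq_iff pos_divide_less_eq pos_le_divide_eq)
  have eq: "indicator {0<..1} \<tau> * g (nat \<lceil>\<tau> * real n\<rceil>) = (\<Sum>k=1..n. g k * indicator (A k) \<tau>)" for \<tau>
  proof (cases "\<tau> \<in> {0<..1}")
    case True
    have "(\<Sum>k=1..n. g k * indicator (A k) \<tau>) = (\<Sum>k\<in>{1..n}. if k = nat \<lceil>\<tau> * real n\<rceil> then g k else 0)"
      using ceiling_range(1)[OF True n] by (intro sum.cong) (auto simp: indicator_def A)
    then show ?thesis using True ceiling_range(3)[OF True n] by simp
  next
    case False
    have "\<tau> \<notin> A k" if "k \<in> {1..n}" for k
    proof
      assume "\<tau> \<in> A k"
      then have t: "(real k - 1) / real n < \<tau>" "\<tau> \<le> real k / real n" by (auto simp: A_def)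
      have "0 \<le> (real k - 1) / real n" using that n0 by auto
      moreover have "real k / real n \<le> 1" using that n0 by auto
      ultimately show False using t False by auto
    qed
    then show ?thesis using False by simp
  qed
  have m: "measure lborel (A k) = 1 / real n" "emeasure lborel (A k) < \<infinity>" for k
  proof -
    have "(real k - 1) / real n \<le> real k / real n" using n0 by (intro divide_right_mono) auto
    then show "measure lborel (A k) = 1 / real n" "emeasure lborel (A k) < \<infinity>"
      by (simp_all add: A_def diff_divide_distrib)
  qed
  have i: "integrable lborel (\<lambda>\<tau>. g k * indicator (A k) \<tau>)" for k
    using m(2)[of k] by (intro integrable_mult_right integrable_real_indicator) (auto simp: A_def)
  show ?I unfolding eq by (intro Bochner_Integration.integrable_sum i)
  have "(\<integral>\<tau>. indicator {0<..1} \<tau> * g (nat \<lceil>\<tau> * real n\<rceil>) \<partial>lborel) = (\<Sum>k=1..n. \<integral>\<tau>. g k * indicator (A k) \<tau> \<partial>lborel)"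
    unfolding eq by (rule Bochner_Integration.integral_sum) (rule i)
  also have "\<dots> = (\<Sum>k=1..n. g k * (1 / real n))" by (simp add: m(1) A_def[symmetric])
  also have "\<dots> = (\<Sum>k=1..n. g k) / real n" by (simp add: sum_divide_distrib)
  finally show ?E .
qed

lemma integral_Z_finite:
  fixes f :: "int \<Rightarrow> real"
  assumes "finite A" "\<And>j. j \<notin> A \<Longrightarrow> f j = 0"
  shows "(\<integral>j. f j \<partial>\<Z>) = sum f A"
proof -
  have sub: "{a \<in> UNIV. f a \<noteq> 0} \<subseteq> A" using assms(2) by auto
  have "(\<integral>j. f j \<partial>\<Z>) = (\<Sum>a | a \<in> UNIV \<and> f a \<noteq> 0. f a)"
    by (rule lebesgue_integral_count_space_finite_support) (rule finite_subset[OF sub assms(1)])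
  also have "\<dots> = sum f A" by (rule sum.mono_neutral_left) (use assms sub in auto)
  finally show ?thesis .
qed

section \<open>The limiting variance\<close>

context gaussian_array
begin

text \<open>
  The normalized sum, the covariances \<open>r\<close> of its terms, and the covariances
  \<open>R\<close> of the stationary process frozen at \<open>\<tau>\<close>.
\<close>

definition S :: "nat \<Rightarrow> 'a \<Rightarrow> real" where
  "S n \<omega> = (\<Sum>k=1..n. ft n k (Z n k \<omega>)) / sqrt (real n)"

definition r :: "nat \<Rightarrow> nat \<Rightarrow> nat \<Rightarrow> real" where
  "r n k l = expectation (\<lambda>\<omega>. ft n k (Z n k \<omega>) * ft n l (Z n l \<omega>))"

definition R :: "real \<Rightarrow> int \<Rightarrow> real" where
  "R \<tau> h = expectation (\<lambda>\<omega>. \<phi>t \<tau> (ZV \<tau> 0 \<omega>) * \<phi>t \<tau> (ZV \<tau> h \<omega>))"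

text \<open>
  The covariance at lag \<open>h\<close> around the time that corresponds to
  \<open>\<tau>\<close>, extended by zero where the second index leaves \<open>{1..n}\<close>.
\<close>

definition cc :: "nat \<Rightarrow> real \<Rightarrow> int \<Rightarrow> real" where
  "cc n \<tau> h = (if 1 \<le> \<lceil>\<tau> * real n\<rceil> + h \<and> \<lceil>\<tau> * real n\<rceil> + h \<le> int n
    then r n (nat \<lceil>\<tau> * real n\<rceil>) (nat (\<lceil>\<tau> * real n\<rceil> + h)) else 0)"

lemma ft_Z_sqi: "n \<ge> n1 \<Longrightarrow> k \<in> {1..n} \<Longrightarrow> sqi M (\<lambda>\<omega>. ft n k (Z n k \<omega>))"
  using std_pair_L2(1)[OF prob_space_axioms pair_XX ft_sqi] by blast

lemma S_sqi: "n \<ge> n1 \<Longrightarrow> sqi M (S n)"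
proof -
  assume n: "n \<ge> n1"
  have "sqi M (\<lambda>\<omega>. \<Sum>k=1..n. ft n k (Z n k \<omega>))" by (intro sqi_sum ft_Z_sqi n)
  from sqi_cmult[OF this, of "1 / sqrt (real n)"] show ?thesis by (simp add: S_def[abs_def])
qed

lemma S_variance:
  assumes n: "n \<ge> n1"
  shows "(nrm M (S n))\<^sup>2 = (\<Sum>k=1..n. \<Sum>l=1..n. r n k l) / real n"
proof -
  have "(nrm M (S n))\<^sup>2 = expectation (\<lambda>\<omega>. (\<Sum>k=1..n. \<Sum>l=1..n. ft n k (Z n k \<omega>) * ft n l (Z n l \<omega>))) / real n"
    unfolding nrm_sq S_def power_divide unfolding power2_eq_square sum_product by simp
  also have "expectation (\<lambda>\<omega>. (\<Sum>k=1..n. \<Sum>l=1..n. ft n k (Z n k \<omega>) * ft n l (Z n l \<omega>))) = (\<Sum>k=1..n. \<Sum>l=1..n. r n k l)"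
    unfolding r_def
    by (subst Bochner_Integration.integral_sum)
      (auto intro!: sum.cong Bochner_Integration.integral_sum Bochner_Integration.integrable_sum sqi_mult ft_Z_sqi n)
  finally show ?thesis .
qed

lemma cov_bound:
  assumes n: "n \<ge> n2" and k: "k \<in> {1..n}" "l \<in> {1..n}"
    and p: "std_pair M U U' (crossm y y')" and e: "env (int k) y" "env (int l) y'"
    and pd: "posdef c (gram y)" "posdef c (gram y')"
  shows "\<bar>expectation (\<lambda>\<omega>. ft n k (U \<omega>) * ft n l (U' \<omega>))\<bar> \<le> rho c (int l - int k) * Cf\<^sup>2"
proof -
  have n1: "n \<ge> n1" using n Cf(2) by simp
  have "\<bar>expectation (\<lambda>\<omega>. ft n k (U \<omega>) * ft n l (U' \<omega>))\<bar> \<le> rho c (int l - int k) * (nrm \<gamma> (ft n k) * nrm \<gamma> (ft n l))"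
    by (intro cov_rho[OF p e pd] ft_sqi[OF n1] ft_rank[OF n1 k(1)] k)
  also have "\<dots> \<le> rho c (int l - int k) * (Cf * Cf)"
    using k by (intro mult_left_mono mult_mono Cf(3)[OF n] rho_nonneg c_pos) (auto simp: Cf(1))
  finally show ?thesis by (simp add: power2_eq_square)
qed

lemma r_bound:
  assumes n: "n \<ge> n2" and k: "k \<in> {1..n}" "l \<in> {1..n}"
  shows "\<bar>r n k l\<bar> \<le> rho c (int l - int k) * Cf\<^sup>2"
proof -
  have n1: "n \<ge> n1" using n Cf(2) by simp
  show ?thesis unfolding r_def using k
    by (intro cov_bound[OF n k pair_XX[OF n1 k]] env_X posdef_X[OF n1]) auto
qed

lemma R_bound:
  assumes t: "\<tau> \<in> {0<..1}"
  shows "\<bar>R \<tau> h\<bar> \<le> rho c h * Cf\<^sup>2"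
proof -
  have "\<bar>R \<tau> h\<bar> \<le> rho c (h - 0) * (nrm \<gamma> (\<phi>t \<tau>) * nrm \<gamma> (\<phi>t \<tau>))"
    unfolding R_def
    by (rule cov_rho[OF pair_VV[OF t] env_W[OF t] env_W[OF t] posdef_Wc[OF t] posdef_Wc[OF t] \<phi>t_sqi[OF t] \<phi>t_sqi[OF t] \<phi>t_rank[OF t]])
  also have "\<dots> \<le> rho c (h - 0) * (Cf * Cf)"
    by (intro mult_left_mono mult_mono Cf(4)[OF t] rho_nonneg c_pos) (auto simp: Cf(1))
  finally show ?thesis by (simp add: power2_eq_square)
qed

lemma cc_bound:
  assumes n: "n \<ge> n2" and t: "\<tau> \<in> {0<..1}"
  shows "\<bar>cc n \<tau> h\<bar> \<le> rho c h * Cf\<^sup>2"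
proof (cases "1 \<le> \<lceil>\<tau> * real n\<rceil> + h \<and> \<lceil>\<tau> * real n\<rceil> + h \<le> int n")
  case True
  have n1: "1 \<le> n" using n Cf(2) n1(1) by simp
  have l: "nat (\<lceil>\<tau> * real n\<rceil> + h) \<in> {1..n}" using True by auto
  have "\<bar>r n (nat \<lceil>\<tau> * real n\<rceil>) (nat (\<lceil>\<tau> * real n\<rceil> + h))\<bar>
      \<le> rho c (int (nat (\<lceil>\<tau> * real n\<rceil> + h)) - int (nat \<lceil>\<tau> * real n\<rceil>)) * Cf\<^sup>2"
    by (rule r_bound[OF n ceiling_range(3)[OF t n1] l])
  also have "int (nat (\<lceil>\<tau> * real n\<rceil> + h)) - int (nat \<lceil>\<tau> * real n\<rceil>) = h"
    using True ceiling_range(1)[OF t n1] by simp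
  finally show ?thesis using True by (simp add: cc_def)
qed (auto simp: cc_def rho_nonneg c_pos)

lemma cc_sum:
  assumes t: "\<tau> \<in> {0<..1}" and n: "1 \<le> n"
  shows "(\<integral>h. cc n \<tau> h \<partial>\<Z>) = (\<Sum>l=1..n. r n (nat \<lceil>\<tau> * real n\<rceil>) l)"
proof -
  define k where "k = \<lceil>\<tau> * real n\<rceil>"
  define f where "f l = (if 1 \<le> l \<and> l \<le> int n then r n (nat k) (nat l) else 0)" for l
  have "(\<integral>h. cc n \<tau> h \<partial>\<Z>) = (\<integral>h. f (h + k) \<partial>\<Z>)"
    unfolding cc_def f_def k_def[symmetric] by (simp only: add.commute[of k])
  also have "\<dots> = (\<integral>l. f l \<partial>\<Z>)" by (rule integral_Z_shift)
  also have "\<dots> = (\<Sum>l\<in>int ` {1..n}. f l)"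
    by (rule integral_Z_finite) (auto simp: f_def image_int_atLeastAtMost)
  also have "\<dots> = (\<Sum>l=1..n. r n (nat k) l)"
    by (subst sum.reindex) (auto simp: f_def intro!: sum.cong)
  finally show ?thesis by (simp add: k_def)
qed

text \<open>
  \<open>ft n (k n)\<close> is close to \<open>\<phi>t (k n / n)\<close> by the uniform
  convergence assumption, and \<open>\<phi>t\<close> is continuous at \<open>\<tau>\<close>.
\<close>

lemma ft_converges:
  assumes t: "\<tau> \<in> {0<..1}" and k: "\<forall>\<^sub>F n in sequentially. k n \<in> {1..n}"
    and lim: "(\<lambda>n. real (k n) / real n) \<longlonglongrightarrow> \<tau>"
  shows "(\<lambda>n. nrm \<gamma> (\<lambda>z. ft n (k n) z - \<phi>t \<tau> z)) \<longlonglongrightarrow> 0"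
proof (rule Lim_null_comparison)
  define F where "F s = nrm \<gamma> (\<lambda>z. \<phi>t s z - \<phi>t \<tau> z)" for s
  have F\<tau>: "F \<tau> = 0" by (simp add: F_def nrm_def)
  have "continuous (at \<tau> within {0<..1}) F"
    unfolding continuous_within F\<tau> using \<phi>t_continuous[OF t] by (simp add: F_def[abs_def])
  from continuous_within_tendsto_compose[OF this _ lim]
  have Fl: "(\<lambda>n. F (real (k n) / real n)) \<longlonglongrightarrow> 0"
    unfolding F\<tau> using k by (elim meta_mp) (auto elim!: eventually_mono)
  show "(\<lambda>n. d n + F (real (k n) / real n)) \<longlonglongrightarrow> 0"
    by (rule tendsto_add_zero[OF d_lim Fl])
  show "\<forall>\<^sub>F n in sequentially. norm (nrm \<gamma> (\<lambda>z. ft n (k n) z - \<phi>t \<tau> z)) \<le> d n + F (real (k n) / real n)"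
    using k ft_\<phi>t eventually_ge_at_top[of n1]
  proof eventually_elim
    case (elim n)
    define s where "s = real (k n) / real n"
    have s: "s \<in> {0<..1}" using elim(1) by (auto simp: s_def)
    have kn: "max 1 (nat \<lfloor>s * real n\<rfloor>) = k n" using elim(1) by (simp add: s_def)
    have "nrm \<gamma> (\<lambda>z. ft n (k n) z - \<phi>t \<tau> z) \<le> nrm \<gamma> (\<lambda>z. ft n (k n) z - \<phi>t s z) + nrm \<gamma> (\<lambda>z. \<phi>t s z - \<phi>t \<tau> z)"
      by (rule nrm_triangle3[OF ft_sqi[OF elim(3,1)] \<phi>t_sqi[OF s] \<phi>t_sqi[OF t]])
    also have "\<dots> \<le> d n + F s" using bspec[OF elim(2) s] unfolding kn by (simp add: F_def)
    finally show ?case by (simp add: s_def)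
  qed
qed

lemma crossm_converges:
  assumes t: "\<tau> \<in> {0<..1}" and e: "0 < e"
  shows "\<exists>N\<ge>n1. \<forall>n\<ge>N. 1 \<le> \<lceil>\<tau> * real n\<rceil> + h \<longrightarrow> \<lceil>\<tau> * real n\<rceil> + h \<le> int n \<longrightarrow>
    norm (crossm (yX n (nat \<lceil>\<tau> * real n\<rceil>)) (yX n (nat (\<lceil>\<tau> * real n\<rceil> + h))) - crossm (yW \<tau> 0) (yW \<tau> h)) < e"
proof -
  define D where "D = (real CARD('n))\<^sup>2 * (2 * stdC TYPE('n) c bn)"
  have D: "0 \<le> D" using c_pos by (simp add: D_def stdC_def)
  define \<delta> where "\<delta> = e / (D + 1)"
  have \<delta>: "0 < \<delta>" "D * \<delta> < e" using e D by (simp_all add: \<delta>_def field_simps)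
  from x_lim[OF \<delta>(1), of "int CARD('n) + 1 + \<bar>h\<bar>"] obtain N where N: "\<And>n \<tau> t. n \<ge> N \<Longrightarrow> \<tau> \<in> {0<..1} \<Longrightarrow> t \<in> {1..n + CARD('n)} \<Longrightarrow>
    \<bar>\<lfloor>real n * \<tau>\<rfloor> - int t\<bar> \<le> int CARD('n) + 1 + \<bar>h\<bar> \<Longrightarrow> nrm \<Z> (\<lambda>i. x n t i - w \<tau> (int t) i) \<le> \<delta>" by blast
  show ?thesis
  proof (intro exI[of _ "max N n1"] conjI allI impI)
    fix n assume n: "max N n1 \<le> n" and lo: "1 \<le> \<lceil>\<tau> * real n\<rceil> + h" and hi: "\<lceil>\<tau> * real n\<rceil> + h \<le> int n"
    define k l where "k = nat \<lceil>\<tau> * real n\<rceil>" and "l = nat (\<lceil>\<tau> * real n\<rceil> + h)"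
    have nn: "n1 \<le> n" "N \<le> n" "1 \<le> n" using n n1(1) by auto
    have k: "k \<in> {1..n}" unfolding k_def by (rule ceiling_range(3)[OF t nn(3)])
    have ik: "int k = \<lceil>\<tau> * real n\<rceil>" using ceiling_range(1)[OF t nn(3)] by (simp add: k_def)
    have l: "l \<in> {1..n}" "int l = int k + h" using lo hi ik by (auto simp: l_def)
    have fl: "\<bar>\<lfloor>real n * \<tau>\<rfloor> - \<lceil>\<tau> * real n\<rceil>\<bar> \<le> 1"
      by (simp add: mult.commute[of "real n"]) linarith
    have cl: "nrm \<Z> (\<lambda>i. yX n j a i - yW \<tau> (int j) a i) \<le> \<delta>" if j: "j = k \<or> j = l" for j a
    proof -
      have "nrm \<Z> (\<lambda>i. x n (j + idx a) i - w \<tau> (int (j + idx a)) i) \<le> \<delta>"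
      proof (rule N[OF nn(2) t])
        show "j + idx a \<in> {1..n + CARD('n)}" using j k l(1) idx_le[of a] by auto
        show "\<bar>\<lfloor>real n * \<tau>\<rfloor> - int (j + idx a)\<bar> \<le> int CARD('n) + 1 + \<bar>h\<bar>"
          using j fl ik l(2) idx_le[of a] by auto
      qed
      then show ?thesis by (simp add: yX_def yW_def)
    qed
    have "norm (crossm (yX n k) (yX n l) - crossm (yW \<tau> (int k)) (yW \<tau> (int l))) \<le> (real CARD('n))\<^sup>2 * (2 * stdC TYPE('n) c bn * \<delta>)"
    proof (rule crossm_close)
      have k': "1 \<le> k" "k \<le> n" and l': "1 \<le> l" "l \<le> n" using k l by auto
      show "sqi \<Z> (yX n k a)" "sqi \<Z> (yX n l a)" "sqi \<Z> (yW \<tau> (int k) a)" "sqi \<Z> (yW \<tau> (int l) a)" for a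
        by (rule env_sqi[OF env_X[OF k']] env_sqi[OF env_X[OF l']] env_sqi[OF env_W[OF t]])+
      show "nrm \<Z> (yX n k a) \<le> bn" "nrm \<Z> (yX n l a) \<le> bn" "nrm \<Z> (yW \<tau> (int k) a) \<le> bn" "nrm \<Z> (yW \<tau> (int l) a) \<le> bn" for a
        by (rule env_nrm[OF env_X[OF k']] env_nrm[OF env_X[OF l']] env_nrm[OF env_W[OF t]])+
      show "posdef c (gram (yX n k))" "posdef c (gram (yX n l))" by (rule posdef_X[OF nn(1) k] posdef_X[OF nn(1) l(1)])+
      show "posdef c (gram (yW \<tau> (int k)))" "posdef c (gram (yW \<tau> (int l)))" by (rule posdef_Wc[OF t])+
    qed (use cl in auto)
    also have "\<dots> = D * \<delta>" by (simp add: D_def)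
    also have "\<dots> < e" by (rule \<delta>(2))
    finally show "norm (crossm (yX n (nat \<lceil>\<tau> * real n\<rceil>)) (yX n (nat (\<lceil>\<tau> * real n\<rceil> + h))) - crossm (yW \<tau> 0) (yW \<tau> h)) < e"
      unfolding k_def[symmetric] l_def[symmetric] l(2) crossm_W[OF t] .
  qed simp
qed

text \<open>
  Both indices \<open>k = \<lceil>\<tau> n\<rceil>\<close> and \<open>l = k + h\<close> satisfy
  \<open>k / n \<longlongrightarrow> \<tau>\<close>. First replace both functions by
  \<open>\<phi>t \<tau>\<close>, then the cross covariance matrix by its limit. The end point
  \<open>\<tau> = 1\<close> is excluded because there \<open>l\<close> exceeds \<open>n\<close>
  for positive lags.
\<close>

lemma cc_limit:
  assumes t: "\<tau> \<in> {0<..<1}"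
  shows "(\<lambda>n. cc n \<tau> h) \<longlonglongrightarrow> R \<tau> h"
proof -
  have t1: "\<tau> \<in> {0<..1}" using t by auto
  define k l where "k n = nat \<lceil>\<tau> * real n\<rceil>" and "l n = nat (\<lceil>\<tau> * real n\<rceil> + h)" for n
  obtain N1 where N1: "real N1 \<ge> (1 + \<bar>real_of_int h\<bar>) / \<tau>" using real_arch_simple by blast
  obtain N2 where N2: "real N2 \<ge> (1 + \<bar>real_of_int h\<bar>) / (1 - \<tau>)" using real_arch_simple by blast
  define N0 where "N0 = max (max N1 N2) (max n2 1)"
  have rng: "1 \<le> \<lceil>\<tau> * real n\<rceil> + h" "\<lceil>\<tau> * real n\<rceil> + h \<le> int n" if n: "n \<ge> N0" for n
  proof -
    have "(1 + \<bar>real_of_int h\<bar>) / \<tau> \<le> real n" using N1 n by (auto simp: N0_def)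
    then have "1 + \<bar>real_of_int h\<bar> \<le> \<tau> * real n" using t by (simp add: pos_divide_le_eq mult.commute)
    then show "1 \<le> \<lceil>\<tau> * real n\<rceil> + h" by linarith
    have "(1 + \<bar>real_of_int h\<bar>) / (1 - \<tau>) \<le> real n" using N2 n by (auto simp: N0_def)
    then have "1 + \<bar>real_of_int h\<bar> \<le> real n - \<tau> * real n" using t by (simp add: pos_divide_le_eq algebra_simps)
    then show "\<lceil>\<tau> * real n\<rceil> + h \<le> int n" by linarith
  qed
  have lim_c: "(\<lambda>n. real_of_int \<lceil>\<tau> * real n\<rceil> / real n) \<longlonglongrightarrow> \<tau>"
  proof (rule LIM_zero_cancel, rule Lim_null_comparison[OF _ lim_1_over_n])
    show "\<forall>\<^sub>F n in sequentially. norm (real_of_int \<lceil>\<tau> * real n\<rceil> / real n - \<tau>) \<le> 1 / real n"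
      using eventually_ge_at_top[of 1]
    proof eventually_elim
      case (elim n)
      have "real_of_int \<lceil>\<tau> * real n\<rceil> / real n - \<tau> = (real_of_int \<lceil>\<tau> * real n\<rceil> - \<tau> * real n) / real n"
        using elim by (simp add: field_simps)
      moreover have "0 \<le> real_of_int \<lceil>\<tau> * real n\<rceil> - \<tau> * real n" "real_of_int \<lceil>\<tau> * real n\<rceil> - \<tau> * real n \<le> 1" by linarith+
      ultimately show ?case by (simp add: divide_right_mono)
    qed
  qed
  have kl_lim: "(\<lambda>n. real (k n) / real n) \<longlonglongrightarrow> \<tau>" "(\<lambda>n. real (l n) / real n) \<longlonglongrightarrow> \<tau>"
  proof -
    have "(\<lambda>n. real_of_int \<lceil>\<tau> * real n\<rceil> / real n + real_of_int h * (1 / real n)) \<longlonglongrightarrow> \<tau> + real_of_int h * 0"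
      by (intro tendsto_intros lim_c lim_1_over_n)
    then have "(\<lambda>n. (real_of_int (\<lceil>\<tau> * real n\<rceil> + h)) / real n) \<longlonglongrightarrow> \<tau>" by (simp add: add_divide_distrib)
    moreover have "real_of_int (\<lceil>\<tau> * real n\<rceil> + h) / real n = real (l n) / real n" if "n \<ge> N0" for n
    proof -
      have "int (l n) = \<lceil>\<tau> * real n\<rceil> + h" using rng(1)[OF that] by (simp add: l_def)
      then have "real_of_int (\<lceil>\<tau> * real n\<rceil> + h) = real (l n)" by (metis of_int_of_nat_eq)
      then show ?thesis by simp
    qed
    ultimately show "(\<lambda>n. real (l n) / real n) \<longlonglongrightarrow> \<tau>"
      by (rule Lim_transform_eventually[OF _ eventually_sequentiallyI])
    have "real_of_int \<lceil>\<tau> * real n\<rceil> / real n = real (k n) / real n" if "n \<ge> 1" for n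
    proof -
      have "int (k n) = \<lceil>\<tau> * real n\<rceil>" using ceiling_range(1)[OF t1 that] unfolding k_def by linarith
      then have "real_of_int \<lceil>\<tau> * real n\<rceil> = real (k n)" by (metis of_int_of_nat_eq)
      then show ?thesis by simp
    qed
    with lim_c show "(\<lambda>n. real (k n) / real n) \<longlonglongrightarrow> \<tau>"
      by (rule Lim_transform_eventually[OF _ eventually_sequentiallyI])
  qed
  have k_ev: "\<forall>\<^sub>F n in sequentially. k n \<in> {1..n}"
    unfolding k_def using ceiling_range(3)[OF t1] by (rule eventually_sequentiallyI)
  have l_ev: "\<forall>\<^sub>F n in sequentially. l n \<in> {1..n}"
  proof (rule eventually_sequentiallyI)
    show "l n \<in> {1..n}" if "n \<ge> N0" for n
      using rng[OF that] unfolding l_def atLeastAtMost_iff by linarith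
  qed
  define a where "a n = nrm \<gamma> (\<lambda>z. ft n (k n) z - \<phi>t \<tau> z) * Cf + Cf * nrm \<gamma> (\<lambda>z. ft n (l n) z - \<phi>t \<tau> z)" for n
  have a_lim: "a \<longlonglongrightarrow> 0" unfolding a_def[abs_def]
    by (intro tendsto_add_zero tendsto_mult_left_zero tendsto_mult_right_zero ft_converges[OF t1 k_ev kl_lim(1)] ft_converges[OF t1 l_ev kl_lim(2)])
  show ?thesis
  proof (rule LIMSEQ_I)
    fix e :: real assume e: "0 < e"
    then have e2: "0 < e / 2" by simp
    from std_pair_continuous[OF prob_space_axioms e2 \<phi>t_sqi[OF t1] \<phi>t_sqi[OF t1], of "crossm (yW \<tau> 0) (yW \<tau> h)"]
    obtain D where D: "0 < D" "\<And>U U' Q U0 U0'. std_pair M U U' Q \<Longrightarrow> std_pair M U0 U0' (crossm (yW \<tau> 0) (yW \<tau> h)) \<Longrightarrow>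
      norm (Q - crossm (yW \<tau> 0) (yW \<tau> h)) < D \<Longrightarrow>
      \<bar>expectation (\<lambda>\<omega>. \<phi>t \<tau> (U \<omega>) * \<phi>t \<tau> (U' \<omega>)) - expectation (\<lambda>\<omega>. \<phi>t \<tau> (U0 \<omega>) * \<phi>t \<tau> (U0' \<omega>))\<bar> < e / 2" by blast
    from crossm_converges[OF t1 D(1), of h] obtain N3 where N3: "N3 \<ge> n1" "\<And>n. n \<ge> N3 \<Longrightarrow> 1 \<le> \<lceil>\<tau> * real n\<rceil> + h \<Longrightarrow> \<lceil>\<tau> * real n\<rceil> + h \<le> int n \<Longrightarrow>
      norm (crossm (yX n (k n)) (yX n (l n)) - crossm (yW \<tau> 0) (yW \<tau> h)) < D"
      unfolding k_def l_def by blast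
    from order_tendstoD(2)[OF a_lim e2] obtain N4 where N4: "\<And>n. n \<ge> N4 \<Longrightarrow> a n < e / 2" by (auto simp: eventually_sequentially)
    show "\<exists>no. \<forall>n\<ge>no. norm (cc n \<tau> h - R \<tau> h) < e"
    proof (intro exI[of _ "max N0 (max N3 N4)"] allI impI)
      fix n assume "max N0 (max N3 N4) \<le> n"
      then have n: "n \<ge> N0" "n \<ge> N3" "n \<ge> N4" "n \<ge> n2" "n \<ge> n1" "n \<ge> 1" using N3(1) by (auto simp: N0_def)
      have k: "k n \<in> {1..n}" unfolding k_def by (rule ceiling_range(3)[OF t1 n(6)])
      have l: "l n \<in> {1..n}" using rng[OF n(1)] by (auto simp: l_def)
      have c: "cc n \<tau> h = r n (k n) (l n)" using rng[OF n(1)] by (simp add: cc_def k_def l_def)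
      note p = pair_XX[OF n(5) k l]
      have 1: "\<bar>r n (k n) (l n) - expectation (\<lambda>\<omega>. \<phi>t \<tau> (Z n (k n) \<omega>) * \<phi>t \<tau> (Z n (l n) \<omega>))\<bar> \<le> a n"
      proof -
        have "\<bar>r n (k n) (l n) - expectation (\<lambda>\<omega>. \<phi>t \<tau> (Z n (k n) \<omega>) * \<phi>t \<tau> (Z n (l n) \<omega>))\<bar>
            \<le> nrm \<gamma> (\<lambda>z. ft n (k n) z - \<phi>t \<tau> z) * nrm \<gamma> (ft n (l n)) + nrm \<gamma> (\<phi>t \<tau>) * nrm \<gamma> (\<lambda>z. ft n (l n) z - \<phi>t \<tau> z)"
          unfolding r_def by (rule std_pair_inner_diff[OF prob_space_axioms p ft_sqi[OF n(5) k] ft_sqi[OF n(5) l] \<phi>t_sqi[OF t1] \<phi>t_sqi[OF t1]])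
        also have "\<dots> \<le> a n" unfolding a_def
          by (intro add_mono mult_left_mono mult_right_mono Cf(3)[OF n(4) l] Cf(4)[OF t1]) auto
        finally show ?thesis .
      qed
      have 2: "\<bar>expectation (\<lambda>\<omega>. \<phi>t \<tau> (Z n (k n) \<omega>) * \<phi>t \<tau> (Z n (l n) \<omega>)) - R \<tau> h\<bar> < e / 2"
        unfolding R_def by (rule D(2)[OF p pair_VV[OF t1] N3(2)[OF n(2) rng[OF n(1)]]])
      show "norm (cc n \<tau> h - R \<tau> h) < e" unfolding c real_norm_def using 1 2 N4[OF n(3)] by linarith
    qed
  qed
qed

lemma R_integrable: "\<tau> \<in> {0<..1} \<Longrightarrow> integrable \<Z> (R \<tau>)"
  by (rule Bochner_Integration.integrable_bound[of _ "\<lambda>h. rho c h * Cf\<^sup>2"])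
    (use R_bound rho_integrable[OF c_pos] in \<open>auto intro!: AE_I2 order_trans[OF _ abs_ge_self]\<close>)

lemma cc_integrable: "n \<ge> n2 \<Longrightarrow> \<tau> \<in> {0<..1} \<Longrightarrow> integrable \<Z> (cc n \<tau>)"
  by (rule Bochner_Integration.integrable_bound[of _ "\<lambda>h. rho c h * Cf\<^sup>2"])
    (use cc_bound rho_integrable[OF c_pos] in \<open>auto intro!: AE_I2 order_trans[OF _ abs_ge_self]\<close>)

text \<open>
  Dominated convergence twice: over the lags for fixed \<open>\<tau>\<close>, and then over
  \<open>\<tau>\<close>. Measurability of the limit function comes for free, as it is a limit of
  step functions.
\<close>

theorem variance_limit:
  shows "set_integrable lborel {0<..1} (\<lambda>\<tau>. \<integral>h. R \<tau> h \<partial>\<Z>)" (is ?I)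
    and "(\<lambda>n. (nrm M (S n))\<^sup>2) \<longlonglongrightarrow> (LINT \<tau>:{0<..1}|lborel. (\<integral>h. R \<tau> h \<partial>\<Z>))" (is ?L)
proof -
  define g where "g \<tau> = (\<integral>h. R \<tau> h \<partial>\<Z>)" for \<tau>
  \<comment> \<open>the estimates hold from \<open>n2\<close> on, so the sequence is shifted\<close>
  define N where "N = max n2 1"
  have N: "n + N \<ge> n2" "n + N \<ge> 1" "n + N \<ge> n1" for n using Cf(2) by (auto simp: N_def)
  define s where "s n \<tau> = indicator {0<..1} \<tau> * (\<Sum>l=1..n+N. r (n + N) (nat \<lceil>\<tau> * real (n + N)\<rceil>) l)" for n \<tau>
  define K where "K = (\<integral>h. rho c h * Cf\<^sup>2 \<partial>\<Z>)"
  have si: "integrable lborel (s n)" for n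
    unfolding s_def[abs_def] by (rule riemann_step(1)[OF N(2)])
  have sI: "(\<integral>\<tau>. s n \<tau> \<partial>lborel) = (nrm M (S (n + N)))\<^sup>2" for n
    unfolding s_def S_variance[OF N(3)] by (rule riemann_step(2)[OF N(2)])
  have s_eq: "s n \<tau> = (\<integral>h. cc (n + N) \<tau> h \<partial>\<Z>)" if "\<tau> \<in> {0<..1}" for n \<tau>
    using that by (simp add: s_def cc_sum[OF that N(2)])
  have lim: "(\<lambda>n. s n \<tau>) \<longlonglongrightarrow> g \<tau>" if t: "\<tau> \<in> {0<..<1}" for \<tau>
  proof -
    have t1: "\<tau> \<in> {0<..1}" using t by auto
    have "(\<lambda>n. \<integral>h. cc (n + N) \<tau> h \<partial>\<Z>) \<longlonglongrightarrow> (\<integral>h. R \<tau> h \<partial>\<Z>)"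
    proof (rule integral_dominated_convergence)
      show "integrable \<Z> (\<lambda>h. rho c h * Cf\<^sup>2)" using rho_integrable[OF c_pos] by simp
      show "AE h in \<Z>. (\<lambda>n. cc (n + N) \<tau> h) \<longlonglongrightarrow> R \<tau> h"
        by (intro AE_I2 LIMSEQ_ignore_initial_segment cc_limit t)
      show "AE h in \<Z>. norm (cc (n + N) \<tau> h) \<le> rho c h * Cf\<^sup>2" for n
        by (intro AE_I2) (use cc_bound[OF N(1) t1] in auto)
    qed simp_all
    then show ?thesis using s_eq[OF t1] by (simp add: g_def)
  qed
  have sb: "\<bar>s n \<tau>\<bar> \<le> indicator {0<..1} \<tau> * K" for n \<tau>
  proof (cases "\<tau> \<in> {0<..1}")
    case True
    have "\<bar>s n \<tau>\<bar> \<le> (\<integral>h. \<bar>cc (n + N) \<tau> h\<bar> \<partial>\<Z>)" unfolding s_eq[OF True] by (rule integral_abs_bound)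
    also have "\<dots> \<le> K" unfolding K_def using cc_integrable[OF N(1) True] rho_integrable[OF c_pos]
      by (intro integral_mono cc_bound[OF N(1) True]) auto
    finally show ?thesis using True by simp
  qed (simp add: s_def)
  have hm: "(\<lambda>\<tau>. indicator {0<..<1} \<tau> * g \<tau>) \<in> borel_measurable lborel"
  proof (rule borel_measurable_LIMSEQ_real)
    show "(\<lambda>\<tau>. indicator {0<..<1} \<tau> * s n \<tau>) \<in> borel_measurable lborel" for n
      using borel_measurable_integrable[OF si[of n]] by measurable
    show "(\<lambda>n. indicator {0<..<1} \<tau> * s n \<tau>) \<longlonglongrightarrow> indicator {0<..<1} \<tau> * g \<tau>" for \<tau>
      using lim[of \<tau>] by (auto simp: indicator_def)
  qed
  have fm: "(\<lambda>\<tau>. indicator {0<..1} \<tau> * g \<tau>) \<in> borel_measurable lborel"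
  proof -
    have "(\<lambda>\<tau>. indicator {0<..1} \<tau> * g \<tau>) = (\<lambda>\<tau>. indicator {0<..<1} \<tau> * g \<tau> + indicator {1} \<tau> * g 1)"
      by (auto simp: fun_eq_iff indicator_def)
    moreover have "(\<lambda>\<tau>. indicator {1} \<tau> * g 1) \<in> borel_measurable lborel" by measurable
    ultimately show ?thesis using borel_measurable_add[OF hm] by simp
  qed
  have wi: "integrable lborel (\<lambda>\<tau>::real. indicator {0<..1} \<tau> * K)" for K :: real
    by (intro integrable_mult_left integrable_real_indicator) auto
  have "AE \<tau> in lborel. \<tau> \<noteq> (1::real)" by (rule AE_lborel_singleton)
  then have ae: "AE \<tau> in lborel. (\<lambda>n. s n \<tau>) \<longlonglongrightarrow> indicator {0<..1} \<tau> * g \<tau>"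
  proof eventually_elim
    case (elim \<tau>)
    show ?case
    proof (cases "\<tau> \<in> {0<..1}")
      case True
      then show ?thesis using lim[of \<tau>] elim by auto
    qed (simp add: s_def)
  qed
  have bd: "AE \<tau> in lborel. norm (s n \<tau>) \<le> indicator {0<..1} \<tau> * K" for n using sb by auto
  have sm: "s n \<in> borel_measurable lborel" for n using si[of n] by (rule borel_measurable_integrable)
  have i: "integrable lborel (\<lambda>\<tau>. indicator {0<..1} \<tau> * g \<tau>)"
    by (rule integrable_dominated_convergence[OF fm sm wi ae bd])
  then show ?I by (simp add: set_integrable_def g_def)
  have "(\<lambda>n. \<integral>\<tau>. s n \<tau> \<partial>lborel) \<longlonglongrightarrow> (\<integral>\<tau>. indicator {0<..1} \<tau> * g \<tau> \<partial>lborel)"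
    by (rule integral_dominated_convergence[OF fm sm wi ae bd])
  then have "(\<lambda>n. (nrm M (S (n + N)))\<^sup>2) \<longlonglongrightarrow> (LINT \<tau>:{0<..1}|lborel. g \<tau>)"
    by (simp add: sI set_lebesgue_integral_def)
  then show ?L unfolding g_def by (rule LIMSEQ_offset)
qed

end

section \<open>Truncation and approximation by local variables\<close>

lemma integral_diff_product:
  assumes "sqi M a" "sqi M b" "sqi M p" "sqi M q"
  shows "(\<integral>\<omega>. (a \<omega> - b \<omega>) * (p \<omega> - q \<omega>) \<partial>M)
    = ((\<integral>\<omega>. a \<omega> * p \<omega> \<partial>M) - (\<integral>\<omega>. a \<omega> * q \<omega> \<partial>M)) - ((\<integral>\<omega>. b \<omega> * p \<omega> \<partial>M) - (\<integral>\<omega>. b \<omega> * q \<omega> \<partial>M))"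
proof -
  note i = sqi_mult[OF assms(1,3)] sqi_mult[OF assms(1,4)] sqi_mult[OF assms(2,3)] sqi_mult[OF assms(2,4)]
  have "(\<lambda>\<omega>. (a \<omega> - b \<omega>) * (p \<omega> - q \<omega>)) = (\<lambda>\<omega>. (a \<omega> * p \<omega> - a \<omega> * q \<omega>) - (b \<omega> * p \<omega> - b \<omega> * q \<omega>))"
    by (simp add: algebra_simps)
  then show ?thesis using i by (simp add: Bochner_Integration.integral_diff)
qed

context gaussian_array
begin

text \<open>
  The error of truncating the moving average at lag \<open>J\<close>.
\<close>

definition E :: "nat \<Rightarrow> nat \<Rightarrow> nat \<Rightarrow> 'a \<Rightarrow> real" where
  "E J n k \<omega> = ft n k (Z n k \<omega>) - ft n k (ZT J n k \<omega>)"

lemma ft_ZT_sqi: "n \<ge> n1 \<Longrightarrow> J \<ge> J0 \<Longrightarrow> k \<in> {1..n} \<Longrightarrow> sqi M (\<lambda>\<omega>. ft n k (ZT J n k \<omega>))"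
  using std_pair_L2(1)[OF prob_space_axioms pair_TT ft_sqi] by blast

lemma E_sqi: "n \<ge> n1 \<Longrightarrow> J \<ge> J0 \<Longrightarrow> k \<in> {1..n} \<Longrightarrow> sqi M (E J n k)"
  unfolding E_def[abs_def] by (intro sqi_diff ft_Z_sqi ft_ZT_sqi)

text \<open>
  The product of two truncation errors consists of four covariances, and the bound of rank
  \<open>m\<close> applies to each of them. It does not improve with \<open>J\<close>, but it is
  summable over the lags.
\<close>

lemma E_cov:
  assumes n: "n \<ge> n2" and J: "J \<ge> J0" and k: "k \<in> {1..n}" "l \<in> {1..n}"
  shows "\<bar>expectation (\<lambda>\<omega>. E J n k \<omega> * E J n l \<omega>)\<bar> \<le> 4 * (rho c (int l - int k) * Cf\<^sup>2)"
proof -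
  have n1: "n \<ge> n1" using n Cf(2) by simp
  have k': "1 \<le> k" "k \<le> n" and l': "1 \<le> l" "l \<le> n" using k by auto
  note eX = env_X[OF k'] env_X[OF l'] and eT = env_T[OF k', of J] env_T[OF l', of J]
  note pX = posdef_X[OF n1 k(1)] posdef_X[OF n1 k(2)] and pT = posdef_T[OF J n1 k(1)] posdef_T[OF J n1 k(2)]
  have eq: "expectation (\<lambda>\<omega>. E J n k \<omega> * E J n l \<omega>)
    = (expectation (\<lambda>\<omega>. ft n k (Z n k \<omega>) * ft n l (Z n l \<omega>)) - expectation (\<lambda>\<omega>. ft n k (Z n k \<omega>) * ft n l (ZT J n l \<omega>)))
    - (expectation (\<lambda>\<omega>. ft n k (ZT J n k \<omega>) * ft n l (Z n l \<omega>)) - expectation (\<lambda>\<omega>. ft n k (ZT J n k \<omega>) * ft n l (ZT J n l \<omega>)))"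
    unfolding E_def by (intro integral_diff_product ft_Z_sqi[OF n1] ft_ZT_sqi[OF n1 J] k)
  show ?thesis
    unfolding eq
    using cov_bound[OF n k pair_XX[OF n1 k] eX(1) eX(2) pX(1) pX(2)]
      cov_bound[OF n k pair_XT[OF n1 J k] eX(1) eT(2) pX(1) pT(2)]
      cov_bound[OF n k pair_TX[OF n1 J k] eT(1) eX(2) pT(1) pX(2)]
      cov_bound[OF n k pair_TT[OF n1 J k] eT(1) eT(2) pT(1) pT(2)]
    by linarith
qed

text \<open>
  Bound at lag \<open>h\<close> for the covariances of errors of norm at most \<open>q\<close>.
  Its sum over all lags tends to \<open>0\<close> with \<open>q\<close>, by dominated
  convergence.
\<close>

definition G :: "real \<Rightarrow> int \<Rightarrow> real" where
  "G q h = min (q\<^sup>2) (4 * (rho c h * Cf\<^sup>2))"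

lemma G_nonneg: "0 \<le> G q h" by (simp add: G_def rho_nonneg c_pos)

lemma G_integrable: "integrable \<Z> (G q)"
proof (rule Bochner_Integration.integrable_bound)
  show "integrable \<Z> (\<lambda>h. 4 * (rho c h * Cf\<^sup>2))" using rho_integrable[OF c_pos] by simp
  show "AE h in \<Z>. norm (G q h) \<le> norm (4 * (rho c h * Cf\<^sup>2))"
    by (intro AE_I2) (simp add: G_def rho_nonneg c_pos)
qed simp

lemma G_small:
  assumes "0 < \<eta>"
  shows "\<exists>q>0. (\<integral>h. G q h \<partial>\<Z>) < \<eta>"
proof -
  define q :: "nat \<Rightarrow> real" where "q N = 1 / real (Suc N)" for N
  have "(\<lambda>N. (q N)\<^sup>2) \<longlonglongrightarrow> 0\<^sup>2" unfolding q_def by (intro tendsto_power LIMSEQ_Suc[OF lim_1_over_n])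
  then have q0: "(\<lambda>N. (q N)\<^sup>2) \<longlonglongrightarrow> 0" by simp
  have "(\<lambda>N. \<integral>h. G (q N) h \<partial>\<Z>) \<longlonglongrightarrow> (\<integral>h. 0 \<partial>\<Z>)"
  proof (rule integral_dominated_convergence)
    show "integrable \<Z> (\<lambda>h. 4 * (rho c h * Cf\<^sup>2))" using rho_integrable[OF c_pos] by simp
    show "AE h in \<Z>. (\<lambda>N. G (q N) h) \<longlonglongrightarrow> 0"
    proof (rule AE_I2)
      fix h
      have "(\<lambda>N. G (q N) h) \<longlonglongrightarrow> min 0 (4 * (rho c h * Cf\<^sup>2))" unfolding G_def by (intro tendsto_min q0 tendsto_const)
      then show "(\<lambda>N. G (q N) h) \<longlonglongrightarrow> 0" by (simp add: rho_nonneg c_pos)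
    qed
    show "AE h in \<Z>. norm (G (q N) h) \<le> 4 * (rho c h * Cf\<^sup>2)" for N
      by (intro AE_I2) (simp add: G_def rho_nonneg c_pos)
  qed simp_all
  from order_tendstoD(2)[OF this, of \<eta>] assms obtain N where "(\<integral>h. G (q N) h \<partial>\<Z>) < \<eta>"
    by (auto simp: eventually_sequentially)
  then show ?thesis by (intro exI[of _ "q N"]) (simp add: q_def)
qed

lemma E_sum:
  assumes n: "n \<ge> n2" and J: "J \<ge> J0" and q: "\<And>k. k \<in> {1..n} \<Longrightarrow> nrm M (E J n k) \<le> q"
  shows "(nrm M (\<lambda>\<omega>. (\<Sum>k=1..n. E J n k \<omega>) / sqrt (real n)))\<^sup>2 \<le> (\<integral>h. G q h \<partial>\<Z>)"
proof -
  have n1': "n \<ge> n1" using n Cf(2) by simp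
  then have n0: "0 < real n" using n1(1) by simp
  note s = E_sqi[OF n1' J]
  have b: "expectation (\<lambda>\<omega>. E J n k \<omega> * E J n l \<omega>) \<le> G q (int l - int k)" if k: "k \<in> {1..n}" "l \<in> {1..n}" for k l
  proof -
    have "\<bar>expectation (\<lambda>\<omega>. E J n k \<omega> * E J n l \<omega>)\<bar> \<le> nrm M (E J n k) * nrm M (E J n l)"
      by (rule L2_Cauchy_Schwarz[OF s[OF k(1)] s[OF k(2)]])
    also have "\<dots> \<le> q * q" using q[OF k(1)] by (intro mult_mono q k) (auto intro: order_trans[OF nrm_nonneg])
    finally show ?thesis using E_cov[OF n J k] by (auto simp: G_def power2_eq_square)
  qed
  have "(\<Sum>k=1..n. \<Sum>l=1..n. expectation (\<lambda>\<omega>. E J n k \<omega> * E J n l \<omega>)) \<le> (\<Sum>k=1..n. \<integral>h. G q h \<partial>\<Z>)"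
  proof (rule sum_mono)
    fix k assume k: "k \<in> {1..n}"
    have "(\<Sum>l=1..n. expectation (\<lambda>\<omega>. E J n k \<omega> * E J n l \<omega>)) \<le> (\<Sum>l=1..n. G q (int l - int k))"
      by (intro sum_mono b k)
    also have "\<dots> = sum (G q) ((\<lambda>l. int l - int k) ` {1..n})"
      by (subst sum.reindex) (auto simp: inj_on_def)
    also have "\<dots> \<le> (\<integral>h. G q h \<partial>\<Z>)" by (intro sum_le_integral_Z G_integrable G_nonneg) simp
    finally show "(\<Sum>l=1..n. expectation (\<lambda>\<omega>. E J n k \<omega> * E J n l \<omega>)) \<le> (\<integral>h. G q h \<partial>\<Z>)" .
  qed
  then have le: "(\<Sum>k=1..n. \<Sum>l=1..n. expectation (\<lambda>\<omega>. E J n k \<omega> * E J n l \<omega>)) \<le> (\<integral>h. G q h \<partial>\<Z>) * real n"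
    by (simp add: mult.commute)
  have "(nrm M (\<lambda>\<omega>. (\<Sum>k=1..n. E J n k \<omega>) / sqrt (real n)))\<^sup>2
      = expectation (\<lambda>\<omega>. (\<Sum>k=1..n. \<Sum>l=1..n. E J n k \<omega> * E J n l \<omega>)) / real n"
    unfolding nrm_sq power_divide unfolding power2_eq_square sum_product by simp
  also have "expectation (\<lambda>\<omega>. (\<Sum>k=1..n. \<Sum>l=1..n. E J n k \<omega> * E J n l \<omega>))
      = (\<Sum>k=1..n. \<Sum>l=1..n. expectation (\<lambda>\<omega>. E J n k \<omega> * E J n l \<omega>))"
    by (subst Bochner_Integration.integral_sum)
      (auto intro!: sum.cong Bochner_Integration.integral_sum Bochner_Integration.integrable_sum sqi_mult s)
  finally have eq: "(nrm M (\<lambda>\<omega>. (\<Sum>k=1..n. E J n k \<omega>) / sqrt (real n)))\<^sup>2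
      = (\<Sum>k=1..n. \<Sum>l=1..n. expectation (\<lambda>\<omega>. E J n k \<omega> * E J n l \<omega>)) / real n" .
  show ?thesis unfolding eq pos_divide_le_eq[OF n0] by (rule le)
qed

text \<open>
  Each of finitely many functions \<open>ft N0 k'\<close> changes little when its argument is
  replaced by one with nearly identical standardization, and cutting off at a large
  \<open>J\<close> makes the standardizations nearly identical, uniformly in \<open>n\<close>
  and \<open>k\<close>.
\<close>

lemma E_small:
  assumes q: "0 < q"
  shows "\<exists>J\<ge>J0. \<exists>N\<ge>n2. \<forall>n\<ge>N. \<forall>k\<in>{1..n}. nrm M (E J n k) \<le> q"
proof -
  obtain N0 where N0: "N0 \<ge> n1" "\<And>n k. n \<ge> N0 \<Longrightarrow> k \<in> {1..n} \<Longrightarrow> \<exists>k'\<in>{1..N0}. nrm \<gamma> (\<lambda>z. ft n k z - ft N0 k' z) \<le> q / 4"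
    using finite_net[of "q / 4"] q by auto
  have q2: "q / 2 > 0" using q by simp
  have "\<forall>k'\<in>{1..N0}. \<exists>d>0. \<forall>U U' Q. std_pair M U U' Q \<longrightarrow> norm (Q - mat 1) < d \<longrightarrow>
    nrm M (\<lambda>\<omega>. ft N0 k' (U \<omega>) - ft N0 k' (U' \<omega>)) < q / 2"
    using std_pair_near_identity[OF prob_space_axioms q2 ft_sqi[OF N0(1)]] by blast
  from bchoice[OF this] obtain dd where dd': "\<forall>k'\<in>{1..N0}. dd k' > 0 \<and> (\<forall>U U' Q. std_pair M U U' Q \<longrightarrow> norm (Q - mat 1) < dd k' \<longrightarrow>
    nrm M (\<lambda>\<omega>. ft N0 k' (U \<omega>) - ft N0 k' (U' \<omega>)) < q / 2)" ..
  then have dd: "\<And>k'. k' \<in> {1..N0} \<Longrightarrow> dd k' > 0" "\<And>k' U U' Q. k' \<in> {1..N0} \<Longrightarrow> std_pair M U U' Q \<Longrightarrow>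
    norm (Q - mat 1) < dd k' \<Longrightarrow> nrm M (\<lambda>\<omega>. ft N0 k' (U \<omega>) - ft N0 k' (U' \<omega>)) < q / 2"
    by blast+
  define d0 where "d0 = Min (dd ` {1..N0})"
  have ne: "{1..N0} \<noteq> {}" using N0(1) n1(1) by auto
  have d0: "0 < d0" unfolding d0_def using dd(1) ne by (subst Min_gr_iff) auto
  have d0_le: "d0 \<le> dd k'" if "k' \<in> {1..N0}" for k' unfolding d0_def using that by (intro Min_le) auto
  define D where "D = (real CARD('n))\<^sup>2 * (2 * stdC TYPE('n) c bn)"
  have D: "0 \<le> D" using c_pos by (simp add: D_def stdC_def)
  define \<delta> where "\<delta> = d0 / (D + 1)"
  have \<delta>: "0 < \<delta>" "D * \<delta> < d0" using d0 D by (simp_all add: \<delta>_def field_simps)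
  from order_tendstoD(2)[OF tail_lim \<delta>(1)] obtain J1 where J1: "\<And>J. J \<ge> J1 \<Longrightarrow> tail J < \<delta>"
    by (auto simp: eventually_sequentially)
  define J where "J = max J0 J1"
  have J: "J \<ge> J0" "tail J \<le> \<delta>" using J1[of J] by (auto simp: J_def)
  show ?thesis
  proof (rule exI[of _ J], rule conjI[OF J(1)], rule exI[of _ "max N0 n2"], intro conjI allI impI ballI)
    fix n k assume "max N0 n2 \<le> n" and k: "k \<in> {1..n}"
    then have n: "n \<ge> N0" "n \<ge> n2" "n \<ge> n1" using N0(1) by auto
    have k': "1 \<le> k" "k \<le> n" using k by auto
    obtain i where i: "i \<in> {1..N0}" "nrm \<gamma> (\<lambda>z. ft n k z - ft N0 i z) \<le> q / 4" using N0(2)[OF n(1) k] by auto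
    note p = pair_XT[OF n(3) J(1) k k]
    note s = ft_sqi[OF n(3) k] ft_sqi[OF N0(1) i(1)]
    note sX = env_sqi[OF env_X[OF k']] and sT = env_sqi[OF env_T[OF k', of J]]
    note nX = env_nrm[OF env_X[OF k']] and nT = env_nrm[OF env_T[OF k', of J]]
    note pX = posdef_X[OF n(3) k] and pT = posdef_T[OF J(1) n(3) k]
    have dX: "nrm \<Z> (\<lambda>i. yX n k a i - yX n k a i) \<le> \<delta>" for a using \<delta>(1) by (simp add: nrm_def)
    have dT: "nrm \<Z> (\<lambda>i. yT J n k a i - yX n k a i) \<le> \<delta>" for a using T_close_X[OF k', of J a] J(2) by simp
    have "norm (crossm (yX n k) (yT J n k) - crossm (yX n k) (yX n k)) \<le> D * \<delta>"
      using crossm_close[OF sX sX sT sX pX pX pT pX nX nX nT nX dX dT] by (simp add: D_def mult.assoc)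
    also have "\<dots> < dd i" using \<delta>(2) d0_le[OF i(1)] by simp
    finally have cl: "norm (crossm (yX n k) (yT J n k) - mat 1) < dd i" unfolding crossm_self[OF sX pX] .
    have 1: "nrm M (\<lambda>\<omega>. ft n k (Z n k \<omega>) - ft N0 i (Z n k \<omega>)) \<le> q / 4"
      using std_pair_L2(3)[OF prob_space_axioms p sqi_diff[OF s]] i(2) by simp
    have 2: "nrm M (\<lambda>\<omega>. ft N0 i (Z n k \<omega>) - ft N0 i (ZT J n k \<omega>)) \<le> q / 2"
      using dd(2)[OF i(1) p cl] by simp
    have 3: "nrm M (\<lambda>\<omega>. ft N0 i (ZT J n k \<omega>) - ft n k (ZT J n k \<omega>)) \<le> q / 4"
      using std_pair_L2(4)[OF prob_space_axioms p sqi_diff[OF s(2,1)]] i(2)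
      unfolding nrm_minus_commute[of \<gamma> "ft N0 i" "ft n k"] by simp
    note sM = std_pair_L2(1,2)[OF prob_space_axioms p s(1)] std_pair_L2(1,2)[OF prob_space_axioms p s(2)]
    have "nrm M (E J n k) \<le> nrm M (\<lambda>\<omega>. ft n k (Z n k \<omega>) - ft N0 i (Z n k \<omega>))
        + nrm M (\<lambda>\<omega>. ft N0 i (Z n k \<omega>) - ft n k (ZT J n k \<omega>))"
      unfolding E_def[abs_def] by (rule nrm_triangle3[OF sM(1) sM(3) sM(2)])
    moreover have "nrm M (\<lambda>\<omega>. ft N0 i (Z n k \<omega>) - ft n k (ZT J n k \<omega>)) \<le> nrm M (\<lambda>\<omega>. ft N0 i (Z n k \<omega>) - ft N0 i (ZT J n k \<omega>))
        + nrm M (\<lambda>\<omega>. ft N0 i (ZT J n k \<omega>) - ft n k (ZT J n k \<omega>))"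
      by (rule nrm_triangle3[OF sM(3) sM(4) sM(2)])
    ultimately show "nrm M (E J n k) \<le> q" using 1 2 3 by linarith
  qed simp
qed

lemma ZT_fld:
  assumes "f \<in> borel_measurable borel"
  shows "(\<lambda>\<omega>. f (ZT J n k \<omega>)) \<in> borel_measurable (fld M \<epsilon> (near (J + CARD('n)) k))"
proof -
  have "(\<lambda>\<omega>. YT J n k \<omega> $ a) \<in> borel_measurable (fld M \<epsilon> (near (J + CARD('n)) k))" for a
  proof -
    have "\<epsilon> i \<in> borel_measurable (fld M \<epsilon> (near (J + CARD('n)) k))" if "\<bar>int k + int (idx a) - i\<bar> \<le> int J" for i
      using that idx_le[of a] by (intro fld_coord) auto
    then show ?thesis unfolding YT_def partial_def vec_lambda_beta
      by (intro borel_measurable_sum borel_measurable_times borel_measurable_const) auto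
  qed
  then have "ZT J n k \<in> borel_measurable (fld M \<epsilon> (near (J + CARD('n)) k))"
    by (intro borel_measurable_vec) (simp add: ZT_def matrix_vector_mult_def borel_measurable_sum)
  from measurable_compose[OF this assms] show ?thesis .
qed

text \<open>
  Choose \<open>q\<close>, then the window \<open>J\<close>, such that truncation costs at most
  \<open>\<eta> / 2\<close>. The window fixes the range \<open>D\<close> of dependence, and then
  \<open>\<zeta>\<close> is chosen for the approximation by trigonometric polynomials, whose
  errors are local and add up to at most \<open>\<surd>(4 D + 1) \<zeta> = \<eta> / 2\<close>.
  The local variables are uniformly bounded because finitely many trigonometric polynomials
  suffice.
\<close>

lemma local_approximation:
  assumes \<eta>: "0 < \<eta>"
  shows "\<exists>D B n1. \<forall>n\<ge>n1. \<exists>\<xi>. (\<forall>k\<in>{1..n}. \<xi> k \<in> borel_measurable (fld M \<epsilon> (near D k))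
        \<and> (\<forall>\<omega>. \<bar>\<xi> k \<omega>\<bar> \<le> B) \<and> expectation (\<xi> k) = 0)
        \<and> nrm M (\<lambda>\<omega>. S n \<omega> - (\<Sum>k=1..n. \<xi> k \<omega>) / sqrt (real n)) \<le> \<eta>"
proof -
  obtain q where q: "q > 0" "(\<integral>h. G q h \<partial>\<Z>) < (\<eta> / 2)\<^sup>2" using G_small[of "(\<eta> / 2)\<^sup>2"] \<eta> by auto
  obtain J N where J: "J \<ge> J0" and N: "N \<ge> n2" "\<And>n k. n \<ge> N \<Longrightarrow> k \<in> {1..n} \<Longrightarrow> nrm M (E J n k) \<le> q"
    using E_small[OF q(1)] by blast
  define D where "D = J + CARD('n)"
  define \<zeta> where "\<zeta> = \<eta> / 2 / sqrt (real (4 * D + 1))"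
  have "\<zeta>\<^sup>2 = (\<eta> / 2)\<^sup>2 / real (4 * D + 1)" unfolding \<zeta>_def power_divide by simp
  then have \<zeta>: "0 < \<zeta>" "real (4 * D + 1) * \<zeta>\<^sup>2 = (\<eta> / 2)\<^sup>2" using \<eta> by (simp_all add: \<zeta>_def)
  obtain N1 where N1: "N1 \<ge> n1" "\<And>n k. n \<ge> N1 \<Longrightarrow> k \<in> {1..n} \<Longrightarrow> \<exists>k'\<in>{1..N1}. nrm \<gamma> (\<lambda>z. ft n k z - ft N1 k' z) \<le> \<zeta> / 2"
    using finite_net[of "\<zeta> / 2"] \<zeta>(1) by auto
  have "\<exists>xs. nrm \<gamma> (\<lambda>z. ft N1 k' z - trig xs z) < \<zeta> / 2" if "k' \<in> {1..N1}" for k'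
  proof -
    have "\<zeta> / 2 > 0" using \<zeta>(1) by simp
    from sg.apprE[OF sg.trig_dense[OF ft_sqi[OF N1(1) that]] this] show ?thesis by blast
  qed
  then obtain xs where xs: "\<And>k'. k' \<in> {1..N1} \<Longrightarrow> nrm \<gamma> (\<lambda>z. ft N1 k' z - trig (xs k') z) < \<zeta> / 2" by metis
  obtain Bt where Bt: "\<And>k' z. \<bar>trig (xs k') z\<bar> \<le> Bt k'" "\<And>k'. 0 < Bt k'" using trig_bounded[of "xs _"] by metis
  define B where "B = (\<Sum>k'\<in>{1..N1}. Bt k')"
  have B: "\<bar>trig (xs k') z\<bar> \<le> B" if "k' \<in> {1..N1}" for k' z
  proof -
    have "Bt k' \<le> B" unfolding B_def by (rule member_le_sum[OF that]) (auto intro: less_imp_le Bt(2))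
    then show ?thesis using Bt(1)[of k' z] by simp
  qed
  show ?thesis
  proof (rule exI[of _ D], rule exI[of _ "2 * B"], rule exI[of _ "max N N1"], intro allI impI)
    fix n assume "max N N1 \<le> n"
    then have n: "n \<ge> N" "n \<ge> N1" "n \<ge> n2" "n \<ge> n1" using N(1) N1(1) by auto
    have n0: "0 < real n" using n(4) n1(1) by simp
    obtain i where i: "\<And>k. k \<in> {1..n} \<Longrightarrow> i k \<in> {1..N1}" "\<And>k. k \<in> {1..n} \<Longrightarrow> nrm \<gamma> (\<lambda>z. ft n k z - ft N1 (i k) z) \<le> \<zeta> / 2"
      using N1(2)[OF n(2)] by metis
    define T where "T k z = trig (xs (i k)) z" for k z
    define \<xi> where "\<xi> k \<omega> = T k (ZT J n k \<omega>) - expectation (\<lambda>\<omega>. T k (ZT J n k \<omega>))" for k \<omega>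
    define g where "g k z = ft n k z - T k z" for k z
    define e where "e k \<omega> = ft n k (ZT J n k \<omega>) - \<xi> k \<omega>" for k \<omega>
    have Tm: "T k \<in> borel_measurable borel" and sT: "sqi \<gamma> (T k)" for k
      unfolding T_def[abs_def] by (auto intro: sg.sqi_trig)
    have g: "sqi \<gamma> (g k)" "nrm \<gamma> (g k) \<le> \<zeta>" if k: "k \<in> {1..n}" for k
    proof -
      show "sqi \<gamma> (g k)" unfolding g_def[abs_def] by (intro sqi_diff ft_sqi n k sT)
      have "nrm \<gamma> (g k) \<le> nrm \<gamma> (\<lambda>z. ft n k z - ft N1 (i k) z) + nrm \<gamma> (\<lambda>z. ft N1 (i k) z - T k z)"
        unfolding g_def[abs_def] by (rule nrm_triangle3[OF ft_sqi[OF n(4) k] ft_sqi[OF N1(1) i(1)[OF k]] sT])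
      also have "\<dots> \<le> \<zeta>" using i(2)[OF k] xs[OF i(1)[OF k]] by (simp add: T_def)
      finally show "nrm \<gamma> (g k) \<le> \<zeta>" .
    qed
    note L2 = std_pair_L2(1,3)[OF prob_space_axioms pair_TT[OF n(4) J]]
    have sTZ: "sqi M (\<lambda>\<omega>. T k (ZT J n k \<omega>))" if k: "k \<in> {1..n}" for k by (rule L2(1)[OF k k sT])
    have sc: "sqi M (\<lambda>\<omega>. a)" for a by (rule sqi_bounded[where B="\<bar>a\<bar>"]) auto
    have s\<xi>: "sqi M (\<xi> k)" if k: "k \<in> {1..n}" for k unfolding \<xi>_def[abs_def] by (intro sqi_diff sTZ sc k)
    have ft0: "expectation (\<lambda>\<omega>. ft n k (ZT J n k \<omega>)) = 0" if k: "k \<in> {1..n}" for k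
    proof -
      note p = pair_TT[OF n(4) J k k]
      have "ZT J n k \<in> borel_measurable M" using p by (simp add: std_pair_def)
      from law_transfer(1)[OF std_pair_law(1)[OF prob_space_axioms p] this sqi_std_gaussianD[OF ft_sqi[OF n(4) k]]]
      show ?thesis using ft_mean[OF n(4) k] by simp
    qed
    have \<xi>0: "expectation (\<xi> k) = 0" if k: "k \<in> {1..n}" for k
      unfolding \<xi>_def[abs_def] using sqi_integrable[OF sTZ[OF k]] by (simp add: prob_space)
    have \<xi>m: "\<xi> k \<in> borel_measurable (fld M \<epsilon> (near D k))" for k
      unfolding \<xi>_def[abs_def] D_def by (intro borel_measurable_diff ZT_fld Tm borel_measurable_const)
    have \<xi>B: "\<bar>\<xi> k \<omega>\<bar> \<le> 2 * B" if k: "k \<in> {1..n}" for k \<omega>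
    proof -
      have T: "\<bar>T k z\<bar> \<le> B" for z unfolding T_def by (rule B[OF i(1)[OF k]])
      have "\<bar>expectation (\<lambda>\<omega>. T k (ZT J n k \<omega>))\<bar> \<le> expectation (\<lambda>\<omega>. \<bar>T k (ZT J n k \<omega>)\<bar>)" by (rule integral_abs_bound)
      also have "\<dots> \<le> B"
        by (rule integral_le_const) (use sqi_integrable[OF sTZ[OF k]] T in auto)
      finally show ?thesis using T[of "ZT J n k \<omega>"] unfolding \<xi>_def by linarith
    qed
    have se: "sqi M (e k)" if k: "k \<in> {1..n}" for k
      unfolding e_def[abs_def] by (intro sqi_diff ft_ZT_sqi n J k s\<xi>)
    have e0: "expectation (e k) = 0" if k: "k \<in> {1..n}" for k
      unfolding e_def[abs_def] using sqi_integrable[OF ft_ZT_sqi[OF n(4) J k]] sqi_integrable[OF s\<xi>[OF k]] ft0[OF k] \<xi>0[OF k]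
      by (subst Bochner_Integration.integral_diff) auto
    have eV: "expectation (\<lambda>\<omega>. (e k \<omega>)\<^sup>2) \<le> \<zeta>\<^sup>2" if k: "k \<in> {1..n}" for k
    proof -
      define U where "U \<omega> = g k (ZT J n k \<omega>)" for \<omega>
      have sU: "sqi M U" unfolding U_def[abs_def] by (rule L2(1)[OF k k g(1)[OF k]])
      note iU = sqi_integrable[OF sU] sqiD(2)[OF sU]
      have eU: "e k \<omega> = U \<omega> - expectation U" for \<omega>
      proof -
        have "expectation U = 0 - expectation (\<lambda>\<omega>. T k (ZT J n k \<omega>))"
          unfolding U_def[abs_def] g_def ft0[OF k, symmetric]
          using sqi_integrable[OF ft_ZT_sqi[OF n(4) J k]] sqi_integrable[OF sTZ[OF k]] by simp
        then show ?thesis by (simp add: e_def \<xi>_def U_def g_def)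
      qed
      have "expectation (\<lambda>\<omega>. (e k \<omega>)\<^sup>2) = expectation (\<lambda>\<omega>. (U \<omega>)\<^sup>2) - (expectation U)\<^sup>2"
        unfolding eU using variance_eq[OF iU] .
      also have "\<dots> \<le> (nrm M U)\<^sup>2" by (simp add: nrm_sq)
      also have "nrm M U = nrm \<gamma> (g k)" unfolding U_def[abs_def] by (rule L2(2)[OF k k g(1)[OF k]])
      also have "(nrm \<gamma> (g k))\<^sup>2 \<le> \<zeta>\<^sup>2" by (intro power_mono g k) simp
      finally show ?thesis .
    qed
    have em: "e k \<in> borel_measurable (fld M \<epsilon> (near D k))" if k: "k \<in> {1..n}" for k
      unfolding e_def[abs_def]
      by (intro borel_measurable_diff \<xi>m) (unfold D_def, intro ZT_fld sqi_std_gaussianD ft_sqi n k)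
    have 1: "nrm M (\<lambda>\<omega>. (\<Sum>k=1..n. E J n k \<omega>) / sqrt (real n)) \<le> \<eta> / 2"
    proof (rule power2_le_imp_le)
      show "(nrm M (\<lambda>\<omega>. (\<Sum>k=1..n. E J n k \<omega>) / sqrt (real n)))\<^sup>2 \<le> (\<eta> / 2)\<^sup>2"
        by (rule order_trans[OF E_sum[OF n(3) J N(2)[OF n(1)]] less_imp_le[OF q(2)]])
    qed (use \<eta> in simp)
    have 2: "nrm M (\<lambda>\<omega>. (\<Sum>k=1..n. e k \<omega>) / sqrt (real n)) \<le> \<eta> / 2"
    proof (rule power2_le_imp_le)
      have "(nrm M (\<lambda>\<omega>. (\<Sum>k=1..n. e k \<omega>) / sqrt (real n)))\<^sup>2 = expectation (\<lambda>\<omega>. (\<Sum>k=1..n. e k \<omega>)\<^sup>2) / real n"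
        unfolding nrm_sq power_divide by simp
      also have "\<dots> \<le> real n * real (4 * D + 1) * \<zeta>\<^sup>2 / real n"
        using n0 by (intro divide_right_mono local_variance[OF noise_indep em se e0 eV]) auto
      also have "\<dots> = (\<eta> / 2)\<^sup>2" using n0 \<zeta>(2) by simp
      finally show "(nrm M (\<lambda>\<omega>. (\<Sum>k=1..n. e k \<omega>) / sqrt (real n)))\<^sup>2 \<le> (\<eta> / 2)\<^sup>2" .
    qed (use \<eta> in simp)
    have split: "S n \<omega> - (\<Sum>k=1..n. \<xi> k \<omega>) / sqrt (real n)
        = (\<Sum>k=1..n. E J n k \<omega>) / sqrt (real n) + (\<Sum>k=1..n. e k \<omega>) / sqrt (real n)" for \<omega>
      unfolding S_def E_def e_def diff_divide_distrib[symmetric] add_divide_distrib[symmetric]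
        sum_subtractf[symmetric] sum.distrib[symmetric] by (intro arg_cong2[where f="(/)"] sum.cong refl) simp
    have sE': "sqi M (\<lambda>\<omega>. (\<Sum>k=1..n. E J n k \<omega>) / sqrt (real n))"
      using sqi_cmult[OF sqi_sum[of "{1..n}" M "E J n", OF E_sqi[OF n(4) J]], of "1 / sqrt (real n)"] by simp
    have se': "sqi M (\<lambda>\<omega>. (\<Sum>k=1..n. e k \<omega>) / sqrt (real n))"
      using sqi_cmult[OF sqi_sum[of "{1..n}" M e, OF se], of "1 / sqrt (real n)"] by simp
    have "nrm M (\<lambda>\<omega>. S n \<omega> - (\<Sum>k=1..n. \<xi> k \<omega>) / sqrt (real n)) \<le> \<eta>"
      unfolding split using nrm_triangle[OF sE' se'] 1 2 by linarith
    then show "\<exists>\<xi>. (\<forall>k\<in>{1..n}. \<xi> k \<in> borel_measurable (fld M \<epsilon> (near D k))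
        \<and> (\<forall>\<omega>. \<bar>\<xi> k \<omega>\<bar> \<le> 2 * B) \<and> expectation (\<xi> k) = 0)
        \<and> nrm M (\<lambda>\<omega>. S n \<omega> - (\<Sum>k=1..n. \<xi> k \<omega>) / sqrt (real n)) \<le> \<eta>"
      using \<xi>m \<xi>B \<xi>0 by (intro exI[of _ \<xi>]) auto
  qed
qed

lemma S_char_limit:
  "(\<lambda>n. expectation (\<lambda>\<omega>. iexp (t * S n \<omega>)))
    \<longlonglongrightarrow> of_real (exp (- (LINT \<tau>:{0<..1}|lborel. (\<integral>h. R \<tau> h \<partial>\<Z>)) * t\<^sup>2 / 2))"
  by (rule local_approx_char_limit[OF noise_indep S_sqi variance_limit(2) local_approximation])

end

section \<open>Convergence to the centred normal law\<close>

lemma (in gaussian_noise) char_centred_normal: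
  assumes "0 \<le> v"
  shows "real_distribution (centred_normal v)" "char (centred_normal v) t = of_real (exp (- v * t\<^sup>2 / 2))"
proof -
  have "real_distribution (centred_normal v) \<and> char (centred_normal v) t = of_real (exp (- v * t\<^sup>2 / 2))"
  proof (cases "v = 0")
    case True
    have "prob_space (return borel (0::real))" by (rule prob_space_return) simp
    then show ?thesis using True
      by (simp add: centred_normal_def real_distribution_def real_distribution_axioms_def char_def integral_return)
  next
    case False
    then have v: "0 < sqrt v" using assms by simp
    \<comment> \<open>the law is that of a multiple of one noise variable\<close>
    have "distributed M lborel (\<lambda>\<omega>. 0 + sqrt v * \<epsilon> 0 \<omega>) (normal_density (0 + sqrt v * 0) (\<bar>sqrt v\<bar> * 1))"
      using v by (intro normal_density_affine noise_normal) auto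
    then have d: "distributed M lborel (\<lambda>\<omega>. sqrt v * \<epsilon> 0 \<omega>) (normal_density 0 (sqrt v))" using v by simp
    have cn: "centred_normal v = density lborel (normal_density 0 (sqrt v))" using False by (simp add: centred_normal_def)
    have "char (centred_normal v) t = (\<integral>x. iexp (t * x) \<partial>distr M lborel (\<lambda>\<omega>. sqrt v * \<epsilon> 0 \<omega>))"
      unfolding char_def cn distributed_distr_eq_density[OF d] ..
    also have "\<dots> = expectation (\<lambda>\<omega>. iexp (t * (sqrt v * \<epsilon> 0 \<omega>)))"
      by (rule integral_distr) simp_all
    also have "\<dots> = expectation (\<lambda>\<omega>. cis (t * sqrt v * \<epsilon> 0 \<omega>))"
      by (simp add: cis_conv_exp mult_ac)
    also have "\<dots> = of_real (exp (- (t * sqrt v)\<^sup>2 / 2))" by (rule noise_char)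
    also have "(t * sqrt v)\<^sup>2 = v * t\<^sup>2" using assms by (simp add: power_mult_distrib)
    finally have "char (centred_normal v) t = of_real (exp (- v * t\<^sup>2 / 2))" by simp
    moreover have "real_distribution (centred_normal v)"
      using prob_space_normal_density v
      by (simp add: cn real_distribution_def real_distribution_axioms_def)
    ultimately show ?thesis by blast
  qed
  then show "real_distribution (centred_normal v)" "char (centred_normal v) t = of_real (exp (- v * t\<^sup>2 / 2))" by auto
qed

text \<open>
  Levy's continuity theorem. The hypothesis \<open>eq\<close> leaves finitely many \<open>T
  n\<close> free, since the standardization of the array makes sense for large \<open>n\<close>
  only.
\<close>

lemma (in gaussian_noise) weak_conv_centred_normal:
  fixes S T :: "nat \<Rightarrow> 'a \<Rightarrow> real"
  assumes T: "\<And>n. T n \<in> borel_measurable M" and eq: "\<And>n \<omega>. n \<ge> N \<Longrightarrow> T n \<omega> = S n \<omega>" and v: "0 \<le> v"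
    and lim: "\<And>t. (\<lambda>n. expectation (\<lambda>\<omega>. iexp (t * S n \<omega>))) \<longlonglongrightarrow> of_real (exp (- v * t\<^sup>2 / 2))"
  shows "weak_conv_m (\<lambda>n. distr M borel (T n)) (centred_normal v)"
proof (rule levy_continuity)
  show "real_distribution (distr M borel (T n))" for n
    using prob_space_distr[OF T] by (simp add: real_distribution_def real_distribution_axioms_def)
  show "real_distribution (centred_normal v)" by (rule char_centred_normal(1)[OF v])
  fix t
  have "char (distr M borel (T n)) t = expectation (\<lambda>\<omega>. iexp (t * T n \<omega>))" for n
    unfolding char_def by (rule integral_distr) (use T in simp_all)
  then have "expectation (\<lambda>\<omega>. iexp (t * S n \<omega>)) = char (distr M borel (T n)) t" if "n \<ge> N" for n
    using eq[OF that] by simp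
  with lim[of t] have "(\<lambda>n. char (distr M borel (T n)) t) \<longlonglongrightarrow> of_real (exp (- v * t\<^sup>2 / 2))"
    by (rule Lim_transform_eventually[OF _ eventually_sequentiallyI])
  then show "(\<lambda>n. char (distr M borel (T n)) t) \<longlonglongrightarrow> char (centred_normal v) t"
    unfolding char_centred_normal(2)[OF v] .
qed

section \<open>Coefficients, suprema and standardized functions\<close>

lemma nrm_le_of_nn_integral:
  assumes "(\<integral>\<^sup>+x. ennreal ((g x)\<^sup>2) \<partial>\<mu>) \<le> s" "s < \<top>"
  shows "nrm \<mu> g \<le> sqrt (enn2real s)"
proof -
  have "(\<integral>x. (g x)\<^sup>2 \<partial>\<mu>) \<le> enn2real s"
  proof (cases "integrable \<mu> (\<lambda>x. (g x)\<^sup>2)")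
    case True
    then have "ennreal (\<integral>x. (g x)\<^sup>2 \<partial>\<mu>) \<le> s" using assms(1) by (simp add: nn_integral_eq_integral)
    then have "enn2real (ennreal (\<integral>x. (g x)\<^sup>2 \<partial>\<mu>)) \<le> enn2real s" by (rule enn2real_mono[OF _ assms(2)])
    then show ?thesis by simp
  next
    \<comment> \<open>a non-integrable square has integral \<open>0\<close> by convention\<close>
    case False
    then show ?thesis by (simp add: not_integrable_integral_eq)
  qed
  then show ?thesis by (simp add: nrm_def)
qed

lemma nrm_mono:
  assumes "sqi M g" "\<And>x. \<bar>f x\<bar> \<le> g x" "f \<in> borel_measurable M"
  shows "nrm M f \<le> nrm M g"
proof -
  have le: "(f x)\<^sup>2 \<le> (g x)\<^sup>2" for x
    using power_mono[OF assms(2)[of x], of 2] by simp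
  have "sqi M f" by (rule sqi_bound[OF assms(1,3)]) (use assms(2) in \<open>auto intro: order_trans[OF _ abs_ge_self]\<close>)
  then have "(\<integral>x. (f x)\<^sup>2 \<partial>M) \<le> (\<integral>x. (g x)\<^sup>2 \<partial>M)"
    using assms(1) le by (intro integral_mono) (auto simp: sqi_def)
  then show ?thesis by (simp add: nrm_def)
qed

text \<open>
  \<open>b = K / u\<close> decays like \<open>\<bar>j\<bar>^(\<alpha> - 1)\<close>, so
  \<open>b^s\<close> is summable if \<open>(1 - \<alpha>) * s > 1\<close>. For \<open>s =
  2\<close> this is \<open>\<alpha> < 1/2\<close>, and for \<open>s = 2m/(m + 1)\<close> it is
  \<open>m * (1 - 2 * \<alpha>) > 1\<close>.
\<close>

lemma envelope_power_kernel:
  fixes idx :: "'n::finite \<Rightarrow> nat" and u :: "int \<Rightarrow> real"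
  assumes u: "\<And>j. u j = max 1 (real_of_int \<bar>j\<bar> powr (1 - \<alpha>))" and K: "0 \<le> K"
    and \<alpha>: "\<alpha> < 1 / 2" and m: "real m > 1 / (1 - 2 * \<alpha>)"
  shows "envelope (\<lambda>j. K / u j) m"
proof
  define b where "b j = K / u j" for j
  have u1: "1 \<le> u j" for j by (simp add: u)
  show b0: "0 \<le> K / u j" for j using K u1[of j] by simp
  have a: "0 < 1 - 2 * \<alpha>" using \<alpha> by simp
  then have m0: "1 < real m * (1 - 2 * \<alpha>)" using m by (simp add: pos_divide_less_eq)
  show m1: "1 \<le> m" using m0 by (cases m) auto
  have b2: "integrable \<Z> (\<lambda>j. (K / u j)\<^sup>2)"
  proof -
    have "integrable \<Z> (\<lambda>j. (K / u j) powr 2)" by (rule integrable_envelope[OF u _ _ K]) (use \<alpha> in auto)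
    moreover have "(K / u j) powr 2 = (K / u j)\<^sup>2" for j using b0[of j] powr_realpow'[of "K / u j" 2] by simp
    ultimately show ?thesis by simp
  qed
  then show "sqi \<Z> (\<lambda>j. K / u j)" by (simp add: sqi_def)
  define p where "p = 2 * real m / (real m + 1)"
  have bp: "integrable \<Z> (\<lambda>j. (K / u j) powr p)"
  proof (rule integrable_envelope[OF u _ _ K])
    show "0 < p" using m1 by (simp add: p_def)
    have "real m + 1 < (1 - \<alpha>) * (2 * real m)" using m0 by (simp add: algebra_simps)
    then show "(1 - \<alpha>) * p > 1" by (simp add: p_def pos_less_divide_eq)
  qed
  show "integrable \<Z> (\<lambda>l. (\<integral>j. K / u j * (K / u (j + l)) \<partial>\<Z>) ^ m)"
    by (rule young_convolution[OF b0 m1 p_def bp b2])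
qed

text \<open>
  For each \<open>j\<close> the supremum over \<open>\<tau>\<close> and \<open>t\<close> tends
  to zero, and it is dominated by \<open>2 * b j\<close>; hence the norm of the sequence of
  suprema tends to zero.
\<close>

lemma uniform_kernel_limit:
  fixes a :: "nat \<Rightarrow> nat \<Rightarrow> int \<Rightarrow> real" and aa :: "real \<Rightarrow> int \<Rightarrow> real"
  assumes b: "sqi \<Z> b"
    and ab: "\<And>n j t. 1 \<le> n \<Longrightarrow> t \<in> {1..n + \<nu>} \<Longrightarrow> \<bar>a n t j\<bar> \<le> b j"
    and aab: "\<And>\<tau> j. \<tau> \<in> {0<..1} \<Longrightarrow> \<bar>aa \<tau> j\<bar> \<le> b j"
    and lim: "\<And>j L. (0::real) < L \<Longrightarrow>
        (\<lambda>n. SUP \<tau>\<in>{0<..1}. SUP k\<in>{k. 1 \<le> k \<and> k \<le> n + \<nu> \<and> real_of_int \<bar>\<lfloor>real n * \<tau>\<rfloor> - int k\<bar> \<le> L}.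
                 ennreal \<bar>a n k j - aa \<tau> j\<bar>) \<longlonglongrightarrow> 0"
    and e: "0 < e"
  shows "\<exists>N. \<forall>n\<ge>N. \<forall>\<tau>\<in>{0<..1}. \<forall>t\<in>{1..n + \<nu>}.
        \<bar>\<lfloor>real n * \<tau>\<rfloor> - int t\<bar> \<le> L \<longrightarrow> nrm \<Z> (\<lambda>j. a n t j - aa \<tau> j) \<le> e"
proof -
  define L' where "L' = max 1 (real_of_int L)"
  define s where "s n j = (SUP \<tau>\<in>{0<..1}. SUP k\<in>{k. 1 \<le> k \<and> k \<le> n + \<nu> \<and> real_of_int \<bar>\<lfloor>real n * \<tau>\<rfloor> - int k\<bar> \<le> L'}.
                 ennreal \<bar>a n k j - aa \<tau> j\<bar>)" for n j
  have b0: "0 \<le> b j" for j using aab[of 1 j] by (simp add: order_trans[OF abs_ge_zero])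
  have diff: "\<bar>a n t j - aa \<tau> j\<bar> \<le> 2 * b j" if "1 \<le> n" "t \<in> {1..n + \<nu>}" "\<tau> \<in> {0<..1}" for n t j \<tau>
    using ab[OF that(1,2), of j] aab[OF that(3), of j] by linarith
  have s_le: "s n j \<le> ennreal (2 * b j)" if n: "1 \<le> n" for n j
    unfolding s_def using diff[OF n] by (intro SUP_least ennreal_leI) auto
  have s0: "(\<lambda>n. enn2real (s (Suc n) j)) \<longlonglongrightarrow> 0" for j
  proof (rule tendsto_enn2real)
    have "(\<lambda>n. s n j) \<longlonglongrightarrow> 0" unfolding s_def by (rule lim) (simp add: L'_def)
    from LIMSEQ_Suc[OF this] show "(\<lambda>n. s (Suc n) j) \<longlonglongrightarrow> ennreal 0" by simp
  qed simp
  have sb: "enn2real (s (Suc n) j) \<le> 2 * b j" for n j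
    using enn2real_mono[OF s_le[of "Suc n" j]] b0[of j] by simp
  have s2: "sqi \<Z> (\<lambda>j. 2 * b j)" by (rule sqi_cmult[OF b])
  have "(\<lambda>n. nrm \<Z> (\<lambda>j. enn2real (s (Suc n) j) - 0)) \<longlonglongrightarrow> 0"
    by (rule nrm_dominated[OF _ _ s2]) (use sb s0 in auto)
  from order_tendstoD(2)[OF this e] obtain N where N: "\<And>n. n \<ge> N \<Longrightarrow> nrm \<Z> (\<lambda>j. enn2real (s (Suc n) j)) < e"
    by (auto simp: eventually_sequentially)
  show ?thesis
  proof (intro exI[of _ "Suc N"] allI impI ballI)
    fix n \<tau> t assume n: "Suc N \<le> n" and \<tau>: "\<tau> \<in> {0<..1}" and t: "t \<in> {1..n + \<nu>}" and L: "\<bar>\<lfloor>real n * \<tau>\<rfloor> - int t\<bar> \<le> L"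
    obtain n' where n': "n = Suc n'" "N \<le> n'" using n by (cases n) auto
    have "real_of_int \<bar>\<lfloor>real n * \<tau>\<rfloor> - int t\<bar> \<le> real_of_int L" using L by (simp only: of_int_le_iff)
    then have L2: "real_of_int \<bar>\<lfloor>real n * \<tau>\<rfloor> - int t\<bar> \<le> L'" by (simp add: L'_def)
    have pt: "\<bar>a n t j - aa \<tau> j\<bar> \<le> enn2real (s n j)" for j
    proof -
      have "ennreal \<bar>a n t j - aa \<tau> j\<bar> \<le> (SUP k\<in>{k. 1 \<le> k \<and> k \<le> n + \<nu> \<and> real_of_int \<bar>\<lfloor>real n * \<tau>\<rfloor> - int k\<bar> \<le> L'}.
                 ennreal \<bar>a n k j - aa \<tau> j\<bar>)" using t L2 by (intro SUP_upper) auto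
      also have "\<dots> \<le> s n j" unfolding s_def by (rule SUP_upper[OF \<tau>])
      finally have "enn2real (ennreal \<bar>a n t j - aa \<tau> j\<bar>) \<le> enn2real (s n j)"
        by (rule enn2real_mono) (use s_le[of n j] n' in \<open>auto intro: le_less_trans\<close>)
      then show ?thesis by simp
    qed
    have "sqi \<Z> (\<lambda>j. enn2real (s n j))"
      by (rule sqi_bound[OF s2]) (use sb b0 n' in auto)
    then have "nrm \<Z> (\<lambda>j. a n t j - aa \<tau> j) \<le> nrm \<Z> (\<lambda>j. enn2real (s n j))"
      by (rule nrm_mono[OF _ pt]) simp
    also have "\<dots> \<le> e" using N[OF n'(2)] by (simp add: n'(1))
    finally show "nrm \<Z> (\<lambda>j. a n t j - aa \<tau> j) \<le> e" .
  qed
qed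

lemma (in gaussian_noise) gram_second_moment:
  assumes "\<And>a. lin (y a) (\<lambda>\<omega>. Y \<omega> $ a)"
  shows "second_moment_matrix M Y = gram y"
  by (simp add: second_moment_matrix_def gram_def lin_inner[OF assms assms])

text \<open>
  Passing from functions of \<open>Y\<close> to functions of its standardization. Polynomials in
  one are polynomials of the same degree in the other, so the rank condition carries over.
\<close>

lemma (in gaussian_noise) standardized_function:
  fixes Y :: "'a \<Rightarrow> real^'n::finite"
  assumes l: "\<And>a. lin (y a) (\<lambda>\<omega>. Y \<omega> $ a)" and p: "posdef c (gram y)"
    and f: "f \<in> L2_fun0 (distr M borel Y)" and rank: "hermite_rank_ge (distr M borel Y) m f"
    and g: "\<And>x. g x = f (matrix_sqrt (gram y) *v x)"
  shows "g (inv_sqrt (gram y) *v Y \<omega>) = f (Y \<omega>)"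
    and "sqi std_gaussian g" and "P \<in> poly_funs (m - 1) \<Longrightarrow> (\<integral>z. P z * g z \<partial>std_gaussian) = 0"
proof -
  define A where "A = gram y"
  define Z where "Z \<omega> = inv_sqrt A *v Y \<omega>" for \<omega>
  have eq: "g (Z \<omega>) = f (Y \<omega>)" for \<omega>
    using inv_sqrt_props(1)[OF p] by (simp add: g Z_def A_def matrix_vector_mul_assoc)
  then show "g (inv_sqrt (gram y) *v Y \<omega>) = f (Y \<omega>)" by (simp add: Z_def A_def)
  have lm: "(\<lambda>x. B *v x) \<in> borel_measurable borel" for B :: "real^'n^'n"
    by (intro borel_measurable_continuous_onI linear_continuous_on matrix_vector_mul_bounded_linear)
  have pair: "std_pair M Z Z (crossm y y)"
    unfolding Z_def[abs_def] A_def by (rule std_pair_standardize[OF l l p p])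
  then have Zm: "Z \<in> borel_measurable M" by (simp add: std_pair_def)
  have law: "distr M borel Z = std_gaussian" by (rule std_pair_law(1)[OF prob_space_axioms pair])
  have Ym: "Y \<in> borel_measurable M" using linD(2)[OF l] by (intro borel_measurable_vec) (auto simp: sqi_def)
  have fm: "f \<in> borel_measurable borel" and fi: "integrable (distr M borel Y) (\<lambda>x. (f x)\<^sup>2)"
    using f by (auto simp: L2_fun0_def L2_fun_def)
  have gm: "g \<in> borel_measurable borel"
    unfolding g by (rule measurable_compose[OF lm fm])
  have "integrable M (\<lambda>\<omega>. (f (Y \<omega>))\<^sup>2)"
    using fi fm Ym by (subst (asm) integrable_distr_eq) auto
  then have "sqi M (\<lambda>\<omega>. g (Z \<omega>))" unfolding eq sqi_def using measurable_compose[OF Ym fm] by simp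
  then show "sqi std_gaussian g" using law_transfer(3)[OF law Zm gm] by simp
  show "(\<integral>z. P z * g z \<partial>std_gaussian) = 0" if P: "P \<in> poly_funs (m - 1)"
  proof -
    have Q: "(\<lambda>x. P (inv_sqrt A *v x)) \<in> poly_funs (m - 1)" by (rule poly_funs_linear_subst[OF P])
    have Pm: "P \<in> borel_measurable borel" by (rule sqi_std_gaussianD[OF sqi_poly_funs[OF P]])
    have Qm: "(\<lambda>x. P (inv_sqrt A *v x)) \<in> borel_measurable borel" by (rule sqi_std_gaussianD[OF sqi_poly_funs[OF Q]])
    have "(\<integral>z. P z * g z \<partial>std_gaussian) = expectation (\<lambda>\<omega>. P (Z \<omega>) * g (Z \<omega>))"
      by (rule law_transfer(1)[OF law Zm, symmetric]) (intro borel_measurable_times Pm gm)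
    also have "\<dots> = expectation (\<lambda>\<omega>. P (inv_sqrt A *v Y \<omega>) * f (Y \<omega>))" by (simp only: eq) (simp add: Z_def)
    also have "\<dots> = (\<integral>y. P (inv_sqrt A *v y) * f y \<partial>distr M borel Y)"
      by (rule integral_distr[symmetric]) (intro Ym borel_measurable_times Qm fm)+
    also have "\<dots> = 0" by (rule bspec[OF conjunct2[OF rank[unfolded hermite_rank_ge_def]] Q])
    finally show ?thesis .
  qed
qed

text \<open>
  The kernels are rewritten as coefficients of the noise, \<open>x n t i = a n t (t -
  i)\<close>. The lower bound for the spectra of \<open>\<Sigma>W\<close> is the reciprocal of a
  bound \<open>C\<close> for the inverses, and the square root of the supremum in
  \<open>\<phi>t_lim\<close> serves as the rate \<open>d\<close>. The sign of
  \<open>\<sigma>2\<close> comes from its being a limit of variances.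
\<close>

theorem proposition3:
  fixes M :: "'a measure"
    and \<epsilon> :: "int \<Rightarrow> 'a \<Rightarrow> real"
    and idx :: "'n::finite \<Rightarrow> nat"
    and K \<alpha> :: real
    and u :: "int \<Rightarrow> real"
    and a :: "nat \<Rightarrow> nat \<Rightarrow> int \<Rightarrow> real"
    and aa :: "real \<Rightarrow> int \<Rightarrow> real"
    and X :: "nat \<Rightarrow> nat \<Rightarrow> 'a \<Rightarrow> real"
    and W :: "real \<Rightarrow> int \<Rightarrow> 'a \<Rightarrow> real"
    and Y :: "nat \<Rightarrow> nat \<Rightarrow> 'a \<Rightarrow> real ^ 'n"
    and V :: "real \<Rightarrow> int \<Rightarrow> 'a \<Rightarrow> real ^ 'n"
    and \<Sigma>Y :: "nat \<Rightarrow> nat \<Rightarrow> real ^ 'n ^ 'n"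
    and \<Sigma>W :: "real \<Rightarrow> real ^ 'n ^ 'n"
    and m :: nat
    and f ft :: "nat \<Rightarrow> nat \<Rightarrow> real ^ 'n \<Rightarrow> real"
    and \<phi> \<phi>t :: "real \<Rightarrow> real ^ 'n \<Rightarrow> real"
    and \<sigma>2 :: real
  assumes idx: "bij_betw idx UNIV {1..CARD('n)}"
    and K: "0 \<le> K" and \<alpha>: "\<alpha> < 1 / 2"
    and u: "\<And>j. u j = max 1 (real_of_int \<bar>j\<bar> powr (1 - \<alpha>))"
    and M: "prob_space M"
    and \<epsilon>_indep: "prob_space.indep_vars M (\<lambda>_. borel) \<epsilon> UNIV"
    and \<epsilon>_normal: "\<And>k. distributed M lborel (\<epsilon> k) std_normal_density"
    and X: "\<And>n t. 1 \<le> n \<Longrightarrow> t \<in> {1..n + CARD('n)} \<Longrightarrow>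
              mean_square_sum M (\<lambda>j \<omega>. a n t j * \<epsilon> (int t - j) \<omega>) (X n t)"
    and a_bound: "\<And>n j t. 1 \<le> n \<Longrightarrow> t \<in> {1..n + CARD('n)} \<Longrightarrow> \<bar>a n t j\<bar> \<le> K / u j"
    and aa_bound: "\<And>\<tau> j. \<tau> \<in> {0<..1} \<Longrightarrow> \<bar>aa \<tau> j\<bar> \<le> K / u j"
    and a_lim: "\<And>j L. (0::real) < L \<Longrightarrow>
        (\<lambda>n. SUP \<tau>\<in>{0<..1}.
               SUP k\<in>{k. 1 \<le> k \<and> k \<le> n + CARD('n) \<and>
                          real_of_int \<bar>\<lfloor>real n * \<tau>\<rfloor> - int k\<bar> \<le> L}.
                 ennreal \<bar>a n k j - aa \<tau> j\<bar>) \<longlonglongrightarrow> 0"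
    and W: "\<And>\<tau> t. \<tau> \<in> {0<..1} \<Longrightarrow>
              mean_square_sum M (\<lambda>j \<omega>. aa \<tau> j * \<epsilon> (t - j) \<omega>) (W \<tau> t)"
    and Y: "\<And>n k. Y n k = window idx (X n) k"
    and V: "\<And>\<tau> j. V \<tau> j = window idx (W \<tau>) j"
    and \<Sigma>Y: "\<And>n k. \<Sigma>Y n k = second_moment_matrix M (Y n k)"
    and \<Sigma>W: "\<And>\<tau>. \<Sigma>W \<tau> = second_moment_matrix M (V \<tau> 0)"
    and \<Sigma>W_inv: "\<And>\<tau>. \<tau> \<in> {0<..1} \<Longrightarrow> invertible (\<Sigma>W \<tau>)"
    and \<Sigma>W_bdd: "bdd_above ((\<lambda>\<tau>. spectral_norm (matrix_inv (\<Sigma>W \<tau>))) ` {0<..1})"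
    and m: "real m > 1 / (1 - 2 * \<alpha>)"
    and f_L2: "\<And>n k. 1 \<le> k \<Longrightarrow> k \<le> n \<Longrightarrow> f n k \<in> L2_fun0 (distr M borel (Y n k))"
    and f_rank: "\<And>n k. 1 \<le> k \<Longrightarrow> k \<le> n \<Longrightarrow> hermite_rank_ge (distr M borel (Y n k)) m (f n k)"
    and ft: "\<And>n k x. ft n k x = f n k (matrix_sqrt (\<Sigma>Y n k) *v x)"
    and \<phi>t_L2: "\<And>\<tau>. \<tau> \<in> {0<..1} \<Longrightarrow> \<phi>t \<tau> \<in> L2_fun0 std_gaussian"
    and \<phi>t_cont: "\<And>\<tau>. \<tau> \<in> {0<..1} \<Longrightarrow>
        ((\<lambda>s. L2_norm std_gaussian (\<lambda>x. \<phi>t s x - \<phi>t \<tau> x)) \<longlongrightarrow> 0) (at \<tau> within {0<..1})"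
    and \<phi>t_lim: "(\<lambda>n. SUP \<tau>\<in>{0<..1}.
          \<integral>\<^sup>+x. ennreal ((ft n (max 1 (nat \<lfloor>\<tau> * real n\<rfloor>)) x - \<phi>t \<tau> x)\<^sup>2) \<partial>std_gaussian)
        \<longlonglongrightarrow> 0"
    and \<phi>: "\<And>\<tau> x. \<phi> \<tau> x = \<phi>t \<tau> (matrix_inv (matrix_sqrt (\<Sigma>W \<tau>)) *v x)"
    and \<sigma>2: "\<sigma>2 = (LINT \<tau>:{0<..1}|lborel.
          (\<Sum>\<^sub>\<infinity>j\<in>(UNIV::int set). \<integral>\<omega>. \<phi> \<tau> (V \<tau> 0 \<omega>) * \<phi> \<tau> (V \<tau> j \<omega>) \<partial>M))"
  shows "(\<forall>\<tau>\<in>{0<..1}.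
            (\<lambda>j::int. \<integral>\<omega>. \<phi> \<tau> (V \<tau> 0 \<omega>) * \<phi> \<tau> (V \<tau> j \<omega>) \<partial>M) summable_on UNIV) \<and>
         set_integrable lborel {0<..1}
            (\<lambda>\<tau>. \<Sum>\<^sub>\<infinity>j\<in>(UNIV::int set). \<integral>\<omega>. \<phi> \<tau> (V \<tau> 0 \<omega>) * \<phi> \<tau> (V \<tau> j \<omega>) \<partial>M) \<and>
         0 \<le> \<sigma>2 \<and>
         weak_conv_m
            (\<lambda>n. distr M borel (\<lambda>\<omega>. (\<Sum>k=1..n. f n k (Y n k \<omega>)) / sqrt (real n)))
            (centred_normal \<sigma>2)"
proof -
  interpret gaussian_noise M \<epsilon>
    using M \<epsilon>_indep \<epsilon>_normal by (intro gaussian_noise.intro gaussian_noise_axioms.intro)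
  define b where "b j = K / u j" for j
  interpret envelope b idx m
    unfolding b_def[abs_def] by (rule envelope_power_kernel[OF u K \<alpha> m])
  have idx_range: "idx i \<in> {1..CARD('n)}" for i using idx by (auto simp: bij_betw_def)
  define x where "x n t i = a n t (int t - i)" for n t i
  define w where "w \<tau> t i = aa \<tau> (t - i)" for \<tau> t i
  have sqi_a: "sqi \<Z> (a n t)" if "1 \<le> n" "t \<in> {1..n + CARD('n)}" for n t
    by (rule sqi_bound[OF sqi_b]) (use order_trans[OF a_bound[OF that] abs_ge_self] in \<open>simp_all add: b_def\<close>)
  have sqi_aa: "sqi \<Z> (aa \<tau>)" if "\<tau> \<in> {0<..1}" for \<tau>
    by (rule sqi_bound[OF sqi_b]) (use order_trans[OF aa_bound[OF that] abs_ge_self] in \<open>simp_all add: b_def\<close>)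
  have Y_lin: "lin (x n (k + idx i)) (\<lambda>\<omega>. Y n k \<omega> $ i)" if k: "1 \<le> k" "k \<le> n" for n k i
  proof -
    have t: "k + idx i \<in> {1..n + CARD('n)}" and n: "1 \<le> n" using k idx_range[of i] by auto
    show ?thesis
      using mean_square_sum_lin[OF sqi_a[OF n t] X[OF n t]] by (simp add: Y window_def x_def[abs_def])
  qed
  have V_lin: "lin (w \<tau> (j + int (idx i))) (\<lambda>\<omega>. V \<tau> j \<omega> $ i)" if "\<tau> \<in> {0<..1}" for \<tau> j i
    using mean_square_sum_lin[OF sqi_aa[OF that] W[OF that]] by (simp add: V window_def w_def[abs_def])
  have \<Sigma>Y_gram: "\<Sigma>Y n k = gram (\<lambda>i. x n (k + idx i))" if k: "1 \<le> k" "k \<le> n" for n k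
    unfolding \<Sigma>Y by (rule gram_second_moment[OF Y_lin[OF k]])
  have \<Sigma>W_gram: "\<Sigma>W \<tau> = gram (\<lambda>i. w \<tau> (int (idx i)))" if "\<tau> \<in> {0<..1}" for \<tau>
    unfolding \<Sigma>W using gram_second_moment[OF V_lin[OF that, of 0]] by simp
  obtain C0 where C0: "\<And>\<tau>. \<tau> \<in> {0<..1} \<Longrightarrow> spectral_norm (matrix_inv (\<Sigma>W \<tau>)) \<le> C0"
    using \<Sigma>W_bdd unfolding bdd_above_def by blast
  define C where "C = max 1 C0"
  define s where "s n = (SUP \<tau>\<in>{0<..1}.
    \<integral>\<^sup>+x. ennreal ((ft n (max 1 (nat \<lfloor>\<tau> * real n\<rfloor>)) x - \<phi>t \<tau> x)\<^sup>2) \<partial>std_gaussian)" for n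
  have s0: "s \<longlonglongrightarrow> 0" unfolding s_def by (rule \<phi>t_lim)
  interpret A: gaussian_array M \<epsilon> b idx m x w Y V ft \<phi>t "1 / C" "\<lambda>n. sqrt (enn2real (s n))"
  proof
    show "idx i \<le> CARD('n)" for i using idx_range[of i] by simp
    show "\<bar>x n t i\<bar> \<le> b (int t - i)" if "1 \<le> n" "t \<in> {1..n + CARD('n)}" for n t i
      using a_bound[OF that] by (simp add: x_def b_def)
    show "\<bar>w \<tau> t i\<bar> \<le> b (t - i)" if "\<tau> \<in> {0<..1}" for \<tau> t i
      using aa_bound[OF that] by (simp add: w_def b_def)
    show "w \<tau> (t + s) (i + s) = w \<tau> t i" for \<tau> t s i by (simp add: w_def)
    show "\<exists>N. \<forall>n\<ge>N. \<forall>\<tau>\<in>{0<..1}. \<forall>t\<in>{1..n + CARD('n)}.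
        \<bar>\<lfloor>real n * \<tau>\<rfloor> - int t\<bar> \<le> L \<longrightarrow> nrm \<Z> (\<lambda>i. x n t i - w \<tau> (int t) i) \<le> e" if e: "0 < e" for L e
    proof -
      have refl: "nrm \<Z> (\<lambda>i. x n t i - w \<tau> (int t) i) = nrm \<Z> (\<lambda>j. a n t j - aa \<tau> j)" for n t \<tau>
        unfolding nrm_def x_def w_def by (subst integral_Z_reflect[of "\<lambda>j. (a n t j - aa \<tau> j)\<^sup>2"]) (rule refl)
      show ?thesis unfolding refl
        by (rule uniform_kernel_limit[OF sqi_b _ _ a_lim e]) (simp_all add: b_def a_bound aa_bound)
    qed
    show "lin (x n (k + idx i)) (\<lambda>\<omega>. Y n k \<omega> $ i)" if "1 \<le> k" "k \<le> n" for n k i by (rule Y_lin[OF that])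
    show "lin (w \<tau> (j + int (idx i))) (\<lambda>\<omega>. V \<tau> j \<omega> $ i)" if "\<tau> \<in> {0<..1}" for \<tau> j i by (rule V_lin[OF that])
    show "posdef (1 / C) (gram (\<lambda>i. w \<tau> (int (idx i))))" if t: "\<tau> \<in> {0<..1}" for \<tau>
    proof (rule posdef_of_inverse)
      have "sqi \<Z> (w \<tau> (int (idx i)))" for i using linD(1)[OF V_lin[OF t, of 0 i]] by simp
      then show "0 \<le> z \<bullet> (gram (\<lambda>i. w \<tau> (int (idx i))) *v z)" for z by (subst gram_quadratic) simp_all
      show "invertible (gram (\<lambda>i. w \<tau> (int (idx i))))" using \<Sigma>W_inv[OF t] by (simp add: \<Sigma>W_gram[OF t])
      show "spectral_norm (matrix_inv (gram (\<lambda>i. w \<tau> (int (idx i))))) \<le> C"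
        using C0[OF t] by (simp add: \<Sigma>W_gram[OF t] C_def)
    qed (simp_all add: gram_symmetric C_def)
    show "sqi std_gaussian (ft n k) \<and> (\<forall>P\<in>poly_funs (m - 1). (\<integral>z. P z * ft n k z \<partial>std_gaussian) = 0)"
      if k: "1 \<le> k" "k \<le> n" and p: "posdef c (gram (\<lambda>i. x n (k + idx i)))" for n k c
    proof -
      have g: "ft n k z = f n k (matrix_sqrt (gram (\<lambda>i. x n (k + idx i))) *v z)" for z
        unfolding ft \<Sigma>Y_gram[OF k] ..
      show ?thesis
        using standardized_function(2,3)[OF Y_lin[OF k] p f_L2[OF k] f_rank[OF k] g] by blast
    qed
    show "sqi std_gaussian (\<phi>t \<tau>)" if "\<tau> \<in> {0<..1}" for \<tau>
      using \<phi>t_L2[OF that] by (auto simp: L2_fun0_def L2_fun_def sqi_def)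
    show "((\<lambda>s. nrm std_gaussian (\<lambda>z. \<phi>t s z - \<phi>t \<tau> z)) \<longlongrightarrow> 0) (at \<tau> within {0<..1})" if "\<tau> \<in> {0<..1}" for \<tau>
      using \<phi>t_cont[OF that] by (simp add: L2_norm_def nrm_def)
    show "(\<lambda>n. sqrt (enn2real (s n))) \<longlonglongrightarrow> 0"
      using tendsto_real_sqrt[OF tendsto_enn2real[of s 0 sequentially]] s0 by simp
    show "\<forall>\<^sub>F n in sequentially. \<forall>\<tau>\<in>{0<..1}.
        nrm std_gaussian (\<lambda>z. ft n (max 1 (nat \<lfloor>\<tau> * real n\<rfloor>)) z - \<phi>t \<tau> z) \<le> sqrt (enn2real (s n))"
      using order_tendstoD(2)[OF s0, of \<top>]
    proof (rule eventually_mono)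
      show "\<forall>\<tau>\<in>{0<..1}. nrm std_gaussian (\<lambda>z. ft n (max 1 (nat \<lfloor>\<tau> * real n\<rfloor>)) z - \<phi>t \<tau> z) \<le> sqrt (enn2real (s n))"
        if "s n < \<top>" for n
      proof (intro ballI nrm_le_of_nn_integral that)
        fix \<tau> :: real assume "\<tau> \<in> {0<..1}"
        then show "(\<integral>\<^sup>+z. ennreal ((ft n (max 1 (nat \<lfloor>\<tau> * real n\<rfloor>)) z - \<phi>t \<tau> z)\<^sup>2) \<partial>std_gaussian) \<le> s n"
          unfolding s_def by (rule SUP_upper)
      qed
    qed simp
  qed
  have R: "(\<integral>\<omega>. \<phi> \<tau> (V \<tau> 0 \<omega>) * \<phi> \<tau> (V \<tau> j \<omega>) \<partial>M) = A.R \<tau> j" if "\<tau> \<in> {0<..1}" for \<tau> j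
    unfolding A.R_def A.ZV_def \<phi> inv_sqrt_def \<Sigma>W_gram[OF that] A.yW_def[abs_def] by simp
  have sum: "(\<lambda>j. \<integral>\<omega>. \<phi> \<tau> (V \<tau> 0 \<omega>) * \<phi> \<tau> (V \<tau> j \<omega>) \<partial>M) summable_on UNIV"
    "(\<Sum>\<^sub>\<infinity>j\<in>UNIV. \<integral>\<omega>. \<phi> \<tau> (V \<tau> 0 \<omega>) * \<phi> \<tau> (V \<tau> j \<omega>) \<partial>M) = (\<integral>j. A.R \<tau> j \<partial>\<Z>)" if t: "\<tau> \<in> {0<..1}" for \<tau>
    unfolding R[OF t] by (rule integral_Z_infsum[OF A.R_integrable[OF t]])+
  have \<sigma>2_eq: "\<sigma>2 = (LINT \<tau>:{0<..1}|lborel. (\<integral>j. A.R \<tau> j \<partial>\<Z>))"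
    unfolding \<sigma>2 by (rule set_lebesgue_integral_cong) (use sum(2) in auto)
  have \<sigma>2_nonneg: "0 \<le> \<sigma>2"
    unfolding \<sigma>2_eq by (rule LIMSEQ_le_const[OF A.variance_limit(2)]) auto
  have meas: "(\<lambda>\<omega>. f n k (Y n k \<omega>)) \<in> borel_measurable M" if k: "1 \<le> k" "k \<le> n" for n k
  proof -
    have "Y n k \<in> borel_measurable M"
      using linD(2)[OF Y_lin[OF k]] by (intro borel_measurable_vec) (auto simp: sqi_def)
    moreover have "f n k \<in> borel_measurable borel" using f_L2[OF k] by (simp add: L2_fun0_def L2_fun_def)
    ultimately show ?thesis by (rule measurable_compose)
  qed
  have sums: "(\<Sum>k=1..n. f n k (Y n k \<omega>)) / sqrt (real n) = A.S n \<omega>" if n: "n \<ge> A.n1" for n \<omega>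
    unfolding A.S_def
  proof (intro arg_cong2[where f="(/)"] sum.cong refl)
    fix k assume k: "k \<in> {1..n}"
    then have k': "1 \<le> k" "k \<le> n" by auto
    have p: "posdef A.c (gram (\<lambda>i. x n (k + idx i)))"
      using A.posdef_X[OF n k] by (simp add: A.yX_def[abs_def])
    have g: "ft n k z = f n k (matrix_sqrt (gram (\<lambda>i. x n (k + idx i))) *v z)" for z
      unfolding ft \<Sigma>Y_gram[OF k'] ..
    show "f n k (Y n k \<omega>) = ft n k (A.Z n k \<omega>)"
      using standardized_function(1)[OF Y_lin[OF k'] p f_L2[OF k'] f_rank[OF k'] g]
      by (simp add: A.Z_def A.yX_def[abs_def])
  qed
  have "weak_conv_m (\<lambda>n. distr M borel (\<lambda>\<omega>. (\<Sum>k=1..n. f n k (Y n k \<omega>)) / sqrt (real n))) (centred_normal \<sigma>2)"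
  proof (rule weak_conv_centred_normal[where S="A.S" and N="A.n1"])
    show "(\<lambda>\<omega>. (\<Sum>k=1..n. f n k (Y n k \<omega>)) / sqrt (real n)) \<in> borel_measurable M" for n
      by (intro borel_measurable_divide borel_measurable_sum borel_measurable_const meas) auto
    show "(\<lambda>n. expectation (\<lambda>\<omega>. iexp (t * A.S n \<omega>))) \<longlonglongrightarrow> of_real (exp (- \<sigma>2 * t\<^sup>2 / 2))" for t
      unfolding \<sigma>2_eq by (rule A.S_char_limit)
  qed (rule sums \<sigma>2_nonneg, assumption?)+
  moreover have "set_integrable lborel {0<..1}
      (\<lambda>\<tau>. \<Sum>\<^sub>\<infinity>j\<in>UNIV. \<integral>\<omega>. \<phi> \<tau> (V \<tau> 0 \<omega>) * \<phi> \<tau> (V \<tau> j \<omega>) \<partial>M)"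
    using A.variance_limit(1) by (subst set_integrable_cong[OF refl refl sum(2)])
  ultimately show ?thesis using sum(1) \<sigma>2_nonneg by blast
qed

end
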